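(* Let $K=\mathrm{diag}(K_1,\dots,K_N)$ be a complex diagonal matrix, let $\Lambda^{(1)},\dots,\Lambda^{(n)}$ be integral dominant $\mathfrak{gl}_N$-weights with $\Lambda^{(s)}_N=0$ for all $s$, let $z_1,\dots,z_n$ be distinct complex numbers, and let $\mathcal M_{\boldsymbol\Lambda}(\boldsymbol z)[\boldsymbol m]$ be a weight subspace of $\mathcal M_{\boldsymbol\Lambda}(\boldsymbol z)$. For $i=1,\dots,n$, $j=1,\dots,N$, and any nonzero vector $v\in\mathcal M_{\boldsymbol\Lambda}(\boldsymbol z)[\boldsymbol m]$, there exists an $\mathcal M_{\boldsymbol\Lambda}(\boldsymbol z)[\boldsymbol m]$-valued solution $f(u)$ of the differential equation $\mathcal D_{K,\mathcal M_{\boldsymbol\Lambda}(\boldsymbol z)[\boldsymbol m]}(u,\partial_u)f(u)=0$ such that $$f(u)=v\,(u-z_i)^{\Lambda^{(i)}_j+N-j}+O\big((u-z_i)^{\Lambda^{(i)}_j+N-j+1}\big)\qquad(u\to z_i).$$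
   Context: $e_{ab}$ are the standard generators of $\mathfrak{gl}_N$. An integral dominant weight is $\Lambda=(\Lambda_1,\dots,\Lambda_N)$ with $\Lambda_a-\Lambda_{a+1}\in\mathbb Z_{\ge0}$; $M_\Lambda$ is the irreducible finite-dimensional $\mathfrak{gl}_N$-module with highest weight $\Lambda$. $\mathcal M_{\boldsymbol\Lambda}(\boldsymbol z)=M_{\Lambda^{(1)}}(z_1)\otimes\dots\otimes M_{\Lambda^{(n)}}(z_n)$ is the tensor product of evaluation $\mathfrak{gl}_N[x]$-modules, i.e. the vector space $M_{\Lambda^{(1)}}\otimes\dots\otimes M_{\Lambda^{(n)}}$ on which $e_{ab}x^s$ acts as $\sum_jz_j^se^{(j)}_{ab}$, where $e^{(j)}_{ab}$ is $e_{ab}$ acting on the $j$-th factor. $\mathcal M_{\boldsymbol\Lambda}(\boldsymbol z)[\boldsymbol m]$ is the subspace of vectors $x$ with $\sum_je^{(j)}_{aa}x=m_ax$ for all $a$. With $\partial_u=d/du$, the universal differential operator associated with $K=(K_{ab})$ is $$\mathcal D_{K,\mathcal M_{\boldsymbol\Lambda}(\boldsymbol z)}(u,\partial_u)=\sum_{\sigma\in S_N}(-1)^\sigma X_{1\sigma_1}X_{2\sigma_2}\cdots X_{N\sigma_N},\qquad X_{ab}=\delta_{ab}\partial_u-K_{ab}-\sum_{j=1}^n\frac{e^{(j)}_{ba}}{u-z_j}.$$ For diagonal $K$ its coefficients preserve weight subspaces, and $\mathcal D_{K,\mathcal M_{\boldsymbol\Lambda}(\boldsymbol z)[\boldsymbol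 m]}(u,\partial_u)$ is its restriction to $\mathcal M_{\boldsymbol\Lambda}(\boldsymbol z)[\boldsymbol m]$-valued functions of $u$. *)

theory Defs
  imports
    "HOL-Complex_Analysis.Complex_Analysis"
    "HOL-Combinatorics.Combinatorics"
    "HOL-Library.Landau_Symbols"
    "Jordan_Normal_Form.VS_Connect"
begin

text \<open>
  Indices \<open>a, b\<close> of the standard generators run over \<open>{1..N}\<close>, tensor factors over \<open>{1..n}\<close>.
  A finite-dimensional \<open>gl\<^sub>N\<close>-module is given on coordinate space \<open>\<complex>\<^sup>d\<close> by the
  matrices \<open>E a b\<close> with which the generators \<open>e\<^sub>a\<^sub>b\<close> act.
\<close>

definition gl_module :: "nat \<Rightarrow> nat \<Rightarrow> (nat \<Rightarrow> nat \<Rightarrow> complex mat) \<Rightarrow> bool" where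
  "gl_module N d E \<longleftrightarrow>
     (\<forall>a\<in>{1..N}. \<forall>b\<in>{1..N}. E a b \<in> carrier_mat d d) \<and>
     (\<forall>a\<in>{1..N}. \<forall>b\<in>{1..N}. \<forall>a'\<in>{1..N}. \<forall>b'\<in>{1..N}.
        E a b * E a' b' - E a' b' * E a b =
          (if b = a' then E a b' else 0\<^sub>m d d) - (if a = b' then E a' b else 0\<^sub>m d d))"

definition gl_irreducible :: "nat \<Rightarrow> nat \<Rightarrow> (nat \<Rightarrow> nat \<Rightarrow> complex mat) \<Rightarrow> bool" where
  "gl_irreducible N d E \<longleftrightarrow> d \<noteq> 0 \<and>
     (\<forall>W. VectorSpace.subspace class_ring W (module_vec TYPE(complex) d) \<and>
          (\<forall>a\<in>{1..N}. \<forall>b\<in>{1..N}. \<forall>w\<in>W. E a b *\<^sub>v w \<in> W)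
        \<longrightarrow> W = {0\<^sub>v d} \<or> W = carrier_vec d)"

definition highest_weight_vector ::
    "nat \<Rightarrow> nat \<Rightarrow> (nat \<Rightarrow> nat \<Rightarrow> complex mat) \<Rightarrow> (nat \<Rightarrow> int) \<Rightarrow> complex vec \<Rightarrow> bool" where
  "highest_weight_vector N d E \<Lambda> w \<longleftrightarrow>
     w \<in> carrier_vec d \<and> w \<noteq> 0\<^sub>v d \<and>
     (\<forall>a\<in>{1..N}. \<forall>b\<in>{1..N}. a < b \<longrightarrow> E a b *\<^sub>v w = 0\<^sub>v d) \<and>
     (\<forall>a\<in>{1..N}. E a a *\<^sub>v w = of_int (\<Lambda> a) \<cdot>\<^sub>v w)"

definition irreducible_highest_weight_module ::
    "nat \<Rightarrow> nat \<Rightarrow> (nat \<Rightarrow> nat \<Rightarrow> complex mat) \<Rightarrow> (nat \<Rightarrow> int) \<Rightarrow> bool" where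
  "irreducible_highest_weight_module N d E \<Lambda> \<longleftrightarrow>
     gl_module N d E \<and> gl_irreducible N d E \<and> (\<exists>w. highest_weight_vector N d E \<Lambda> w)"

definition integral_dominant :: "nat \<Rightarrow> (nat \<Rightarrow> int) \<Rightarrow> bool" where
  "integral_dominant N \<Lambda> \<longleftrightarrow> (\<forall>a\<in>{1..<N}. \<Lambda> a - \<Lambda> (a + 1) \<ge> 0)"

text \<open>
  A vector \<open>x\<close> of the tensor product of the \<open>\<complex>\<^bsup>d s\<^esup>\<close>, \<open>s = 1, \<dots>, n\<close>, is given by its
  coordinates \<open>x \<beta>\<close> with respect to the product basis, indexed by the multi-indices \<open>\<beta>\<close> with
  \<open>\<beta> s < d s\<close>; off the multi-indices it is \<open>0\<close>.
\<close>

definition multi_indices :: "nat \<Rightarrow> (nat \<Rightarrow> nat) \<Rightarrow> (nat \<Rightarrow> nat) set" where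
  "multi_indices n d = (\<Pi>\<^sub>E s\<in>{1..n}. {..<d s})"

definition tensor_space :: "nat \<Rightarrow> (nat \<Rightarrow> nat) \<Rightarrow> ((nat \<Rightarrow> nat) \<Rightarrow> complex) set" where
  "tensor_space n d = {x. \<forall>\<beta>. \<beta> \<notin> multi_indices n d \<longrightarrow> x \<beta> = 0}"

text \<open>The operator \<open>1 \<otimes> \<dots> \<otimes> A \<otimes> \<dots> \<otimes> 1\<close> with \<open>A\<close> in the \<open>s\<close>-th place:\<close>

definition factor_op ::
    "nat \<Rightarrow> (nat \<Rightarrow> nat) \<Rightarrow> nat \<Rightarrow> complex mat \<Rightarrow> ((nat \<Rightarrow> nat) \<Rightarrow> complex) \<Rightarrow> (nat \<Rightarrow> nat) \<Rightarrow> complex" where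
  "factor_op n d s A x = (\<lambda>\<beta>.
     if \<beta> \<in> multi_indices n d then \<Sum>c<d s. A $$ (\<beta> s, c) * x (\<beta>(s := c)) else 0)"

definition weight_subspace ::
    "nat \<Rightarrow> nat \<Rightarrow> (nat \<Rightarrow> nat) \<Rightarrow> (nat \<Rightarrow> nat \<Rightarrow> nat \<Rightarrow> complex mat) \<Rightarrow> (nat \<Rightarrow> complex)
      \<Rightarrow> ((nat \<Rightarrow> nat) \<Rightarrow> complex) set" where
  "weight_subspace N n d E m = {x \<in> tensor_space n d.
     \<forall>a\<in>{1..N}. \<forall>\<beta>. (\<Sum>s=1..n. factor_op n d s (E s a a) x \<beta>) = m a * x \<beta>}"

text \<open>
  The entries \<open>X\<^sub>a\<^sub>b\<close> act on functions of \<open>u\<close> with values in the tensor product; note the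
  transposed generator \<open>e\<^sub>b\<^sub>a\<close>.
\<close>

definition X_op ::
    "nat \<Rightarrow> (nat \<Rightarrow> nat) \<Rightarrow> (nat \<Rightarrow> nat \<Rightarrow> nat \<Rightarrow> complex mat) \<Rightarrow> (nat \<Rightarrow> nat \<Rightarrow> complex) \<Rightarrow> (nat \<Rightarrow> complex)
      \<Rightarrow> nat \<Rightarrow> nat \<Rightarrow> (complex \<Rightarrow> (nat \<Rightarrow> nat) \<Rightarrow> complex) \<Rightarrow> complex \<Rightarrow> (nat \<Rightarrow> nat) \<Rightarrow> complex" where
  "X_op n d E K z a b f = (\<lambda>u \<beta>.
     (if a = b then deriv (\<lambda>t. f t \<beta>) u else 0) - K a b * f u \<beta>
       - (\<Sum>s=1..n. factor_op n d s (E s b a) (f u) \<beta> / (u - z s)))"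

text \<open>The \<open>foldr\<close> is the composition \<open>X\<^bsub>1 \<sigma>\<^sub>1\<^esub> \<circ> \<dots> \<circ> X\<^bsub>N \<sigma>\<^sub>N\<^esub>\<close>, whose rightmost factor acts first.\<close>

definition universal_diff_op ::
    "nat \<Rightarrow> nat \<Rightarrow> (nat \<Rightarrow> nat) \<Rightarrow> (nat \<Rightarrow> nat \<Rightarrow> nat \<Rightarrow> complex mat) \<Rightarrow> (nat \<Rightarrow> nat \<Rightarrow> complex) \<Rightarrow> (nat \<Rightarrow> complex)
      \<Rightarrow> (complex \<Rightarrow> (nat \<Rightarrow> nat) \<Rightarrow> complex) \<Rightarrow> complex \<Rightarrow> (nat \<Rightarrow> nat) \<Rightarrow> complex" where
  "universal_diff_op N n d E K z f = (\<lambda>u \<beta>.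
     \<Sum>\<sigma> | \<sigma> permutes {1..N}.
       of_int (sign \<sigma>) * foldr (\<lambda>a. X_op n d E K z a (\<sigma> a)) [1..<N+1] f u \<beta>)"

end

theory Submission
  imports Defs "HOL-Library.Function_Algebras"
begin

text \<open>
  Let \<open>D\<close> be the universal differential operator. On \<open>v (u - z\<^sub>i)\<^bsup>l\<^esup>\<close> its leading term is
  \<open>(u - z\<^sub>i)\<^bsup>l-N\<^esup> P(l) v\<close>, where \<open>P(l)\<close> commutes with \<open>gl\<^sub>N\<close> on the \<open>i\<close>-th factor and therefore is the scalar
  \<open>\<Prod>\<^sub>a (l - (N - a) - \<Lambda>\<^sub>a)\<close>, as one sees on the highest weight vector. So the exponents are the
  \<open>\<Lambda>\<^sub>j + N - j\<close>; they differ by integers, and the point is that the Frobenius recursion started at a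
  small exponent is not obstructed at the larger ones, all of which are less than \<open>N + k\<close> with \<open>k = |\<Lambda>|\<close>.

  To see this, embed the \<open>i\<close>-th factor as a direct summand into the \<open>k\<close>-th tensor power of the vector
  representation and move the \<open>k\<close> vector sites to distinct points \<open>w\<^sub>s\<close> near \<open>z\<^sub>i\<close>. For regular \<open>f\<close> the pole of
  \<open>D f\<close> at a vector site is at most simple, and if its residue vanishes then so does the value of \<open>D f\<close>.
  Hence for a polynomial \<open>f\<close> of degree less than \<open>N + k\<close> the \<open>k\<close> residue conditions already make \<open>D f\<close>
  vanish at all \<open>w\<^sub>s\<close>. If the coefficient of \<open>f\<close> at \<open>(u - z\<^sub>i)\<^bsup>l\<^esup>\<close> is restricted to a complement of the kernel of \<open>P(l)\<close>,
  enlarged by \<open>v\<close> for the one exponent \<open>l\<close> of interest, there are more unknowns than conditions, since the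
  kernels of \<open>P(l)\<close> have total dimension at most \<open>N\<close> times that of the weight space. A normalised nonzero
  solution has a limit as all \<open>w\<^sub>s\<close> tend to \<open>z\<^sub>i\<close>, with \<open>D f = O((u - z\<^sub>i)\<^bsup>k\<^esup>)\<close>; its lowest coefficient lies in the
  kernel of \<open>P\<close>, hence is a multiple of \<open>v\<close>. From degree \<open>N + k\<close> on the recursion is regular, and a geometric
  majorant gives convergence.
\<close>

section \<open>Additive operators\<close>

text \<open>Why a vanishing residue forces a zero: near a vector site \<open>w\<close> the matrix is
  Z minus \<phi> times the transposed generators, with \<phi> = 1/(u - w). The matrix unit relations
  collapse the row determinant to \<open>rdet Z - \<phi> * G\<close> with regular Z and G, and up to
  the unit of the site \<open>rdet Z\<close> is a first order operator applied to G. The residue is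
  minus the value of G f at \<open>w\<close>; once it vanishes, both parts have the derivative of G
  f as constant term, and these cancel. The numbers fit because k zeros merge to a zero of order k,
  and the coefficient of that order in D f is the first one to involve the exponent N + k: the
  recursion takes over exactly where the limit stops. The value of k comes from the embedding, since
  dominance and \<Lambda>_N = 0 make \<Lambda> a partition of k. The left inverse is needed to carry
  the solution back with \<open>v\<close> as its leading coefficient. The kernels have total
  dimension at most N times that of the weight space because P is monic of degree N in l. The limit
  is taken on moments along a fixed circle, as these depend continuously on the sites even when the
  sites collide.\<close>

text \<open>
  Functions \<open>'x \<Rightarrow> 'r\<close> serve as vectors with entries in a ring; the entries of the matrices \<open>X\<close> below
  are elements of the ring of additive operators on them.
\<close>

typedef (overloaded) ('x, 'r :: ring_1) addop =
  "{f :: ('x \<Rightarrow> 'r) \<Rightarrow> 'x \<Rightarrow> 'r. \<forall>x y. f (x + y) = f x + f y}"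
  morphisms app Addop
  by (rule exI[of _ "\<lambda>x. x"]) simp

lemma app_add: "app T (x + y) = app T x + app T y"
  using app[of T] by simp

lemma app_Addop: "(\<And>x y. f (x + y) = f x + f y) \<Longrightarrow> app (Addop f) = f"
  by (rule Addop_inverse) simp

lemma app_0 [simp]: "app T 0 = 0"
  using app_add[of T 0 0] by simp

lemma app_zero_fun [simp]: "app T (\<lambda>x. 0) = (\<lambda>x. 0)"
  using app_0[of T] unfolding zero_fun_def .

lemma app_uminus: "app T (- x) = - app T x"
  using app_add[of T x "- x"] by (simp add: eq_neg_iff_add_eq_0 add.commute)

lemma app_diff: "app T (x - y) = app T x - app T y"
  using app_add[of T x "- y"] by (simp add: app_uminus)

lemma app_sum: "app T (\<Sum>i\<in>A. x i) = (\<Sum>i\<in>A. app T (x i))"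
  by (induction A rule: infinite_finite_induct) (simp_all only: app_add sum.infinite sum.empty sum.insert app_0 not_False_eq_True)

lemma addop_eqI: "(\<And>x. app S x = app T x) \<Longrightarrow> S = T"
  by (simp add: app_inject[symmetric] fun_eq_iff)

instantiation addop :: (type, ring_1) ring_1
begin

definition zero_addop :: "('a, 'b) addop" where "zero_addop = Addop (\<lambda>x. 0)"
definition one_addop :: "('a, 'b) addop" where "one_addop = Addop (\<lambda>x. x)"
definition plus_addop :: "('a, 'b) addop \<Rightarrow> ('a, 'b) addop \<Rightarrow> ('a, 'b) addop"
  where "plus_addop S T = Addop (\<lambda>x. app S x + app T x)"
definition minus_addop :: "('a, 'b) addop \<Rightarrow> ('a, 'b) addop \<Rightarrow> ('a, 'b) addop"
  where "minus_addop S T = Addop (\<lambda>x. app S x - app T x)"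
definition uminus_addop :: "('a, 'b) addop \<Rightarrow> ('a, 'b) addop"
  where "uminus_addop S = Addop (\<lambda>x. - app S x)"
definition times_addop :: "('a, 'b) addop \<Rightarrow> ('a, 'b) addop \<Rightarrow> ('a, 'b) addop"
  where "times_addop S T = Addop (\<lambda>x. app S (app T x))"

lemma app_ring_simps:
  "app (0 :: ('a, 'b) addop) x = 0"
  "app (1 :: ('a, 'b) addop) x = x"
  "app (S + T :: ('a, 'b) addop) x = app S x + app T x"
  "app (S - T) x = app S x - app T x"
  "app (- S) x = - app S x"
  "app (S * T) x = app S (app T x)"
  by (simp_all add: zero_addop_def one_addop_def plus_addop_def minus_addop_def uminus_addop_def
      times_addop_def app_Addop app_add algebra_simps)

instance
proof
  show "(0 :: ('a, 'b) addop) \<noteq> 1"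
  proof
    assume "(0 :: ('a, 'b) addop) = 1"
    then have "app (0 :: ('a, 'b) addop) (\<lambda>_. 1) = app 1 (\<lambda>_. 1)" by simp
    then show False by (simp add: app_ring_simps fun_eq_iff)
  qed
qed (rule addop_eqI; simp add: app_ring_simps app_add algebra_simps)+

end

declare app_ring_simps [simp]

lemma app_sum_left: "app (\<Sum>i\<in>A. T i) x = (\<Sum>i\<in>A. app (T i) x)"
  by (induction A rule: infinite_finite_induct) simp_all

lemma app_prod_list: "app (prod_list (map T as)) x = foldr (\<lambda>a. app (T a)) as x"
  by (induction as) simp_all

lemma app_of_int: "app (of_int k) x = (\<lambda>b. of_int k * x b)"
proof -
  have nat: "app (of_nat m) x = (\<lambda>b. of_nat m * x b)" for m
    by (induction m) (simp_all add: fun_eq_iff algebra_simps)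
  obtain m n where "k = int m - int n" by (rule int_diff_cases)
  then show ?thesis
    by (simp add: nat) (simp add: fun_eq_iff algebra_simps)
qed

section \<open>Row determinants\<close>

definition rdet :: "nat \<Rightarrow> (nat \<Rightarrow> nat \<Rightarrow> 'a :: ring_1) \<Rightarrow> 'a" where
  "rdet N X = (\<Sum>\<sigma> | \<sigma> permutes {1..N}. of_int (sign \<sigma>) * prod_list (map (\<lambda>a. X a (\<sigma> a)) [1..<N+1]))"

text \<open>
  The Grassmann algebra with generators \<open>\<xi>\<^sub>1, \<dots>, \<xi>\<^sub>N\<close> acts on functions of finite sets, \<open>B\<close> standing for
  the monomial \<open>\<Prod>\<^bsub>b\<in>B\<^esub> \<xi>\<^sub>b\<close>: \<open>Lm\<close> is multiplication by a coefficient, \<open>xi\<close> by a generator, and \<open>io\<close> is the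
  contraction. The forms \<open>\<eta>\<^sub>a = \<Sum>\<^sub>b X\<^sub>a\<^sub>b \<xi>\<^sub>b\<close> of a Manin matrix anticommute, and their product is the row
  determinant times the top form.
\<close>

definition Lm :: "'a :: ring_1 \<Rightarrow> (nat set, 'a) addop" where
  "Lm x = Addop (\<lambda>\<Omega> B. x * \<Omega> B)"

lemma app_Lm: "app (Lm x) \<Omega> = (\<lambda>B. x * \<Omega> B)"
  unfolding Lm_def by (subst app_Addop) (auto simp: fun_eq_iff algebra_simps)

lemma Lm_simps: "Lm (x + y) = Lm x + Lm y" "Lm (x - y) = Lm x - Lm y" "Lm (- x) = - Lm x"
  "Lm (x * y) = Lm x * Lm y" "Lm 0 = 0" "Lm 1 = 1"
  by (rule addop_eqI; auto simp: app_Lm fun_eq_iff algebra_simps)+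

lemma Lm_sum: "Lm (\<Sum>i\<in>A. f i) = (\<Sum>i\<in>A. Lm (f i))"
  by (induction A rule: infinite_finite_induct) (simp_all add: Lm_simps)

lemma Lm_of_int: "Lm (of_int k) = of_int k"
proof -
  have nat: "Lm (of_nat m) = of_nat m" for m
    by (induction m) (simp_all add: Lm_simps)
  show ?thesis by (cases k rule: int_diff_cases) (simp add: nat Lm_simps)
qed

text \<open>The number of generators that the b-th one passes on its way to its place in a sorted
  monomial; it supplies the signs of \<open>xi\<close> and \<open>io\<close>.\<close>

definition inv_below :: "nat \<Rightarrow> nat set \<Rightarrow> nat" where
  "inv_below b B = card {c \<in> B. c < b}"

lemma inv_below_remove: "inv_below b (B - {c}) = (if c \<in> B \<and> c < b then inv_below b B - 1 else inv_below b B)"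
proof -
  have "{x \<in> B - {c}. x < b} = {x \<in> B. x < b} - {c}" by auto
  then show ?thesis unfolding inv_below_def by (auto simp: card_Diff_singleton_if)
qed

lemma inv_below_pos: "c \<in> B \<Longrightarrow> c < b \<Longrightarrow> inv_below b B > 0"
  unfolding inv_below_def by (subst card_gt_0_iff) auto

lemma inv_below_insert: "inv_below b (insert c B) = (if c \<notin> B \<and> c < b then Suc (inv_below b B) else inv_below b B)"
proof -
  have "{x \<in> insert c B. x < b} = (if c < b then insert c {x \<in> B. x < b} else {x \<in> B. x < b})" by auto
  then show ?thesis unfolding inv_below_def by (auto simp: card_insert_if)
qed

definition xi :: "nat \<Rightarrow> (nat set, 'a :: ring_1) addop" where
  "xi b = Addop (\<lambda>\<Omega> B. if b \<in> B then (-1) ^ inv_below b B * \<Omega> (B - {b}) else 0)"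

definition io :: "nat \<Rightarrow> (nat set, 'a :: ring_1) addop" where
  "io b = Addop (\<lambda>\<Omega> B. if b \<notin> B then (-1) ^ inv_below b B * \<Omega> (insert b B) else 0)"

lemma app_xi: "app (xi b) \<Omega> = (\<lambda>B. if b \<in> B then (-1) ^ inv_below b B * \<Omega> (B - {b}) else 0)"
  unfolding xi_def by (subst app_Addop) (auto simp: fun_eq_iff algebra_simps)

lemma app_io: "app (io b) \<Omega> = (\<lambda>B. if b \<notin> B then (-1) ^ inv_below b B * \<Omega> (insert b B) else 0)"
  unfolding io_def by (subst app_Addop) (auto simp: fun_eq_iff algebra_simps)

lemma minus_one_power_commute: "(-1) ^ n * x = x * (-1) ^ n" for x :: "'a :: ring_1"
  by (cases "even n") simp_all

lemma xi_Lm: "xi b * Lm x = Lm x * xi b" and io_Lm: "io b * Lm x = Lm x * io b"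
  by (rule addop_eqI; auto simp: app_xi app_io app_Lm fun_eq_iff mult.assoc[symmetric] minus_one_power_commute[of _ x])+

lemma xi_sq: "xi b * xi b = 0"
  by (rule addop_eqI) (auto simp: app_xi fun_eq_iff)

lemma xi_anti: "xi b * xi c = - (xi c * xi b)"
proof (cases "b = c")
  case True
  then show ?thesis by (simp add: xi_sq)
next
  case False
  show ?thesis
  proof (rule addop_eqI, rule ext)
    fix \<Omega> :: "nat set \<Rightarrow> 'a" and B
    consider "b \<in> B" "c \<in> B" "b < c" | "b \<in> B" "c \<in> B" "c < b" | "\<not> (b \<in> B \<and> c \<in> B)"
      using False by linarith
    then show "app (xi b * xi c) \<Omega> B = app (- (xi c * xi b)) \<Omega> B"
    proof cases
      \<comment> \<open>Removing the smaller index lowers the count of the larger one by one and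
        leaves the other count alone, whence the relative sign.\<close>
      case 1
      have "B - {b} - {c} = B - {c} - {b}" by auto
      with 1 False show ?thesis using inv_below_pos[of b B c]
        by (cases "even (inv_below b B)"; cases "even (inv_below c B)") (auto simp: app_xi inv_below_remove)
    next
      case 2
      have "B - {b} - {c} = B - {c} - {b}" by auto
      with 2 False show ?thesis using inv_below_pos[of c B b]
        by (cases "even (inv_below b B)"; cases "even (inv_below c B)") (auto simp: app_xi inv_below_remove)
    qed (auto simp: app_xi)
  qed
qed

text \<open>The Clifford relation. It makes \<open>xi d * io c\<close> the derivation that replaces
  the generator with index c by the one with index d.\<close>

lemma io_xi: "io c * xi b = (if b = c then 1 else 0) - xi b * io c"
proof (cases "b = c")
  case True
  show ?thesis
  proof (rule addop_eqI, rule ext)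
    fix \<Omega> :: "nat set \<Rightarrow> 'a" and B
    show "app (io c * xi b) \<Omega> B = app ((if b = c then 1 else 0) - xi b * io c) \<Omega> B"
      using True by (cases "c \<in> B")
        (auto simp: app_xi app_io inv_below_remove inv_below_insert mult.assoc[symmetric]
          power_add[symmetric] insert_absorb)
  qed
next
  case False
  show ?thesis
  proof (rule addop_eqI, rule ext)
    fix \<Omega> :: "nat set \<Rightarrow> 'a" and B
    consider "b \<in> B" "c \<notin> B" "b < c" | "b \<in> B" "c \<notin> B" "c < b" | "b \<notin> B \<or> c \<in> B"
      using False by linarith
    then show "app (io c * xi b) \<Omega> B = app ((if b = c then 1 else 0) - xi b * io c) \<Omega> B"
    proof cases
      case 1
      have "insert c B - {b} = insert c (B - {b})" using False by auto
      with 1 False show ?thesis using inv_below_pos[of b B c]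
        by (cases "even (inv_below b B)"; cases "even (inv_below c B)") (auto simp: app_xi app_io inv_below_remove inv_below_insert)
    next
      case 2
      have "insert c B - {b} = insert c (B - {b})" using False by auto
      with 2 False show ?thesis
        by (cases "even (inv_below b B)"; cases "even (inv_below c B)") (auto simp: app_xi app_io inv_below_remove inv_below_insert)
    qed (use False in \<open>auto simp: app_xi app_io\<close>)
  qed
qed

section \<open>Ordered products of anticommuting elements\<close>

lemma anti_move:
  fixes x :: "'a :: ring_1"
  assumes "\<And>y. y \<in> set ys \<Longrightarrow> x * f y = - (f y * x)"
  shows "x * prod_list (map f ys) = (-1) ^ length ys * (prod_list (map f ys) * x)"
  using assms
proof (induction ys)
  case (Cons y ys)
  have IH: "x * prod_list (map f ys) = (-1) ^ length ys * (prod_list (map f ys) * x)"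
    using Cons by simp
  have "x * prod_list (map f (y # ys)) = (x * f y) * prod_list (map f ys)"
    by (simp add: mult.assoc)
  also have "\<dots> = - (f y * (x * prod_list (map f ys)))"
    using Cons.prems[of y] by (simp add: mult.assoc)
  also have "\<dots> = - (f y * (-1) ^ length ys * (prod_list (map f ys) * x))"
    by (simp only: IH mult.assoc)
  also have "f y * (-1) ^ length ys = (-1) ^ length ys * f y"
    by (simp add: minus_one_power_commute)
  finally show ?case by (simp add: mult.assoc)
qed simp

text \<open>The first of two equal factors is moved next to the second at the cost of a sign. That
  squares vanish is a separate hypothesis: anticommuting with itself only says that twice the square
  is zero.\<close>

lemma anti_repeat:
  fixes f :: "nat \<Rightarrow> 'a :: ring_1"
  assumes "\<And>x y. x \<in> set bs \<Longrightarrow> y \<in> set bs \<Longrightarrow> f x * f y = - (f y * f x)"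
    and "\<And>x. x \<in> set bs \<Longrightarrow> f x * f x = 0" and "\<not> distinct bs"
  shows "prod_list (map f bs) = 0"
proof -
  obtain xs ys zs y where bs: "bs = xs @ [y] @ ys @ [y] @ zs"
    using assms(3) not_distinct_decomp by blast
  have "f y * prod_list (map f ys) = (-1) ^ length ys * (prod_list (map f ys) * f y)"
    by (rule anti_move, rule assms(1)) (use bs in auto)
  then have "f y * prod_list (map f ys) * f y = (-1) ^ length ys * (prod_list (map f ys) * (f y * f y))"
    by (simp add: mult.assoc)
  then have "f y * prod_list (map f ys) * f y = 0"
    using assms(2)[of y] bs by simp
  then show ?thesis unfolding bs by (simp add: mult.assoc) (simp add: mult.assoc[symmetric])
qed

text \<open>Both letters pass the same stretch \<open>ys\<close> between them, so these signs cancel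
  and only the one from exchanging the two letters remains.\<close>

lemma anti_swap:
  fixes f :: "nat \<Rightarrow> 'a :: ring_1"
  assumes anti: "\<And>x y. x \<in> set bs \<Longrightarrow> y \<in> set bs \<Longrightarrow> f x * f y = - (f y * f x)"
    and "distinct bs" "a \<in> set bs" "b \<in> set bs" "a \<noteq> b"
  shows "prod_list (map (f \<circ> Transposition.transpose a b) bs) = - prod_list (map f bs)"
proof -
  have *: "prod_list (map (f \<circ> Transposition.transpose a b) bs) = - prod_list (map f bs)"
    if bs: "bs = xs @ [a] @ ys @ [b] @ zs" for a b xs ys zs
  proof -
    have d: "a \<notin> set xs \<union> set ys \<union> set zs" "b \<notin> set xs \<union> set ys \<union> set zs" "a \<noteq> b"
      using \<open>distinct bs\<close> bs by auto
    have id: "map (f \<circ> Transposition.transpose a b) us = map f us"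
      if "a \<notin> set us" "b \<notin> set us" for us
      using that by (auto simp: Transposition.transpose_def)
    have 1: "f a * prod_list (map f ys) = (-1) ^ length ys * (prod_list (map f ys) * f a)"
      by (rule anti_move, rule anti) (use bs in auto)
    have 2: "f b * prod_list (map f ys) = (-1) ^ length ys * (prod_list (map f ys) * f b)"
      by (rule anti_move, rule anti) (use bs in auto)
    have ab: "f b * f a = - (f a * f b)" by (rule anti) (use bs in auto)
    have "f b * prod_list (map f ys) * f a = - (f a * prod_list (map f ys) * f b)"
      unfolding 1 2 by (simp only: mult.assoc ab) simp
    then have "f b * prod_list (map f ys) * f a * t = - (f a * prod_list (map f ys) * f b) * t" for t
      by (simp only:)
    then have "f b * (prod_list (map f ys) * (f a * t)) = - (f a * (prod_list (map f ys) * (f b * t)))" for t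
      by (simp only: mult.assoc mult_minus_left)
    then show ?thesis unfolding bs using d by (simp add: id)
  qed
  from \<open>a \<in> set bs\<close> obtain xs zs where 1: "bs = xs @ a # zs" by (meson split_list)
  then consider "b \<in> set xs" | "b \<in> set zs" using assms by auto
  then show ?thesis
  proof cases
    case 1
    then obtain us vs where "xs = us @ b # vs" by (meson split_list)
    then have "bs = us @ [b] @ vs @ [a] @ zs" using \<open>bs = xs @ a # zs\<close> by simp
    from *[OF this] show ?thesis by (simp add: transpose_commute)
  next
    case 2
    then obtain us vs where "zs = us @ b # vs" by (meson split_list)
    then have "bs = xs @ [a] @ us @ [b] @ vs" using \<open>bs = xs @ a # zs\<close> by simp
    from *[OF this] show ?thesis .
  qed
qed

lemma set_upt1: "set [1..<N+1] = {1..N}"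
  by auto

text \<open>Induction over transpositions. Each is composed on the outside and so exchanges two
  letters of a word that is already permuted, which costs one sign by
  \<open>anti_swap\<close>.\<close>

lemma prod_xi_perm:
  fixes f :: "nat \<Rightarrow> (nat set, 'a :: ring_1) addop"
  assumes "\<sigma> permutes {1..N}" and f: "f = xi"
  shows "prod_list (map (f \<circ> \<sigma>) [1..<N+1]) = of_int (sign \<sigma>) * prod_list (map f [1..<N+1])"
  using assms(1) finite_atLeastAtMost
proof (induction \<sigma> rule: permutes_induct)
  case id
  then show ?case by simp
next
  case (swap a b p)
  have anti: "f x * f y = - (f y * f x)" for x y
    unfolding f by (rule xi_anti)
  have set: "set (map p [1..<N+1]) = {1..N}"
    using permutes_image[OF \<open>p permutes {1..N}\<close>] by (simp only: set_map set_upt1)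
  have dist: "distinct (map p [1..<N+1])"
    using permutes_inj_on[OF \<open>p permutes {1..N}\<close>] by (simp add: distinct_map)
  have "prod_list (map (f \<circ> (Transposition.transpose a b \<circ> p)) [1..<N+1])
      = prod_list (map (f \<circ> Transposition.transpose a b) (map p [1..<N+1]))"
    by (simp only: map_map comp_assoc)
  also have "\<dots> = - prod_list (map f (map p [1..<N+1]))"
    using anti_swap[where f = f and bs = "map p [1..<N+1]" and a = a and b = b, OF anti dist] set swap by blast
  also have "\<dots> = - (of_int (sign p) * prod_list (map f [1..<N+1]))"
    by (simp only: map_map swap.IH)
  also have "\<dots> = of_int (sign (Transposition.transpose a b \<circ> p)) * prod_list (map f [1..<N+1])"
    using swap permutation_permutes[of p] by (subst sign_compose) (auto simp: sign_swap_id permutation_swap_id)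
  finally show ?case .
qed

section \<open>Linear forms of a noncommutative matrix and their product\<close>

definition eta :: "nat \<Rightarrow> (nat \<Rightarrow> nat \<Rightarrow> 'a :: ring_1) \<Rightarrow> nat \<Rightarrow> (nat set, 'a) addop" where
  "eta N X a = (\<Sum>b=1..N. Lm (X a b) * xi b)"

lemma prod_eta_expand:
  "prod_list (map (eta N X) as) =
    (\<Sum>bs | set bs \<subseteq> {1..N} \<and> length bs = length as.
       Lm (prod_list (map2 X as bs)) * prod_list (map xi bs))"
proof (induction as)
  case Nil
  have "{bs. set bs \<subseteq> {1..N} \<and> length bs = length []} = {[]}" by auto
  then show ?case by (simp add: Lm_simps)
next
  case (Cons a as)
  let ?B = "{bs. set bs \<subseteq> {1..N} \<and> length bs = length as}"
  have "(\<Sum>bs | set bs \<subseteq> {1..N} \<and> length bs = length (a # as).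
       Lm (prod_list (map2 X (a # as) bs)) * prod_list (map xi bs))
      = (\<Sum>(bs, b)\<in>?B \<times> {1..N}. Lm (prod_list (map2 X (a # as) (b # bs))) * prod_list (map xi (b # bs)))"
    unfolding lists_length_Suc_eq length_Cons
    by (subst sum.reindex) (auto simp: inj_on_def case_prod_unfold)
  also have "\<dots> = (\<Sum>bs\<in>?B. \<Sum>b=1..N. Lm (X a b) * xi b * (Lm (prod_list (map2 X as bs)) * prod_list (map xi bs)))"
    unfolding sum.cartesian_product[symmetric]
  proof (intro sum.cong refl)
    fix bs b
    have "xi b * (Lm (prod_list (map2 X as bs)) * prod_list (map xi bs))
        = Lm (prod_list (map2 X as bs)) * (xi b * prod_list (map xi bs))"
      by (simp add: mult.assoc[symmetric] xi_Lm)
    then show "Lm (prod_list (map2 X (a # as) (b # bs))) * prod_list (map xi (b # bs))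
      = Lm (X a b) * xi b * (Lm (prod_list (map2 X as bs)) * prod_list (map xi bs))"
      by (simp add: Lm_simps mult.assoc)
  qed
  also have "\<dots> = eta N X a * (\<Sum>bs\<in>?B. Lm (prod_list (map2 X as bs)) * prod_list (map xi bs))"
    unfolding eta_def sum_product by (subst sum.swap) simp
  finally show ?case using Cons by simp
qed

text \<open>No commutation among the entries enters: coefficients commute with generators, so they
  keep their row order; words with a repeated column vanish, and the remaining ones are
  permutations, sorted with a sign.\<close>

lemma prod_eta_rdet:
  "prod_list (map (eta N X) [1..<N+1]) = Lm (rdet N X) * prod_list (map xi [1..<N+1])"
proof -
  let ?L = "[1..<N+1]"
  let ?g = "\<lambda>bs. Lm (prod_list (map2 X ?L bs)) * prod_list (map xi bs)"
  have "prod_list (map (eta N X) ?L) = (\<Sum>bs | set bs \<subseteq> {1..N} \<and> length bs = length ?L. ?g bs)"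
    by (rule prod_eta_expand)
  also have "\<dots> = (\<Sum>bs | set bs \<subseteq> {1..N} \<and> length bs = length ?L \<and> distinct bs. ?g bs)"
  proof (rule sum.mono_neutral_right)
    have "prod_list (map xi bs) = (0 :: (nat set, 'a) addop)" if "\<not> distinct bs" for bs
      by (rule anti_repeat[OF xi_anti xi_sq that])
    then show "\<forall>i\<in>{bs. set bs \<subseteq> {1..N} \<and> length bs = length ?L}
      - {bs. set bs \<subseteq> {1..N} \<and> length bs = length ?L \<and> distinct bs}. ?g i = 0"
      by auto
  qed (use finite_lists_length_eq[of "{1..N}"] in auto)
  also have "\<dots> = (\<Sum>\<sigma> | \<sigma> permutes {1..N}. ?g (map \<sigma> ?L))"
  proof (rule sum.reindex_bij_betw[symmetric])
    show "bij_betw (\<lambda>\<sigma>. map \<sigma> ?L) {\<sigma>. \<sigma> permutes {1..N}}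
      {bs. set bs \<subseteq> {1..N} \<and> length bs = length ?L \<and> distinct bs}"
      unfolding bij_betw_def
    proof
      show "inj_on (\<lambda>\<sigma>. map \<sigma> ?L) {\<sigma>. \<sigma> permutes {1..N}}"
      proof (rule inj_onI, rule ext)
        fix \<sigma> \<tau> a assume *: "\<sigma> \<in> {\<sigma>. \<sigma> permutes {1..N}}" "\<tau> \<in> {\<sigma>. \<sigma> permutes {1..N}}"
          "map \<sigma> ?L = map \<tau> ?L"
        show "\<sigma> a = \<tau> a"
        proof (cases "a \<in> {1..N}")
          case True
          then show ?thesis using *(3) by auto
        next
          case False
          then show ?thesis using * by (metis mem_Collect_eq permutes_not_in)
        qed
      qed
      show "(\<lambda>\<sigma>. map \<sigma> ?L) ` {\<sigma>. \<sigma> permutes {1..N}}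
          = {bs. set bs \<subseteq> {1..N} \<and> length bs = length ?L \<and> distinct bs}" (is "?A = ?B")
      proof
        show "?A \<subseteq> ?B"
        proof
          fix bs assume "bs \<in> ?A"
          then obtain \<sigma> where \<sigma>: "\<sigma> permutes {1..N}" and bs: "bs = map \<sigma> ?L" by blast
          have "set bs = {1..N}"
            unfolding bs set_map set_upt1 by (rule permutes_image[OF \<sigma>])
          moreover have "distinct bs"
            unfolding bs distinct_map set_upt1 using permutes_inj_on[OF \<sigma>] by simp
          moreover have "length bs = length ?L" using bs by (simp only: length_map)
          ultimately show "bs \<in> ?B" by blast
        qed
        show "?B \<subseteq> ?A"
        proof
          fix bs assume bs: "bs \<in> ?B"
          \<comment> \<open>The shift by one is between rows, counted from 1, and positions in a
            list, counted from 0.\<close>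
          define \<sigma> where "\<sigma> = (\<lambda>a. if a \<in> {1..N} then bs ! (a - 1) else a)"
          have len: "length bs = N" using bs by simp
          have "inj_on \<sigma> {1..N}"
            using bs len by (auto simp: inj_on_def \<sigma>_def nth_eq_iff_index_eq)
          moreover have "\<sigma> ` {1..N} \<subseteq> {1..N}"
          proof
            fix y assume "y \<in> \<sigma> ` {1..N}"
            then obtain a where "a \<in> {1..N}" "y = bs ! (a - 1)" by (auto simp: \<sigma>_def)
            then have "y \<in> set bs" using len by auto
            then show "y \<in> {1..N}" using bs by auto
          qed
          ultimately have "bij_betw \<sigma> {1..N} {1..N}"
            by (simp add: bij_betw_def endo_inj_surj)
          then have "\<sigma> permutes {1..N}"
            by (rule bij_imp_permutes) (auto simp: \<sigma>_def)
          moreover have "map \<sigma> ?L = bs"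
            by (rule nth_equalityI) (use len in \<open>auto simp: \<sigma>_def simp del: upt_Suc\<close>)
          ultimately show "bs \<in> ?A" by blast
        qed
      qed
    qed
  qed
  also have "\<dots> = (\<Sum>\<sigma> | \<sigma> permutes {1..N}. Lm (of_int (sign \<sigma>) * prod_list (map (\<lambda>a. X a (\<sigma> a)) ?L)) * prod_list (map xi ?L))"
  proof (intro sum.cong refl)
    fix \<sigma> assume "\<sigma> \<in> {\<sigma>. \<sigma> permutes {1..N}}"
    then have p: "prod_list (map xi (map \<sigma> ?L)) = of_int (sign \<sigma>) * prod_list (map xi ?L)"
      unfolding map_map by (intro prod_xi_perm) simp_all
    have m: "map2 X ?L (map \<sigma> ?L) = map (\<lambda>a. X a (\<sigma> a)) ?L"
      by (rule nth_equalityI) auto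
    show "?g (map \<sigma> ?L) = Lm (of_int (sign \<sigma>) * prod_list (map (\<lambda>a. X a (\<sigma> a)) ?L)) * prod_list (map xi ?L)"
      unfolding p m by (simp add: Lm_simps Lm_of_int mult.assoc[symmetric] sign_def)
  qed
  also have "\<dots> = Lm (rdet N X) * prod_list (map xi ?L)"
    by (simp add: rdet_def Lm_sum sum_distrib_right)
  finally show ?thesis .
qed

definition unit_form :: "nat set \<Rightarrow> 'a :: ring_1" where
  "unit_form B = (if B = {} then 1 else 0)"

text \<open>Built up from the last generator: each new factor has the smallest index, so no sign
  arises.\<close>

lemma top_xi: "app (prod_list (map xi [1..<N+1])) unit_form {1..N} = 1"
proof -
  have "app (prod_list (map xi [Suc N - k..<N+1])) unit_form {Suc N - k..N} = (1::'a)" if "k \<le> N" for k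
    using that
  proof (induction k)
    case (Suc k)
    have "[Suc N - Suc k..<N+1] = (Suc N - Suc k) # [Suc N - k..<N+1]"
      using Suc.prems by (subst upt_conv_Cons) (auto simp: Suc_diff_le simp del: upt_Suc)
    moreover have "{Suc N - Suc k..N} - {Suc N - Suc k} = {Suc N - k..N}" using Suc.prems by auto
    moreover have "inv_below (Suc N - Suc k) {Suc N - Suc k..N} = 0"
      by (auto simp: inv_below_def)
    ultimately show ?case using Suc by (simp add: app_xi del: upt_Suc)
  qed (auto simp: unit_form_def)
  from this[of N] show ?thesis by simp
qed

lemma top_Lm: "app (Lm x * T) \<Omega> B = x * app T \<Omega> B"
  by (simp add: app_Lm)

lemma rdet_top: "rdet N X = app (prod_list (map (eta N X) [1..<N+1])) unit_form {1..N}"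
  unfolding prod_eta_rdet by (simp only: top_Lm top_xi mult_1_right)

text \<open>Arguments by antisymmetry end with T = -T, and only without 2-torsion does this give T =
  0.\<close>

lemma addop_torsion_free:
  fixes T :: "('x, 'a :: ring_1) addop"
  assumes tf: "\<And>x :: 'a. x + x = 0 \<Longrightarrow> x = 0" and "T + T = 0"
  shows "T = 0"
proof (rule addop_eqI, rule ext)
  fix x b
  have "app (T + T) x b = 0" by (simp add: assms(2))
  then have "app T x b + app T x b = 0" by simp
  then have "app T x b = 0" by (rule tf)
  then show "app T x b = app 0 x b" by simp
qed

lemma eta_mult:
  "eta N X a * eta N Y c = (\<Sum>b=1..N. \<Sum>d=1..N. Lm (X a b * Y c d) * (xi b * xi d))"
  unfolding eta_def sum_product
proof (intro sum.cong refl)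
  fix b d
  have "Lm (X a b) * xi b * (Lm (Y c d) * xi d) = Lm (X a b) * (xi b * Lm (Y c d)) * xi d"
    by (simp only: mult.assoc)
  then show "Lm (X a b) * xi b * (Lm (Y c d) * xi d) = Lm (X a b * Y c d) * (xi b * xi d)"
    by (simp only: xi_Lm Lm_simps mult.assoc)
qed

text \<open>The anticommutator is the sum of the commutators of \<open>X a b\<close> and
  \<open>X c d\<close> against \<open>xi b * xi d\<close>. The Manin relation makes the coefficient
  symmetric in b and d while the forms are antisymmetric. The case a = c is included and later
  yields that squares vanish.\<close>

lemma eta_anti:
  fixes X :: "nat \<Rightarrow> nat \<Rightarrow> 'a :: ring_1"
  assumes tf: "\<And>x :: 'a. x + x = 0 \<Longrightarrow> x = 0"
    and comm: "\<And>b d. b \<in> {1..N} \<Longrightarrow> d \<in> {1..N} \<Longrightarrow>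
      X a b * X c d - X c d * X a b = X a d * X c b - X c b * X a d"
  shows "eta N X a * eta N X c = - (eta N X c * eta N X a)"
proof -
  define S where "S = (\<lambda>b d. X a b * X c d - X c d * X a b)"
  define T where "T = (\<Sum>b=1..N. \<Sum>d=1..N. Lm (S b d) * (xi b * xi d))"
  have "eta N X c * eta N X a = (\<Sum>b=1..N. \<Sum>d=1..N. Lm (X c d * X a b) * (xi d * xi b))"
    unfolding eta_mult by (rule sum.swap)
  also have "\<dots> = - (\<Sum>b=1..N. \<Sum>d=1..N. Lm (X c d * X a b) * (xi b * xi d))"
    unfolding sum_negf[symmetric]
  proof (intro sum.cong refl)
    fix b d
    show "Lm (X c d * X a b) * (xi d * xi b) = - (Lm (X c d * X a b) * (xi b * xi d))"
      by (subst xi_anti) simp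
  qed
  finally have 1: "eta N X c * eta N X a = - (\<Sum>b=1..N. \<Sum>d=1..N. Lm (X c d * X a b) * (xi b * xi d))" .
  have T: "eta N X a * eta N X c + eta N X c * eta N X a = T"
    unfolding 1 unfolding eta_mult T_def S_def
    by (simp add: Lm_simps left_diff_distrib sum_subtractf)
  have "T = (\<Sum>d=1..N. \<Sum>b=1..N. Lm (S b d) * (xi b * xi d))"
    unfolding T_def by (rule sum.swap)
  also have "\<dots> = (\<Sum>d=1..N. \<Sum>b=1..N. - (Lm (S d b) * (xi d * xi b)))"
  proof (intro sum.cong refl)
    fix b d assume "b \<in> {1..N}" "d \<in> {1..N}"
    then have "S b d = S d b" unfolding S_def using comm by blast
    then show "Lm (S b d) * (xi b * xi d) = - (Lm (S d b) * (xi d * xi b))"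
      by (subst xi_anti) simp
  qed
  also have "\<dots> = - T" by (simp add: T_def sum_negf)
  finally have "T + T = 0" by (simp add: eq_neg_iff_add_eq_0)
  have "T = 0" by (rule addop_torsion_free[OF _ \<open>T + T = 0\<close>]) (rule tf)
  with T show ?thesis by (simp add: eq_neg_iff_add_eq_0)
qed

lemma square_zero:
  fixes T :: "('x, 'a :: ring_1) addop"
  assumes "\<And>x :: 'a. x + x = 0 \<Longrightarrow> x = 0" and "T * T = - (T * T)"
  shows "T * T = 0"
proof (rule addop_torsion_free)
  show "T * T + T * T = 0" using assms(2) by (simp add: eq_neg_iff_add_eq_0)
qed (rule assms(1))

text \<open>
  Commutation with \<open>e - \<xi>\<^sub>d \<iota>\<^sub>c\<close> replaces \<open>\<eta>\<^sub>c\<close> by \<open>\<eta>\<^sub>d\<close>, which kills the product of all \<open>\<eta>\<^sub>a\<close> unless \<open>c = d\<close>.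
\<close>

lemma rdet_central:
  fixes X :: "nat \<Rightarrow> nat \<Rightarrow> 'a :: ring_1"
  assumes tf: "\<And>x :: 'a. x + x = 0 \<Longrightarrow> x = 0"
    and comm: "\<And>a b c d. a \<in> {1..N} \<Longrightarrow> b \<in> {1..N} \<Longrightarrow> c \<in> {1..N} \<Longrightarrow> d \<in> {1..N} \<Longrightarrow>
      X a b * X c d - X c d * X a b = X a d * X c b - X c b * X a d"
    and cd: "c \<in> {1..N}" "d \<in> {1..N}"
    and e: "\<And>a b. a \<in> {1..N} \<Longrightarrow> b \<in> {1..N} \<Longrightarrow>
      e * X a b - X a b * e = (if d = b then X a c else 0) - (if a = c then X d b else 0)"
  shows "e * rdet N X = rdet N X * e"
proof -
  define E where "E = eta N X"
  define D where "D = (xi d * io c :: (nat set, 'a) addop)"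
  define Q where "Q = Lm e - D"
  define L where "L = [1..<N+1]"
  have anti: "E a * E b = - (E b * E a)" if "a \<in> {1..N}" "b \<in> {1..N}" for a b
    unfolding E_def
  proof (rule eta_anti)
    show "X a b' * X b d - X b d * X a b' = X a d * X b b' - X b b' * X a d"
      if "b' \<in> {1..N}" "d \<in> {1..N}" for b' d
      using comm \<open>a \<in> {1..N}\<close> \<open>b \<in> {1..N}\<close> that by blast
  qed (rule tf)
  have sq: "E a * E a = 0" if "a \<in> {1..N}" for a
    by (rule square_zero[OF _ anti[OF that that]]) (rule tf)
  have D_Lm: "D * Lm x = Lm x * D" for x
    unfolding D_def by (simp only: mult.assoc io_Lm) (simp only: mult.assoc[symmetric] xi_Lm)
  have D_xi: "D * xi b - xi b * D = (if b = c then xi d else 0)" for b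
  proof -
    have "xi b * D = - (xi d * xi b * io c)"
      unfolding D_def mult.assoc[symmetric] by (subst xi_anti) simp
    moreover have "D * xi b = xi d * ((if b = c then 1 else 0) - xi b * io c)"
      unfolding D_def mult.assoc io_xi ..
    ultimately show ?thesis by (simp add: right_diff_distrib mult.assoc)
  qed
  have DE: "D * E a - E a * D = Lm (X a c) * xi d" for a
  proof -
    have "D * E a - E a * D = (\<Sum>b=1..N. Lm (X a b) * (D * xi b - xi b * D))"
      unfolding E_def eta_def sum_distrib_left sum_distrib_right sum_subtractf[symmetric] right_diff_distrib
      by (simp only: mult.assoc[symmetric] D_Lm)
    also have "\<dots> = (\<Sum>b=1..N. if b = c then Lm (X a b) * xi d else 0)"
      unfolding D_xi by (intro sum.cong) auto
    also have "\<dots> = Lm (X a c) * xi d" using cd by simp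
    finally show ?thesis .
  qed
  have eE: "Lm e * E a - E a * Lm e = Lm (X a c) * xi d - (if a = c then E d else 0)"
    if "a \<in> {1..N}" for a
  proof -
    have "Lm e * E a - E a * Lm e = (\<Sum>b=1..N. Lm (e * X a b - X a b * e) * xi b)"
      unfolding E_def eta_def sum_distrib_left sum_distrib_right sum_subtractf[symmetric] Lm_simps left_diff_distrib
      by (simp only: mult.assoc xi_Lm)
    also have "\<dots> = (\<Sum>b=1..N. (if d = b then Lm (X a c) * xi b else 0) - (if a = c then Lm (X d b) * xi b else 0))"
    proof (intro sum.cong refl)
      fix b assume "b \<in> {1..N}"
      from e[OF that this] show "Lm (e * X a b - X a b * e) * xi b =
        (if d = b then Lm (X a c) * xi b else 0) - (if a = c then Lm (X d b) * xi b else 0)"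
        by (simp only:) (auto simp: Lm_simps left_diff_distrib)
    qed
    also have "\<dots> = Lm (X a c) * xi d - (if a = c then E d else 0)"
      using cd by (simp add: sum_subtractf E_def eta_def)
    finally show ?thesis .
  qed
  have QE: "Q * E a = E a * Q - (if a = c then E d else 0)" if "a \<in> {1..N}" for a
    using DE[of a] eE[OF that] unfolding Q_def by (simp add: algebra_simps)
  define r where "r = (\<lambda>a. if a = c then d else a)"
  \<comment> \<open>Since the word is distinct, c occurs in it at most once; the derivation
    therefore replaces a single factor and no sum over positions arises.\<close>
  have QP: "Q * prod_list (map E as) = prod_list (map E as) * Q
      - (if c \<in> set as then prod_list (map E (map r as)) else 0)"
    if "distinct as" "set as \<subseteq> {1..N}" for as
    using that
  proof (induction as)
    case (Cons a as)
    have r: "r c = d" "a \<noteq> c \<Longrightarrow> r a = a" by (simp_all add: r_def)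
    have id: "prod_list (map (E \<circ> r) as) = prod_list (map E as)" if "c \<notin> set as"
      by (rule arg_cong[of _ _ prod_list]) (use that in \<open>auto simp: r_def\<close>)
    have "Q * prod_list (map E (a # as)) = (Q * E a) * prod_list (map E as)"
      by (simp only: list.map prod_list.Cons mult.assoc)
    also have "\<dots> = E a * (Q * prod_list (map E as)) - (if a = c then E d else 0) * prod_list (map E as)"
      using QE[of a] Cons.prems by (simp add: left_diff_distrib mult.assoc)
    also have "Q * prod_list (map E as) = prod_list (map E as) * Q
      - (if c \<in> set as then prod_list (map E (map r as)) else 0)"
      using Cons by simp
    finally show ?case
      using Cons.prems id r by (cases "a = c") (auto simp: right_diff_distrib mult.assoc)
  qed simp
  have setL: "set L = {1..N}" "distinct L" unfolding L_def set_upt1 by auto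
  have rL: "prod_list (map E (map r L)) = (if c = d then prod_list (map E L) else 0)"
  proof (cases "c = d")
    case True
    then have "map r L = L" by (intro map_idI) (auto simp: r_def)
    with True show ?thesis by simp
  next
    case False
    have "\<not> distinct (map r L)"
    proof
      assume "distinct (map r L)"
      then have "inj_on r {1..N}" using setL by (simp add: distinct_map)
      moreover have "r c = r d" by (simp add: r_def)
      ultimately have "c = d" using cd by (rule inj_onD)
      then show False using False by simp
    qed
    moreover have "set (map r L) \<subseteq> {1..N}" using setL cd by (auto simp: r_def)
    ultimately have "prod_list (map E (map r L)) = 0"
      by (intro anti_repeat anti sq) auto
    then show ?thesis using False by simp
  qed
  have c: "c \<in> set L" using setL cd by simp
  have main: "Q * prod_list (map E L) = prod_list (map E L) * Q - (if c = d then prod_list (map E L) else 0)"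
    using QP[of L] setL c unfolding rL by simp
  define R where "R = rdet N X"
  define Px where "Px = prod_list (map (xi :: nat \<Rightarrow> (nat set, 'a) addop) L)"
  have PE: "prod_list (map E L) = Lm R * Px"
    unfolding E_def L_def R_def Px_def by (rule prod_eta_rdet)
  have topPx: "app Px unit_form {1..N} = 1" unfolding Px_def L_def by (rule top_xi)
  \<comment> \<open>\<open>D\<close> fixes the top form if c = d and kills it otherwise. The
    correction term of \<open>main\<close> thus occurs on both sides and drops out.\<close>
  have lhs: "app (Q * prod_list (map E L)) unit_form {1..N} = e * R - (if c = d then R else 0)"
  proof -
    have "D * (Lm R * Px) = Lm R * (D * Px)" by (metis D_Lm mult.assoc)
    moreover have "app (D * Px) unit_form {1..N} = (if c = d then 1 else 0)"
    proof -
      have ins: "insert d ({1..N} - {d}) = {1..N}" "insert d {1..N} = {1..N}" using cd by auto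
      show ?thesis
        using cd topPx unfolding D_def
        by (cases "c = d")
           (auto simp: app_xi app_io inv_below_remove ins[unfolded One_nat_def] mult.assoc[symmetric] power_add[symmetric])
    qed
    ultimately show ?thesis unfolding PE Q_def left_diff_distrib using topPx
      by (simp add: app_Lm)
  qed
  have Px_Lm: "Px * Lm x = Lm x * Px" for x
  proof -
    have "prod_list (map xi as) * Lm x = Lm x * prod_list (map xi as)" for as
    proof (induction as)
      case (Cons a as)
      then show ?case by (simp add: mult.assoc) (simp add: mult.assoc[symmetric] xi_Lm)
    qed simp
    then show ?thesis unfolding Px_def by blast
  qed
  \<comment> \<open>A contraction kills the form 1, so on it \<open>Q\<close> acts as
    \<open>e\<close> does.\<close>
  have "app Q unit_form = app (Lm e) unit_form"
    by (auto simp: Q_def D_def app_xi app_io unit_form_def fun_eq_iff)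
  then have "app (prod_list (map E L) * Q) unit_form {1..N} = app (Lm R * (Px * Lm e)) unit_form {1..N}"
    unfolding PE by simp
  also have "\<dots> = R * e" unfolding Px_Lm using topPx by (simp add: app_Lm)
  finally have rhs: "app (prod_list (map E L) * Q) unit_form {1..N} = R * e" .
  have "app (prod_list (map E L)) unit_form {1..N} = R"
    unfolding PE using topPx by (simp add: app_Lm)
  then have "e * R - (if c = d then R else 0) = R * e - (if c = d then R else 0)"
    using arg_cong[OF main, of "\<lambda>T. app T unit_form {1..N}"] unfolding lhs
    by (simp add: rhs[simplified] del: app_ring_simps(6) split: if_splits) (use rhs in auto)
  then show ?thesis unfolding R_def by simp
qed

text \<open>
  In the application \<open>\<phi> = 1 / (u - w)\<close> and \<open>P\<close> consists of the operators regular at \<open>w\<close>: the matrix unit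
  relations make all higher powers of \<open>\<phi>\<close> cancel.
\<close>

lemma rdet_vector_site:
  fixes Z e X :: "nat \<Rightarrow> nat \<Rightarrow> 'a :: ring_1"
  assumes tf: "\<And>x :: 'a. x + x = 0 \<Longrightarrow> x = 0"
    and comm: "\<And>a b c d. a \<in> {1..N} \<Longrightarrow> b \<in> {1..N} \<Longrightarrow> c \<in> {1..N} \<Longrightarrow> d \<in> {1..N} \<Longrightarrow>
      Z a b * Z c d - Z c d * Z a b = Z a d * Z c b - Z c b * Z a d"
    and eZ: "\<And>a b c d. a \<in> {1..N} \<Longrightarrow> b \<in> {1..N} \<Longrightarrow> c \<in> {1..N} \<Longrightarrow> d \<in> {1..N} \<Longrightarrow>
      e a b * Z c d = Z c d * e a b"
    and ee: "\<And>a b c d. a \<in> {1..N} \<Longrightarrow> b \<in> {1..N} \<Longrightarrow> c \<in> {1..N} \<Longrightarrow> d \<in> {1..N} \<Longrightarrow>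
      e a b * e c d = (if b = c then e a d else 0)"
    and e\<phi>: "\<And>a b. a \<in> {1..N} \<Longrightarrow> b \<in> {1..N} \<Longrightarrow> e a b * \<phi> = \<phi> * e a b"
    and Z\<phi>: "\<And>a b. a \<in> {1..N} \<Longrightarrow> b \<in> {1..N} \<Longrightarrow>
      Z a b * \<phi> = \<phi> * Z a b - (if a = b then \<phi> * \<phi> else 0)"
    and X: "\<And>a b. a \<in> {1..N} \<Longrightarrow> b \<in> {1..N} \<Longrightarrow> X a b = Z a b - \<phi> * e b a"
    and P: "0 \<in> P" "1 \<in> P" "\<And>x y. x \<in> P \<Longrightarrow> y \<in> P \<Longrightarrow> x + y \<in> P" "\<And>x y. x \<in> P \<Longrightarrow> y \<in> P \<Longrightarrow> x * y \<in> P"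
      "\<And>x. x \<in> P \<Longrightarrow> - x \<in> P"
      "\<And>a b. a \<in> {1..N} \<Longrightarrow> b \<in> {1..N} \<Longrightarrow> Z a b \<in> P" "\<And>a b. a \<in> {1..N} \<Longrightarrow> b \<in> {1..N} \<Longrightarrow> e a b \<in> P"
  shows "\<exists>G\<in>P. rdet N X = rdet N Z - \<phi> * G \<and>
    (\<Sum>c=1..N. e c c) * rdet N Z = (\<Sum>c=1..N. \<Sum>b=1..N. e c b * Z c b) * G"
proof -
  define \<zeta> where "\<zeta> = eta N Z"
  define \<theta> where "\<theta> = eta N (\<lambda>a b. e b a)"
  define L where "L = [1..<N+1]"
  have setL: "set L = {1..N}" "distinct L" unfolding L_def set_upt1 by auto
  have anti: "\<zeta> a * \<zeta> c = - (\<zeta> c * \<zeta> a)" if "a \<in> {1..N}" "c \<in> {1..N}" for a c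
    unfolding \<zeta>_def
  proof (rule eta_anti)
    show "Z a b * Z c d - Z c d * Z a b = Z a d * Z c b - Z c b * Z a d"
      if "b \<in> {1..N}" "d \<in> {1..N}" for b d
      using comm \<open>a \<in> {1..N}\<close> \<open>c \<in> {1..N}\<close> that by blast
  qed (rule tf)
  have sq: "\<zeta> a * \<zeta> a = 0" if "a \<in> {1..N}" for a
    by (rule square_zero[OF _ anti[OF that that]]) (rule tf)
  have \<theta>\<zeta>: "\<zeta> a * \<theta> c = - (\<theta> c * \<zeta> a)" if "a \<in> {1..N}" "c \<in> {1..N}" for a c
  proof -
    have "\<theta> c * \<zeta> a = (\<Sum>b=1..N. \<Sum>d=1..N. Lm (e d c * Z a b) * (xi d * xi b))"
      unfolding \<zeta>_def \<theta>_def eta_mult by (rule sum.swap)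
    also have "\<dots> = (\<Sum>b=1..N. \<Sum>d=1..N. - (Lm (Z a b * e d c) * (xi b * xi d)))"
    proof (intro sum.cong refl)
      fix b d assume "b \<in> {1..N}" "d \<in> {1..N}"
      then have "e d c * Z a b = Z a b * e d c" using eZ that by blast
      then show "Lm (e d c * Z a b) * (xi d * xi b) = - (Lm (Z a b * e d c) * (xi b * xi d))"
        by (subst xi_anti) simp
    qed
    also have "\<dots> = - (\<zeta> a * \<theta> c)"
      unfolding \<zeta>_def \<theta>_def eta_mult by (simp only: sum_negf)
    finally show ?thesis by simp
  qed
  \<comment> \<open>This is where the matrix unit relations enter: a product of two singular forms
    is again linear in the generators of the site.\<close>
  have \<theta>\<theta>: "\<theta> a * \<theta> c = - (xi a * \<theta> c)" if "a \<in> {1..N}" "c \<in> {1..N}" for a c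
  proof -
    have "\<theta> a * \<theta> c = (\<Sum>b=1..N. \<Sum>d=1..N. if d = a then Lm (e b c) * (xi b * xi d) else 0)"
      unfolding \<theta>_def eta_mult
    proof (intro sum.cong refl)
      fix b d assume "b \<in> {1..N}" "d \<in> {1..N}"
      then have "e b a * e d c = (if a = d then e b c else 0)" using ee that by blast
      then show "Lm (e b a * e d c) * (xi b * xi d) = (if d = a then Lm (e b c) * (xi b * xi d) else 0)"
        by (auto simp: Lm_simps)
    qed
    also have "\<dots> = (\<Sum>b=1..N. Lm (e b c) * (xi b * xi a))"
      using that by simp
    also have "\<dots> = (\<Sum>b=1..N. - (xi a * (Lm (e b c) * xi b)))"
    proof (intro sum.cong refl)
      fix b
      have "Lm (e b c) * (xi b * xi a) = - (Lm (e b c) * xi a * xi b)"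
        unfolding mult.assoc by (subst xi_anti) simp
      then show "Lm (e b c) * (xi b * xi a) = - (xi a * (Lm (e b c) * xi b))"
        by (simp only: xi_Lm[symmetric] mult.assoc)
    qed
    also have "\<dots> = - (xi a * \<theta> c)"
      by (simp only: \<theta>_def eta_def sum_negf sum_distrib_left)
    finally show ?thesis .
  qed
  have \<theta>\<phi>: "\<theta> a * Lm \<phi> = Lm \<phi> * \<theta> a" if "a \<in> {1..N}" for a
    unfolding \<theta>_def eta_def sum_distrib_left sum_distrib_right
  proof (intro sum.cong refl)
    fix b assume "b \<in> {1..N}"
    then have "e b a * \<phi> = \<phi> * e b a" using e\<phi> that by blast
    then show "Lm (e b a) * xi b * Lm \<phi> = Lm \<phi> * (Lm (e b a) * xi b)"
      by (simp only: mult.assoc xi_Lm) (simp only: mult.assoc[symmetric] Lm_simps(4)[symmetric])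
  qed
  have \<zeta>\<phi>: "\<zeta> a * Lm \<phi> = Lm \<phi> * \<zeta> a - Lm (\<phi> * \<phi>) * xi a" if "a \<in> {1..N}" for a
  proof -
    have "\<zeta> a * Lm \<phi> = (\<Sum>b=1..N. Lm \<phi> * (Lm (Z a b) * xi b) - (if b = a then Lm (\<phi> * \<phi>) * xi b else 0))"
      unfolding \<zeta>_def eta_def sum_distrib_right
    proof (intro sum.cong refl)
      fix b assume "b \<in> {1..N}"
      then have "Z a b * \<phi> = \<phi> * Z a b - (if a = b then \<phi> * \<phi> else 0)" using Z\<phi> that by blast
      then have "Lm (Z a b) * Lm \<phi> = Lm \<phi> * Lm (Z a b) - (if a = b then Lm (\<phi> * \<phi>) else 0)"
        by (simp only: Lm_simps(4)[symmetric]) (auto simp: Lm_simps)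
      then show "Lm (Z a b) * xi b * Lm \<phi> = Lm \<phi> * (Lm (Z a b) * xi b) - (if b = a then Lm (\<phi> * \<phi>) * xi b else 0)"
        by (simp only: mult.assoc xi_Lm) (auto simp: mult.assoc[symmetric] left_diff_distrib)
    qed
    also have "\<dots> = Lm \<phi> * \<zeta> a - Lm (\<phi> * \<phi>) * xi a"
      using that by (simp add: sum_subtractf \<zeta>_def eta_def sum_distrib_left)
    finally show ?thesis .
  qed
  have \<eta>: "eta N X a = \<zeta> a - Lm \<phi> * \<theta> a" if "a \<in> {1..N}" for a
    unfolding eta_def \<zeta>_def \<theta>_def sum_distrib_left sum_subtractf[symmetric]
    by (intro sum.cong refl) (use X that in \<open>simp add: Lm_simps left_diff_distrib mult.assoc\<close>)
  \<comment> \<open>\<open>M as a\<close> is the product of the \<zeta> along \<open>as\<close> with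
    the factor at \<open>a\<close> omitted and the sign of its position, a kind of cofactor;
    \<open>\<Gamma>\<close> collects the terms with exactly one \<theta>, moved to the
    front.\<close>
  define M where "M = rec_list (\<lambda>a. 0) (\<lambda>a' as r a. if a = a' then prod_list (map \<zeta> as) else - (\<zeta> a' * r a))"
  have M: "M [] a = 0" "M (a' # as) a = (if a = a' then prod_list (map \<zeta> as) else - (\<zeta> a' * M as a))" for a a' as
    unfolding M_def by simp_all
  define \<Gamma> where "\<Gamma> = (\<lambda>as. \<Sum>a\<in>set as. \<theta> a * M as a)"
  have \<Gamma>: "\<Gamma> (a' # as) = \<theta> a' * prod_list (map \<zeta> as) + \<zeta> a' * \<Gamma> as"
    if "distinct (a' # as)" "set (a' # as) \<subseteq> {1..N}" for a' as
  proof -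
    have "\<Gamma> (a' # as) = \<theta> a' * prod_list (map \<zeta> as) + (\<Sum>a\<in>set as. \<theta> a * M (a' # as) a)"
      unfolding \<Gamma>_def using that by (simp add: M)
    also have "(\<Sum>a\<in>set as. \<theta> a * M (a' # as) a) = (\<Sum>a\<in>set as. \<zeta> a' * (\<theta> a * M as a))"
    proof (intro sum.cong refl)
      fix a assume a: "a \<in> set as"
      then have "\<zeta> a' * \<theta> a = - (\<theta> a * \<zeta> a')" using \<theta>\<zeta> that by auto
      with a that show "\<theta> a * M (a' # as) a = \<zeta> a' * (\<theta> a * M as a)"
        by (auto simp: M mult.assoc[symmetric])
    qed
    finally show ?thesis by (simp add: \<Gamma>_def sum_distrib_left)
  qed
  have \<theta>\<Gamma>: "\<theta> a * \<Gamma> as = - (xi a * \<Gamma> as)" if "a \<in> {1..N}" "set as \<subseteq> {1..N}" for a as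
    unfolding \<Gamma>_def sum_distrib_left sum_negf[symmetric]
  proof (intro sum.cong refl)
    fix c assume "c \<in> set as"
    then have "\<theta> a * \<theta> c = - (xi a * \<theta> c)" using \<theta>\<theta> that by auto
    then show "\<theta> a * (\<theta> c * M as c) = - (xi a * (\<theta> c * M as c))"
      by (simp add: mult.assoc[symmetric])
  qed
  have expand: "prod_list (map (eta N X) as) = prod_list (map \<zeta> as) - Lm \<phi> * \<Gamma> as"
    if "distinct as" "set as \<subseteq> {1..N}" for as
    using that
  proof (induction as)
    case Nil
    then show ?case by (simp add: \<Gamma>_def)
  next
    case (Cons a as)
    have a: "a \<in> {1..N}" "set as \<subseteq> {1..N}" using Cons.prems by auto
    \<comment> \<open>The double poles cancel here: commuting \<zeta> past \<phi> produces the same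
      \<phi>-squared term as the product of the two \<theta> contributions.\<close>
    have 1: "\<zeta> a * (Lm \<phi> * \<Gamma> as) = Lm \<phi> * (\<zeta> a * \<Gamma> as) - Lm (\<phi> * \<phi>) * (xi a * \<Gamma> as)"
      using \<zeta>\<phi>[OF a(1)] by (simp add: mult.assoc[symmetric] left_diff_distrib)
    have 2: "Lm \<phi> * \<theta> a * (Lm \<phi> * \<Gamma> as) = - (Lm (\<phi> * \<phi>) * (xi a * \<Gamma> as))"
    proof -
      have "Lm \<phi> * \<theta> a * (Lm \<phi> * \<Gamma> as) = Lm \<phi> * (\<theta> a * Lm \<phi>) * \<Gamma> as" by (simp only: mult.assoc)
      also have "\<dots> = Lm (\<phi> * \<phi>) * (\<theta> a * \<Gamma> as)" unfolding \<theta>\<phi>[OF a(1)] by (simp add: Lm_simps mult.assoc)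
      finally show ?thesis unfolding \<theta>\<Gamma>[OF a] by simp
    qed
    have "prod_list (map (eta N X) (a # as)) = (\<zeta> a - Lm \<phi> * \<theta> a) * (prod_list (map \<zeta> as) - Lm \<phi> * \<Gamma> as)"
      using Cons \<eta>[OF a(1)] by simp
    also have "\<dots> = \<zeta> a * prod_list (map \<zeta> as) - Lm \<phi> * \<theta> a * prod_list (map \<zeta> as)
        - (\<zeta> a * (Lm \<phi> * \<Gamma> as) - Lm \<phi> * \<theta> a * (Lm \<phi> * \<Gamma> as))"
      by (simp only: left_diff_distrib right_diff_distrib)
    also have "\<dots> = prod_list (map \<zeta> (a # as)) - Lm \<phi> * \<Gamma> (a # as)"
      unfolding 1 2 \<Gamma>[OF Cons.prems] by (simp add: mult.assoc distrib_left)
    finally show ?case .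
  qed
  \<comment> \<open>As for cofactors: \<zeta> with the matching index restores the full product up
    to the sign already in \<open>M\<close>, any other index repeats a factor.\<close>
  have \<zeta>M: "\<zeta> c * M as a = (if a = c then prod_list (map \<zeta> as) else 0)"
    if "distinct as" "set as \<subseteq> {1..N}" "a \<in> set as" "c \<in> set as" for as a c
    using that
  proof (induction as)
    case (Cons a' as)
    have rep: "\<zeta> c * prod_list (map \<zeta> as) = 0" if "c \<in> set as"
    proof -
      have "prod_list (map \<zeta> (c # as)) = 0"
      proof (rule anti_repeat)
        fix x y assume "x \<in> set (c # as)" "y \<in> set (c # as)"
        then have xy: "x \<in> {1..N}" "y \<in> {1..N}" using Cons.prems that by auto
        then show "\<zeta> x * \<zeta> y = - (\<zeta> y * \<zeta> x)" by (rule anti)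
        from xy(1) show "\<zeta> x * \<zeta> x = 0" by (rule sq)
      qed (use that in auto)
      then show ?thesis by simp
    qed
    show ?case
    proof (cases "a = a'")
      case True
      then show ?thesis using Cons.prems rep by (auto simp: M)
    next
      case False
      then have a: "a \<in> set as" using Cons.prems by simp
      show ?thesis
      proof (cases "c = a'")
        case True
        then show ?thesis using False sq[of a'] Cons.prems
          by (simp add: M mult.assoc[symmetric])
      next
        case False2: False
        then have c: "c \<in> set as" using Cons.prems by simp
        have "\<zeta> c * \<zeta> a' = - (\<zeta> a' * \<zeta> c)" by (rule anti) (use Cons.prems c in auto)
        then have "\<zeta> c * M (a' # as) a = \<zeta> a' * (\<zeta> c * M as a)"
          using False by (simp add: M mult.assoc[symmetric])
        also have "\<zeta> c * M as a = (if a = c then prod_list (map \<zeta> as) else 0)"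
          using Cons a c by simp
        finally show ?thesis by auto
      qed
    qed
  qed simp
  \<comment> \<open>Multiplication by \<open>Zt\<close> turns each \<theta> back into the \<zeta>,
    so on \<open>\<Gamma>\<close> it recovers the product of all \<zeta>. Hence the regular part of
    the determinant is controlled by \<open>G\<close>.\<close>
  define Zt where "Zt = (\<Sum>c=1..N. \<Sum>b=1..N. e c b * Z c b)"
  have Zt\<theta>: "Lm Zt * \<theta> a = (\<Sum>c=1..N. Lm (e c a) * \<zeta> c)" if "a \<in> {1..N}" for a
  proof -
    have 1: "Zt * e d a = (\<Sum>c=1..N. e c a * Z c d)" if d: "d \<in> {1..N}" for d
    proof -
      have "Zt * e d a = (\<Sum>c=1..N. \<Sum>b=1..N. if b = d then e c a * Z c b else 0)"
        unfolding Zt_def sum_distrib_right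
      proof (intro sum.cong refl)
        fix c b assume cb: "c \<in> {1..N}" "b \<in> {1..N}"
        have "e c b * Z c b * e d a = e c b * e d a * Z c b"
          using eZ[of d a c b] cb d \<open>a \<in> {1..N}\<close> by (simp add: mult.assoc)
        then show "e c b * Z c b * e d a = (if b = d then e c a * Z c b else 0)"
          using ee[of c b d a] cb d \<open>a \<in> {1..N}\<close> by simp
      qed
      then show ?thesis using d by simp
    qed
    have "Lm Zt * \<theta> a = (\<Sum>d=1..N. Lm (Zt * e d a) * xi d)"
      by (simp add: \<theta>_def eta_def sum_distrib_left Lm_simps mult.assoc)
    also have "\<dots> = (\<Sum>d=1..N. \<Sum>c=1..N. Lm (e c a) * (Lm (Z c d) * xi d))"
      by (intro sum.cong refl) (simp add: 1 Lm_sum Lm_simps sum_distrib_right mult.assoc)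
    also have "\<dots> = (\<Sum>c=1..N. Lm (e c a) * \<zeta> c)"
      by (subst sum.swap) (simp add: \<zeta>_def eta_def sum_distrib_left)
    finally show ?thesis .
  qed
  have Zt\<Gamma>: "Lm Zt * \<Gamma> L = Lm (\<Sum>c=1..N. e c c) * prod_list (map \<zeta> L)"
  proof -
    have "Lm Zt * \<Gamma> L = (\<Sum>a=1..N. (Lm Zt * \<theta> a) * M L a)"
      unfolding \<Gamma>_def setL sum_distrib_left by (simp only: mult.assoc)
    also have "\<dots> = (\<Sum>a=1..N. \<Sum>c=1..N. if c = a then Lm (e c a) * prod_list (map \<zeta> L) else 0)"
    proof (rule sum.cong[OF refl])
      fix a assume a: "a \<in> {1..N}"
      have "(Lm Zt * \<theta> a) * M L a = (\<Sum>c=1..N. Lm (e c a) * (\<zeta> c * M L a))"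
        unfolding Zt\<theta>[OF a] sum_distrib_right by (simp only: mult.assoc)
      also have "\<dots> = (\<Sum>c=1..N. if c = a then Lm (e c a) * prod_list (map \<zeta> L) else 0)"
        by (intro sum.cong refl) (use \<zeta>M[of L a] setL a in auto)
      finally show "(Lm Zt * \<theta> a) * M L a = (\<Sum>c=1..N. if c = a then Lm (e c a) * prod_list (map \<zeta> L) else 0)" .
    qed
    also have "\<dots> = Lm (\<Sum>c=1..N. e c c) * prod_list (map \<zeta> L)"
      by (simp add: Lm_sum sum_distrib_right)
    finally show ?thesis .
  qed
  define G where "G = app (\<Gamma> L) unit_form {1..N}"
  have Ztop: "app (prod_list (map \<zeta> L)) unit_form {1..N} = rdet N Z"
    unfolding \<zeta>_def L_def by (rule rdet_top[symmetric])
  have Xtop: "app (prod_list (map (eta N X) L)) unit_form {1..N} = rdet N X"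
    unfolding L_def by (rule rdet_top[symmetric])
  have 1: "rdet N X = rdet N Z - \<phi> * G"
    using Xtop Ztop setL unfolding G_def by (simp add: expand app_Lm)
  have 2: "(\<Sum>c=1..N. e c c) * rdet N Z = Zt * G"
  proof -
    have "(\<Sum>c=1..N. e c c) * rdet N Z = app (Lm (\<Sum>c=1..N. e c c) * prod_list (map \<zeta> L)) unit_form {1..N}"
      unfolding top_Lm Ztop ..
    also have "\<dots> = Zt * G" unfolding Zt\<Gamma>[symmetric] top_Lm G_def ..
    finally show ?thesis .
  qed
  \<comment> \<open>Operators on forms that keep all coefficients in \<open>P\<close>; since all
    factors of \<open>\<Gamma>\<close> are of this kind, \<open>G\<close> lies in
    \<open>P\<close>.\<close>
  define S where "S = {T :: (nat set, 'a) addop. \<forall>\<Omega>. (\<forall>B. \<Omega> B \<in> P) \<longrightarrow> (\<forall>B. app T \<Omega> B \<in> P)}"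
  have Ssum: "(\<Sum>i\<in>A. T i) \<in> S" if "\<And>i. i \<in> A \<Longrightarrow> T i \<in> S" for A and T :: "nat \<Rightarrow> (nat set, 'a) addop"
    using that by (induction A rule: infinite_finite_induct) (auto simp: S_def P)
  have Smult: "T * T' \<in> S" if "T \<in> S" "T' \<in> S" for T T' using that by (auto simp: S_def)
  have Sneg: "- T \<in> S" if "T \<in> S" for T using that by (auto simp: S_def P)
  have sg: "(-1) ^ n * x \<in> P" if "x \<in> P" for n :: nat and x
    using that by (cases "even n") (auto simp: P)
  have Sxi: "xi b \<in> S" for b by (auto simp: S_def app_xi P sg)
  have SL: "Lm x \<in> S" if "x \<in> P" for x using that by (auto simp: S_def app_Lm P)
  have S\<zeta>: "\<zeta> a \<in> S" if "a \<in> {1..N}" for a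
    unfolding \<zeta>_def eta_def by (intro Ssum Smult SL Sxi P that)
  have S\<theta>: "\<theta> a \<in> S" if "a \<in> {1..N}" for a
    unfolding \<theta>_def eta_def by (intro Ssum Smult SL Sxi P that)
  have SP: "prod_list (map \<zeta> as) \<in> S" if "set as \<subseteq> {1..N}" for as
    using that
  proof (induction as)
    case (Cons a as)
    then have "\<zeta> a * prod_list (map \<zeta> as) \<in> S" by (intro Smult S\<zeta>) auto
    then show ?case by simp
  qed (simp add: S_def)
  have SM: "M as a \<in> S" if "set as \<subseteq> {1..N}" for as a
    using that
  proof (induction as)
    case Nil
    then show ?case by (auto simp: M S_def P)
  next
    case (Cons a' as)
    then show ?case using SP[of as] by (auto simp: M intro!: Smult Sneg S\<zeta>)
  qed
  have "\<Gamma> L \<in> S" unfolding \<Gamma>_def using setL by (intro Ssum Smult S\<theta> SM) auto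
  moreover have "\<forall>B. unit_form B \<in> P" by (auto simp: unit_form_def P)
  ultimately have "G \<in> P" unfolding S_def G_def by blast
  with 1 2 show ?thesis unfolding Zt_def by blast
qed

section \<open>Gaudin systems over Laurent series\<close>

definition sc :: "'r :: comm_ring_1 \<Rightarrow> ('i, 'r) addop" where
  "sc c = Addop (\<lambda>x \<beta>. c * x \<beta>)"

text \<open>
  The operator with kernel \<open>M\<close>; the map \<open>h\<close> into the ring of entries is the identity for vectors and
  \<open>fls_const\<close> for Laurent expansions at a point.
\<close>

definition mk :: "(complex \<Rightarrow> 'r :: comm_ring_1) \<Rightarrow> 'i set \<Rightarrow> ('i \<Rightarrow> 'i \<Rightarrow> complex) \<Rightarrow> ('i, 'r) addop" where
  "mk h I M = Addop (\<lambda>x \<beta>. \<Sum>\<gamma>\<in>I. h (M \<beta> \<gamma>) * x \<gamma>)"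

definition dd :: "('i, complex fls) addop" where
  "dd = Addop (\<lambda>x \<beta>. fls_deriv (x \<beta>))"

lemma app_sc: "app (sc c) x = (\<lambda>\<beta>. c * x \<beta>)"
  unfolding sc_def by (subst app_Addop) (auto simp: fun_eq_iff algebra_simps)

lemma app_mk: "app (mk h I M) x = (\<lambda>\<beta>. \<Sum>\<gamma>\<in>I. h (M \<beta> \<gamma>) * x \<gamma>)"
  unfolding mk_def by (subst app_Addop) (auto simp: fun_eq_iff algebra_simps sum.distrib)

lemma app_dd: "app dd x = (\<lambda>\<beta>. fls_deriv (x \<beta>))"
  unfolding dd_def by (subst app_Addop) (auto simp: fun_eq_iff)

lemma sc_simps: "sc (c + c') = sc c + sc c'" "sc (c - c') = sc c - sc c'" "sc (- c) = - sc c"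
  "sc (c * c') = sc c * sc c'" "sc 0 = 0" "sc 1 = 1"
  by (rule addop_eqI; auto simp: app_sc fun_eq_iff algebra_simps)+

lemma sc_mk: "sc c * mk h I M = mk h I M * sc c"
  by (rule addop_eqI) (auto simp: app_sc app_mk fun_eq_iff sum_distrib_left mult.left_commute)

lemma sc_commute: "sc c * sc c' = sc c' * sc c"
  by (rule addop_eqI) (auto simp: app_sc fun_eq_iff mult.left_commute)

lemma dd_sc: "dd * sc c = sc c * dd + sc (fls_deriv c)"
  by (rule addop_eqI) (auto simp: app_sc app_dd fun_eq_iff algebra_simps)

lemma fls_deriv_sum: "fls_deriv (sum f A) = (\<Sum>i\<in>A. fls_deriv (f i))"
  by (induction A rule: infinite_finite_induct) simp_all

lemma dd_mk: "dd * mk fls_const I M = mk fls_const I M * dd"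
  by (rule addop_eqI) (auto simp: app_mk app_dd fun_eq_iff fls_deriv_sum)

definition chom :: "(complex \<Rightarrow> 'r :: comm_ring_1) \<Rightarrow> bool" where
  "chom h \<longleftrightarrow> h 0 = 0 \<and> h 1 = 1 \<and> (\<forall>x y. h (x + y) = h x + h y) \<and> (\<forall>x y. h (x * y) = h x * h y)"

lemma chom_fls_const [simp]: "chom fls_const" and chom_id [simp]: "chom (\<lambda>x. x)"
  by (auto simp: chom_def fls_plus_const)

lemma chomD: assumes "chom h"
  shows "h 0 = 0" "h 1 = 1" "h (x + y) = h x + h y" "h (x * y) = h x * h y" "h (- x) = - h x" "h (x - y) = h x - h y"
    "h (sum f A) = (\<Sum>i\<in>A. h (f i))"
proof -
  show 1: "h 0 = 0" "h 1 = 1" "h (x + y) = h x + h y" "h (x * y) = h x * h y" for x y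
    using assms by (auto simp: chom_def)
  show neg: "h (- x) = - h x" for x
    using 1(3)[of x "- x"] 1(1) by (simp add: eq_neg_iff_add_eq_0 add.commute)
  show "h (x - y) = h x - h y" using 1(3)[of x "- y"] neg[of y] by simp
  show "h (sum f A) = (\<Sum>i\<in>A. h (f i))"
    by (induction A rule: infinite_finite_induct) (simp_all add: 1)
qed

lemma mk_mult:
  assumes "chom h" "\<And>\<beta> \<delta>. \<delta> \<in> J \<Longrightarrow> (\<Sum>\<gamma>\<in>I. M \<beta> \<gamma> * M' \<gamma> \<delta>) = R \<beta> \<delta>"
  shows "mk h I M * mk h J M' = mk h J R"
proof (rule addop_eqI, rule ext)
  fix x \<beta>
  have "app (mk h I M * mk h J M') x \<beta> = (\<Sum>\<gamma>\<in>I. \<Sum>\<delta>\<in>J. h (M \<beta> \<gamma> * M' \<gamma> \<delta>) * x \<delta>)"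
    by (simp add: app_mk sum_distrib_left chomD[OF assms(1)] mult.assoc)
  also have "\<dots> = (\<Sum>\<delta>\<in>J. h (\<Sum>\<gamma>\<in>I. M \<beta> \<gamma> * M' \<gamma> \<delta>) * x \<delta>)"
    by (subst sum.swap) (simp add: chomD[OF assms(1)] sum_distrib_right)
  also have "\<dots> = app (mk h J R) x \<beta>" by (simp add: app_mk assms(2))
  finally show "app (mk h I M * mk h J M') x \<beta> = app (mk h J R) x \<beta>" .
qed

lemma mk_cong:
  assumes "\<And>\<beta> \<gamma>. \<gamma> \<in> I \<Longrightarrow> M \<beta> \<gamma> = M' \<beta> \<gamma>"
  shows "mk h I M = mk h I M'"
  by (rule addop_eqI) (auto simp: app_mk fun_eq_iff assms)

lemma mk_add: "chom h \<Longrightarrow> mk h I M + mk h I M' = mk h I (\<lambda>\<beta> \<gamma>. M \<beta> \<gamma> + M' \<beta> \<gamma>)"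
  by (rule addop_eqI) (auto simp: app_mk fun_eq_iff chomD algebra_simps sum.distrib)

lemma mk_zero: "chom h \<Longrightarrow> mk h I (\<lambda>\<beta> \<gamma>. 0) = 0"
  by (rule addop_eqI) (auto simp: app_mk fun_eq_iff chomD)

lemma mk_sum: "chom h \<Longrightarrow> (\<Sum>s\<in>T. mk h I (M s)) = mk h I (\<lambda>\<beta> \<gamma>. \<Sum>s\<in>T. M s \<beta> \<gamma>)"
  by (induction T rule: infinite_finite_induct) (simp_all add: mk_zero mk_add)

text \<open>The expansion of 1/(u - z s) in the local variable u - z0. Inversion in the field of
  Laurent series treats sites at \<open>z0\<close> and away from it alike.\<close>

definition pole :: "('s \<Rightarrow> complex) \<Rightarrow> complex \<Rightarrow> 's \<Rightarrow> complex fls" where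
  "pole z z0 s = inverse (fls_X + fls_const (z0 - z s))"

lemma pole_self: "z s = z0 \<Longrightarrow> pole z z0 s = fls_X_inv"
  by (simp add: pole_def fls_inverse_X)

lemma fls_deriv_pole: "fls_deriv (pole z z0 s) = - (pole z z0 s * pole z z0 s)"
  by (simp add: pole_def fls_inverse_deriv power2_eq_square)

section \<open>Orders and coefficients of vectors of Laurent series\<close>

definition ordge :: "int \<Rightarrow> ('i \<Rightarrow> complex fls) \<Rightarrow> bool" where
  "ordge j x \<longleftrightarrow> (\<forall>\<beta>. \<forall>n<j. fls_nth (x \<beta>) n = 0)"

definition cf :: "int \<Rightarrow> ('i \<Rightarrow> complex fls) \<Rightarrow> 'i \<Rightarrow> complex" where
  "cf n x = (\<lambda>\<beta>. fls_nth (x \<beta>) n)"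

lemma cf_simps: "cf n (x + y) = cf n x + cf n y" "cf n (x - y) = cf n x - cf n y" "cf n (- x) = - cf n x" "cf n 0 = 0"
  by (auto simp: cf_def fun_eq_iff)

lemma cf_sum: "cf n (\<Sum>i\<in>A. x i) = (\<Sum>i\<in>A. cf n (x i))"
  by (induction A rule: infinite_finite_induct) (simp_all only: cf_simps sum.infinite sum.empty sum.insert not_False_eq_True)

lemma ordge_cf: "ordge j x \<longleftrightarrow> (\<forall>n<j. cf n x = 0)"
  by (auto simp: ordge_def cf_def fun_eq_iff)

lemma ordge_simps: "ordge j 0" "ordge j x \<Longrightarrow> ordge j y \<Longrightarrow> ordge j (x + y)" "ordge j x \<Longrightarrow> ordge j y \<Longrightarrow> ordge j (x - y)"
  "ordge j x \<Longrightarrow> ordge j (- x)" "ordge j x \<Longrightarrow> j' \<le> j \<Longrightarrow> ordge j' x"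
  by (auto simp: ordge_def)

lemma ordge_sum: "(\<And>i. i \<in> A \<Longrightarrow> ordge j (x i)) \<Longrightarrow> ordge j (\<Sum>i\<in>A. x i)"
  by (simp add: ordge_cf cf_sum)

lemma fls_below_iff: "(\<forall>n<j. fls_nth f n = 0) \<longleftrightarrow> f = 0 \<or> j \<le> fls_subdegree f"
  using fls_subdegree_geI[of f j] by (auto intro: fls_eq0_below_subdegree)

lemma fls_mult_below:
  fixes f g :: "complex fls"
  assumes "\<forall>n<i. fls_nth f n = 0" "\<forall>n<j. fls_nth g n = 0"
  shows "\<forall>n<i+j. fls_nth (f * g) n = 0"
  using assms unfolding fls_below_iff by (cases "f = 0"; cases "g = 0") auto

lemma pole_regular:
  assumes "z s \<noteq> z0" shows "\<forall>n<0. fls_nth (pole z z0 s) n = 0"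
proof -
  have "fls_nth (fls_X + fls_const (z0 - z s)) 0 \<noteq> 0" using assms by simp
  then have "fls_subdegree (fls_X + fls_const (z0 - z s)) = 0"
    by (intro fls_subdegree_eqI) auto
  then have "fls_subdegree (pole z z0 s) = 0" unfolding pole_def by (subst fls_inverse_subdegree) auto
  then show ?thesis by (auto intro: fls_eq0_below_subdegree)
qed

lemma ordge_mk: "ordge j x \<Longrightarrow> ordge j (app (mk fls_const I M) x)"
  by (auto simp: ordge_def app_mk fls_nth_sum)

lemma cf_mk: "cf n (app (mk fls_const I M) x) = app (mk (\<lambda>c. c) I M) (cf n x)"
  by (auto simp: cf_def app_mk fls_nth_sum fun_eq_iff)

lemma ordge_sc: "\<forall>n<0. fls_nth \<phi> n = 0 \<Longrightarrow> ordge j x \<Longrightarrow> ordge j (app (sc \<phi>) x)"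
  unfolding ordge_def app_sc using fls_mult_below[of 0 \<phi> j] by simp

lemma cf_sc_const: "cf n (app (sc (fls_const c)) x) = app (sc c) (cf n x)"
  by (auto simp: cf_def app_sc fun_eq_iff)

lemma cf_sc_X_inv: "cf n (app (sc fls_X_inv) x) = cf (n + 1) x"
  by (auto simp: cf_def app_sc fun_eq_iff fls_X_inv_times_conv_shift)

lemma cf_dd: "cf n (app dd x) = app (sc (of_int (n + 1))) (cf (n + 1) x)"
  by (auto simp: cf_def app_dd app_sc fun_eq_iff)

lemma ordge_sc_X_inv: "ordge j x \<Longrightarrow> ordge (j - 1) (app (sc fls_X_inv) x)"
  by (auto simp: ordge_cf cf_sc_X_inv)

lemma ordge_dd: "ordge j x \<Longrightarrow> ordge (j - 1) (app dd x)"
  by (auto simp: ordge_cf cf_dd)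

text \<open>In general differentiation lowers the order by one, but the derivative of the constant
  term is zero, so regularity is kept.\<close>

lemma ordge_dd0: "ordge 0 x \<Longrightarrow> ordge 0 (app dd x)"
  unfolding ordge_cf
proof (intro allI impI)
  fix n :: int assume x: "\<forall>n<0. cf n x = 0" and "n < 0"
  then consider "n + 1 < 0" | "n = -1" by linarith
  then show "cf n (app dd x) = 0"
  proof cases
    case 1
    then have "cf (n + 1) x = 0" using x by blast
    then show ?thesis by (simp only: cf_dd app_0)
  next
    case 2
    then show ?thesis by (simp add: cf_dd app_sc fun_eq_iff)
  qed
qed

lemma fls_addop_torsion_free:
  fixes T :: "('i, complex fls) addop" assumes "T + T = 0" shows "T = 0"
proof (rule addop_torsion_free[OF _ assms])
  fix x :: "complex fls" assume "x + x = 0"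
  then have "fls_nth x n + fls_nth x n = 0" for n by (metis fls_plus_nth fls_zero_nth)
  then show "x = 0" by (intro fls_eqI) (simp add: mult_2[symmetric])
qed

text \<open>The monomial with coefficient \<open>v\<close> and exponent \<open>l\<close> in the
  local variable; \<open>fls_shift\<close> lowers exponents, hence the sign.\<close>

definition fmono :: "int \<Rightarrow> ('i \<Rightarrow> complex) \<Rightarrow> 'i \<Rightarrow> complex fls" where
  "fmono l v = (\<lambda>\<beta>. fls_shift (- l) (fls_const (v \<beta>)))"

lemma cf_fmono: "cf n (fmono l v) = (if n = l then v else 0)"
  by (auto simp: cf_def fmono_def fun_eq_iff)

lemma ordge_fmono: "ordge l (fmono l v)"
  by (auto simp: ordge_cf cf_fmono)

lemma app_mk_fmono: "app (mk fls_const I M) (fmono l v) = fmono l (app (mk (\<lambda>c. c) I M) v)"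
proof (rule ext, rule fls_eqI)
  fix \<beta> n
  have "cf n (app (mk fls_const I M) (fmono l v)) \<beta> = cf n (fmono l (app (mk (\<lambda>c. c) I M) v)) \<beta>"
    unfolding cf_mk cf_fmono by simp
  then show "fls_nth (app (mk fls_const I M) (fmono l v) \<beta>) n = fls_nth (fmono l (app (mk (\<lambda>c. c) I M) v) \<beta>) n"
    by (simp add: cf_def)
qed

text \<open>
  Several commuting actions of \<open>gl\<^sub>N\<close>, one for each site in \<open>S\<close>, on the functions supported on \<open>I\<close>.
\<close>

locale gaudin =
  fixes N :: nat and I :: "'i set" and S :: "'s set" and e :: "'s \<Rightarrow> nat \<Rightarrow> nat \<Rightarrow> 'i \<Rightarrow> 'i \<Rightarrow> complex"
  assumes finI: "finite I" and finS: "finite S"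
    and supp: "\<And>s a b \<beta> \<gamma>. s \<in> S \<Longrightarrow> a \<in> {1..N} \<Longrightarrow> b \<in> {1..N} \<Longrightarrow> \<beta> \<notin> I \<Longrightarrow> e s a b \<beta> \<gamma> = 0"
    and rel: "\<And>s a b c d \<beta> \<gamma>. s \<in> S \<Longrightarrow> a \<in> {1..N} \<Longrightarrow> b \<in> {1..N} \<Longrightarrow> c \<in> {1..N} \<Longrightarrow> d \<in> {1..N} \<Longrightarrow> \<gamma> \<in> I \<Longrightarrow>
      (\<Sum>\<delta>\<in>I. e s a b \<beta> \<delta> * e s c d \<delta> \<gamma>) + (if a = d then e s c b \<beta> \<gamma> else 0)
      = (\<Sum>\<delta>\<in>I. e s c d \<beta> \<delta> * e s a b \<delta> \<gamma>) + (if b = c then e s a d \<beta> \<gamma> else 0)"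
    and comm: "\<And>s s' a b c d \<beta> \<gamma>. s \<in> S \<Longrightarrow> s' \<in> S \<Longrightarrow> s \<noteq> s' \<Longrightarrow> a \<in> {1..N} \<Longrightarrow> b \<in> {1..N} \<Longrightarrow> c \<in> {1..N} \<Longrightarrow> d \<in> {1..N} \<Longrightarrow> \<gamma> \<in> I \<Longrightarrow>
      (\<Sum>\<delta>\<in>I. e s a b \<beta> \<delta> * e s' c d \<delta> \<gamma>) = (\<Sum>\<delta>\<in>I. e s' c d \<beta> \<delta> * e s a b \<delta> \<gamma>)"
begin

definition ef :: "(complex \<Rightarrow> 'r :: comm_ring_1) \<Rightarrow> 's \<Rightarrow> nat \<Rightarrow> nat \<Rightarrow> ('i, 'r) addop" where
  "ef h s a b = mk h I (e s a b)"

lemma ef_rel: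
  assumes h: "chom h" and s: "s \<in> S" "a \<in> {1..N}" "b \<in> {1..N}" "c \<in> {1..N}" "d \<in> {1..N}"
  shows "ef h s a b * ef h s c d - ef h s c d * ef h s a b
    = (if b = c then ef h s a d else 0) - (if a = d then ef h s c b else 0)"
proof -
  have m: "mk h I M * mk h I M' = mk h I (\<lambda>\<beta> \<gamma>. \<Sum>\<delta>\<in>I. M \<beta> \<delta> * M' \<delta> \<gamma>)" for M M'
    by (rule mk_mult[OF h refl])
  have "ef h s a b * ef h s c d + (if a = d then ef h s c b else 0)
      = mk h I (\<lambda>\<beta> \<gamma>. (\<Sum>\<delta>\<in>I. e s a b \<beta> \<delta> * e s c d \<delta> \<gamma>) + (if a = d then e s c b \<beta> \<gamma> else 0))"
    by (simp add: ef_def mk_add[OF h] m)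
  also have "\<dots> = mk h I (\<lambda>\<beta> \<gamma>. (\<Sum>\<delta>\<in>I. e s c d \<beta> \<delta> * e s a b \<delta> \<gamma>) + (if b = c then e s a d \<beta> \<gamma> else 0))"
    by (rule mk_cong) (rule rel[OF s])
  also have "\<dots> = ef h s c d * ef h s a b + (if b = c then ef h s a d else 0)"
    by (simp add: ef_def mk_add[OF h] m)
  finally show ?thesis by (simp add: algebra_simps)
qed

lemma ef_comm:
  assumes h: "chom h" and s: "s \<in> S" "s' \<in> S" "s \<noteq> s'" "a \<in> {1..N}" "b \<in> {1..N}" "c \<in> {1..N}" "d \<in> {1..N}"
  shows "ef h s a b * ef h s' c d = ef h s' c d * ef h s a b"
proof -
  have "ef h s a b * ef h s' c d = mk h I (\<lambda>\<beta> \<gamma>. \<Sum>\<delta>\<in>I. e s a b \<beta> \<delta> * e s' c d \<delta> \<gamma>)"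
    unfolding ef_def by (rule mk_mult[OF h refl])
  also have "\<dots> = mk h I (\<lambda>\<beta> \<gamma>. \<Sum>\<delta>\<in>I. e s' c d \<beta> \<delta> * e s a b \<delta> \<gamma>)"
    by (rule mk_cong) (rule comm[OF s])
  also have "\<dots> = ef h s' c d * ef h s a b"
    unfolding ef_def by (rule mk_mult[OF h refl, symmetric])
  finally show ?thesis .
qed

abbreviation "efl \<equiv> ef fls_const"

text \<open>The matrix \<open>X\<close> expanded at \<open>z0\<close>, with the poles at the sites in \<open>T\<close> only.\<close>

definition XX :: "(nat \<Rightarrow> complex) \<Rightarrow> 's set \<Rightarrow> ('s \<Rightarrow> complex) \<Rightarrow> complex \<Rightarrow> nat \<Rightarrow> nat \<Rightarrow> ('i, complex fls) addop" where
  "XX K T z z0 a b = (if a = b then dd - sc (fls_const (K a)) else 0) - (\<Sum>s\<in>T. sc (pole z z0 s) * efl s b a)"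

lemma sc_ef: "sc c * ef h s a b = ef h s a b * sc c"
  unfolding ef_def by (rule sc_mk)

lemma dd_ef: "dd * efl s a b = efl s a b * dd"
  unfolding ef_def by (rule dd_mk)

text \<open>Different sites commute, so only the summand at \<open>s\<close> contributes; \<phi>
  will be the poles, or constantly 1.\<close>

lemma sum_ef_rel:
  assumes h: "chom h" and T: "T \<subseteq> S" "s \<in> T" "a \<in> {1..N}" "b \<in> {1..N}" "c \<in> {1..N}" "d \<in> {1..N}"
  shows "(\<Sum>s'\<in>T. ef h s a b * (sc (\<phi> s') * ef h s' c d) - sc (\<phi> s') * ef h s' c d * ef h s a b)
    = sc (\<phi> s) * ((if b = c then ef h s a d else 0) - (if a = d then ef h s c b else 0))"
proof -
  have fin: "finite T" using T finS finite_subset by blast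
  have "(\<Sum>s'\<in>T. ef h s a b * (sc (\<phi> s') * ef h s' c d) - sc (\<phi> s') * ef h s' c d * ef h s a b)
    = (\<Sum>s'\<in>T. sc (\<phi> s') * (ef h s a b * ef h s' c d - ef h s' c d * ef h s a b))"
  proof (intro sum.cong refl)
    fix s'
    have "ef h s a b * (sc (\<phi> s') * ef h s' c d) = sc (\<phi> s') * (ef h s a b * ef h s' c d)"
      by (simp only: mult.assoc[symmetric] sc_ef[symmetric])
    then show "ef h s a b * (sc (\<phi> s') * ef h s' c d) - sc (\<phi> s') * ef h s' c d * ef h s a b
      = sc (\<phi> s') * (ef h s a b * ef h s' c d - ef h s' c d * ef h s a b)"
      by (simp add: right_diff_distrib mult.assoc)
  qed
  also have "\<dots> = (\<Sum>s'\<in>T. if s' = s then sc (\<phi> s) * (ef h s a b * ef h s c d - ef h s c d * ef h s a b) else 0)"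
  proof (intro sum.cong refl)
    fix s' assume "s' \<in> T"
    then show "sc (\<phi> s') * (ef h s a b * ef h s' c d - ef h s' c d * ef h s a b)
      = (if s' = s then sc (\<phi> s) * (ef h s a b * ef h s c d - ef h s c d * ef h s a b) else 0)"
      using ef_comm[OF h, of s s' a b c d] T subsetD[OF T(1), of s] subsetD[OF T(1), of s'] by auto
  qed
  also have "\<dots> = sc (\<phi> s) * (ef h s a b * ef h s c d - ef h s c d * ef h s a b)"
    using fin T by simp
  finally show ?thesis using T by (subst (asm) ef_rel[OF h]) auto
qed

text \<open>Cross terms between different sites vanish, and differentiating a pole gives minus its
  square, which is also what the product of two poles at one site gives. So everything is a sum over
  single sites with squared poles.\<close>

lemma XX_comm:
  assumes T: "T \<subseteq> S" and i: "a \<in> {1..N}" "b \<in> {1..N}" "c \<in> {1..N}" "d \<in> {1..N}"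
  shows "XX K T z z0 a b * XX K T z z0 c d - XX K T z z0 c d * XX K T z z0 a b
    = (\<Sum>s\<in>T. sc (pole z z0 s * pole z z0 s) *
        ((if a = b then efl s d c else 0) - (if c = d then efl s b a else 0)
          + ((if a = d then efl s b c else 0) - (if b = c then efl s d a else 0))))"
proof -
  define \<phi> where "\<phi> = pole z z0"
  define A where "A = (\<lambda>a b. \<Sum>s\<in>T. sc (\<phi> s) * efl s b a)"
  define B where "B = (\<lambda>a b. if a = b then dd - sc (fls_const (K a)) else 0 :: ('i, complex fls) addop)"
  have XX: "XX K T z z0 a b = B a b - A a b" for a b
    by (simp add: XX_def A_def B_def \<phi>_def)
  have "dd * sc (fls_const k) = sc (fls_const k) * (dd :: ('i, complex fls) addop)" for k
    by (simp add: dd_sc sc_simps)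
  then have BB: "B a b * B c d = B c d * B a b"
    by (simp add: B_def left_diff_distrib right_diff_distrib) (simp add: sc_commute)
  have BA: "B a b * A c d - A c d * B a b = (\<Sum>s\<in>T. - (sc (\<phi> s * \<phi> s) * (if a = b then efl s d c else 0)))" for a b c d
  proof -
    have "(dd - sc (fls_const k)) * (sc (\<phi> s) * efl s d c) - (sc (\<phi> s) * efl s d c) * (dd - sc (fls_const k))
        = - (sc (\<phi> s * \<phi> s) * efl s d c)" for s k
    proof -
      have 1: "dd * (sc (\<phi> s) * efl s d c) = sc (\<phi> s) * (efl s d c * dd) - sc (\<phi> s * \<phi> s) * efl s d c"
      proof -
        have "dd * (sc (\<phi> s) * efl s d c) = (sc (\<phi> s) * dd + sc (fls_deriv (\<phi> s))) * efl s d c"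
          by (simp only: mult.assoc[symmetric] dd_sc)
        also have "\<dots> = sc (\<phi> s) * (efl s d c * dd) - sc (\<phi> s * \<phi> s) * efl s d c"
          unfolding \<phi>_def fls_deriv_pole by (simp add: distrib_right left_diff_distrib mult.assoc dd_ef sc_simps(3))
        finally show ?thesis .
      qed
      have 2: "sc (fls_const k) * (sc (\<phi> s) * efl s d c) = sc (\<phi> s) * (efl s d c * sc (fls_const k))"
        by (simp only: sc_ef[symmetric] mult.assoc[symmetric]) (simp only: sc_commute[of "fls_const k"])
      show ?thesis unfolding left_diff_distrib right_diff_distrib 1 2 by (simp add: mult.assoc)
    qed
    then show ?thesis
      by (cases "a = b") (simp_all add: B_def A_def sum_distrib_left sum_distrib_right flip: sum_subtractf)
  qed
  have AA: "A a b * A c d - A c d * A a b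
      = (\<Sum>s\<in>T. sc (\<phi> s * \<phi> s) * ((if a = d then efl s b c else 0) - (if b = c then efl s d a else 0)))"
  proof -
    have "A a b * A c d - A c d * A a b = (\<Sum>s\<in>T. sc (\<phi> s) *
        (\<Sum>s'\<in>T. efl s b a * (sc (\<phi> s') * efl s' d c) - sc (\<phi> s') * efl s' d c * efl s b a))"
    proof -
      have "A c d * A a b = (\<Sum>s\<in>T. \<Sum>s'\<in>T. sc (\<phi> s) * (sc (\<phi> s') * efl s' d c * efl s b a))"
        unfolding A_def sum_product
      proof (subst sum.swap, intro sum.cong refl)
        fix s s'
        have "sc (\<phi> s') * efl s' d c * (sc (\<phi> s) * efl s b a) = sc (\<phi> s') * (efl s' d c * sc (\<phi> s)) * efl s b a"
          by (simp only: mult.assoc)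
        also have "\<dots> = sc (\<phi> s') * sc (\<phi> s) * efl s' d c * efl s b a"
          by (simp only: sc_ef[symmetric] mult.assoc)
        also have "sc (\<phi> s') * sc (\<phi> s) = (sc (\<phi> s) * sc (\<phi> s') :: ('i, complex fls) addop)"
          by (rule sc_commute)
        finally show "sc (\<phi> s') * efl s' d c * (sc (\<phi> s) * efl s b a) = sc (\<phi> s) * (sc (\<phi> s') * efl s' d c * efl s b a)"
          by (simp only: mult.assoc)
      qed
      moreover have "A a b * A c d = (\<Sum>s\<in>T. \<Sum>s'\<in>T. sc (\<phi> s) * (efl s b a * (sc (\<phi> s') * efl s' d c)))"
        unfolding A_def sum_product by (simp only: mult.assoc)
      ultimately show ?thesis
        by (simp only: sum_subtractf right_diff_distrib sum_distrib_left)
    qed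
    also have "\<dots> = (\<Sum>s\<in>T. sc (\<phi> s) * (sc (\<phi> s) * ((if a = d then efl s b c else 0) - (if b = c then efl s d a else 0))))"
      by (intro sum.cong refl) (simp only: sum_ef_rel[OF chom_fls_const T _ i(2,1,4,3)])
    finally show ?thesis by (simp only: mult.assoc[symmetric] sc_simps(4))
  qed
  have "XX K T z z0 a b * XX K T z z0 c d - XX K T z z0 c d * XX K T z z0 a b
    = (B c d * A a b - A a b * B c d) - (B a b * A c d - A c d * B a b) + (A a b * A c d - A c d * A a b)"
    unfolding XX using BB by (simp add: algebra_simps)
  also have "\<dots> = (\<Sum>s\<in>T. sc (\<phi> s * \<phi> s) *
        ((if a = b then efl s d c else 0) - (if c = d then efl s b a else 0)
          + ((if a = d then efl s b c else 0) - (if b = c then efl s d a else 0))))"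
    unfolding BA AA sum_subtractf[symmetric] sum.distrib[symmetric]
    by (intro sum.cong refl) (simp add: algebra_simps)
  finally show ?thesis unfolding \<phi>_def .
qed

text \<open>The right-hand side of \<open>XX_comm\<close> does not change when b and d are
  exchanged.\<close>

lemma XX_manin:
  assumes T: "T \<subseteq> S" and i: "a \<in> {1..N}" "b \<in> {1..N}" "c \<in> {1..N}" "d \<in> {1..N}"
  shows "XX K T z z0 a b * XX K T z z0 c d - XX K T z z0 c d * XX K T z z0 a b
    = XX K T z z0 a d * XX K T z z0 c b - XX K T z z0 c b * XX K T z z0 a d"
  unfolding XX_comm[OF T i] XX_comm[OF T i(1,4,3,2)]
  by (intro sum.cong refl arg_cong2[of _ _ _ _ "(*)"]) (auto simp: algebra_simps)

lemma sum_ef_XX: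
  assumes T: "T \<subseteq> T'" "T' \<subseteq> S" and i: "a \<in> {1..N}" "b \<in> {1..N}" "c \<in> {1..N}" "d \<in> {1..N}"
  shows "(\<Sum>s\<in>T. efl s c d) * XX K T' z z0 a b - XX K T' z z0 a b * (\<Sum>s\<in>T. efl s c d)
    = - (\<Sum>s\<in>T. sc (pole z z0 s) * ((if d = b then efl s c a else 0) - (if c = a then efl s b d else 0)))"
proof -
  define \<phi> where "\<phi> = pole z z0"
  have "efl s c d * XX K T' z z0 a b - XX K T' z z0 a b * efl s c d
    = - (sc (\<phi> s) * ((if d = b then efl s c a else 0) - (if c = a then efl s b d else 0)))" if s: "s \<in> T" for s
  proof -
    have s': "s \<in> T'" using s T by blast
    define B where "B = (if a = b then dd - sc (fls_const (K a)) else 0 :: ('i, complex fls) addop)"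
    have XX: "XX K T' z z0 a b = B - (\<Sum>s'\<in>T'. sc (\<phi> s') * efl s' b a)"
      by (simp add: XX_def B_def \<phi>_def)
    have B: "efl s c d * B = B * efl s c d"
      by (simp add: B_def left_diff_distrib right_diff_distrib dd_ef sc_ef)
    have "efl s c d * XX K T' z z0 a b - XX K T' z z0 a b * efl s c d
      = - (\<Sum>s'\<in>T'. efl s c d * (sc (\<phi> s') * efl s' b a) - sc (\<phi> s') * efl s' b a * efl s c d)"
      unfolding XX right_diff_distrib left_diff_distrib B
      by (simp add: sum_distrib_left sum_distrib_right sum_subtractf)
    also have "\<dots> = - (sc (\<phi> s) * ((if d = b then efl s c a else 0) - (if c = a then efl s b d else 0)))"
      unfolding sum_ef_rel[OF chom_fls_const T(2) s' i(3,4,2,1)] ..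
    finally show ?thesis .
  qed
  then show ?thesis
    unfolding \<phi>_def[symmetric] sum_distrib_left sum_distrib_right sum_subtractf[symmetric] sum_negf[symmetric]
    by (intro sum.cong refl)
qed

text \<open>For K = 0 the matrix is covariant under the diagonal action of gl_N, as
  \<open>rdet_central\<close> requires. A diagonal K with different entries breaks this; what
  survives is the torus, treated in \<open>rdet_weight_commute\<close>.\<close>

lemma rdet_sum_ef_commute:
  assumes T: "T \<subseteq> S" and i: "c \<in> {1..N}" "d \<in> {1..N}"
  shows "(\<Sum>s\<in>T. efl s c d) * rdet N (XX (\<lambda>a. 0) T z z0) = rdet N (XX (\<lambda>a. 0) T z z0) * (\<Sum>s\<in>T. efl s c d)"
proof (rule rdet_central)
  show "x = 0" if "x + x = 0" for x :: "('i, complex fls) addop"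
    by (rule fls_addop_torsion_free[OF that])
  fix a b assume ab: "a \<in> {1..N}" "b \<in> {1..N}"
  have *: "XX (\<lambda>a. 0) T z z0 a b = (if a = b then dd else 0) - (\<Sum>s\<in>T. sc (pole z z0 s) * efl s b a)" for a b
    by (simp add: XX_def sc_simps)
  show "(\<Sum>s\<in>T. efl s c d) * XX (\<lambda>a. 0) T z z0 a b - XX (\<lambda>a. 0) T z z0 a b * (\<Sum>s\<in>T. efl s c d) =
    (if d = b then XX (\<lambda>a. 0) T z z0 a c else 0) - (if a = c then XX (\<lambda>a. 0) T z z0 d b else 0)"
    unfolding sum_ef_XX[OF subset_refl T ab i]
    by (auto simp: * sum_subtractf right_diff_distrib sum_negf)
qed (use XX_manin[OF T] i in auto)

text \<open>Each entry shifts the weight by the difference of its column and row weights, and these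
  shifts add up to zero along a permutation.\<close>

lemma rdet_weight_commute:
  assumes c: "c \<in> {1..N}"
  shows "(\<Sum>s\<in>S. efl s c c) * rdet N (XX K S z z0) = rdet N (XX K S z z0) * (\<Sum>s\<in>S. efl s c c)"
proof -
  define H where "H = (\<Sum>s\<in>S. efl s c c)"
  define X where "X = XX K S z z0"
  define w where "w = (\<lambda>a. if a = c then 1 else 0 :: int)"
  have X: "X a b = (if a = b then dd - sc (fls_const (K a)) else 0) - (\<Sum>s\<in>S. sc (pole z z0 s) * efl s b a)" for a b
    unfolding X_def XX_def ..
  have HX: "H * X a b = X a b * (H + of_int (w b - w a))" if "a \<in> {1..N}" "b \<in> {1..N}" for a b
  proof -
    have "H * X a b - X a b * H = X a b * of_int (w b - w a)"
      unfolding H_def X_def sum_ef_XX[OF subset_refl subset_refl that c c]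
      by (cases "a = c"; cases "b = c")
        (auto simp: w_def XX_def sum_negf)
    then show ?thesis by (simp add: algebra_simps)
  qed
  have of_int_comm: "of_int k * Y = Y * of_int k" for k and Y :: "('i, complex fls) addop"
    by (rule Ints_induct[of "of_int k"]) (auto simp: mult_of_int_commute)
  have list: "H * prod_list (map (\<lambda>a. X a (\<sigma> a)) as) = prod_list (map (\<lambda>a. X a (\<sigma> a)) as) * (H + of_int (\<Sum>a\<leftarrow>as. w (\<sigma> a) - w a))"
    if "\<sigma> permutes {1..N}" "set as \<subseteq> {1..N}" for \<sigma> as
    using that(2)
  proof (induction as)
    case (Cons a as)
    define Pr where "Pr = prod_list (map (\<lambda>a. X a (\<sigma> a)) as)"
    have "\<sigma> a \<in> {1..N}" using Cons.prems that(1) permutes_in_image by fastforce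
    then have "H * X a (\<sigma> a) = X a (\<sigma> a) * (H + of_int (w (\<sigma> a) - w a))"
      using HX Cons.prems by simp
    then have "H * (X a (\<sigma> a) * Pr) = X a (\<sigma> a) * (H + of_int (w (\<sigma> a) - w a)) * Pr"
      by (simp only: mult.assoc[symmetric])
    also have "\<dots> = X a (\<sigma> a) * (H * Pr + Pr * of_int (w (\<sigma> a) - w a))"
      by (simp only: mult.assoc distrib_right of_int_comm[of "w (\<sigma> a) - w a" Pr])
    also have "H * Pr = Pr * (H + of_int (\<Sum>a\<leftarrow>as. w (\<sigma> a) - w a))"
      unfolding Pr_def using Cons by simp
    finally show ?case unfolding Pr_def[symmetric] list.map prod_list.Cons
      by (simp only: mult.assoc distrib_left[symmetric] add.assoc) (simp add: add.commute add.left_commute mult.assoc)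
  qed simp
  show ?thesis
    unfolding H_def[symmetric] X_def[symmetric] rdet_def sum_distrib_left sum_distrib_right
  proof (intro sum.cong refl)
    fix \<sigma> assume "\<sigma> \<in> {\<sigma>. \<sigma> permutes {1..N}}"
    then have p: "\<sigma> permutes {1..N}" by simp
    have "(\<Sum>a\<leftarrow>[1..<N+1]. w (\<sigma> a) - w a) = (\<Sum>a\<in>{1..N}. w (\<sigma> a) - w a)"
      unfolding set_upt1[symmetric] by (subst sum_list_distinct_conv_sum_set) simp_all
    also have "\<dots> = (\<Sum>a\<in>{1..N}. w (\<sigma> a)) - (\<Sum>a\<in>{1..N}. w a)" by (rule sum_subtractf)
    also have "(\<Sum>a\<in>{1..N}. w (\<sigma> a)) = (\<Sum>a\<in>{1..N}. w a)"
      using sum.permute[OF p, of w] by (simp add: comp_def)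
    finally have z: "(\<Sum>a\<leftarrow>[1..<N+1]. w (\<sigma> a) - w a) = 0" by simp
    have "H * prod_list (map (\<lambda>a. X a (\<sigma> a)) [1..<N+1]) = prod_list (map (\<lambda>a. X a (\<sigma> a)) [1..<N+1]) * H"
      using list[OF p, of "[1..<N+1]"] unfolding z set_upt1 by simp
    then show "H * (of_int (sign \<sigma>) * prod_list (map (\<lambda>a. X a (\<sigma> a)) [1..<N+1])) =
      of_int (sign \<sigma>) * prod_list (map (\<lambda>a. X a (\<sigma> a)) [1..<N+1]) * H"
      by (simp only: mult.assoc[symmetric] of_int_comm[of _ H, symmetric]) (simp only: mult.assoc)
  qed
qed

end

section \<open>Leading coefficients\<close>

lemma sum_fun_apply: "(\<Sum>i\<in>A. f i) x = (\<Sum>i\<in>A. f i x)" for f :: "'a \<Rightarrow> 'b \<Rightarrow> 'c :: comm_monoid_add"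
  by (induction A rule: infinite_finite_induct) simp_all

lemma app_if0: "app T (if P then x else 0) = (if P then app T x else 0)"
  by (cases P) (simp_all only: if_True if_False app_0)

lemma app_eqD: "S * T = T' * S' \<Longrightarrow> app S (app T x) = app T' (app S' x)"
  unfolding app_ring_simps(6)[symmetric] by (rule arg_cong)

lemma ordge_if: "(P \<Longrightarrow> ordge j x) \<Longrightarrow> (\<not> P \<Longrightarrow> ordge j y) \<Longrightarrow> ordge j (if P then x else y)"
  by simp

lemma of_int_commute: "of_int k * y = y * of_int k" for y :: "'a :: ring_1"
  by (rule mult_of_int_commute)

lemma rdet_intertwine:
  fixes X X' :: "nat \<Rightarrow> nat \<Rightarrow> 'a :: ring_1"
  assumes "\<And>a b. a \<in> {1..N} \<Longrightarrow> b \<in> {1..N} \<Longrightarrow> y * X a b = X' a b * y"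
  shows "y * rdet N X = rdet N X' * y"
proof -
  have list: "y * prod_list (map (\<lambda>a. X a (\<sigma> a)) as) = prod_list (map (\<lambda>a. X' a (\<sigma> a)) as) * y"
    if "\<sigma> permutes {1..N}" "set as \<subseteq> {1..N}" for \<sigma> as
    using that(2)
  proof (induction as)
    case (Cons a as)
    have "\<sigma> a \<in> {1..N}" using Cons.prems that(1) permutes_in_image by fastforce
    then have "y * X a (\<sigma> a) = X' a (\<sigma> a) * y" using assms Cons.prems by simp
    then have "y * (X a (\<sigma> a) * r) = X' a (\<sigma> a) * (y * r)" for r
      by (simp only: mult.assoc[symmetric])
    then show ?case using Cons by (simp add: mult.assoc)
  qed simp
  show ?thesis
    unfolding rdet_def sum_distrib_left sum_distrib_right
  proof (intro sum.cong refl)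
    fix \<sigma> assume "\<sigma> \<in> {\<sigma>. \<sigma> permutes {1..N}}"
    then have *: "y * prod_list (map (\<lambda>a. X a (\<sigma> a)) [1..<N+1]) = prod_list (map (\<lambda>a. X' a (\<sigma> a)) [1..<N+1]) * y"
      by (intro list) (auto simp only: set_upt1)
    show "y * (of_int (sign \<sigma>) * prod_list (map (\<lambda>a. X a (\<sigma> a)) [1..<N+1]))
      = of_int (sign \<sigma>) * prod_list (map (\<lambda>a. X' a (\<sigma> a)) [1..<N+1]) * y"
      by (simp only: mult.assoc[symmetric] of_int_commute[of _ y, symmetric])
        (simp only: mult.assoc *)
  qed
qed

lemma rdet_invariant:
  fixes X :: "nat \<Rightarrow> nat \<Rightarrow> ('x, 'r :: ring_1) addop"
  assumes X: "\<And>a b x. a \<in> {1..N} \<Longrightarrow> b \<in> {1..N} \<Longrightarrow> Q x \<Longrightarrow> Q (app (X a b) x)"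
    and Q: "Q 0" "\<And>x y. Q x \<Longrightarrow> Q y \<Longrightarrow> Q (x + y)" "\<And>x. Q x \<Longrightarrow> Q (- x)"
    and "Q x"
  shows "Q (app (rdet N X) x)"
proof -
  have list: "Q (app (prod_list (map (\<lambda>a. X a (\<sigma> a)) as)) x)"
    if "\<sigma> permutes {1..N}" "set as \<subseteq> {1..N}" for \<sigma> as
    using that(2)
  proof (induction as)
    case (Cons a as)
    have "\<sigma> a \<in> {1..N}" using Cons.prems that(1) permutes_in_image by fastforce
    then show ?case using Cons X by simp
  qed (simp add: \<open>Q x\<close>)
  have Qsum: "Q (\<Sum>i\<in>A. f i)" if "\<And>i. i \<in> A \<Longrightarrow> Q (f i)" for A :: "(nat \<Rightarrow> nat) set" and f
    using that by (induction A rule: infinite_finite_induct)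
      (simp_all only: Q sum.infinite sum.empty sum.insert not_False_eq_True insert_iff simp_thms)
  show ?thesis
    unfolding rdet_def app_sum_left
  proof (intro Qsum)
    fix \<sigma> assume "\<sigma> \<in> {\<sigma>. \<sigma> permutes {1..N}}"
    then have "Q (app (prod_list (map (\<lambda>a. X a (\<sigma> a)) [1..<N+1])) x)"
      by (intro list) (auto simp only: set_upt1)
    moreover have "of_int (sign \<sigma>) = (1 :: ('x, 'r) addop) \<or> of_int (sign \<sigma>) = (- 1 :: ('x, 'r) addop)"
      by (auto simp: sign_def)
    ultimately show "Q (app (of_int (sign \<sigma>) * prod_list (map (\<lambda>a. X a (\<sigma> a)) [1..<N+1])) x)"
      using Q(3) by (elim disjE) (simp_all only: app_ring_simps)
  qed
qed

lemma of_int_eq_sc: "(of_int k :: ('i, complex) addop) = sc (of_int k)"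
  by (rule addop_eqI) (simp add: app_of_int app_sc)

lemma cf_of_int: "cf n (app (of_int k) x) = app (of_int k) (cf n x)"
  by (simp add: app_of_int cf_def flip: fls_of_int)

context gaudin
begin

abbreviation "efc \<equiv> ef (\<lambda>c. c)"

text \<open>
  The indicial polynomial at a point occupied by the sites \<open>T\<close>: the shift of \<open>r\<close> in row \<open>a\<close> accounts for
  the \<open>N - a\<close> factors that have lowered the exponent before.
\<close>

definition X0 :: "'s set \<Rightarrow> complex \<Rightarrow> nat \<Rightarrow> nat \<Rightarrow> ('i, complex) addop" where
  "X0 T r a b = (if a = b then sc r else 0) - (\<Sum>s\<in>T. efc s b a)"

definition P0 :: "'s set \<Rightarrow> complex \<Rightarrow> ('i, complex) addop" where
  "P0 T r = (\<Sum>\<sigma> | \<sigma> permutes {1..N}. of_int (sign \<sigma>) *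
     prod_list (map (\<lambda>a. X0 T (r - (of_nat N - of_nat a)) a (\<sigma> a)) [1..<N+1]))"

lemma cf_ef: "cf n (app (efl s a b) x) = app (efc s a b) (cf n x)"
  unfolding ef_def by (rule cf_mk)

lemma ordge_ef: "ordge j x \<Longrightarrow> ordge j (app (efl s a b) x)"
  unfolding ef_def by (rule ordge_mk)

lemma fls_const_regular: "\<forall>n<0. fls_nth (fls_const c) n = 0"
  by simp

text \<open>The derivative and the poles at \<open>z0\<close> lower the order by one; K and the
  other poles do not lower it and so are invisible in the leading coefficient.\<close>

lemma XX_lead:
  assumes T: "T \<subseteq> S" and x: "ordge l x"
  shows "ordge (l - 1) (app (XX K T z z0 a b) x)"
    and "cf (l - 1) (app (XX K T z z0 a b) x) = app (X0 {s \<in> T. z s = z0} (of_int l) a b) (cf l x)"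
proof -
  have fin: "finite T" using T finS finite_subset by blast
  have 1: "ordge (l - 1) (app (if a = b then dd - sc (fls_const (K a)) else 0) x)"
  proof -
    have "ordge (l - 1) (app dd x)" using x by (rule ordge_dd)
    moreover have "ordge (l - 1) (app (sc (fls_const (K a))) x)"
      by (rule ordge_simps(5)[OF ordge_sc[OF fls_const_regular x]]) simp
    ultimately have "ordge (l - 1) (app dd x - app (sc (fls_const (K a))) x)" by (rule ordge_simps(3))
    then show ?thesis by (cases "a = b") (simp_all only: refl if_True if_False app_ring_simps ordge_simps(1))
  qed
  have 2: "cf (l - 1) (app (if a = b then dd - sc (fls_const (K a)) else 0) x) = app (if a = b then sc (of_int l) else 0) (cf l x)"
    using x by (auto simp: cf_simps cf_dd cf_sc_const ordge_cf)
  have 3: "ordge (l - 1) (app (sc (pole z z0 s) * efl s b a) x)" for s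
  proof (cases "z s = z0")
    case True
    then show ?thesis using ordge_sc_X_inv[OF ordge_ef[OF x]] by (simp add: pole_self)
  next
    case False
    have "ordge l (app (sc (pole z z0 s)) (app (efl s b a) x))"
      by (rule ordge_sc[OF pole_regular]) (use False x ordge_ef in auto)
    from ordge_simps(5)[OF this, of "l - 1"] show ?thesis by simp
  qed
  have 4: "cf (l - 1) (app (sc (pole z z0 s) * efl s b a) x) = (if z s = z0 then app (efc s b a) (cf l x) else 0)" for s
  proof (cases "z s = z0")
    case True
    then show ?thesis by (simp add: pole_self cf_sc_X_inv cf_ef)
  next
    case False
    have "ordge l (app (sc (pole z z0 s)) (app (efl s b a) x))"
      by (rule ordge_sc[OF pole_regular]) (use False x ordge_ef in auto)
    then show ?thesis using False by (simp add: ordge_cf)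
  qed
  show "ordge (l - 1) (app (XX K T z z0 a b) x)"
    unfolding XX_def app_ring_simps(4) app_sum_left
    by (intro ordge_simps(3) ordge_sum 1 3)
  have "cf (l - 1) (app (XX K T z z0 a b) x) = app (if a = b then sc (of_int l) else 0) (cf l x)
      - (\<Sum>s\<in>T. if z s = z0 then app (efc s b a) (cf l x) else 0)"
    unfolding XX_def app_ring_simps(4) app_sum_left cf_simps cf_sum 2 4 ..
  also have "(\<Sum>s\<in>T. if z s = z0 then app (efc s b a) (cf l x) else 0) = (\<Sum>s\<in>{s \<in> T. z s = z0}. app (efc s b a) (cf l x))"
    using fin by (simp only: sum.inter_filter)
  finally show "cf (l - 1) (app (XX K T z z0 a b) x) = app (X0 {s \<in> T. z s = z0} (of_int l) a b) (cf l x)"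
    by (simp only: X0_def app_ring_simps(4) app_sum_left)
qed

lemma rdet_lead:
  assumes T: "T \<subseteq> S" and x: "ordge l x"
  shows "ordge (l - int N) (app (rdet N (XX K T z z0)) x)"
    and "cf (l - int N) (app (rdet N (XX K T z z0)) x) = app (P0 {s \<in> T. z s = z0} (of_int l)) (cf l x)"
proof -
  define X where "X = XX K T z z0"
  define T0 where "T0 = {s \<in> T. z s = z0}"
  \<comment> \<open>The rightmost factor acts first, so the induction runs down from N + 1; after
    the rows k, ..., N the order has dropped by N + 1 - k.\<close>
  have list: "ordge (l - (int N + 1 - int k)) (app (prod_list (map (\<lambda>a. X a (\<sigma> a)) [k..<N+1])) x) \<and>
     cf (l - (int N + 1 - int k)) (app (prod_list (map (\<lambda>a. X a (\<sigma> a)) [k..<N+1])) x)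
      = app (prod_list (map (\<lambda>a. X0 T0 (of_int l - (of_nat N - of_nat a)) a (\<sigma> a)) [k..<N+1])) (cf l x)"
    if "k \<le> N + 1" for k and \<sigma> :: "nat \<Rightarrow> nat"
    using that
  proof (induction rule: inc_induct)
    case base
    then show ?case using x by simp
  next
    case (step k)
    define y where "y = app (prod_list (map (\<lambda>a. X a (\<sigma> a)) [Suc k..<N+1])) x"
    have upt: "[k..<N+1] = k # [Suc k..<N+1]" using step by (simp only: upt_conv_Cons)
    have y: "ordge (l - (int N - int k)) y" "cf (l - (int N - int k)) y =
       app (prod_list (map (\<lambda>a. X0 T0 (of_int l - (of_nat N - of_nat a)) a (\<sigma> a)) [Suc k..<N+1])) (cf l x)"
      using step unfolding y_def by simp_all
    have idx: "l - (int N - int k) - 1 = l - (int N + 1 - int k)" by simp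
    have r: "of_int (l - (int N - int k)) = of_int l - (of_nat N - of_nat k :: complex)" by simp
    show ?case
      unfolding upt list.map prod_list.Cons app_ring_simps(6) y_def[symmetric] y(2)[symmetric]
      using XX_lead[OF T y(1), of K z z0 k "\<sigma> k"] unfolding X_def[symmetric] T0_def[symmetric] idx r by simp
  qed
  have 1: "1 \<le> N + 1" by simp
  note list1 = list[OF 1, simplified of_nat_1 add_diff_cancel_right']
  have idx: "l - (int N + 1 - int 1) = l - int N" by simp
  show "ordge (l - int N) (app (rdet N (XX K T z z0)) x)"
    unfolding rdet_def app_sum_left X_def[symmetric]
  proof (intro ordge_sum)
    fix \<sigma>
    have "ordge (l - int N) (app (prod_list (map (\<lambda>a. X a (\<sigma> a)) [1..<N+1])) x)"
      using list[OF 1, of \<sigma>] unfolding idx by blast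
    then show "ordge (l - int N) (app (of_int (sign \<sigma>) * prod_list (map (\<lambda>a. X a (\<sigma> a)) [1..<N+1])) x)"
      unfolding app_ring_simps(6) ordge_cf cf_of_int by (metis app_0)
  qed
  show "cf (l - int N) (app (rdet N (XX K T z z0)) x) = app (P0 {s \<in> T. z s = z0} (of_int l)) (cf l x)"
    unfolding rdet_def P0_def app_sum_left X_def[symmetric] T0_def[symmetric] cf_sum
  proof (intro sum.cong refl)
    fix \<sigma>
    show "cf (l - int N) (app (of_int (sign \<sigma>) * prod_list (map (\<lambda>a. X a (\<sigma> a)) [1..<N+1])) x)
      = app (of_int (sign \<sigma>) * prod_list (map (\<lambda>a. X0 T0 (of_int l - (of_nat N - of_nat a)) a (\<sigma> a)) [1..<N+1])) (cf l x)"
      using list[OF 1, of \<sigma>] unfolding idx app_ring_simps(6) cf_of_int by presburger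
  qed
qed

text \<open>Read from right to left, this transfers identities between row determinants to
  \<open>P0\<close>.\<close>

lemma P0_mono:
  assumes "T \<subseteq> S"
  shows "app (P0 {s \<in> T. z s = z0} (of_int l)) v = cf (l - int N) (app (rdet N (XX K T z z0)) (fmono l v))"
  using rdet_lead(2)[OF assms ordge_fmono[of l v], where K = K and z = z and ?z0.0 = z0] by (simp add: cf_fmono)

text \<open>Only the residues at the point matter, so K = 0 and all sites at the origin will do; K =
  0 is what the gl_N-symmetry asks for.\<close>

lemma P0_mono':
  assumes "T \<subseteq> S"
  shows "app (P0 T (of_int l)) v = cf (l - int N) (app (rdet N (XX (\<lambda>a. 0) T (\<lambda>s. 0) 0)) (fmono l v))"
  using P0_mono[OF assms, of "\<lambda>s. 0" 0] by simp

text \<open>Off-diagonal entries do not contain r, so a permutation with a moved point has lower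
  degree and the identity alone contributes the top power. That the polynomial is monic is the
  point: it gives the recursion behind the dimension count.\<close>

lemma P0_polynomial:
  "\<exists>A. (\<forall>m c. A m * sc c = sc c * A m) \<and> (\<forall>r. P0 T r = sc (r ^ N) + (\<Sum>m<N. sc (r ^ m) * A m))"
proof -
  \<comment> \<open>Operator polynomials in the exponent of degree below \<open>q\<close>.\<close>
  define pop where "pop = (\<lambda>q (F :: complex \<Rightarrow> ('i, complex) addop). \<exists>A. (\<forall>m c. A m * sc c = sc c * A m) \<and> (\<forall>r. F r = (\<Sum>m<q. sc (r ^ m) * A m)))"
  have pop0: "pop q (\<lambda>r. 0)" for q
    unfolding pop_def by (rule exI[of _ "\<lambda>m. 0"]) simp
  have pop_add: "pop q (\<lambda>r. F r + G r)" if "pop q F" "pop q G" for q F G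
  proof -
    obtain A B where "\<forall>r. F r = (\<Sum>m<q. sc (r ^ m) * A m)" "\<forall>r. G r = (\<Sum>m<q. sc (r ^ m) * B m)"
      "\<forall>m c. A m * sc c = sc c * A m" "\<forall>m c. B m * sc c = sc c * B m"
      using \<open>pop q F\<close> \<open>pop q G\<close> unfolding pop_def by blast
    then show ?thesis unfolding pop_def by (intro exI[of _ "\<lambda>m. A m + B m"]) (simp add: distrib_left distrib_right sum.distrib)
  qed
  have pop_sum: "pop q (\<lambda>r. \<Sum>i\<in>J. F i r)" if "\<And>i. i \<in> J \<Longrightarrow> pop q (F i)" for q and J :: "(nat \<Rightarrow> nat) set" and F
    using that by (induction J rule: infinite_finite_induct) (auto intro: pop0 pop_add)
  have pop_left: "pop q (\<lambda>r. C * F r)" if "pop q F" "\<And>c. C * sc c = sc c * C" for q F C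
  proof -
    obtain A where A: "\<forall>r. F r = (\<Sum>m<q. sc (r ^ m) * A m)" "\<forall>m c. A m * sc c = sc c * A m" using \<open>pop q F\<close> unfolding pop_def by blast
    have "C * F r = (\<Sum>m<q. sc (r ^ m) * (C * A m))" for r
      using A(1) that(2) by (simp add: sum_distrib_left mult.assoc[symmetric])
    moreover have "C * A m * sc c = sc c * (C * A m)" for m c
      using A(2) that(2) by (simp only: mult.assoc) (simp only: mult.assoc[symmetric] that(2))
    ultimately show ?thesis unfolding pop_def by (intro exI[of _ "\<lambda>m. C * A m"] conjI allI)
  qed
  have pop_if: "pop q (\<lambda>r. if P then F r else 0)" if "pop q F" for q F P
    using that pop0 by (cases P) simp_all
  have pop_mono: "pop (Suc q) F" if "pop q F" for q F
  proof -
    obtain A where A: "\<forall>r. F r = (\<Sum>m<q. sc (r ^ m) * A m)" "\<forall>m c. A m * sc c = sc c * A m" using \<open>pop q F\<close> unfolding pop_def by blast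
    then show ?thesis unfolding pop_def
      by (intro exI[of _ "\<lambda>m. if m < q then A m else 0"]) simp
  qed
  have pop_r: "pop (Suc q) (\<lambda>r. sc r * F r)" if "pop q F" for q F
  proof -
    obtain A where A: "\<forall>r. F r = (\<Sum>m<q. sc (r ^ m) * A m)" "\<forall>m c. A m * sc c = sc c * A m" using \<open>pop q F\<close> unfolding pop_def by blast
    have "sc r * F r = (\<Sum>m<Suc q. sc (r ^ m) * (case m of 0 \<Rightarrow> 0 | Suc m' \<Rightarrow> A m'))" for r
      unfolding sum.lessThan_Suc_shift using A(1)
      by (simp add: sum_distrib_left mult.assoc[symmetric] sc_simps(4))
    then show ?thesis unfolding pop_def using A(2)
      by (intro exI[of _ "\<lambda>m. case m of 0 \<Rightarrow> 0 | Suc m' \<Rightarrow> A m'"]) (simp split: nat.split)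
  qed
  have pop_pow: "pop (Suc q) (\<lambda>r. sc (r ^ q) * C)" if "\<And>c. C * sc c = sc c * C" for q C
    unfolding pop_def using that by (intro exI[of _ "\<lambda>m. if m = q then C else 0"])
      (simp add: if_distrib[of "(*) _"] cong: if_cong)
  have list: "\<exists>F. pop (length as) F \<and> (\<forall>r. prod_list (map (\<lambda>a. X0 T (r - (of_nat N - of_nat a)) a (\<sigma> a)) as)
      = (if \<forall>a\<in>set as. \<sigma> a = a then sc (r ^ length as) else 0) + F r)" for as and \<sigma> :: "nat \<Rightarrow> nat"
  proof (induction as)
    case Nil
    show ?case by (rule exI[of _ "\<lambda>r. 0"]) (simp add: pop0 sc_simps)
  next
    case (Cons a as)
    then obtain F where F: "pop (length as) F" "\<forall>r. prod_list (map (\<lambda>a. X0 T (r - (of_nat N - of_nat a)) a (\<sigma> a)) as)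
      = (if \<forall>a\<in>set as. \<sigma> a = a then sc (r ^ length as) else 0) + F r" by blast
    define C where "C = (if a = \<sigma> a then sc (of_nat a - of_nat N) else 0) - (\<Sum>s\<in>T. efc s (\<sigma> a) a)"
    have C: "C * sc c = sc c * C" for c
      unfolding C_def by (auto simp: left_diff_distrib right_diff_distrib sum_distrib_left sum_distrib_right sc_ef sc_commute)
    have X0: "X0 T (r - (of_nat N - of_nat a)) a (\<sigma> a) = (if a = \<sigma> a then sc r else 0) + C" for r
      by (auto simp: X0_def C_def sc_simps)
    define F' where "F' = (\<lambda>r. (if a = \<sigma> a then sc r * F r else 0) + (C * F r + (if \<forall>a\<in>set as. \<sigma> a = a then sc (r ^ length as) * C else 0)))"
    have "pop (length (a # as)) F'"
      unfolding F'_def list.size add_0_right add_Suc_right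
      by (intro pop_add pop_if pop_r[OF F(1)] pop_mono[OF pop_left[OF F(1) C]] pop_pow C)
    moreover have "prod_list (map (\<lambda>a. X0 T (r - (of_nat N - of_nat a)) a (\<sigma> a)) (a # as))
      = (if \<forall>a\<in>set (a # as). \<sigma> a = a then sc (r ^ length (a # as)) else 0) + F' r" for r
      unfolding list.map prod_list.Cons X0 F(2)[rule_format] F'_def
      by (auto simp: distrib_left distrib_right C sc_simps(4) mult.assoc)
    ultimately show ?case by blast
  qed
  obtain F where F: "\<And>\<sigma>. pop N (F \<sigma>)" "\<And>\<sigma> r. prod_list (map (\<lambda>a. X0 T (r - (of_nat N - of_nat a)) a (\<sigma> a)) [1..<N+1])
      = (if \<forall>a\<in>{1..N}. \<sigma> a = a then sc (r ^ N) else 0) + F \<sigma> r"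
  proof -
    have "\<forall>\<sigma> :: nat \<Rightarrow> nat. \<exists>F. pop N F \<and> (\<forall>r. prod_list (map (\<lambda>a. X0 T (r - (of_nat N - of_nat a)) a (\<sigma> a)) [1..<N+1])
      = (if \<forall>a\<in>{1..N}. \<sigma> a = a then sc (r ^ N) else 0) + F r)"
      using list[of "[1..<N+1]"] unfolding set_upt1 length_upt add_diff_cancel_right' by blast
    from choice[OF this] show ?thesis using that by blast
  qed
  have "P0 T r = sc (r ^ N) + (\<Sum>\<sigma> | \<sigma> permutes {1..N}. of_int (sign \<sigma>) * F \<sigma> r)" for r
  proof -
    have id: "(\<forall>a\<in>{1..N}. \<sigma> a = a) \<longleftrightarrow> \<sigma> = id" if "\<sigma> permutes {1..N}" for \<sigma>
      using permutes_not_in[OF that] by (auto simp: fun_eq_iff)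
    have "P0 T r = (\<Sum>\<sigma> | \<sigma> permutes {1..N}. (if \<sigma> = id then sc (r ^ N) else 0) + of_int (sign \<sigma>) * F \<sigma> r)"
      unfolding P0_def F(2)
    proof (intro sum.cong refl)
      fix \<sigma> assume "\<sigma> \<in> {\<sigma>. \<sigma> permutes {1..N}}"
      then have "(\<forall>a\<in>{1..N}. \<sigma> a = a) \<longleftrightarrow> \<sigma> = id" using id by blast
      then show "of_int (sign \<sigma>) * ((if \<forall>a\<in>{1..N}. \<sigma> a = a then sc (r ^ N) else 0) + F \<sigma> r)
        = (if \<sigma> = id then sc (r ^ N) else 0) + of_int (sign \<sigma>) * F \<sigma> r"
        by (simp only:) (simp add: distrib_left)
    qed
    also have "\<dots> = sc (r ^ N) + (\<Sum>\<sigma> | \<sigma> permutes {1..N}. of_int (sign \<sigma>) * F \<sigma> r)"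
      by (simp add: sum.distrib finite_permutations permutes_id sign_id)
    finally show ?thesis .
  qed
  moreover have "pop N (\<lambda>r. \<Sum>\<sigma> | \<sigma> permutes {1..N}. of_int (sign \<sigma>) * F \<sigma> r)"
    by (intro pop_sum pop_left F of_int_commute)
  ultimately show ?thesis unfolding pop_def by (elim exE conjE, intro exI conjI) (assumption, simp only: simp_thms)
qed

lemma P0_sc: "P0 T r * sc k = sc k * P0 T r"
proof -
  obtain A where A: "\<And>m c. A m * sc c = sc c * A m" "\<And>r. P0 T r = sc (r ^ N) + (\<Sum>m<N. sc (r ^ m) * A m)"
    using P0_polynomial[of T] by blast
  have "sc (r ^ m) * A m * sc k = sc k * (sc (r ^ m) * A m)" for m
    by (simp only: mult.assoc A(1)) (simp only: mult.assoc[symmetric] sc_commute)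
  then show ?thesis
    unfolding A(2) by (simp add: distrib_left distrib_right sum_distrib_left sum_distrib_right sc_commute[of k])
qed

text \<open>The factorisation of the row determinant turns a vanishing residue at a vector site into a zero there.\<close>

lemma vector_site_vanishing:
  fixes x :: "'i \<Rightarrow> complex fls"
  assumes p: "p \<in> S" "\<And>s. s \<in> S - {p} \<Longrightarrow> z s \<noteq> z p"
    and ee: "\<And>a b c d \<beta> \<gamma>. a \<in> {1..N} \<Longrightarrow> b \<in> {1..N} \<Longrightarrow> c \<in> {1..N} \<Longrightarrow> d \<in> {1..N} \<Longrightarrow> \<gamma> \<in> I \<Longrightarrow>
      (\<Sum>\<delta>\<in>I. e p a b \<beta> \<delta> * e p c d \<delta> \<gamma>) = (if b = c then e p a d \<beta> \<gamma> else 0)"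
    and x: "ordge 0 x" "app (\<Sum>c=1..N. efl p c c) x = x"
    and res: "cf (-1) (app (rdet N (XX K S z (z p))) x) = 0"
  shows "ordge 1 (app (rdet N (XX K S z (z p))) x)"
proof -
  define X where "X = XX K S z (z p)"
  define Z where "Z = XX K (S - {p}) z (z p)"
  \<comment> \<open>\<open>u\<close> is a unit for the generators of the site \<open>p\<close> and
    fixes \<open>x\<close>, but need not be the unit of the operator ring; hence it is carried along
    explicitly.\<close>
  define u where "u = (\<Sum>c=1..N. efl p c c)"
  have rest: "S - {p} \<subseteq> S" by blast
  have ee': "efl p a b * efl p c d = (if b = c then efl p a d else 0)"
    if "a \<in> {1..N}" "b \<in> {1..N}" "c \<in> {1..N}" "d \<in> {1..N}" for a b c d
  proof -
    have "efl p a b * efl p c d = mk fls_const I (\<lambda>\<beta> \<gamma>. if b = c then e p a d \<beta> \<gamma> else 0)"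
      unfolding ef_def by (rule mk_mult) (use ee that in auto)
    then show ?thesis by (auto simp: ef_def mk_zero)
  qed
  have XZ: "X a b = Z a b - sc fls_X_inv * efl p b a" for a b
    unfolding X_def Z_def XX_def sum.remove[OF finS p(1)] by (simp add: pole_self)
  have eZ: "efl p a b * Z c d = Z c d * efl p a b"
    if "a \<in> {1..N}" "b \<in> {1..N}" "c \<in> {1..N}" "d \<in> {1..N}" for a b c d
  proof -
    have "efl p a b * (sc (pole z (z p) s) * efl s d c) = sc (pole z (z p) s) * efl s d c * efl p a b"
      if "s \<in> S - {p}" for s
    proof -
      have "efl p a b * (sc (pole z (z p) s) * efl s d c) = sc (pole z (z p) s) * (efl p a b * efl s d c)"
        by (simp only: mult.assoc[symmetric] sc_ef[symmetric])
      also have "efl p a b * efl s d c = efl s d c * efl p a b"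
        by (rule ef_comm) (use that p(1) \<open>a \<in> {1..N}\<close> \<open>b \<in> {1..N}\<close> \<open>c \<in> {1..N}\<close> \<open>d \<in> {1..N}\<close> in auto)
      finally show ?thesis by (simp only: mult.assoc)
    qed
    then show ?thesis unfolding Z_def XX_def
      by (simp add: left_diff_distrib right_diff_distrib sum_distrib_left sum_distrib_right dd_ef sc_ef)
  qed
  define P where "P = {T :: ('i, complex fls) addop. \<forall>x. ordge 0 x \<longrightarrow> ordge 0 (app T x)}"
  \<comment> \<open>Without the site \<open>p\<close> there is no pole at \<open>z p\<close>: apart
    from the derivative, \<open>Z\<close> does not lower any order.\<close>
  have Z0: "ordge j (app (Z a b) x - (if a = b then app dd x else 0))" if "ordge j x" for j x a b
  proof -
    have "app (Z a b) x - (if a = b then app dd x else 0)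
        = - (if a = b then app (sc (fls_const (K a))) x else 0) - (\<Sum>s\<in>S - {p}. app (sc (pole z (z p) s)) (app (efl s b a) x))"
      by (simp add: Z_def XX_def app_sum_left)
    moreover have "ordge j (\<Sum>s\<in>S - {p}. app (sc (pole z (z p) s)) (app (efl s b a) x))"
      by (intro ordge_sum ordge_sc ordge_ef that pole_regular p(2))
    moreover have "ordge j (- (if a = b then app (sc (fls_const (K a))) x else 0))"
    proof (cases "a = b")
      case True
      then show ?thesis using ordge_simps(4)[OF ordge_sc[OF fls_const_regular that]] by simp
    next
      case False
      then show ?thesis using ordge_simps(1) by simp
    qed
    ultimately show ?thesis using ordge_simps(3) by (simp only:)
  qed
  have "\<exists>G\<in>P. rdet N X = rdet N Z - sc fls_X_inv * G \<and>
    (\<Sum>c=1..N. efl p c c) * rdet N Z = (\<Sum>c=1..N. \<Sum>b=1..N. efl p c b * Z c b) * G"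
  proof (rule rdet_vector_site)
    show "x = 0" if "x + x = 0" for x :: "('i, complex fls) addop"
      by (rule fls_addop_torsion_free[OF that])
    fix a b assume ab: "a \<in> {1..N}" "b \<in> {1..N}"
    show "efl p a b * sc fls_X_inv = sc fls_X_inv * efl p a b" by (rule sc_ef[symmetric])
    show "X a b = Z a b - sc fls_X_inv * efl p b a" by (rule XZ)
    have dX: "dd * sc fls_X_inv = sc fls_X_inv * dd - (sc fls_X_inv * sc fls_X_inv :: ('i, complex fls) addop)"
    proof -
      have "fls_deriv fls_X_inv = - (fls_X_inv * fls_X_inv :: complex fls)"
        using fls_deriv_pole[of z "z p" p] by (simp only: pole_self)
      then have "dd * sc fls_X_inv = sc fls_X_inv * dd + sc (- (fls_X_inv * fls_X_inv :: complex fls))"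
        by (simp only: dd_sc)
      then show ?thesis by (simp only: sc_simps(3,4)) simp
    qed
    have kX: "sc (fls_const k) * sc fls_X_inv = (sc fls_X_inv * sc (fls_const k) :: ('i, complex fls) addop)" for k
      by (rule sc_commute)
    show "Z a b * sc fls_X_inv = sc fls_X_inv * Z a b - (if a = b then sc fls_X_inv * sc fls_X_inv else 0)"
    proof -
      have "(\<Sum>s\<in>S - {p}. sc (pole z (z p) s) * efl s b a) * sc fls_X_inv = sc fls_X_inv * (\<Sum>s\<in>S - {p}. sc (pole z (z p) s) * efl s b a)"
        unfolding sum_distrib_left sum_distrib_right
        by (intro sum.cong refl) (simp only: mult.assoc sc_ef[symmetric], simp only: mult.assoc[symmetric] sc_commute[of fls_X_inv])
      then show ?thesis
        unfolding Z_def XX_def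
        by (cases "a = b") (simp_all add: left_diff_distrib right_diff_distrib dX kX)
    qed
    show "Z a b \<in> P"
    proof -
      have "ordge 0 (app (Z a b) x)" if "ordge 0 x" for x
      proof -
        have "ordge 0 (if a = b then app dd x else 0)"
          by (intro ordge_if ordge_dd0 that ordge_simps(1))
        from ordge_simps(2)[OF Z0[OF that, of a b] this] show ?thesis by (simp only: diff_add_cancel)
      qed
      then show ?thesis by (simp add: P_def)
    qed
    show "efl p a b \<in> P" by (simp add: P_def ordge_ef)
  qed (use ee' eZ XX_manin[OF rest] in \<open>auto simp: P_def Z_def intro: ordge_simps\<close>)
  then obtain G where G: "G \<in> P" "rdet N X = rdet N Z - sc fls_X_inv * G"
    "u * rdet N Z = (\<Sum>c=1..N. \<Sum>b=1..N. efl p c b * Z c b) * G" unfolding u_def by blast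
  define g where "g = app G x"
  have g: "ordge 0 g" using G(1) x(1) by (simp add: P_def g_def)
  define Zg where "Zg = (\<Sum>c=1..N. \<Sum>b=1..N. app (efl p c b) (app (Z c b) g))"
  have uZ: "u * Z a b = Z a b * u" if "a \<in> {1..N}" "b \<in> {1..N}" for a b
    unfolding u_def sum_distrib_left sum_distrib_right by (intro sum.cong refl eZ that)
  have ue: "u * efl p a b = efl p a b" "efl p a b * u = efl p a b" if "a \<in> {1..N}" "b \<in> {1..N}" for a b
  proof -
    have "u * efl p a b = (\<Sum>c=1..N. if c = a then efl p c b else 0)"
      unfolding u_def sum_distrib_right by (intro sum.cong refl) (use ee' that in auto)
    then show "u * efl p a b = efl p a b" using that by simp
    have "efl p a b * u = (\<Sum>c=1..N. if b = c then efl p a c else 0)"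
      unfolding u_def sum_distrib_left by (intro sum.cong refl) (use ee' that in auto)
    then show "efl p a b * u = efl p a b" using that by simp
  qed
  have uX: "u * X a b = X a b * u" if "a \<in> {1..N}" "b \<in> {1..N}" for a b
  proof -
    have "u * sc fls_X_inv = sc fls_X_inv * u"
      unfolding u_def sum_distrib_left sum_distrib_right by (simp only: sc_ef)
    then have "u * (sc fls_X_inv * efl p b a) = sc fls_X_inv * (u * efl p b a)"
      by (simp only: mult.assoc[symmetric])
    then show ?thesis unfolding XZ left_diff_distrib right_diff_distrib uZ[OF that]
      using ue that by (simp add: mult.assoc)
  qed
  have "u * rdet N X = rdet N X * u" by (rule rdet_intertwine) (rule uX)
  then have uD: "app u (app (rdet N X) x) = app (rdet N X) x"
    using x(2) unfolding u_def[symmetric] by (metis app_ring_simps(6))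
  have "u * rdet N Z = rdet N Z * u" by (rule rdet_intertwine) (rule uZ)
  then have "app (rdet N Z) x = app (u * rdet N Z) x"
    using x(2) unfolding u_def[symmetric] by (metis app_ring_simps(6))
  also have "\<dots> = Zg" unfolding G(3) by (simp add: Zg_def app_sum_left g_def)
  finally have Dx: "app (rdet N X) x = Zg - app (sc fls_X_inv) g"
    unfolding G(2) by (simp only: app_ring_simps g_def)
  have Zg_split: "ordge j (Zg - app u (app dd g))" if "ordge j g" for j
  proof -
    have "Zg - app u (app dd g) = (\<Sum>c=1..N. \<Sum>b=1..N. app (efl p c b) (app (Z c b) g) - app (efl p c b) (if c = b then app dd g else 0))"
    proof -
      have "(\<Sum>b=1..N. app (efl p c b) (if c = b then app dd g else 0)) = app (efl p c c) (app dd g)" if "c \<in> {1..N}" for c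
      proof -
        have "(\<Sum>b=1..N. app (efl p c b) (if c = b then app dd g else 0)) = (\<Sum>b=1..N. if c = b then app (efl p c b) (app dd g) else 0)"
          by (intro sum.cong refl) (rule app_if0)
        also have "\<dots> = app (efl p c c) (app dd g)" using that by (simp only: sum.delta' finite_atLeastAtMost if_True)
        finally show ?thesis .
      qed
      then have "app u (app dd g) = (\<Sum>c=1..N. \<Sum>b=1..N. app (efl p c b) (if c = b then app dd g else 0))"
        unfolding u_def app_sum_left by (intro sum.cong refl) (simp only:)
      then show ?thesis unfolding Zg_def by (simp only: sum_subtractf)
    qed
    moreover have "ordge j (\<Sum>c=1..N. \<Sum>b=1..N. app (efl p c b) (app (Z c b) g) - app (efl p c b) (if c = b then app dd g else 0))"
      unfolding app_diff[symmetric] by (intro ordge_sum ordge_ef Z0 that)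
    ultimately show ?thesis by (simp only:)
  qed
  have u_ord: "ordge j (app u y)" if "ordge j y" for j y
    unfolding u_def app_sum_left by (intro ordge_sum ordge_ef that)
  \<comment> \<open>\<open>Zg\<close> is regular, so the residue of the determinant is minus the
    constant term of \<open>g\<close>, and the hypothesis makes \<open>g\<close> vanish at the
    site.\<close>
  have "ordge 0 Zg"
    using ordge_simps(2)[OF Zg_split[OF g] u_ord[OF ordge_dd0[OF g]]] by (simp only: diff_add_cancel)
  then have "cf (-1) Zg = 0" by (simp add: ordge_cf)
  then have "cf 0 g = 0" using res unfolding X_def[symmetric] Dx cf_simps cf_sc_X_inv by simp
  then have g1: "ordge 1 g"
    using g unfolding ordge_cf by (metis zless_add1_eq add_0)
  \<comment> \<open>As \<open>g\<close> vanishes at the site, only the derivative contributes to the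
    constant term of \<open>Zg\<close>. This is \<open>u\<close> applied to the linear coefficient
    of \<open>g\<close>, which \<open>g\<close> divided by the local variable contributes as well;
    \<open>u\<close> identifies the two.\<close>
  have "cf 0 (Zg - app u (app dd g)) = 0"
    using Zg_split[OF g1] unfolding ordge_cf by simp
  then have Zg0: "cf 0 Zg = cf 0 (app u (app dd g))" by (simp only: cf_simps right_minus_eq)
  define uc where "uc = (\<Sum>c=1..N. efc p c c)"
  have cfu: "cf n (app u y) = app uc (cf n y)" for n y
    unfolding u_def uc_def app_sum_left cf_sum cf_ef ..
  have dg: "cf 0 (app dd g) = cf 1 g" by (simp add: cf_dd app_sc)
  have "uc * uc = uc"
  proof -
    have "app (uc * uc) v = app uc v" for v
    proof -
      have "app u (app u (fmono 0 v)) = app u (fmono 0 v)"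
      proof -
        have "u * u = u" unfolding u_def sum_distrib_left
          by (intro sum.cong refl) (use ue in \<open>auto simp: u_def\<close>)
        then show ?thesis by (metis app_ring_simps(6))
      qed
      then have "cf 0 (app u (app u (fmono 0 v))) = cf 0 (app u (fmono 0 v))" by simp
      then show ?thesis unfolding cfu by (simp add: cf_fmono)
    qed
    then show ?thesis by (rule addop_eqI)
  qed
  then have "app uc (app uc (cf 1 g)) = app uc (cf 1 g)" by (metis app_ring_simps(6))
  then have "app uc (cf 0 (app (rdet N X) x)) = 0"
    unfolding Dx cf_simps cf_sc_X_inv Zg0 cfu dg app_diff by simp
  then have 0: "cf 0 (app (rdet N X) x) = 0"
    unfolding cfu[symmetric] uD .
  have "ordge 0 (app (sc fls_X_inv) g)" using ordge_sc_X_inv[OF g1] by simp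
  then have "ordge 0 (app (rdet N X) x)"
    unfolding Dx using ordge_simps(3)[OF \<open>ordge 0 Zg\<close>] by blast
  then show ?thesis using 0 unfolding X_def[symmetric] ordge_cf
    by (metis zless_add1_eq add_0)
qed

definition wspace :: "(nat \<Rightarrow> complex) \<Rightarrow> ('i \<Rightarrow> complex) set" where
  "wspace m = {v. (\<forall>\<beta>. \<beta> \<notin> I \<longrightarrow> v \<beta> = 0) \<and> (\<forall>a\<in>{1..N}. app (\<Sum>s\<in>S. efc s a a) v = app (sc (m a)) v)}"

lemma wspace_0: "0 \<in> wspace m"
  by (simp only: wspace_def mem_Collect_eq app_0 zero_fun_apply simp_thms ball_triv)

lemma wspace_add: "v \<in> wspace m \<Longrightarrow> w \<in> wspace m \<Longrightarrow> v + w \<in> wspace m"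
  by (simp only: wspace_def mem_Collect_eq app_add) auto

lemma wspace_scale: "v \<in> wspace m \<Longrightarrow> (\<lambda>\<beta>. c * v \<beta>) \<in> wspace m"
proof -
  assume v: "v \<in> wspace m"
  have sc: "(\<lambda>\<beta>. c * v \<beta>) = app (sc c) v" by (simp add: app_sc)
  have "app (\<Sum>s\<in>S. efc s a a) (app (sc c) v) = app (sc c) (app (\<Sum>s\<in>S. efc s a a) v)" for a
    by (rule app_eqD) (simp only: sum_distrib_left sum_distrib_right sc_ef)
  moreover have "app (sc c) (app (sc (m a)) v) = app (sc (m a)) (app (sc c) v)" for a
    by (rule app_eqD) (rule sc_commute)
  ultimately show ?thesis using v unfolding wspace_def sc by (simp add: app_sc)
qed

lemma rdet_sc_commute:
  "sc (fls_const c) * rdet N (XX K S z z0) = rdet N (XX K S z z0) * sc (fls_const c)"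
proof (rule rdet_intertwine)
  fix a b
  have "sc (fls_const c) * (\<Sum>s\<in>S. sc (pole z z0 s) * efl s b a) = (\<Sum>s\<in>S. sc (pole z z0 s) * efl s b a) * sc (fls_const c)"
    unfolding sum_distrib_left sum_distrib_right
    by (intro sum.cong refl) (simp only: mult.assoc sc_ef[symmetric], simp only: mult.assoc[symmetric] sc_commute[of "fls_const c"])
  then show "sc (fls_const c) * XX K S z z0 a b = XX K S z z0 a b * sc (fls_const c)"
    unfolding XX_def by (simp add: left_diff_distrib right_diff_distrib dd_sc sc_simps sc_commute[of "fls_const c"])
qed

text \<open>The weight condition on all coefficients is one on the whole series, where the
  determinant commutes with the Cartan generators.\<close>

lemma rdet_wspace:
  assumes "\<And>n. cf n x \<in> wspace m"
  shows "cf n (app (rdet N (XX K S z z0)) x) \<in> wspace m"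
proof -
  define D where "D = rdet N (XX K S z z0)"
  have x0: "\<forall>\<beta>. \<beta> \<notin> I \<longrightarrow> x \<beta> = 0"
  proof (intro allI impI fls_eqI)
    fix \<beta> k assume "\<beta> \<notin> I"
    then show "fls_nth (x \<beta>) k = fls_nth 0 k" using assms[of k] by (auto simp: wspace_def cf_def)
  qed
  have "\<forall>\<beta>. \<beta> \<notin> I \<longrightarrow> app D x \<beta> = 0"
    unfolding D_def
  proof (rule rdet_invariant[where Q = "\<lambda>x. \<forall>\<beta>. \<beta> \<notin> I \<longrightarrow> x \<beta> = 0"])
    fix a b and x :: "'i \<Rightarrow> complex fls"
    assume "a \<in> {1..N}" "b \<in> {1..N}" "\<forall>\<beta>. \<beta> \<notin> I \<longrightarrow> x \<beta> = 0"
    then show "\<forall>\<beta>. \<beta> \<notin> I \<longrightarrow> app (XX K S z z0 a b) x \<beta> = 0"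
      by (auto simp: XX_def app_sum_left app_dd app_sc ef_def app_mk supp sum_fun_apply)
  qed (use x0 in auto)
  then have 1: "\<forall>\<beta>. \<beta> \<notin> I \<longrightarrow> cf n (app D x) \<beta> = 0" by (simp add: cf_def)
  have "app (\<Sum>s\<in>S. efc s a a) (cf n (app D x)) = app (sc (m a)) (cf n (app D x))" if a: "a \<in> {1..N}" for a
  proof -
    have H: "app (\<Sum>s\<in>S. efl s a a) x = app (sc (fls_const (m a))) x"
    proof (rule ext, rule fls_eqI)
      fix \<beta> k
      have "cf k (app (\<Sum>s\<in>S. efl s a a) x) = cf k (app (sc (fls_const (m a))) x)"
        using assms[of k] a by (simp add: cf_sum cf_ef cf_sc_const app_sum_left wspace_def)
      then show "fls_nth (app (\<Sum>s\<in>S. efl s a a) x \<beta>) k = fls_nth (app (sc (fls_const (m a))) x \<beta>) k"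
        by (auto simp: cf_def fun_eq_iff)
    qed
    have sc: "sc (fls_const c) * D = D * sc (fls_const c)" for c
      unfolding D_def by (rule rdet_sc_commute)
    have "app (\<Sum>s\<in>S. efl s a a) (app D x) = app D (app (\<Sum>s\<in>S. efl s a a) x)"
      by (rule app_eqD) (rule rdet_weight_commute[OF a, of K z z0, folded D_def])
    also have "\<dots> = app (sc (fls_const (m a))) (app D x)"
      unfolding H by (rule app_eqD) (rule sc[symmetric])
    finally have "cf n (app (\<Sum>s\<in>S. efl s a a) (app D x)) = cf n (app (sc (fls_const (m a))) (app D x))"
      by simp
    then show ?thesis by (simp add: cf_sum cf_ef cf_sc_const app_sum_left)
  qed
  with 1 show ?thesis unfolding D_def[symmetric] wspace_def by blast
qed

end

section \<open>Counting solutions of the indicial equation\<close>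

interpretation fv: vector_space "\<lambda>c (f :: 'x \<Rightarrow> complex) x. c * f x"
  by unfold_locales (auto simp: fun_eq_iff algebra_simps)

definition dirac :: "'x \<Rightarrow> 'x \<Rightarrow> complex" where
  "dirac a b = (if a = b then 1 else 0)"

lemma finite_support_span:
  assumes "finite I" "\<And>\<beta>. \<beta> \<notin> I \<Longrightarrow> v \<beta> = 0"
  shows "v \<in> fv.span (dirac ` I)"
proof -
  have "v = (\<Sum>\<beta>\<in>I. (\<lambda>x. v \<beta> * dirac \<beta> x))"
    using assms by (auto simp: fun_eq_iff sum_fun_apply dirac_def if_distrib[of "(*) _"] cong: if_cong)
  moreover have "(\<Sum>\<beta>\<in>I. (\<lambda>x. v \<beta> * dirac \<beta> x)) \<in> fv.span (dirac ` I)"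
    by (intro fv.span_sum fv.span_scale fv.span_base) auto
  ultimately show ?thesis by simp
qed

text \<open>What is counted are indices, not vectors: if two members coincide, their difference is a
  relation at once; otherwise the dimension bound applies to the image.\<close>

lemma family_dependent:
  fixes q :: "'j \<Rightarrow> 'x \<Rightarrow> complex"
  assumes "finite J" "finite T" "card T < card J" "\<And>i. i \<in> J \<Longrightarrow> q i \<in> fv.span T"
  shows "\<exists>y. (\<exists>i\<in>J. y i \<noteq> 0) \<and> (\<forall>x. (\<Sum>i\<in>J. y i * q i x) = 0)"
proof (cases "inj_on q J")
  case True
  have "\<not> fv.independent (q ` J)"
  proof
    assume "fv.independent (q ` J)"
    then have "card (q ` J) \<le> card T"
      using fv.independent_span_bound[OF assms(2)] assms(4) by blast
    then show False using card_image[OF True] assms(3) by simp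
  qed
  then obtain u v where u: "v \<in> q ` J" "u v \<noteq> 0" "(\<Sum>v\<in>q ` J. (\<lambda>x. u v * v x)) = 0"
    using fv.dependent_finite[of "q ` J"] \<open>finite J\<close> by auto
  have "(\<Sum>i\<in>J. u (q i) * q i x) = 0" for x
  proof -
    have "(\<Sum>v\<in>q ` J. u v * v x) = 0" using fun_cong[OF u(3), of x] by (simp add: sum_fun_apply)
    then show ?thesis by (simp add: sum.reindex[OF True])
  qed
  with u show ?thesis by (intro exI[of _ "\<lambda>i. u (q i)"]) auto
next
  case False
  then obtain i j where ij: "i \<in> J" "j \<in> J" "i \<noteq> j" "q i = q j" by (auto simp: inj_on_def)
  have "(\<Sum>l\<in>J. (if l = i then 1 else if l = j then - 1 else 0) * q l x) = 0" for x
  proof -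
    have "(\<Sum>l\<in>J. (if l = i then 1 else if l = j then - 1 else 0) * q l x)
      = (\<Sum>l\<in>J. (if l = i then q i x else 0) - (if l = j then q j x else 0))"
      using ij by (intro sum.cong) auto
    also have "\<dots> = q i x - q j x" using ij \<open>finite J\<close> by (simp add: sum_subtractf)
    finally show ?thesis using ij by simp
  qed
  with ij show ?thesis by (intro exI[of _ "\<lambda>l. if l = i then 1 else if l = j then - 1 else 0"]) auto
qed

lemma independent_sum_zero:
  assumes "fv.independent B" "finite B" "\<And>x. (\<Sum>b\<in>B. u b * b x) = 0" "b \<in> B"
  shows "u b = 0"
proof -
  have "(\<Sum>b\<in>B. (\<lambda>x. u b * b x)) = 0"
    using assms(3) by (simp add: fun_eq_iff sum_fun_apply)
  then show ?thesis using fv.independentD[OF assms(1,2) subset_refl _ assms(4), of u] by simp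
qed

text \<open>A polynomial vanishing at all other nodes, paired with the power sums, isolates
  \<open>v l\<close>.\<close>

lemma vandermonde_zero:
  fixes v :: "nat \<Rightarrow> complex"
  assumes "finite L" "\<And>m. (\<Sum>l\<in>L. of_nat l ^ m * v l) = 0" "l \<in> L"
  shows "v l = 0"
proof -
  define p where "p = (\<Prod>k\<in>L - {l}. [:- of_nat k, 1 :: complex:])"
  have "(\<Sum>k\<in>L. poly p (of_nat k) * v k) = (\<Sum>i\<le>degree p. coeff p i * (\<Sum>k\<in>L. of_nat k ^ i * v k))"
    by (simp add: poly_altdef sum_distrib_left sum_distrib_right mult.assoc sum.swap[of _ L])
  also have "\<dots> = 0" using assms(2) by simp
  finally have "(\<Sum>k\<in>L. poly p (of_nat k) * v k) = 0" .
  moreover have "(\<Sum>k\<in>L. poly p (of_nat k) * v k) = (\<Sum>k\<in>L. if k = l then poly p (of_nat l) * v l else 0)"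
    by (intro sum.cong refl) (use \<open>finite L\<close> in \<open>auto simp: p_def poly_prod\<close>)
  ultimately have "poly p (of_nat l) * v l = 0" using assms(1,3) by simp
  moreover have "poly p (of_nat l) \<noteq> 0"
    using \<open>finite L\<close> by (auto simp: p_def poly_prod)
  ultimately show ?thesis by simp
qed

context gaudin
begin

text \<open>
  If \<open>P0 T l\<close> kills \<open>b\<close>, then \<open>(b, l b, \<dots>, l\<^bsup>N-1\<^esup> b)\<close> is an eigenvector of the companion operator, since
  \<open>P0 T\<close> is monic of degree \<open>N\<close>; for different \<open>l\<close> these are independent in \<open>N\<close> copies of \<open>U\<close>.
\<close>

lemma sum_card_kernel_le:
  assumes "finite L" "finite B" "U \<subseteq> fv.span B"
    and BL: "\<And>l. l \<in> L \<Longrightarrow> finite (BL l) \<and> fv.independent (BL l) \<and> BL l \<subseteq> U \<and> (\<forall>b\<in>BL l. app (P0 T (of_nat l)) b = 0)"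
  shows "(\<Sum>l\<in>L. card (BL l)) \<le> N * card B"
proof (rule ccontr)
  assume neg: "\<not> ?thesis"
  define J where "J = Sigma L BL"
  have finJ: "finite J" unfolding J_def using assms(1) BL by auto
  have cardJ: "card J = (\<Sum>l\<in>L. card (BL l))" unfolding J_def using assms(1) BL by (subst card_SigmaI) auto
  \<comment> \<open>\<open>emb m\<close> puts a vector into the m-th of N copies; \<open>q\<close>
    below forms the tuples b, l b, l^2 b, ... in these copies.\<close>
  define emb where "emb = (\<lambda>m (u :: 'i \<Rightarrow> complex) (x :: nat \<times> 'i). if fst x = m then u (snd x) else 0)"
  define Tb where "Tb = (\<lambda>(m, b). emb m b) ` ({..<N} \<times> B)"
  have Tb: "finite Tb" "card Tb \<le> N * card B"
    unfolding Tb_def using assms(2) card_image_le[of "{..<N} \<times> B"] by auto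
  have emb_span: "emb m u \<in> fv.span Tb" if "m < N" "u \<in> fv.span B" for m u
    using that(2)
  proof (induction rule: fv.span_induct_alt)
    case base
    have "emb m 0 = 0" by (auto simp: emb_def fun_eq_iff)
    then show ?case using fv.span_zero by (simp only:)
  next
    case (step c x y)
    have lin: "emb m ((\<lambda>\<beta>. c * x \<beta>) + y) = (\<lambda>p. c * emb m x p) + emb m y"
      by (auto simp: emb_def fun_eq_iff)
    have "emb m x \<in> fv.span Tb"
      by (rule fv.span_base) (use step that in \<open>auto simp: Tb_def\<close>)
    then show ?case unfolding lin by (intro fv.span_add fv.span_scale step.IH)
  qed
  define q where "q = (\<lambda>(l, b). \<Sum>m<N. (\<lambda>x. of_nat l ^ m * emb m b x))"
  have "q i \<in> fv.span Tb" if "i \<in> J" for i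
  proof -
    obtain l b where i: "i = (l, b)" by (cases i)
    then have "l \<in> L" "b \<in> BL l" using that by (auto simp: J_def)
    with i show ?thesis unfolding q_def using BL[of l] assms(3)
      by (auto intro!: fv.span_sum fv.span_scale emb_span)
  qed
  moreover have "card Tb < card J" using Tb(2) neg cardJ by linarith
  ultimately obtain y where y: "\<exists>i\<in>J. y i \<noteq> 0" "\<forall>x. (\<Sum>i\<in>J. y i * q i x) = 0"
    using family_dependent[OF finJ Tb(1)] by blast
  define v where "v = (\<lambda>l. \<Sum>b\<in>BL l. (\<lambda>x. y (l, b) * b x))"
  have scv: "(\<lambda>x. c * f x) = app (sc c) f" for c and f :: "'i \<Rightarrow> complex" by (simp add: app_sc)
  have kill: "app (P0 T (of_nat l)) (v l) = 0" if "l \<in> L" for l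
  proof -
    have "app (P0 T (of_nat l)) (app (sc (y (l, b))) b) = app (sc (y (l, b))) (app (P0 T (of_nat l)) b)" for b
      by (rule app_eqD[OF P0_sc])
    then show ?thesis unfolding v_def scv app_sum
      by (intro sum.neutral ballI) (use BL[OF that] in simp)
  qed
  have small: "(\<Sum>l\<in>L. app (sc (of_nat l ^ m)) (v l)) = 0" if "m < N" for m
  proof (rule ext)
    fix \<beta>
    have "0 = (\<Sum>i\<in>J. y i * q i (m, \<beta>))" using y(2) by simp
    also have "\<dots> = (\<Sum>(l, b)\<in>J. y (l, b) * (of_nat l ^ m * b \<beta>))"
    proof (intro sum.cong refl, clarify)
      fix l b
      have "q (l, b) (m, \<beta>) = (\<Sum>m'<N. if m = m' then of_nat l ^ m' * b \<beta> else 0)"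
        unfolding q_def by (simp add: sum_fun_apply emb_def if_distrib[of "(*) _"] cong: if_cong)
      then have "q (l, b) (m, \<beta>) = of_nat l ^ m * b \<beta>" using that by simp
      then show "y (l, b) * q (l, b) (m, \<beta>) = y (l, b) * (of_nat l ^ m * b \<beta>)" by simp
    qed
    also have "\<dots> = (\<Sum>l\<in>L. \<Sum>b\<in>BL l. y (l, b) * (of_nat l ^ m * b \<beta>))"
      unfolding J_def using assms(1) BL by (subst sum.Sigma) auto
    also have "\<dots> = (\<Sum>l\<in>L. app (sc (of_nat l ^ m)) (v l)) \<beta>"
      by (simp add: sum_fun_apply app_sc v_def sum_distrib_left mult.left_commute)
    finally show "(\<Sum>l\<in>L. app (sc (of_nat l ^ m)) (v l)) \<beta> = 0 \<beta>" by simp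
  qed
  \<comment> \<open>A linear relation between the tuples gives the power sums below N. As
    \<open>P0\<close> is monic and kills \<open>v l\<close>, higher power sums are combinations of
    lower ones, so all vanish and the Vandermonde argument separates the nodes.\<close>
  have all: "(\<Sum>l\<in>L. app (sc (of_nat l ^ m)) (v l)) = 0" for m
  proof (induction m rule: less_induct)
    case (less m)
    show ?case
    proof (cases "m < N")
      case True
      then show ?thesis by (rule small)
    next
      case False
      obtain A where A: "\<forall>m c. A m * sc c = sc c * A m" "\<forall>r. P0 T r = sc (r ^ N) + (\<Sum>m<N. sc (r ^ m) * A m)"
        using P0_polynomial by blast
      have "app (sc (of_nat l ^ m)) (v l) = - (\<Sum>j<N. app (A j) (app (sc (of_nat l ^ (m - N + j))) (v l)))" if "l \<in> L" for l
      proof -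
        have "app (sc (of_nat l ^ N)) (v l) + (\<Sum>j<N. app (sc (of_nat l ^ j)) (app (A j) (v l))) = 0"
          using kill[OF that] A(2) by (simp only: app_ring_simps app_sum_left)
        then have "app (sc (of_nat l ^ N)) (v l) = - (\<Sum>j<N. app (sc (of_nat l ^ j)) (app (A j) (v l)))"
          by (simp only: eq_neg_iff_add_eq_0)
        then have "app (sc (of_nat l ^ (m - N))) (app (sc (of_nat l ^ N)) (v l))
           = - (\<Sum>j<N. app (sc (of_nat l ^ (m - N))) (app (sc (of_nat l ^ j)) (app (A j) (v l))))"
          by (simp only: app_uminus app_sum)
        moreover have "app (sc (of_nat l ^ (m - N))) (app (sc (of_nat l ^ j)) (app (A j) (v l)))
            = app (A j) (app (sc (of_nat l ^ (m - N + j))) (v l))" for j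
          using A(1) unfolding app_ring_simps(6)[symmetric] mult.assoc[symmetric] sc_simps(4)[symmetric] power_add[symmetric]
          by simp
        moreover have "app (sc (of_nat l ^ (m - N))) (app (sc (of_nat l ^ N)) (v l)) = app (sc (of_nat l ^ m)) (v l)"
          unfolding app_ring_simps(6)[symmetric] sc_simps(4)[symmetric] power_add[symmetric] using False by simp
        ultimately show ?thesis by (simp only:)
      qed
      then have "(\<Sum>l\<in>L. app (sc (of_nat l ^ m)) (v l)) = (\<Sum>l\<in>L. - (\<Sum>j<N. app (A j) (app (sc (of_nat l ^ (m - N + j))) (v l))))"
        by (intro sum.cong refl)
      also have "\<dots> = - (\<Sum>l\<in>L. \<Sum>j<N. app (A j) (app (sc (of_nat l ^ (m - N + j))) (v l)))"
        by (rule sum_negf)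
      also have "(\<Sum>l\<in>L. \<Sum>j<N. app (A j) (app (sc (of_nat l ^ (m - N + j))) (v l)))
          = (\<Sum>j<N. \<Sum>l\<in>L. app (A j) (app (sc (of_nat l ^ (m - N + j))) (v l)))"
        by (rule sum.swap)
      also have "\<dots> = (\<Sum>j<N. app (A j) (\<Sum>l\<in>L. app (sc (of_nat l ^ (m - N + j))) (v l)))"
        by (simp only: app_sum)
      also have "\<dots> = 0"
      proof -
        have "(\<Sum>l\<in>L. app (sc (of_nat l ^ (m - N + j))) (v l)) = 0" if "j < N" for j
          by (rule less) (use False that in simp)
        then have "(\<Sum>j<N. app (A j) (\<Sum>l\<in>L. app (sc (of_nat l ^ (m - N + j))) (v l))) = (\<Sum>j<N. 0)"
          by (intro sum.cong refl) (simp only: lessThan_iff app_0)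
        then show ?thesis by (simp only: sum.neutral_const neg_0_equal_iff_equal minus_zero)
      qed
      finally show ?thesis by (simp only: minus_zero)
    qed
  qed
  obtain l b where lb: "l \<in> L" "b \<in> BL l" "y (l, b) \<noteq> 0" using y(1) by (auto simp: J_def)
  have "v l \<beta> = 0" for \<beta>
  proof (rule vandermonde_zero[OF assms(1) _ lb(1), of "\<lambda>l. v l \<beta>"])
    fix m show "(\<Sum>l\<in>L. of_nat l ^ m * v l \<beta>) = 0"
      using fun_cong[OF all[of m], of \<beta>] by (simp add: sum_fun_apply app_sc)
  qed
  then have "y (l, b) = 0"
    using independent_sum_zero[of "BL l" "\<lambda>b. y (l, b)" b] BL[OF lb(1)] lb(2)
    by (simp add: v_def sum_fun_apply)
  then show False using lb(3) by simp
qed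

end

section \<open>Merging vector sites\<close>

text \<open>Rational functions of \<open>u\<close> with poles at sites that move with the parameter \<open>\<tau>\<close>.\<close>

inductive nice :: "(complex \<Rightarrow> 's \<Rightarrow> complex) \<Rightarrow> 's set \<Rightarrow> (complex \<Rightarrow> complex \<Rightarrow> complex) \<Rightarrow> bool" for zz S where
  nice_const: "nice zz S (\<lambda>\<tau> u. c)"
| nice_var: "nice zz S (\<lambda>\<tau> u. u)"
| nice_inv: "s \<in> S \<Longrightarrow> nice zz S (\<lambda>\<tau> u. 1 / (u - zz \<tau> s))"
| nice_add: "nice zz S f \<Longrightarrow> nice zz S g \<Longrightarrow> nice zz S (\<lambda>\<tau> u. f \<tau> u + g \<tau> u)"
| nice_mult: "nice zz S f \<Longrightarrow> nice zz S g \<Longrightarrow> nice zz S (\<lambda>\<tau> u. f \<tau> u * g \<tau> u)"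

lemma nice_minus: "nice zz S f \<Longrightarrow> nice zz S g \<Longrightarrow> nice zz S (\<lambda>\<tau> u. f \<tau> u - g \<tau> u)"
  using nice_add[OF _ nice_mult[OF nice_const[where c = "-1"]], of zz S f g] by simp

lemma nice_sum: "(\<And>i. i \<in> A \<Longrightarrow> nice zz S (f i)) \<Longrightarrow> nice zz S (\<lambda>\<tau> u. \<Sum>i\<in>A. f i \<tau> u)"
  by (induction A rule: infinite_finite_induct) (auto intro: nice.intros)

lemma nice_prod: "(\<And>i. i \<in> A \<Longrightarrow> nice zz S (f i)) \<Longrightarrow> nice zz S (\<lambda>\<tau> u. \<Prod>i\<in>A. f i \<tau> u)"
  by (induction A rule: infinite_finite_induct) (auto intro: nice.intros)

lemma nice_power: "nice zz S f \<Longrightarrow> nice zz S (\<lambda>\<tau> u. f \<tau> u ^ n)"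
  by (induction n) (auto intro: nice.intros)

lemma nice_has_derivative:
  assumes "nice zz S f"
  shows "\<exists>f'. nice zz S f' \<and> (\<forall>\<tau> u. u \<notin> zz \<tau> ` S \<longrightarrow> (f \<tau> has_field_derivative f' \<tau> u) (at u))"
  using assms
proof induction
  case (nice_const c)
  show ?case by (rule exI[of _ "\<lambda>\<tau> u. 0"]) (auto intro: nice.intros)
next
  case nice_var
  show ?case by (rule exI[of _ "\<lambda>\<tau> u. 1"]) (auto intro: nice.intros)
next
  case (nice_inv s)
  have "nice zz S (\<lambda>\<tau> u. - 1 * (1 / (u - zz \<tau> s) * (1 / (u - zz \<tau> s))))"
    by (intro nice.intros nice_inv)
  moreover have "((\<lambda>u. 1 / (u - zz \<tau> s)) has_field_derivative - 1 * (1 / (u - zz \<tau> s) * (1 / (u - zz \<tau> s)))) (at u)"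
    if "u \<notin> zz \<tau> ` S" for \<tau> u
    using that nice_inv by (auto intro!: derivative_eq_intros simp: field_simps)
  ultimately show ?case by blast
next
  case (nice_add f g)
  then obtain f' g' where "nice zz S f'" "nice zz S g'"
    "\<forall>\<tau> u. u \<notin> zz \<tau> ` S \<longrightarrow> (f \<tau> has_field_derivative f' \<tau> u) (at u)"
    "\<forall>\<tau> u. u \<notin> zz \<tau> ` S \<longrightarrow> (g \<tau> has_field_derivative g' \<tau> u) (at u)" by blast
  then show ?case
    by (intro exI[of _ "\<lambda>\<tau> u. f' \<tau> u + g' \<tau> u"]) (auto intro!: nice.intros DERIV_add)
next
  case (nice_mult f g)
  then obtain f' g' where *: "nice zz S f'" "nice zz S g'"
    "\<forall>\<tau> u. u \<notin> zz \<tau> ` S \<longrightarrow> (f \<tau> has_field_derivative f' \<tau> u) (at u)"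
    "\<forall>\<tau> u. u \<notin> zz \<tau> ` S \<longrightarrow> (g \<tau> has_field_derivative g' \<tau> u) (at u)" by blast
  have "nice zz S (\<lambda>\<tau> u. f \<tau> u * g' \<tau> u + f' \<tau> u * g \<tau> u)"
    by (intro nice.intros *(1,2) nice_mult)
  then show ?case using *(3,4)
    by (intro exI[of _ "\<lambda>\<tau> u. f \<tau> u * g' \<tau> u + f' \<tau> u * g \<tau> u"]) (auto intro!: DERIV_mult')
qed

text \<open>Continuity in the parameter and the point jointly is what permits passing to the limit
  under a contour integral.\<close>

lemma nice_continuous:
  assumes "nice zz S f" "\<And>s. s \<in> S \<Longrightarrow> continuous_on UNIV (\<lambda>\<tau>. zz \<tau> s)"
  shows "continuous_on {p. snd p \<notin> zz (fst p) ` S} (\<lambda>p. f (fst p) (snd p))"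
  using assms(1)
proof induction
  case (nice_inv s)
  have "continuous_on {p. snd p \<notin> zz (fst p) ` S} (\<lambda>p. zz (fst p) s)"
    using continuous_on_compose2[OF assms(2)[OF nice_inv] continuous_on_fst[OF continuous_on_id]] by auto
  then show ?case using nice_inv by (auto intro!: continuous_intros)
qed (auto intro!: continuous_intros)

lemma nice_holomorphic:
  assumes "nice zz S f"
  shows "f \<tau> holomorphic_on - (zz \<tau> ` S)"
proof -
  obtain f' where "\<forall>\<tau> u. u \<notin> zz \<tau> ` S \<longrightarrow> (f \<tau> has_field_derivative f' \<tau> u) (at u)"
    using nice_has_derivative[OF assms] by blast
  then show ?thesis
    by (auto simp: holomorphic_on_def field_differentiable_def intro: DERIV_subset)
qed

section \<open>Laurent expansions and contour integrals\<close>

definition lexp :: "complex \<Rightarrow> (complex \<Rightarrow> 'i \<Rightarrow> complex) \<Rightarrow> ('i \<Rightarrow> complex fls) \<Rightarrow> bool" where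
  "lexp z0 f F \<longleftrightarrow> (\<forall>\<beta>. (\<lambda>t. f (z0 + t) \<beta>) has_laurent_expansion F \<beta>)"

lemma deriv_shift: "deriv f (z0 + t) = deriv (\<lambda>t. f (z0 + t)) t"
  unfolding deriv_def using DERIV_shift[of f _ t z0] by (simp add: add.commute)

lemma pole_laurent: "(\<lambda>t. 1 / (z0 + t - z s)) has_laurent_expansion pole z z0 s"
proof -
  have "(\<lambda>t. inverse (t + (z0 - z s))) has_laurent_expansion inverse (fls_X + fls_const (z0 - z s))"
    by (intro laurent_expansion_intros)
  then show ?thesis by (simp add: pole_def field_simps)
qed

text \<open>The expansion at a moving point \<open>w\<close> of a monomial that is centred at the
  fixed point \<open>z0\<close>.\<close>

definition pw :: "complex \<Rightarrow> complex \<Rightarrow> nat \<Rightarrow> ('i \<Rightarrow> complex) \<Rightarrow> 'i \<Rightarrow> complex fls" where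
  "pw z0 w l b = (\<lambda>\<beta>. fls_const (b \<beta>) * (fls_X + fls_const (w - z0)) ^ l)"

lemma lexp_pw: "lexp w (\<lambda>u \<beta>. b \<beta> * (u - z0) ^ l) (pw z0 w l b)"
  unfolding lexp_def pw_def
proof
  fix \<beta>
  have "(\<lambda>t. b \<beta> * (t + (w - z0)) ^ l) has_laurent_expansion fls_const (b \<beta>) * (fls_X + fls_const (w - z0)) ^ l"
    by (intro laurent_expansion_intros)
  then show "(\<lambda>t. b \<beta> * (w + t - z0) ^ l) has_laurent_expansion fls_const (b \<beta>) * (fls_X + fls_const (w - z0)) ^ l"
    by (simp add: algebra_simps)
qed

lemma linear_power_regular: "\<forall>n<0. fls_nth ((fls_X + fls_const c) ^ l) n = (0 :: complex)"
proof (induction l)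
  case (Suc l)
  have "\<forall>n<0. fls_nth (fls_X + fls_const c) n = (0 :: complex)" by auto
  from fls_mult_below[OF this Suc] show ?case by simp
qed simp

lemma cf_pw: "cf n (pw z0 w l b) = (\<lambda>\<beta>. fls_nth ((fls_X + fls_const (w - z0)) ^ l) n * b \<beta>)"
  by (auto simp: cf_def pw_def fun_eq_iff)

lemma ordge_pw: "ordge 0 (pw z0 w l b)"
  unfolding ordge_cf cf_pw using linear_power_regular by (auto simp: fun_eq_iff)

lemma pw_self: "pw z0 z0 l b = fmono (int l) b"
  by (auto simp: pw_def fmono_def fun_eq_iff fls_X_power_times_conv_shift mult.commute)

text \<open>The circle stays clear of the sites for all parameters in a closed disc. On the compact
  product of disc and circle the function is uniformly continuous, so the integrands converge
  uniformly.\<close>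

lemma nice_contour_limit:
  assumes h: "nice zz S h" and zz: "\<And>s. s \<in> S \<Longrightarrow> continuous_on UNIV (\<lambda>\<tau>. zz \<tau> s)" and "\<rho> > 0"
    and disj: "\<And>\<tau>. cmod \<tau> \<le> \<delta> \<Longrightarrow> sphere z0 \<rho> \<inter> zz \<tau> ` S = {}"
    and \<tau>: "\<And>n. cmod (\<tau> n) \<le> \<delta>" "\<tau> \<longlonglongrightarrow> 0"
  shows "(\<lambda>n. contour_integral (circlepath z0 \<rho>) (h (\<tau> n))) \<longlonglongrightarrow> contour_integral (circlepath z0 \<rho>) (h 0)"
    and "\<And>\<tau>. cmod \<tau> \<le> \<delta> \<Longrightarrow> h \<tau> contour_integrable_on circlepath z0 \<rho>"
proof -
  let ?C = "cball 0 \<delta> \<times> sphere z0 \<rho>"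
  have cont: "continuous_on ?C (\<lambda>p. h (fst p) (snd p))"
  proof (rule continuous_on_subset[OF nice_continuous[OF h zz]])
    show "?C \<subseteq> {p. snd p \<notin> zz (fst p) ` S}"
    proof
      fix p :: "complex \<times> complex" assume "p \<in> ?C"
      then have "cmod (fst p) \<le> \<delta>" "snd p \<in> sphere z0 \<rho>" by auto
      then have "snd p \<notin> zz (fst p) ` S" using disj[of "fst p"] by blast
      then show "p \<in> {p. snd p \<notin> zz (fst p) ` S}" by simp
    qed
  qed
  then have uc: "uniformly_continuous_on ?C (\<lambda>p. h (fst p) (snd p))"
    by (rule compact_uniformly_continuous) (intro compact_Times compact_cball compact_sphere)
  have int: "h \<tau> contour_integrable_on circlepath z0 \<rho>" if "cmod \<tau> \<le> \<delta>" for \<tau>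
  proof (rule contour_integrable_continuous_circlepath)
    have "continuous_on (sphere z0 \<rho>) (\<lambda>u. (\<lambda>p. h (fst p) (snd p)) (\<tau>, u))"
      by (rule continuous_on_compose2[OF cont]) (use that in \<open>auto intro!: continuous_intros\<close>)
    then show "continuous_on (path_image (circlepath z0 \<rho>)) (h \<tau>)" using \<open>\<rho> > 0\<close> by simp
  qed
  then show "\<And>\<tau>. cmod \<tau> \<le> \<delta> \<Longrightarrow> h \<tau> contour_integrable_on circlepath z0 \<rho>" .
  have \<delta>: "0 \<le> \<delta>" using \<tau>(1)[of 0] norm_ge_zero order_trans by blast
  have "uniform_limit (sphere z0 \<rho>) (\<lambda>n. h (\<tau> n)) (h 0) sequentially"
  proof (rule uniform_limitI)
    fix \<epsilon> :: real assume "\<epsilon> > 0"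
    with uc obtain d where d: "d > 0" "\<And>p q. p \<in> ?C \<Longrightarrow> q \<in> ?C \<Longrightarrow> dist q p < d \<Longrightarrow> dist (h (fst q) (snd q)) (h (fst p) (snd p)) < \<epsilon>"
      unfolding uniformly_continuous_on_def by metis
    have "\<forall>\<^sub>F n in sequentially. dist (\<tau> n) 0 < d" using \<tau>(2) d(1) by (rule tendstoD)
    then show "\<forall>\<^sub>F n in sequentially. \<forall>u\<in>sphere z0 \<rho>. dist (h (\<tau> n) u) (h 0 u) < \<epsilon>"
    proof eventually_elim
      case (elim n)
      show ?case
      proof
        fix u assume "u \<in> sphere z0 \<rho>"
        then show "dist (h (\<tau> n) u) (h 0 u) < \<epsilon>"
          using d(2)[of "(0, u)" "(\<tau> n, u)"] elim \<tau>(1)[of n] \<delta> by (simp add: dist_Pair_Pair)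
      qed
    qed
  qed
  then show "(\<lambda>n. contour_integral (circlepath z0 \<rho>) (h (\<tau> n))) \<longlonglongrightarrow> contour_integral (circlepath z0 \<rho>) (h 0)"
    by (intro contour_integral_uniform_limit_circlepath) (use int \<tau> \<open>\<rho> > 0\<close> in auto)
qed

text \<open>An expansion without negative powers has residue zero. Nothing is said about the values
  at the points of \<open>P\<close>, where formulas with division produce arbitrary ones.\<close>

lemma contour_integral_removable:
  assumes "finite P" "P \<subseteq> ball z0 \<rho>" "0 < \<rho>" "\<rho> < R" "g holomorphic_on ball z0 R - P"
    and "\<And>p. p \<in> P \<Longrightarrow> \<exists>G. (\<lambda>t. g (p + t)) has_laurent_expansion G \<and> (\<forall>n<0. fls_nth G n = 0)"
  shows "contour_integral (circlepath z0 \<rho>) g = 0"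
proof -
  have sub: "path_image (circlepath z0 \<rho>) \<subseteq> ball z0 R - P" using assms by (auto simp: sphere_def dist_norm)
  have "contour_integral (circlepath z0 \<rho>) g = 2 * pi * \<i> * (\<Sum>p\<in>P. winding_number (circlepath z0 \<rho>) p * residue g p)"
  proof (rule Residue_theorem)
    show "\<forall>z. z \<notin> ball z0 R \<longrightarrow> winding_number (circlepath z0 \<rho>) z = 0"
      using assms(3,4) by (auto intro!: winding_number_zero_outside[of _ "cball z0 \<rho>"])
  qed (use assms sub in auto)
  also have "(\<Sum>p\<in>P. winding_number (circlepath z0 \<rho>) p * residue g p) = 0"
  proof (intro sum.neutral ballI)
    fix p assume "p \<in> P"
    then obtain G where G: "(\<lambda>t. g (p + t)) has_laurent_expansion G" "\<forall>n<0. fls_nth G n = 0" using assms(6) by blast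
    then have "residue g p = 0" using has_laurent_expansion_residue[OF G(1)] by simp
    then show "winding_number (circlepath z0 \<rho>) p * residue g p = 0" by simp
  qed
  finally show ?thesis by simp
qed

lemma contour_integral_coefficient:
  assumes "0 < \<rho>" "\<rho> < R" "g holomorphic_on ball z0 R - {z0}" "(\<lambda>t. g (z0 + t)) has_laurent_expansion G"
  shows "contour_integral (circlepath z0 \<rho>) g = 2 * pi * \<i> * fls_nth G (-1)"
proof -
  have "contour_integral (circlepath z0 \<rho>) g = 2 * pi * \<i> * (\<Sum>p\<in>{z0}. winding_number (circlepath z0 \<rho>) p * residue g p)"
  proof (rule Residue_theorem)
    show "\<forall>z. z \<notin> ball z0 R \<longrightarrow> winding_number (circlepath z0 \<rho>) z = 0"
      using assms(1,2) by (auto intro!: winding_number_zero_outside[of _ "cball z0 \<rho>"])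
  qed (use assms in \<open>auto simp: sphere_def dist_norm\<close>)
  then show ?thesis
    using assms winding_number_circlepath_centre[of \<rho> z0] has_laurent_expansion_residue[OF assms(4)] by simp
qed

context gaudin
begin

section \<open>The differential operator on functions, with diagonal K\<close>

definition Xan :: "(nat \<Rightarrow> complex) \<Rightarrow> ('s \<Rightarrow> complex) \<Rightarrow> nat \<Rightarrow> nat \<Rightarrow> (complex \<Rightarrow> 'i \<Rightarrow> complex) \<Rightarrow> complex \<Rightarrow> 'i \<Rightarrow> complex" where
  "Xan K z a b f = (\<lambda>u \<beta>. (if a = b then deriv (\<lambda>t. f t \<beta>) u else 0) - (if a = b then K a else 0) * f u \<beta>
     - (\<Sum>s\<in>S. (\<Sum>\<gamma>\<in>I. e s b a \<beta> \<gamma> * f u \<gamma>) / (u - z s)))"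

definition Dan :: "(nat \<Rightarrow> complex) \<Rightarrow> ('s \<Rightarrow> complex) \<Rightarrow> (complex \<Rightarrow> 'i \<Rightarrow> complex) \<Rightarrow> complex \<Rightarrow> 'i \<Rightarrow> complex" where
  "Dan K z f = (\<lambda>u \<beta>. \<Sum>\<sigma> | \<sigma> permutes {1..N}.
     of_int (sign \<sigma>) * foldr (\<lambda>a. Xan K z a (\<sigma> a)) [1..<N+1] f u \<beta>)"

lemma lexp_Xan:
  assumes "lexp z0 f F"
  shows "lexp z0 (Xan K z a b f) (app (XX K S z z0 a b) F)"
  unfolding lexp_def
proof
  fix \<beta>
  have F: "(\<lambda>t. f (z0 + t) \<gamma>) has_laurent_expansion F \<gamma>" for \<gamma> using assms by (simp add: lexp_def)
  have 1: "(\<lambda>t. (if a = b then deriv (\<lambda>t. f t \<beta>) (z0 + t) else 0) - (if a = b then K a else 0) * f (z0 + t) \<beta>)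
    has_laurent_expansion (if a = b then fls_deriv (F \<beta>) else 0) - fls_const (if a = b then K a else 0) * F \<beta>"
    unfolding deriv_shift[of "\<lambda>t. f t \<beta>"]
    by (intro has_laurent_expansion_diff has_laurent_expansion_cmult_left F)
      (use has_laurent_expansion_deriv[OF F[of \<beta>]] in auto)
  have 2: "(\<lambda>t. \<Sum>s\<in>S. 1 / (z0 + t - z s) * (\<Sum>\<gamma>\<in>I. e s b a \<beta> \<gamma> * f (z0 + t) \<gamma>))
    has_laurent_expansion (\<Sum>s\<in>S. pole z z0 s * (\<Sum>\<gamma>\<in>I. fls_const (e s b a \<beta> \<gamma>) * F \<gamma>))"
    by (intro laurent_expansion_intros pole_laurent F)
  have "app (XX K S z z0 a b) F \<beta> = (if a = b then fls_deriv (F \<beta>) else 0) - fls_const (if a = b then K a else 0) * F \<beta>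
      - (\<Sum>s\<in>S. pole z z0 s * (\<Sum>\<gamma>\<in>I. fls_const (e s b a \<beta> \<gamma>) * F \<gamma>))"
    by (simp add: XX_def app_sum_left sum_fun_apply app_dd app_sc ef_def app_mk)
  then show "(\<lambda>t. Xan K z a b f (z0 + t) \<beta>) has_laurent_expansion app (XX K S z z0 a b) F \<beta>"
    using has_laurent_expansion_diff[OF 1 2] by (simp add: Xan_def)
qed

lemma lexp_Dan:
  assumes "lexp z0 f F"
  shows "lexp z0 (Dan K z f) (app (rdet N (XX K S z z0)) F)"
proof -
  have list: "lexp z0 (foldr (\<lambda>a. Xan K z a (\<sigma> a)) as f) (app (prod_list (map (\<lambda>a. XX K S z z0 a (\<sigma> a)) as)) F)" for \<sigma> :: "nat \<Rightarrow> nat" and as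
    by (induction as) (simp_all add: assms lexp_Xan)
  show ?thesis
    unfolding lexp_def
  proof
    fix \<beta>
    have "(\<lambda>t. of_int (sign \<sigma>) * foldr (\<lambda>a. Xan K z a (\<sigma> a)) [1..<N+1] f (z0 + t) \<beta>) has_laurent_expansion
      fls_const (of_int (sign \<sigma>)) * app (prod_list (map (\<lambda>a. XX K S z z0 a (\<sigma> a)) [1..<N+1])) F \<beta>" for \<sigma> :: "nat \<Rightarrow> nat"
      by (intro has_laurent_expansion_cmult_left) (use list[of \<sigma> "[1..<N+1]"] in \<open>unfold lexp_def, blast\<close>)
    then have "(\<lambda>t. Dan K z f (z0 + t) \<beta>) has_laurent_expansion
      (\<Sum>\<sigma> | \<sigma> permutes {1..N}. fls_const (of_int (sign \<sigma>)) * app (prod_list (map (\<lambda>a. XX K S z z0 a (\<sigma> a)) [1..<N+1])) F \<beta>)"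
      unfolding Dan_def by (rule has_laurent_expansion_sum)
    then show "(\<lambda>t. Dan K z f (z0 + t) \<beta>) has_laurent_expansion app (rdet N (XX K S z z0)) F \<beta>"
      unfolding rdet_def app_sum_left sum_fun_apply app_ring_simps(6) app_of_int fls_of_int[symmetric] .
  qed
qed

text \<open>Agreement can hold off the sites only, since division by zero spoils the values there.
  It passes to derivatives because the complement of the finitely many sites is open.\<close>

lemma nice_Xan:
  assumes "\<And>\<beta>. nice zz S (F \<beta>)" "\<And>\<tau> u \<beta>. u \<notin> zz \<tau> ` S \<Longrightarrow> f \<tau> u \<beta> = F \<beta> \<tau> u"
  shows "\<exists>G. (\<forall>\<beta>. nice zz S (G \<beta>)) \<and> (\<forall>\<tau> u \<beta>. u \<notin> zz \<tau> ` S \<longrightarrow> Xan K (zz \<tau>) a b (f \<tau>) u \<beta> = G \<beta> \<tau> u)"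
proof -
  have "\<forall>\<beta>. \<exists>F'. nice zz S F' \<and> (\<forall>\<tau> u. u \<notin> zz \<tau> ` S \<longrightarrow> (F \<beta> \<tau> has_field_derivative F' \<tau> u) (at u))"
    using nice_has_derivative[OF assms(1)] by blast
  then obtain F' where F': "\<And>\<beta>. nice zz S (F' \<beta>)" "\<And>\<beta> \<tau> u. u \<notin> zz \<tau> ` S \<Longrightarrow> (F \<beta> \<tau> has_field_derivative F' \<beta> \<tau> u) (at u)"
    using choice[of "\<lambda>\<beta> F'. nice zz S F' \<and> (\<forall>\<tau> u. u \<notin> zz \<tau> ` S \<longrightarrow> (F \<beta> \<tau> has_field_derivative F' \<tau> u) (at u))"] by blast
  define G where "G = (\<lambda>\<beta> \<tau> u. (if a = b then F' \<beta> \<tau> u else 0) - (if a = b then K a else 0) * F \<beta> \<tau> u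
     - (\<Sum>s\<in>S. (\<Sum>\<gamma>\<in>I. e s b a \<beta> \<gamma> * F \<gamma> \<tau> u) * (1 / (u - zz \<tau> s))))"
  have "nice zz S (\<lambda>\<tau> u. if a = b then F' \<beta> \<tau> u else 0)" for \<beta>
    by (cases "a = b") (auto intro: F' nice_const)
  then have "nice zz S (G \<beta>)" for \<beta>
    unfolding G_def by (intro nice_minus nice_sum nice_mult nice_inv nice_const assms(1))
  moreover have "Xan K (zz \<tau>) a b (f \<tau>) u \<beta> = G \<beta> \<tau> u" if u: "u \<notin> zz \<tau> ` S" for \<tau> u \<beta>
  proof -
    have "open (- (zz \<tau> ` S))" using finS by (simp add: finite_imp_closed open_Compl)
    then have "((\<lambda>t. f \<tau> t \<beta>) has_field_derivative F' \<beta> \<tau> u) (at u)"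
      using u by (intro has_field_derivative_transform_within_open[OF F'(2)[OF u, of \<beta>]]) (auto simp: assms(2))
    then have "deriv (\<lambda>t. f \<tau> t \<beta>) u = F' \<beta> \<tau> u" by (rule DERIV_imp_deriv)
    then show ?thesis using u by (simp add: Xan_def G_def assms(2))
  qed
  ultimately show ?thesis by blast
qed

lemma nice_Dan:
  assumes "\<And>\<beta>. nice zz S (F \<beta>)"
  shows "\<exists>G. (\<forall>\<beta>. nice zz S (G \<beta>)) \<and> (\<forall>\<tau> u \<beta>. u \<notin> zz \<tau> ` S \<longrightarrow> Dan K (zz \<tau>) (\<lambda>u \<beta>. F \<beta> \<tau> u) u \<beta> = G \<beta> \<tau> u)"
proof -
  have list: "\<exists>G. (\<forall>\<beta>. nice zz S (G \<beta>)) \<and> (\<forall>\<tau> u \<beta>. u \<notin> zz \<tau> ` S \<longrightarrow>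
    foldr (\<lambda>a. Xan K (zz \<tau>) a (\<sigma> a)) as (\<lambda>u \<beta>. F \<beta> \<tau> u) u \<beta> = G \<beta> \<tau> u)" for \<sigma> :: "nat \<Rightarrow> nat" and as
  proof (induction as)
    case Nil
    show ?case by (rule exI[of _ F]) (simp add: assms)
  next
    case (Cons a as)
    then obtain G where "\<forall>\<beta>. nice zz S (G \<beta>)" "\<forall>\<tau> u \<beta>. u \<notin> zz \<tau> ` S \<longrightarrow>
      foldr (\<lambda>a. Xan K (zz \<tau>) a (\<sigma> a)) as (\<lambda>u \<beta>. F \<beta> \<tau> u) u \<beta> = G \<beta> \<tau> u" by blast
    then show ?case
      using nice_Xan[of zz G "\<lambda>\<tau>. foldr (\<lambda>a. Xan K (zz \<tau>) a (\<sigma> a)) as (\<lambda>u \<beta>. F \<beta> \<tau> u)" K a "\<sigma> a"] by simp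
  qed
  define G where "G = (\<lambda>\<sigma> :: nat \<Rightarrow> nat. SOME G. (\<forall>\<beta>. nice zz S (G \<beta>)) \<and> (\<forall>\<tau> u \<beta>. u \<notin> zz \<tau> ` S \<longrightarrow>
    foldr (\<lambda>a. Xan K (zz \<tau>) a (\<sigma> a)) [1..<N+1] (\<lambda>u \<beta>. F \<beta> \<tau> u) u \<beta> = G \<beta> \<tau> u))"
  have G: "(\<forall>\<beta>. nice zz S (G \<sigma> \<beta>)) \<and> (\<forall>\<tau> u \<beta>. u \<notin> zz \<tau> ` S \<longrightarrow>
    foldr (\<lambda>a. Xan K (zz \<tau>) a (\<sigma> a)) [1..<N+1] (\<lambda>u \<beta>. F \<beta> \<tau> u) u \<beta> = G \<sigma> \<beta> \<tau> u)" for \<sigma> :: "nat \<Rightarrow> nat"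
    unfolding G_def by (rule someI_ex[OF list])
  show ?thesis
  proof (intro exI conjI allI impI)
    fix \<beta>
    show "nice zz S (\<lambda>\<tau> u. \<Sum>\<sigma> | \<sigma> permutes {1..N}. of_int (sign \<sigma>) * G \<sigma> \<beta> \<tau> u)"
      using G by (intro nice_sum nice_mult nice_const) blast
  next
    fix \<tau> u \<beta> assume "u \<notin> zz \<tau> ` S"
    then show "Dan K (zz \<tau>) (\<lambda>u \<beta>. F \<beta> \<tau> u) u \<beta> = (\<Sum>\<sigma> | \<sigma> permutes {1..N}. of_int (sign \<sigma>) * G \<sigma> \<beta> \<tau> u)"
      unfolding Dan_def using G by (intro sum.cong refl) presburger
  qed
qed

end

lemma finite_family_convergent_subseq:
  fixes y :: "nat \<Rightarrow> 'j \<Rightarrow> complex"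
  assumes "finite J" "\<And>n i. i \<in> J \<Longrightarrow> cmod (y n i) \<le> c"
  shows "\<exists>r Y. strict_mono r \<and> (\<forall>i\<in>J. (\<lambda>n. y (r n) i) \<longlonglongrightarrow> Y i)"
  using assms
proof (induction J rule: finite_induct)
  case empty
  show ?case by (intro exI[of _ "\<lambda>n. n"]) (simp add: strict_mono_def)
next
  case (insert i J)
  then obtain r Y where r: "strict_mono r" "\<forall>i\<in>J. (\<lambda>n. y (r n) i) \<longlonglongrightarrow> Y i" by blast
  have "\<forall>n. y (r n) i \<in> cball 0 c" using insert.prems by simp
  then obtain l s where s: "strict_mono s" "((\<lambda>n. y (r n) i) \<circ> s) \<longlonglongrightarrow> l"
    using compact_cball[of 0 c] unfolding compact_def by metis
  have "(\<lambda>n. y (r (s n)) j) \<longlonglongrightarrow> Y j" if "j \<in> J" for j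
    using LIMSEQ_subseq_LIMSEQ[OF r(2)[rule_format, OF that] s(1)] by (simp add: comp_def)
  then show ?case
    using s strict_mono_o[OF r(1) s(1)] insert.hyps
    by (intro exI[of _ "r \<circ> s"] exI[of _ "Y(i := l)"]) (auto simp: comp_def)
qed

lemma eventually_not_in_finite:
  assumes "finite (A :: complex set)"
  shows "\<forall>\<^sub>F t in at 0. w + t \<notin> A"
proof -
  have "open (- (A - {w}))" using assms by (intro open_Compl finite_imp_closed) simp
  then have "\<forall>\<^sub>F u in at w. u \<notin> A"
    unfolding eventually_at_topological by (intro exI[of _ "- (A - {w})"]) auto
  then show ?thesis unfolding eventually_at_to_0[of _ w] by (simp add: add.commute)
qed

lemma fmono_zero: "fmono l 0 = 0"
  by (auto simp: fmono_def fun_eq_iff)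

context gaudin
begin

lemma rdet_linear:
  "app (rdet N (XX K S z w)) (\<Sum>i\<in>J. app (sc (fls_const (y i))) (x i))
    = (\<Sum>i\<in>J. app (sc (fls_const (y i))) (app (rdet N (XX K S z w)) (x i)))"
  unfolding app_sum by (intro sum.cong refl) (rule app_eqD[OF rdet_sc_commute[symmetric]])

lemma wspace_sum: "(\<And>i. i \<in> A \<Longrightarrow> x i \<in> wspace m) \<Longrightarrow> (\<Sum>i\<in>A. x i) \<in> wspace m"
  by (induction A rule: infinite_finite_induct)
    (simp_all only: wspace_0 wspace_add sum.infinite sum.empty sum.insert not_False_eq_True insert_iff simp_thms)

lemma cf_pw_wspace: "b \<in> wspace m \<Longrightarrow> cf n (pw z0 w l b) \<in> wspace m"
  unfolding cf_pw by (rule wspace_scale)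

text \<open>
  The unknowns are indexed by \<open>J\<close>: for each \<open>l\<close> a basis of a complement of the kernel of \<open>P0 Q l\<close>, and the
  additional \<open>(l0, v)\<close>. The moments of \<open>D f\<close> along a circle around all sites in \<open>Q\<close> vanish before merging,
  and this passes to the limit.
\<close>

lemma frobenius_limit:
  assumes Q: "Q \<subseteq> S" and z: "\<And>s. s \<in> S - Q \<Longrightarrow> z s \<noteq> z0" "\<And>s. s \<in> Q \<Longrightarrow> z s = z0"
    and vec: "\<And>p a b c d \<beta> \<gamma>. p \<in> Q \<Longrightarrow> a \<in> {1..N} \<Longrightarrow> b \<in> {1..N} \<Longrightarrow> c \<in> {1..N} \<Longrightarrow> d \<in> {1..N} \<Longrightarrow> \<gamma> \<in> I \<Longrightarrow>
      (\<Sum>\<delta>\<in>I. e p a b \<beta> \<delta> * e p c d \<delta> \<gamma>) = (if b = c then e p a d \<beta> \<gamma> else 0)"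
    and unit: "\<And>p \<beta> \<gamma>. p \<in> Q \<Longrightarrow> \<beta> \<in> I \<Longrightarrow> \<gamma> \<in> I \<Longrightarrow> (\<Sum>c=1..N. e p c c \<beta> \<gamma>) = (if \<beta> = \<gamma> then 1 else 0)"
    and v: "v \<in> wspace m" "app (P0 Q (of_nat l0)) v = 0" and l0: "l0 < N + card Q"
  shows "\<exists>f. (\<forall>l. f l \<in> wspace m) \<and> f l0 = v \<and> (\<forall>l<l0. f l = 0) \<and>
    ordge (int (card Q)) (app (rdet N (XX K S z z0)) (\<Sum>l<N + card Q. fmono (int l) (f l)))"
proof (cases "v = 0")
  case True
  have "(\<Sum>l<N + card Q. fmono (int l) 0) = (0 :: 'i \<Rightarrow> complex fls)" by (simp only: fmono_zero sum.neutral_const)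
  then show ?thesis using True
    by (intro exI[of _ "\<lambda>l. 0"]) (simp only: wspace_0 app_0 ordge_simps(1) simp_thms)
next
  case False
  define k where "k = card Q"
  define U where "U = wspace m"
  have finQ: "finite Q" using Q finS finite_subset by blast
  obtain c :: "'s \<Rightarrow> complex" where c: "inj_on c Q"
  proof -
    obtain g :: "'s \<Rightarrow> nat" where "inj_on g Q" using finite_imp_inj_to_nat_seg[OF finQ] by blast
    then have "inj_on (\<lambda>s. of_nat (g s) :: complex) Q" by (auto simp: inj_on_def)
    then show ?thesis using that by blast
  qed
  \<comment> \<open>Distinct directions \<open>c s\<close> keep the vector sites apart for \<tau>
    \<noteq> 0, and they all meet in \<open>z0\<close> at \<tau> = 0.\<close>
  define zz where "zz = (\<lambda>\<tau> s. if s \<in> Q then z0 + \<tau> * c s else z s)"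
  have zz0: "zz 0 = z" using z(2) by (auto simp: zz_def fun_eq_iff)
  have zz_cont: "continuous_on UNIV (\<lambda>\<tau>. zz \<tau> s)" for s
    by (cases "s \<in> Q") (auto simp: zz_def intro!: continuous_intros)

  have U_fin: "finite B \<and> card B \<le> card (dirac ` I)" if "fv.independent B" "B \<subseteq> U" for B
  proof (rule fv.independent_span_bound)
    show "finite (dirac ` I)" using finI by simp
    show "B \<subseteq> fv.span (dirac ` I)"
      using that finite_support_span[OF finI] by (auto simp: U_def wspace_def)
  qed (use that in auto)
  obtain B0 where B0: "B0 \<subseteq> U" "fv.independent B0" "U \<subseteq> fv.span B0"
    using fv.maximal_independent_subset[of U] by blast
  have finB0: "finite B0" using U_fin B0 by blast
  define Kl where "Kl = (\<lambda>l. {u \<in> U. app (P0 Q (of_nat l)) u = 0})"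
  \<comment> \<open>\<open>BL l\<close> is a basis of the kernel at the exponent l, containing
    \<open>v\<close> at \<open>l0\<close>; it is extended to a basis \<open>BU l\<close> of the
    weight space, so that \<open>BU l - BL l\<close> spans a complement of the kernel.\<close>
  have "\<exists>BL BU. (if l = l0 then {v} else {}) \<subseteq> BL \<and> BL \<subseteq> Kl l \<and> fv.independent BL \<and> Kl l \<subseteq> fv.span BL \<and>
      BL \<subseteq> BU \<and> BU \<subseteq> U \<and> fv.independent BU \<and> U \<subseteq> fv.span BU" for l
  proof -
    have 1: "(if l = l0 then {v} else {}) \<subseteq> Kl l" using v by (auto simp: Kl_def U_def)
    have "fv.independent {v}"
      by (rule fv.independent_insertI) (use False in \<open>simp_all add: fv.span_empty fv.independent_empty\<close>)
    then have 2: "fv.independent (if l = l0 then {v} else {})"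
      by (simp add: fv.independent_empty)
    obtain BL where BL: "(if l = l0 then {v} else {}) \<subseteq> BL" "BL \<subseteq> Kl l" "fv.independent BL" "Kl l \<subseteq> fv.span BL"
      using fv.maximal_independent_subset_extend[OF 1 2] by blast
    have "BL \<subseteq> U" using BL(2) by (auto simp: Kl_def)
    obtain BU where "BL \<subseteq> BU" "BU \<subseteq> U" "fv.independent BU" "U \<subseteq> fv.span BU"
      using fv.maximal_independent_subset_extend[OF \<open>BL \<subseteq> U\<close> BL(3)] by blast
    with BL show ?thesis by blast
  qed
  then obtain BL BU where B: "\<And>l. (if l = l0 then {v} else {}) \<subseteq> BL l" "\<And>l. BL l \<subseteq> Kl l" "\<And>l. fv.independent (BL l)"
    "\<And>l. Kl l \<subseteq> fv.span (BL l)" "\<And>l. BL l \<subseteq> BU l" "\<And>l. BU l \<subseteq> U" "\<And>l. fv.independent (BU l)" "\<And>l. U \<subseteq> fv.span (BU l)"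
    by metis
  have finB: "finite (BU l)" "finite (BL l)" for l
    using U_fin[OF B(7,6)[of l]] finite_subset[OF B(5)[of l]] by auto
  have cardBU: "card (BU l) = card B0" for l
    using fv.independent_span_bound[OF finB0 B(7)[of l]] fv.independent_span_bound[OF finB(1) B0(2), of l] B(6,8)[of l] B0(1,3)
    by (meson le_antisym subset_trans)
  define J1 where "J1 = Sigma {..<N + k} (\<lambda>l. BU l - BL l)"
  define J where "J = insert (l0, v) J1"
  have v_BL: "v \<in> BL l0" using B(1)[of l0] by simp
  have finJ1: "finite J1" unfolding J1_def using finB by auto
  have finJ: "finite J" unfolding J_def using finJ1 by simp
  have J_U: "l < N + k \<and> b \<in> U" if "(l, b) \<in> J" for l b
    using that l0 v B(6)[of l] by (auto simp: J_def J1_def U_def k_def)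
  \<comment> \<open>There are (N + k) dim U basis vectors, from which at most N dim U in kernels are
    removed, and one, \<open>v\<close>, is put back. This exceeds the k dim U residue
    conditions.\<close>
  have cardJ: "k * card B0 < card J"
  proof -
    have "card J = Suc (card J1)"
      unfolding J_def using v_BL by (intro card_insert_disjoint finJ1) (auto simp: J1_def)
    moreover have "card J1 = (\<Sum>l<N + k. card (BU l) - card (BL l))"
      unfolding J1_def using finB B(5) by (subst card_SigmaI) (auto simp: card_Diff_subset)
    moreover have "(\<Sum>l<N + k. card (BU l) - card (BL l)) + (\<Sum>l<N + k. card (BL l)) = (N + k) * card B0"
    proof -
      have "(\<Sum>l<N + k. card (BU l) - card (BL l)) + (\<Sum>l<N + k. card (BL l)) = (\<Sum>l<N + k. card (BU l))"
        unfolding sum.distrib[symmetric] by (intro sum.cong refl) (use card_mono[OF finB(1) B(5)] in simp)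
      then show ?thesis by (simp add: cardBU)
    qed
    moreover have "(\<Sum>l<N + k. card (BL l)) \<le> N * card B0"
    proof (rule sum_card_kernel_le[OF _ finB0 B0(3)])
      show "finite (BL l) \<and> fv.independent (BL l) \<and> BL l \<subseteq> U \<and> (\<forall>b\<in>BL l. app (P0 Q (of_nat l)) b = 0)" for l
        using finB(2)[of l] B(2,3)[of l] by (auto simp: Kl_def)
    qed simp
    ultimately show ?thesis by (simp add: algebra_simps)
  qed

  have "\<exists>G. (\<forall>\<beta>. nice zz S (G \<beta>)) \<and> (\<forall>\<tau> u \<beta>. u \<notin> zz \<tau> ` S \<longrightarrow> Dan K (zz \<tau>) (\<lambda>u \<beta>. snd i \<beta> * (u - z0) ^ fst i) u \<beta> = G \<beta> \<tau> u)"
    for i :: "nat \<times> ('i \<Rightarrow> complex)"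
  proof (rule nice_Dan)
    show "nice zz S (\<lambda>\<tau> u. snd i \<beta> * (u - z0) ^ fst i)" for \<beta>
      by (intro nice_mult nice_power nice_minus nice_const nice_var)
  qed
  then obtain G where G: "\<And>i \<beta>. nice zz S (G i \<beta>)" "\<And>i \<tau> u \<beta>. u \<notin> zz \<tau> ` S \<Longrightarrow>
      Dan K (zz \<tau>) (\<lambda>u \<beta>. snd i \<beta> * (u - z0) ^ fst i) u \<beta> = G i \<beta> \<tau> u"
    by metis
  \<comment> \<open>One polynomial with coefficients \<open>y\<close>, expanded at a variable point:
    at the moving sites for the residue conditions and at \<open>z0\<close> for the limit.\<close>
  define EE where "EE = (\<lambda>y w. \<Sum>i\<in>J. app (sc (fls_const (y i))) (pw z0 w (fst i) (snd i)))"
  have GE: "(\<lambda>t. \<Sum>i\<in>J. y i * G i \<beta> \<tau> (w + t)) has_laurent_expansion app (rdet N (XX K S (zz \<tau>) w)) (EE y w) \<beta>" for y \<tau> w \<beta>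
  proof -
    have "(\<lambda>t. G i \<beta> \<tau> (w + t)) has_laurent_expansion app (rdet N (XX K S (zz \<tau>) w)) (pw z0 w (fst i) (snd i)) \<beta>" for i
    proof -
      have "\<forall>\<^sub>F t in at 0. w + t \<notin> zz \<tau> ` S" using finS by (intro eventually_not_in_finite) simp
      then have 1: "\<forall>\<^sub>F t in at 0. Dan K (zz \<tau>) (\<lambda>u \<beta>. snd i \<beta> * (u - z0) ^ fst i) (w + t) \<beta> = G i \<beta> \<tau> (w + t)"
        by eventually_elim (rule G(2))
      have 2: "(\<lambda>t. Dan K (zz \<tau>) (\<lambda>u \<beta>. snd i \<beta> * (u - z0) ^ fst i) (w + t) \<beta>) has_laurent_expansion
          app (rdet N (XX K S (zz \<tau>) w)) (pw z0 w (fst i) (snd i)) \<beta>"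
        using lexp_Dan[OF lexp_pw[of w "snd i" z0 "fst i"], of K "zz \<tau>"] unfolding lexp_def by blast
      show ?thesis by (rule iffD1[OF has_laurent_expansion_cong[OF 1 refl] 2])
    qed
    then have "(\<lambda>t. \<Sum>i\<in>J. y i * G i \<beta> \<tau> (w + t)) has_laurent_expansion
      (\<Sum>i\<in>J. fls_const (y i) * app (rdet N (XX K S (zz \<tau>) w)) (pw z0 w (fst i) (snd i)) \<beta>)"
      by (intro laurent_expansion_intros)
    moreover have "app (rdet N (XX K S (zz \<tau>) w)) (EE y w) \<beta>
      = (\<Sum>i\<in>J. fls_const (y i) * app (rdet N (XX K S (zz \<tau>) w)) (pw z0 w (fst i) (snd i)) \<beta>)"
      unfolding EE_def rdet_linear by (simp only: sum_fun_apply app_sc)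
    ultimately show ?thesis by (simp only:)
  qed

  obtain R where R: "R > 0" "\<And>s. s \<in> S - Q \<Longrightarrow> z s \<notin> ball z0 R"
  proof -
    have "finite (z ` (S - Q))" "z0 \<notin> z ` (S - Q)" using finS z(1) by auto
    then obtain R where R: "R > 0" "\<forall>x\<in>z ` (S - Q). x \<noteq> z0 \<longrightarrow> R \<le> dist z0 x"
      using finite_set_avoid[of "z ` (S - Q)" z0] by blast
    have "z s \<notin> ball z0 R" if "s \<in> S - Q" for s
      using R(2) z(1)[OF that] that by (auto simp: not_less)
    then show ?thesis using that R(1) by blast
  qed
  define \<rho> where "\<rho> = R / 2"
  have \<rho>: "0 < \<rho>" "\<rho> < R" using R by (auto simp: \<rho>_def)
  \<comment> \<open>For all parameters of size at most \<delta> the merging sites stay inside the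
    circle of radius \<rho>, while the other sites are outside the larger disc.\<close>
  obtain \<delta> where \<delta>: "\<delta> > 0" "\<And>s. s \<in> Q \<Longrightarrow> \<delta> * cmod (c s) < \<rho>"
  proof -
    define C where "C = (\<Sum>s\<in>Q. cmod (c s)) + 1"
    have C: "C > 0" by (simp add: C_def add_nonneg_pos sum_nonneg)
    have "cmod (c s) < C" if "s \<in> Q" for s
      unfolding C_def using member_le_sum[OF that, of "\<lambda>s. cmod (c s)"] finQ by auto
    then have "\<rho> / C * cmod (c s) < \<rho>" if "s \<in> Q" for s
      using that C \<rho>(1) by (simp add: divide_less_eq mult.commute)
    moreover have "\<rho> / C > 0" using C \<rho> by simp
    ultimately show ?thesis using that by blast
  qed
  have zzQ: "zz \<tau> s \<in> ball z0 \<rho>" if "s \<in> Q" "cmod \<tau> \<le> \<delta>" for \<tau> s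
  proof -
    have "cmod \<tau> * cmod (c s) \<le> \<delta> * cmod (c s)" using that by (intro mult_right_mono) auto
    then show ?thesis using \<delta>(2)[OF that(1)] that(1) by (simp add: zz_def dist_norm norm_mult)
  qed
  have zzS: "zz \<tau> s \<notin> ball z0 R" if "s \<in> S - Q" for \<tau> s
    using R(2)[OF that] that by (simp add: zz_def)
  have disj: "sphere z0 \<rho> \<inter> zz \<tau> ` S = {}" if "cmod \<tau> \<le> \<delta>" for \<tau>
  proof -
    have "zz \<tau> s \<notin> sphere z0 \<rho>" if "s \<in> S" for s
      using zzQ[OF _ \<open>cmod \<tau> \<le> \<delta>\<close>, of s] zzS[of s \<tau>] \<rho> that by (cases "s \<in> Q") auto
    then show ?thesis by blast
  qed
  have zz_inj: "zz \<tau> s \<noteq> zz \<tau> p" if "p \<in> Q" "s \<in> S - {p}" "cmod \<tau> \<le> \<delta>" "\<tau> \<noteq> 0" for \<tau> p s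
  proof (cases "s \<in> Q")
    case True
    then show ?thesis using that c by (auto simp: zz_def inj_on_def)
  next
    case False
    then show ?thesis using zzS[of s \<tau>] zzQ[OF that(1,3)] that \<rho> by auto
  qed

  \<comment> \<open>Division by the k linear factors is compensated by the zeros at the vector
    sites. At \<tau> = 0 the integral of such a moment is, up to 2 \<pi> i, the coefficient of order
    k - 1 - j of the image under the operator.\<close>
  define Gj where "Gj = (\<lambda>j i \<beta> \<tau> u. G i \<beta> \<tau> u * (u - z0) ^ j * (\<Prod>s\<in>Q. 1 / (u - zz \<tau> s)))"
  have Gj: "nice zz S (Gj j i \<beta>)" for j i \<beta>
    unfolding Gj_def using Q
    by (intro nice_mult nice_power nice_minus nice_const nice_var nice_prod nice_inv G(1)) auto
  have GjE: "(\<lambda>t. \<Sum>i\<in>J. y i * Gj j i \<beta> \<tau> (w + t)) has_laurent_expansion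
     app (rdet N (XX K S (zz \<tau>) w)) (EE y w) \<beta> * (fls_X + fls_const (w - z0)) ^ j * (\<Prod>s\<in>Q. pole (zz \<tau>) w s)" for y j \<tau> w \<beta>
  proof -
    have "(\<lambda>t. (t + (w - z0)) ^ j) has_laurent_expansion (fls_X + fls_const (w - z0)) ^ j"
      by (intro laurent_expansion_intros)
    then have 1: "(\<lambda>t. (w + t - z0) ^ j) has_laurent_expansion (fls_X + fls_const (w - z0)) ^ j"
      by (simp add: algebra_simps)
    have 2: "(\<lambda>t. \<Prod>s\<in>Q. 1 / (w + t - zz \<tau> s)) has_laurent_expansion (\<Prod>s\<in>Q. pole (zz \<tau>) w s)"
      by (intro has_laurent_expansion_prod pole_laurent)
    have "(\<lambda>t. (\<Sum>i\<in>J. y i * G i \<beta> \<tau> (w + t)) * (w + t - z0) ^ j * (\<Prod>s\<in>Q. 1 / (w + t - zz \<tau> s))) has_laurent_expansion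
      app (rdet N (XX K S (zz \<tau>) w)) (EE y w) \<beta> * (fls_X + fls_const (w - z0)) ^ j * (\<Prod>s\<in>Q. pole (zz \<tau>) w s)"
      by (intro has_laurent_expansion_mult GE 1 2)
    then show ?thesis unfolding Gj_def sum_distrib_right by (simp only: mult.assoc)
  qed
  have hol: "(\<lambda>u. \<Sum>i\<in>J. y i * Gj j i \<beta> \<tau> u) holomorphic_on ball z0 R - zz \<tau> ` Q" for y j \<beta> \<tau>
  proof -
    have "nice zz S (\<lambda>\<tau> u. \<Sum>i\<in>J. y i * Gj j i \<beta> \<tau> u)" by (intro nice_sum nice_mult nice_const Gj)
    from nice_holomorphic[OF this, of \<tau>] show ?thesis
      by (rule holomorphic_on_subset) (use zzS[of _ \<tau>] in blast)
  qed
  have EE_ord: "ordge 0 (EE y w)" for y w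
    unfolding EE_def by (intro ordge_sum ordge_sc fls_const_regular ordge_pw)
  have EE_U: "cf n (EE y w) \<in> U" for y w n
    unfolding EE_def cf_sum cf_sc_const unfolding app_sc U_def
    by (intro wspace_sum wspace_scale cf_pw_wspace) (use J_U in \<open>auto simp: U_def\<close>)
  have EE_unit: "app (\<Sum>a=1..N. efl p a a) (EE y w) = EE y w" if p: "p \<in> Q" for p y w
  proof (rule ext)
    fix \<beta>
    have supp0: "EE y w \<gamma> = 0" if "\<gamma> \<notin> I" for \<gamma>
    proof (rule fls_eqI)
      fix n show "fls_nth (EE y w \<gamma>) n = fls_nth 0 n"
        using EE_U[of n y w] that by (auto simp: U_def wspace_def cf_def)
    qed
    have "app (\<Sum>a=1..N. efl p a a) (EE y w) \<beta> = (\<Sum>\<gamma>\<in>I. fls_const (\<Sum>a=1..N. e p a a \<beta> \<gamma>) * EE y w \<gamma>)"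
      unfolding ef_def mk_sum[OF chom_fls_const] app_mk ..
    also have "\<dots> = EE y w \<beta>"
    proof (cases "\<beta> \<in> I")
      case True
      have "(\<Sum>\<gamma>\<in>I. fls_const (\<Sum>a=1..N. e p a a \<beta> \<gamma>) * EE y w \<gamma>) = (\<Sum>\<gamma>\<in>I. if \<beta> = \<gamma> then EE y w \<gamma> else 0)"
      proof (intro sum.cong refl)
        fix \<gamma> assume "\<gamma> \<in> I"
        show "fls_const (\<Sum>a=1..N. e p a a \<beta> \<gamma>) * EE y w \<gamma> = (if \<beta> = \<gamma> then EE y w \<gamma> else 0)"
          unfolding unit[OF p True \<open>\<gamma> \<in> I\<close>] by simp
      qed
      then show ?thesis using True finI by simp
    next
      case False
      then show ?thesis using supp p Q by (subst supp0) (auto simp: subset_iff)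
    qed
    finally show "app (\<Sum>a=1..N. efl p a a) (EE y w) \<beta> = EE y w \<beta>" .
  qed

  \<comment> \<open>Any null sequence of nonzero parameters in the disc would do; nonzero keeps the
    sites distinct.\<close>
  define \<tau> where "\<tau> = (\<lambda>n. of_real (\<delta> / real (Suc n)) :: complex)"
  have \<tau>: "cmod (\<tau> n) \<le> \<delta>" "\<tau> n \<noteq> 0" for n
  proof -
    have 1: "cmod (\<tau> n) = \<delta> / real (Suc n)" unfolding \<tau>_def norm_of_real using \<delta>(1) by simp
    have "\<delta> / real (Suc n) \<le> \<delta> / 1" using \<delta>(1) by (intro divide_left_mono) auto
    then show "cmod (\<tau> n) \<le> \<delta>" unfolding 1 by simp
    have "cmod (\<tau> n) \<noteq> 0" unfolding 1 using \<delta>(1) by simp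
    then show "\<tau> n \<noteq> 0" by simp
  qed
  have \<tau>_lim: "\<tau> \<longlonglongrightarrow> 0"
  proof -
    have "(\<lambda>n. \<delta> / real (Suc n)) \<longlonglongrightarrow> 0"
      using LIMSEQ_Suc[OF lim_const_over_n[of \<delta>]] by simp
    from tendsto_of_real[OF this, where 'a = complex] show ?thesis by (simp add: \<tau>_def)
  qed

  \<comment> \<open>The residues at the k sites together form a vector in k copies of the weight
    space, of smaller dimension than the number of unknowns.\<close>
  have "\<exists>y. (\<Sum>i\<in>J. cmod (y i)) = 1 \<and> (\<forall>p\<in>Q. cf (-1) (app (rdet N (XX K S (zz (\<tau> n)) (zz (\<tau> n) p))) (EE y (zz (\<tau> n) p))) = 0)" for n
  proof -
    define r where "r = (\<lambda>p i. cf (-1) (app (rdet N (XX K S (zz (\<tau> n)) (zz (\<tau> n) p))) (pw z0 (zz (\<tau> n) p) (fst i) (snd i))))"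
    define emb where "emb = (\<lambda>p (u :: 'i \<Rightarrow> complex) (x :: 's \<times> 'i). if fst x = p then u (snd x) else 0)"
    define Tb where "Tb = (\<lambda>(p, b). emb p b) ` (Q \<times> B0)"
    have Tb: "finite Tb" "card Tb \<le> k * card B0"
      unfolding Tb_def k_def using finQ finB0 card_image_le[of "Q \<times> B0"] by (auto simp: card_cartesian_product)
    have emb_span: "emb p u \<in> fv.span Tb" if "p \<in> Q" "u \<in> fv.span B0" for p u
      using that(2)
    proof (induction rule: fv.span_induct_alt)
      case base
      have "emb p 0 = 0" by (auto simp: emb_def fun_eq_iff)
      then show ?case using fv.span_zero by (simp only:)
    next
      case (step c x y)
      have lin: "emb p ((\<lambda>\<beta>. c * x \<beta>) + y) = (\<lambda>q. c * emb p x q) + emb p y"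
        by (auto simp: emb_def fun_eq_iff)
      have "emb p x \<in> fv.span Tb"
        by (rule fv.span_base) (use step that in \<open>auto simp: Tb_def\<close>)
      then show ?case unfolding lin by (intro fv.span_add fv.span_scale step.IH)
    qed
    define q where "q = (\<lambda>i. \<Sum>p\<in>Q. emb p (r p i))"
    have "q i \<in> fv.span Tb" if "i \<in> J" for i
    proof -
      have "snd i \<in> U" using J_U[of "fst i" "snd i"] that by simp
      then have "r p i \<in> U" for p
        unfolding r_def U_def by (intro rdet_wspace cf_pw_wspace)
      then show ?thesis unfolding q_def using B0(3) by (intro fv.span_sum emb_span) auto
    qed
    moreover have "card Tb < card J" using Tb(2) cardJ by linarith
    ultimately obtain y where y: "\<exists>i\<in>J. y i \<noteq> 0" "\<forall>x. (\<Sum>i\<in>J. y i * q i x) = 0"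
      using family_dependent[OF finJ Tb(1)] by blast
    define C where "C = (\<Sum>i\<in>J. cmod (y i))"
    obtain i0 where i0: "i0 \<in> J" "y i0 \<noteq> 0" using y(1) by blast
    then have "0 < cmod (y i0)" by simp
    also have "\<dots> \<le> C" unfolding C_def by (rule member_le_sum) (use i0 finJ in auto)
    finally have C: "C > 0" .
    \<comment> \<open>Normalisation, so that a limit of such coefficient vectors exists along a
      subsequence and is nonzero.\<close>
    define y' where "y' = (\<lambda>i. y i / of_real C)"
    have "(\<Sum>i\<in>J. cmod (y' i)) = (\<Sum>i\<in>J. cmod (y i)) / C"
      unfolding sum_divide_distrib using C by (simp add: y'_def norm_divide)
    also have "\<dots> = C / C" by (simp only: C_def)
    finally have "(\<Sum>i\<in>J. cmod (y' i)) = C / C" .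
    then have "(\<Sum>i\<in>J. cmod (y' i)) = 1" using C by simp
    moreover have "cf (-1) (app (rdet N (XX K S (zz (\<tau> n)) (zz (\<tau> n) p))) (EE y' (zz (\<tau> n) p))) = 0" if p: "p \<in> Q" for p
    proof (rule ext)
      fix \<beta>
      have q: "q i (p, \<beta>) = r p i \<beta>" for i
      proof -
        have "q i (p, \<beta>) = (\<Sum>p'\<in>Q. if p = p' then r p' i \<beta> else 0)"
          unfolding q_def sum_fun_apply emb_def by (intro sum.cong refl) simp
        then show ?thesis using p finQ by simp
      qed
      have "cf (-1) (app (rdet N (XX K S (zz (\<tau> n)) (zz (\<tau> n) p))) (EE y' (zz (\<tau> n) p))) \<beta> = (\<Sum>i\<in>J. y' i * r p i \<beta>)"
        unfolding EE_def rdet_linear cf_sum cf_sc_const r_def by (simp add: sum_fun_apply app_sc)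
      also have "\<dots> = (\<Sum>i\<in>J. y i * q i (p, \<beta>)) / of_real C"
        by (simp add: y'_def q sum_divide_distrib)
      also have "\<dots> = 0" using y(2) by simp
      finally show "cf (-1) (app (rdet N (XX K S (zz (\<tau> n)) (zz (\<tau> n) p))) (EE y' (zz (\<tau> n) p))) \<beta> = 0 \<beta>" by simp
    qed
    ultimately show ?thesis by blast
  qed
  then obtain y where y: "\<And>n. (\<Sum>i\<in>J. cmod (y n i)) = 1"
    "\<And>n p. p \<in> Q \<Longrightarrow> cf (-1) (app (rdet N (XX K S (zz (\<tau> n)) (zz (\<tau> n) p))) (EE (y n) (zz (\<tau> n) p))) = 0"
    by metis

  \<comment> \<open>At each vector site the image has a zero by
    \<open>vector_site_vanishing\<close>, and the divisor has a simple one, the sites being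
    distinct; so the integrand has no residue inside the circle.\<close>
  have vanish: "(\<Sum>i\<in>J. y n i * contour_integral (circlepath z0 \<rho>) (Gj j i \<beta> (\<tau> n))) = 0" for n j \<beta>
  proof -
    have int: "Gj j i \<beta> (\<tau> n) contour_integrable_on circlepath z0 \<rho>" for i
      by (rule nice_contour_limit(2)[OF Gj zz_cont \<rho>(1) disj \<tau>(1) \<tau>_lim \<tau>(1)])
    have "(\<Sum>i\<in>J. y n i * contour_integral (circlepath z0 \<rho>) (Gj j i \<beta> (\<tau> n)))
      = contour_integral (circlepath z0 \<rho>) (\<lambda>u. \<Sum>i\<in>J. y n i * Gj j i \<beta> (\<tau> n) u)"
      using int finJ by (subst contour_integral_sum) (auto intro: contour_integrable_lmul simp: contour_integral_lmul)
    also have "\<dots> = 0"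
    proof (rule contour_integral_removable[OF _ _ \<rho> hol])
      show "finite (zz (\<tau> n) ` Q)" using finQ by simp
      show "zz (\<tau> n) ` Q \<subseteq> ball z0 \<rho>" using zzQ \<tau> by blast
      fix w assume "w \<in> zz (\<tau> n) ` Q"
      then obtain p where p: "p \<in> Q" "w = zz (\<tau> n) p" by blast
      have pS: "p \<in> S" using p Q by blast
      have 1: "ordge 1 (app (rdet N (XX K S (zz (\<tau> n)) (zz (\<tau> n) p))) (EE (y n) (zz (\<tau> n) p)))"
        by (rule vector_site_vanishing[OF pS _ _ EE_ord EE_unit[OF p(1)] y(2)[OF p(1)]])
          (use zz_inj[OF p(1) _ \<tau>] vec[OF p(1)] in auto)
      have 2: "\<forall>m < - 1. fls_nth (\<Prod>s\<in>Q. pole (zz (\<tau> n)) w s) m = 0"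
      proof -
        have reg: "\<forall>m<0. fls_nth (\<Prod>s\<in>A. pole (zz (\<tau> n)) w s) m = 0" if "finite A" "A \<subseteq> Q - {p}" for A
          using that
        proof (induction A rule: finite_induct)
          case (insert s A)
          have "\<forall>m<0. fls_nth (pole (zz (\<tau> n)) w s) m = 0"
            by (rule pole_regular) (use zz_inj[OF p(1) _ \<tau>, of s n] insert.prems p Q in auto)
          from fls_mult_below[OF this] insert show ?case by simp
        qed simp
        have "\<forall>m < - 1. fls_nth (pole (zz (\<tau> n)) w p) m = 0" using p(2) by (simp add: pole_self)
        from fls_mult_below[OF this reg[of "Q - {p}"]] show ?thesis
          using finQ p(1) by (simp add: prod.remove[of Q p])
      qed
      have "\<forall>m<1 + 0. fls_nth (app (rdet N (XX K S (zz (\<tau> n)) w)) (EE (y n) w) \<beta> * (fls_X + fls_const (w - z0)) ^ j) m = 0"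
        by (rule fls_mult_below[OF _ linear_power_regular]) (use 1 p(2) in \<open>auto simp: ordge_def\<close>)
      from fls_mult_below[OF this 2] show "\<exists>F. (\<lambda>t. \<Sum>i\<in>J. y n i * Gj j i \<beta> (\<tau> n) (w + t)) has_laurent_expansion F \<and> (\<forall>m<0. fls_nth F m = 0)"
        using GjE by (intro exI conjI) auto
    qed
    finally show ?thesis .
  qed

  have "cmod (y n i) \<le> 1" if "i \<in> J" for n i
    using member_le_sum[OF that, of "\<lambda>i. cmod (y n i)"] finJ y(1)[of n] by auto
  then obtain r Y where r: "strict_mono r" "\<forall>i\<in>J. (\<lambda>n. y (r n) i) \<longlonglongrightarrow> Y i"
    using finite_family_convergent_subseq[OF finJ, of y 1] by blast
  have Y1: "(\<Sum>i\<in>J. cmod (Y i)) = 1"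
  proof -
    have "(\<lambda>n. \<Sum>i\<in>J. cmod (y (r n) i)) \<longlonglongrightarrow> (\<Sum>i\<in>J. cmod (Y i))"
      using r(2) by (intro tendsto_sum tendsto_norm) auto
    then show ?thesis using y(1) by (simp add: LIMSEQ_const_iff)
  qed
  have lim0: "(\<Sum>i\<in>J. Y i * contour_integral (circlepath z0 \<rho>) (Gj j i \<beta> 0)) = 0" for j \<beta>
  proof -
    have "(\<lambda>n. \<Sum>i\<in>J. y (r n) i * contour_integral (circlepath z0 \<rho>) (Gj j i \<beta> (\<tau> (r n))))
      \<longlonglongrightarrow> (\<Sum>i\<in>J. Y i * contour_integral (circlepath z0 \<rho>) (Gj j i \<beta> 0))"
    proof (intro tendsto_sum tendsto_mult)
      fix i assume "i \<in> J"
      then show "(\<lambda>n. y (r n) i) \<longlonglongrightarrow> Y i" using r(2) by blast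
      show "(\<lambda>n. contour_integral (circlepath z0 \<rho>) (Gj j i \<beta> (\<tau> (r n)))) \<longlonglongrightarrow> contour_integral (circlepath z0 \<rho>) (Gj j i \<beta> 0)"
        using LIMSEQ_subseq_LIMSEQ[OF nice_contour_limit(1)[OF Gj zz_cont \<rho>(1) disj \<tau>(1) \<tau>_lim] r(1)]
        by (simp add: comp_def)
    qed
    then show ?thesis unfolding vanish by (simp add: LIMSEQ_const_iff)
  qed
  define D0 where "D0 = rdet N (XX K S z z0)"
  \<comment> \<open>As j runs through all natural numbers, k - 1 - j runs through all orders below
    k.\<close>
  have ord: "ordge (int k) (app D0 (EE Y z0))"
    unfolding ordge_def
  proof (intro allI impI)
    fix \<beta> and n :: int assume n: "n < int k"
    define j where "j = nat (int k - 1 - n)"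
    have jn: "n = int k - 1 - int j" using n by (simp add: j_def)
    have int: "Gj j i \<beta> 0 contour_integrable_on circlepath z0 \<rho>" for i
      by (rule nice_contour_limit(2)[OF Gj zz_cont \<rho>(1) disj \<tau>(1) \<tau>_lim]) (use \<delta> in auto)
    define F where "F = app D0 (EE Y z0) \<beta> * (fls_X + fls_const (z0 - z0)) ^ j * (\<Prod>s\<in>Q. pole z z0 s)"
    have "(\<Sum>i\<in>J. Y i * contour_integral (circlepath z0 \<rho>) (Gj j i \<beta> 0))
      = contour_integral (circlepath z0 \<rho>) (\<lambda>u. \<Sum>i\<in>J. Y i * Gj j i \<beta> 0 u)"
      using int finJ by (subst contour_integral_sum) (auto intro: contour_integrable_lmul simp: contour_integral_lmul)
    also have "\<dots> = 2 * pi * \<i> * fls_nth F (-1)"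
    proof (rule contour_integral_coefficient[OF \<rho>])
      show "(\<lambda>u. \<Sum>i\<in>J. Y i * Gj j i \<beta> 0 u) holomorphic_on ball z0 R - {z0}"
        using hol[of Y j \<beta> 0] by (rule holomorphic_on_subset) (auto simp: zz_def)
      show "(\<lambda>t. \<Sum>i\<in>J. Y i * Gj j i \<beta> 0 (z0 + t)) has_laurent_expansion F"
        using GjE[of Y j \<beta> 0 z0] unfolding F_def D0_def zz0 .
    qed
    finally have "fls_nth F (-1) = 0" using lim0 by simp
    moreover have "F = fls_shift (int k - int j) (app D0 (EE Y z0) \<beta>)"
    proof -
      have "(\<Prod>s\<in>Q. pole z z0 s) = fls_X_inv ^ k"
        using z(2) by (simp add: pole_self k_def)
      then show ?thesis
        unfolding F_def by (simp add: fls_X_power_times_conv_shift fls_X_inv_power_times_conv_shift)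
    qed
    ultimately show "fls_nth (app D0 (EE Y z0) \<beta>) n = 0" unfolding jn by (simp add: algebra_simps)
  qed

  define f where "f = (\<lambda>l. \<Sum>i\<in>{i \<in> J. fst i = l}. (\<lambda>\<beta>. Y i * snd i \<beta>))"
  have fU: "f l \<in> U" for l
    unfolding f_def U_def by (intro wspace_sum wspace_scale) (use J_U in \<open>auto simp: U_def\<close>)
  have f_high: "f l = 0" if "l \<ge> N + k" for l
  proof -
    have "{i \<in> J. fst i = l} = {}" using J_U that by fastforce
    then show ?thesis unfolding f_def by (simp only: sum.empty)
  qed
  have EEf: "cf n (EE Y z0) = (if n \<ge> 0 then f (nat n) else 0)" for n
  proof -
    have "cf n (EE Y z0) = (\<Sum>i\<in>J. if fst i = nat n \<and> n \<ge> 0 then (\<lambda>\<beta>. Y i * snd i \<beta>) else 0)"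
      unfolding EE_def cf_sum cf_sc_const pw_self cf_fmono
      by (intro sum.cong refl) (auto simp: app_sc fun_eq_iff)
    also have "\<dots> = (if n \<ge> 0 then f (nat n) else 0)"
      unfolding f_def sum.inter_filter[OF finJ] by (cases "n \<ge> 0") (simp_all only: simp_thms if_False sum.neutral_const if_True)
    finally show ?thesis .
  qed
  \<comment> \<open>The lowest coefficient of the image is the indicial operator applied to the
    lowest coefficient \<open>f l\<close>, and its order l - N is less than k.\<close>
  have lead: "app (P0 Q (of_nat l)) (f l) = 0" if "\<And>l'. l' < l \<Longrightarrow> f l' = 0" "l < N + k" for l
  proof -
    have "ordge (int l) (EE Y z0)"
      unfolding ordge_cf EEf using that(1) by (simp add: nat_less_iff)
    from rdet_lead(2)[OF subset_refl this, of K z z0]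
    have "cf (int l - int N) (app D0 (EE Y z0)) = app (P0 {s \<in> S. z s = z0} (of_nat l)) (f l)"
      by (simp add: D0_def EEf)
    moreover have "{s \<in> S. z s = z0} = Q" using z Q by auto
    moreover have "cf (int l - int N) (app D0 (EE Y z0)) = 0"
      using ord that(2) unfolding ordge_cf by auto
    ultimately show ?thesis by simp
  qed
  have fY: "f l \<beta> = (\<Sum>b\<in>BU l - BL l. (if l < N + k then Y (l, b) else 0) * b \<beta>) + (if l = l0 then Y (l0, v) * v \<beta> else 0)" for l \<beta>
  proof -
    have "f l \<beta> = (\<Sum>i\<in>J. if fst i = l then Y i * snd i \<beta> else 0)"
      unfolding f_def by (simp add: sum_fun_apply sum.inter_filter[OF finJ, symmetric])
    also have "\<dots> = (\<Sum>i\<in>J1. if fst i = l then Y i * snd i \<beta> else 0) + (if l = l0 then Y (l0, v) * v \<beta> else 0)"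
      unfolding J_def using v_BL finJ1 by (subst sum.insert) (auto simp: J1_def)
    also have "(\<Sum>i\<in>J1. if fst i = l then Y i * snd i \<beta> else 0) = (\<Sum>l'<N + k. \<Sum>b\<in>BU l' - BL l'. if l' = l then Y (l', b) * b \<beta> else 0)"
    proof -
      have "(\<Sum>i\<in>J1. if fst i = l then Y i * snd i \<beta> else 0) = (\<Sum>(l', b)\<in>J1. if l' = l then Y (l', b) * b \<beta> else 0)"
        by (intro sum.cong refl) auto
      then show ?thesis unfolding J1_def using finB by (subst sum.Sigma) auto
    qed
    also have "\<dots> = (\<Sum>l'<N + k. if l' = l then \<Sum>b\<in>BU l - BL l. Y (l, b) * b \<beta> else 0)"
      by (intro sum.cong refl) auto
    also have "\<dots> = (\<Sum>b\<in>BU l - BL l. (if l < N + k then Y (l, b) else 0) * b \<beta>)"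
      by auto
    finally show ?thesis .
  qed
  \<comment> \<open>A leading coefficient lies in the kernel, spanned by \<open>BL l\<close>, and
    apart from the multiple of \<open>v\<close> it is a combination of the complement
    \<open>BU l - BL l\<close>; by independence that combination is trivial.\<close>
  have lead_eq: "(\<forall>b\<in>BU l - BL l. Y (l, b) = 0) \<and> f l = (if l = l0 then (\<lambda>\<beta>. Y (l0, v) * v \<beta>) else 0)"
    if l: "\<And>l'. l' < l \<Longrightarrow> f l' = 0" "l < N + k" for l
  proof -
    have "f l \<in> Kl l" using lead[OF l] fU by (auto simp: Kl_def)
    then have "f l \<in> fv.span (BL l)" using B(4) by blast
    moreover have "(if l = l0 then (\<lambda>\<beta>. Y (l0, v) * v \<beta>) else 0) \<in> fv.span (BL l)"
    proof (cases "l = l0")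
      case True
      then show ?thesis using fv.span_scale[OF fv.span_base[OF v_BL]] by (simp only: refl if_True)
    next
      case False
      then show ?thesis by (simp only: if_False fv.span_zero)
    qed
    ultimately have "f l - (if l = l0 then (\<lambda>\<beta>. Y (l0, v) * v \<beta>) else 0) \<in> fv.span (BL l)"
      by (rule fv.span_diff)
    then obtain u where u: "f l - (if l = l0 then (\<lambda>\<beta>. Y (l0, v) * v \<beta>) else 0) = (\<Sum>b\<in>BL l. (\<lambda>\<beta>. u b * b \<beta>))"
      unfolding fv.span_finite[OF finB(2)] by auto
    define w where "w = (\<lambda>b. if b \<in> BL l then - u b else Y (l, b))"
    have "(\<Sum>b\<in>BU l. w b * b \<beta>) = 0" for \<beta>
    proof -
      have "(\<Sum>b\<in>BU l. w b * b \<beta>) = (\<Sum>b\<in>BU l - BL l. w b * b \<beta>) + (\<Sum>b\<in>BL l. w b * b \<beta>)"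
        using sum.subset_diff[OF B(5)[of l] finB(1)] by blast
      also have "(\<Sum>b\<in>BU l - BL l. w b * b \<beta>) = (\<Sum>b\<in>BU l - BL l. Y (l, b) * b \<beta>)"
        by (intro sum.cong refl) (auto simp: w_def)
      also have "(\<Sum>b\<in>BL l. w b * b \<beta>) = - (\<Sum>b\<in>BL l. u b * b \<beta>)"
        by (simp add: w_def sum_negf)
      also have "(\<Sum>b\<in>BU l - BL l. Y (l, b) * b \<beta>) = f l \<beta> - (if l = l0 then Y (l0, v) * v \<beta> else 0)"
        using fY[of l \<beta>] l(2) by simp
      also have "\<dots> = (\<Sum>b\<in>BL l. u b * b \<beta>)"
        using fun_cong[OF u, of \<beta>] by (simp add: sum_fun_apply split: if_splits)
      finally show ?thesis by simp
    qed
    then have w0: "w b = 0" if "b \<in> BU l" for b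
      using independent_sum_zero[OF B(7) finB(1)] that by blast
    have Y0: "\<forall>b\<in>BU l - BL l. Y (l, b) = 0"
    proof
      fix b assume b: "b \<in> BU l - BL l"
      then have "w b = 0" by (intro w0) simp
      then show "Y (l, b) = 0" using b by (simp add: w_def)
    qed
    moreover have "f l \<beta> = (if l = l0 then Y (l0, v) * v \<beta> else 0)" for \<beta>
      unfolding fY using Y0 by (subst sum.neutral) auto
    ultimately show ?thesis by (auto simp: fun_eq_iff)
  qed
  have f_low: "f l = 0 \<and> (\<forall>b\<in>BU l - BL l. Y (l, b) = 0)" if "l < l0" for l
    using that
  proof (induction l rule: less_induct)
    case (less l)
    have "f l' = 0" if "l' < l" for l' using less.IH[OF that] less.prems that by linarith
    from lead_eq[OF this] show ?case using less.prems l0 unfolding k_def by simp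
  qed
  have fl0: "f l0 = (\<lambda>\<beta>. Y (l0, v) * v \<beta>)"
    using lead_eq[of l0] f_low l0 unfolding k_def by simp
  \<comment> \<open>Otherwise the same argument would remove all coefficients one exponent after the
    other, against the normalisation.\<close>
  have Y_nz: "Y (l0, v) \<noteq> 0"
  proof
    assume Yv: "Y (l0, v) = 0"
    have "f l = 0 \<and> (\<forall>b\<in>BU l - BL l. Y (l, b) = 0)" if "l < N + k" for l
      using that
    proof (induction l rule: less_induct)
      case (less l)
      have "f l' = 0" if "l' < l" for l' using less.IH[OF that] less.prems that by linarith
      from lead_eq[OF this less.prems] show ?case using Yv by (auto simp: fun_eq_iff)
    qed
    then have "Y i = 0" if "i \<in> J" for i
      using that Yv by (auto simp: J_def J1_def)
    then show False using Y1 by simp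
  qed
  define g where "g = (\<lambda>l \<beta>. 1 / Y (l0, v) * f l \<beta>)"
  have gU: "g l \<in> U" for l unfolding g_def U_def by (rule wspace_scale) (use fU U_def in auto)
  have "(\<Sum>l<N + k. fmono (int l) (g l)) = app (sc (fls_const (1 / Y (l0, v)))) (EE Y z0)"
  proof (rule ext, rule fls_eqI)
    fix \<beta> n
    have "cf n (\<Sum>l<N + k. fmono (int l) (g l)) = cf n (app (sc (fls_const (1 / Y (l0, v)))) (EE Y z0))"
    proof -
      have "cf n (\<Sum>l<N + k. fmono (int l) (g l)) = (\<Sum>l<N + k. if l = nat n \<and> n \<ge> 0 then g l else 0)"
        unfolding cf_sum cf_fmono by (intro sum.cong refl) auto
      also have "\<dots> = (if n \<ge> 0 then g (nat n) else 0)"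
      proof (cases "n \<ge> 0 \<and> nat n < N + k")
        case True
        then show ?thesis by (simp only: simp_thms sum.delta finite_lessThan lessThan_iff if_True)
      next
        case False
        have "g (nat n) = 0" if "n \<ge> 0"
          using False f_high[of "nat n"] that by (auto simp: g_def fun_eq_iff)
        moreover have "(\<Sum>l<N + k. if l = nat n \<and> n \<ge> 0 then g l else 0) = 0"
          by (rule sum.neutral) (use False in auto)
        ultimately show ?thesis by (simp only: if_cancel split: if_split) simp
      qed
      also have "\<dots> = cf n (app (sc (fls_const (1 / Y (l0, v)))) (EE Y z0))"
        unfolding cf_sc_const EEf by (auto simp: app_sc g_def fun_eq_iff)
      finally show ?thesis .
    qed
    then show "fls_nth ((\<Sum>l<N + k. fmono (int l) (g l)) \<beta>) n = fls_nth (app (sc (fls_const (1 / Y (l0, v)))) (EE Y z0) \<beta>) n"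
      unfolding cf_def by (rule fun_cong)
  qed
  then have "app D0 (\<Sum>l<N + k. fmono (int l) (g l)) = app (sc (fls_const (1 / Y (l0, v)))) (app D0 (EE Y z0))"
    unfolding D0_def by (simp only: app_eqD[OF rdet_sc_commute])
  then have "ordge (int k) (app D0 (\<Sum>l<N + k. fmono (int l) (g l)))"
    using ordge_sc[OF fls_const_regular ord] by (simp only:)
  moreover have "g l0 = v" using Y_nz by (simp add: g_def fl0)
  moreover have "\<forall>l<l0. g l = 0" using f_low by (auto simp: g_def fun_eq_iff)
  ultimately show ?thesis using gU unfolding U_def k_def D0_def by blast
qed

end

section \<open>Replacing a tensor factor by vector sites\<close>

text \<open>\<open>multi_indices\<close> for an arbitrary set of sites, as the set changes when a
  site is replaced by several.\<close>

definition tI :: "nat set \<Rightarrow> (nat \<Rightarrow> nat) \<Rightarrow> (nat \<Rightarrow> nat) set" where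
  "tI S d = (\<Pi>\<^sub>E s\<in>S. {..<d s})"

text \<open>The matrix of \<open>factor_op\<close> in the product basis.\<close>

definition tker :: "nat set \<Rightarrow> (nat \<Rightarrow> nat) \<Rightarrow> nat \<Rightarrow> complex mat \<Rightarrow> (nat \<Rightarrow> nat) \<Rightarrow> (nat \<Rightarrow> nat) \<Rightarrow> complex" where
  "tker S d s A \<beta> \<gamma> = (if \<beta> \<in> tI S d \<and> \<gamma> \<in> tI S d \<and> (\<forall>s'\<in>S. s' \<noteq> s \<longrightarrow> \<gamma> s' = \<beta> s') then A $$ (\<beta> s, \<gamma> s) else 0)"

lemma finite_tI: "finite S \<Longrightarrow> finite (tI S d)"
  unfolding tI_def by (intro finite_PiE) auto

lemma tI_upd: "\<beta> \<in> tI S d \<Longrightarrow> s \<in> S \<Longrightarrow> c < d s \<Longrightarrow> \<beta>(s := c) \<in> tI S d"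
  unfolding tI_def by (auto simp: PiE_iff extensional_def)

lemma tI_less: "\<beta> \<in> tI S d \<Longrightarrow> s \<in> S \<Longrightarrow> \<beta> s < d s"
  unfolding tI_def by (auto simp: PiE_iff)

lemma tI_eqI: "\<beta> \<in> tI S d \<Longrightarrow> \<gamma> \<in> tI S' d' \<Longrightarrow> S = S' \<Longrightarrow> (\<And>s. s \<in> S \<Longrightarrow> \<beta> s = \<gamma> s) \<Longrightarrow> \<beta> = \<gamma>"
  unfolding tI_def by (rule extensionalityI[of \<beta> S]) (auto simp: PiE_iff)

lemma tker_zero: "\<not> (\<forall>s'\<in>S. s' \<noteq> s \<longrightarrow> \<gamma> s' = \<beta> s') \<Longrightarrow> tker S d s A \<beta> \<gamma> = 0"
  by (simp only: tker_def simp_thms if_False)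

lemma tker_eq:
  "\<beta> \<in> tI S d \<Longrightarrow> \<gamma> \<in> tI S d \<Longrightarrow>
    tker S d s A \<beta> \<gamma> = (if \<forall>s'\<in>S. s' \<noteq> s \<longrightarrow> \<gamma> s' = \<beta> s' then A $$ (\<beta> s, \<gamma> s) else 0)"
  by (simp only: tker_def simp_thms)

text \<open>Only multi-indices that differ from \<beta> at most in the place \<open>s\<close>
  contribute, and they are parametrised by their entry there.\<close>

lemma sum_tker:
  fixes h :: "complex \<Rightarrow> 'r :: comm_ring_1"
  assumes "finite S" "s \<in> S" "\<beta> \<in> tI S d" "h 0 = 0"
  shows "(\<Sum>\<gamma>\<in>tI S d. h (tker S d s A \<beta> \<gamma>) * x \<gamma>) = (\<Sum>c<d s. h (A $$ (\<beta> s, c)) * x (\<beta>(s := c)))"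
proof -
  let ?f = "\<lambda>c. \<beta>(s := c)"
  have img: "?f ` {..<d s} \<subseteq> tI S d" using assms by (auto intro: tI_upd)
  have "(\<Sum>\<gamma>\<in>tI S d. h (tker S d s A \<beta> \<gamma>) * x \<gamma>) = (\<Sum>\<gamma>\<in>?f ` {..<d s}. h (tker S d s A \<beta> \<gamma>) * x \<gamma>)"
  proof (rule sum.mono_neutral_right[OF finite_tI[OF assms(1)] img], rule ballI)
    fix \<gamma> assume \<gamma>: "\<gamma> \<in> tI S d - ?f ` {..<d s}"
    have "\<not> (\<forall>s'\<in>S. s' \<noteq> s \<longrightarrow> \<gamma> s' = \<beta> s')"
    proof
      assume eq: "\<forall>s'\<in>S. s' \<noteq> s \<longrightarrow> \<gamma> s' = \<beta> s'"
      have "\<gamma> = \<beta>(s := \<gamma> s)"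
      proof (rule tI_eqI[of _ S d _ S d])
        show "\<gamma> \<in> tI S d" using \<gamma> by simp
        then show "\<beta>(s := \<gamma> s) \<in> tI S d" using assms tI_upd tI_less by blast
      qed (use eq in auto)
      then show False using \<gamma> assms(2) tI_less[of \<gamma> S d s] by blast
    qed
    then have "tker S d s A \<beta> \<gamma> = 0" by (rule tker_zero)
    then show "h (tker S d s A \<beta> \<gamma>) * x \<gamma> = 0" using assms(4) by simp
  qed
  also have "\<dots> = (\<Sum>c<d s. h (tker S d s A \<beta> (\<beta>(s := c))) * x (\<beta>(s := c)))"
    by (rule sum.reindex_cong[of ?f]) (auto simp: inj_on_def fun_upd_eqD)
  also have "\<dots> = (\<Sum>c<d s. h (A $$ (\<beta> s, c)) * x (\<beta>(s := c)))"
    by (intro sum.cong refl) (use assms in \<open>auto simp: tker_def tI_upd\<close>)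
  finally show ?thesis .
qed

lemma app_tker:
  fixes h :: "complex \<Rightarrow> 'r :: comm_ring_1"
  assumes "finite S" "s \<in> S" "h 0 = 0"
  shows "app (mk h (tI S d) (tker S d s A)) x \<beta>
    = (if \<beta> \<in> tI S d then \<Sum>c<d s. h (A $$ (\<beta> s, c)) * x (\<beta>(s := c)) else 0)"
  using sum_tker[of S s \<beta> d h A x] assms by (auto simp: app_mk tker_def)

lemma tker_mult:
  assumes "finite S" "s \<in> S" "A \<in> carrier_mat (d s) (d s)" "B \<in> carrier_mat (d s) (d s)" "\<gamma> \<in> tI S d"
  shows "(\<Sum>\<delta>\<in>tI S d. tker S d s A \<beta> \<delta> * tker S d s B \<delta> \<gamma>) = tker S d s (A * B) \<beta> \<gamma>"
proof (cases "\<beta> \<in> tI S d")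
  case True
  define P where "P \<longleftrightarrow> (\<forall>s'\<in>S. s' \<noteq> s \<longrightarrow> \<gamma> s' = \<beta> s')"
  have "(\<Sum>\<delta>\<in>tI S d. tker S d s A \<beta> \<delta> * tker S d s B \<delta> \<gamma>) = (\<Sum>c<d s. A $$ (\<beta> s, c) * tker S d s B (\<beta>(s := c)) \<gamma>)"
    by (rule sum_tker[where h = "\<lambda>x. x", OF assms(1,2) True refl])
  also have "\<dots> = (\<Sum>c<d s. if P then A $$ (\<beta> s, c) * B $$ (c, \<gamma> s) else 0)"
  proof (intro sum.cong refl)
    fix c assume "c \<in> {..<d s}"
    then have "\<beta>(s := c) \<in> tI S d" using True assms(2) by (auto intro: tI_upd)
    moreover have "(\<forall>s'\<in>S. s' \<noteq> s \<longrightarrow> \<gamma> s' = (\<beta>(s := c)) s') \<longleftrightarrow> P" by (auto simp: P_def)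
    ultimately show "A $$ (\<beta> s, c) * tker S d s B (\<beta>(s := c)) \<gamma> = (if P then A $$ (\<beta> s, c) * B $$ (c, \<gamma> s) else 0)"
      using tker_eq[of "\<beta>(s := c)" S d \<gamma> s B] assms(5) by (simp only:) simp
  qed
  also have "\<dots> = tker S d s (A * B) \<beta> \<gamma>"
    using assms(3,4) tI_less[OF True assms(2)] tI_less[OF assms(5,2)]
    unfolding tker_eq[OF True assms(5)] P_def[symmetric]
    by (cases P) (auto simp: scalar_prod_def atLeast0LessThan)
  finally show ?thesis .
qed (simp add: tker_def)

lemma tker_commute:
  assumes "finite S" "s \<in> S" "s' \<in> S" "s \<noteq> s'" "\<gamma> \<in> tI S d"
  shows "(\<Sum>\<delta>\<in>tI S d. tker S d s A \<beta> \<delta> * tker S d s' B \<delta> \<gamma>) = (\<Sum>\<delta>\<in>tI S d. tker S d s' B \<beta> \<delta> * tker S d s A \<delta> \<gamma>)"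
proof (cases "\<beta> \<in> tI S d")
  case True
  have *: "(\<Sum>\<delta>\<in>tI S d. tker S d s A \<beta> \<delta> * tker S d s' B \<delta> \<gamma>)
    = (if \<forall>r\<in>S. r \<noteq> s \<and> r \<noteq> s' \<longrightarrow> \<gamma> r = \<beta> r then A $$ (\<beta> s, \<gamma> s) * B $$ (\<beta> s', \<gamma> s') else 0)"
    if s: "s \<in> S" "s' \<in> S" "s \<noteq> s'" for s s' A B
  proof -
    have "(\<Sum>\<delta>\<in>tI S d. tker S d s A \<beta> \<delta> * tker S d s' B \<delta> \<gamma>) = (\<Sum>c<d s. A $$ (\<beta> s, c) * tker S d s' B (\<beta>(s := c)) \<gamma>)"
      by (rule sum_tker[where h = "\<lambda>x. x", OF assms(1) s(1) True refl])
    also have "\<dots> = (\<Sum>c<d s. if c = \<gamma> s then (if \<forall>r\<in>S. r \<noteq> s \<and> r \<noteq> s' \<longrightarrow> \<gamma> r = \<beta> r then A $$ (\<beta> s, \<gamma> s) * B $$ (\<beta> s', \<gamma> s') else 0) else 0)"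
    proof (intro sum.cong refl)
      fix c assume "c \<in> {..<d s}"
      then have "\<beta>(s := c) \<in> tI S d" using True s by (auto intro: tI_upd)
      moreover have "(\<forall>r\<in>S. r \<noteq> s' \<longrightarrow> \<gamma> r = (\<beta>(s := c)) r) \<longleftrightarrow> c = \<gamma> s \<and> (\<forall>r\<in>S. r \<noteq> s \<and> r \<noteq> s' \<longrightarrow> \<gamma> r = \<beta> r)"
        using s by auto
      ultimately show "A $$ (\<beta> s, c) * tker S d s' B (\<beta>(s := c)) \<gamma>
        = (if c = \<gamma> s then (if \<forall>r\<in>S. r \<noteq> s \<and> r \<noteq> s' \<longrightarrow> \<gamma> r = \<beta> r then A $$ (\<beta> s, \<gamma> s) * B $$ (\<beta> s', \<gamma> s') else 0) else 0)"
        using s tker_eq[of "\<beta>(s := c)" S d \<gamma> s' B] assms(5) by (simp only:) auto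
    qed
    also have "\<dots> = (if \<forall>r\<in>S. r \<noteq> s \<and> r \<noteq> s' \<longrightarrow> \<gamma> r = \<beta> r then A $$ (\<beta> s, \<gamma> s) * B $$ (\<beta> s', \<gamma> s') else 0)"
      using tI_less[OF assms(5) s(1)] by simp
    finally show ?thesis .
  qed
  show ?thesis
    unfolding *[OF assms(2,3,4)] *[OF assms(3,2) assms(4)[symmetric]] by (auto simp: mult.commute)
qed (simp add: tker_def)

lemma tensor_gaudin:
  assumes fin: "finite S" and gl: "\<And>s. s \<in> S \<Longrightarrow> gl_module N (d s) (E s)"
  shows "gaudin N (tI S d) S (\<lambda>s a b. tker S d s (E s a b))"
proof
  show "finite (tI S d)" by (rule finite_tI[OF fin])
  show "finite S" by (rule fin)
  show "tker S d s (E s a b) \<beta> \<gamma> = 0" if "\<beta> \<notin> tI S d" for s a b \<beta> \<gamma>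
    using that by (simp add: tker_def)
  fix s a b c d' \<beta> \<gamma>
  assume s: "s \<in> S" and i: "a \<in> {1..N}" "b \<in> {1..N}" "c \<in> {1..N}" "d' \<in> {1..N}" and \<gamma>: "\<gamma> \<in> tI S d"
  have car: "E s a b \<in> carrier_mat (d s) (d s)" if "a \<in> {1..N}" "b \<in> {1..N}" for a b
    using gl[OF s] that by (auto simp: gl_module_def)
  have rel: "E s a b * E s c d' - E s c d' * E s a b
      = (if b = c then E s a d' else 0\<^sub>m (d s) (d s)) - (if a = d' then E s c b else 0\<^sub>m (d s) (d s))"
    using gl[OF s] i by (auto simp: gl_module_def)
  have ent: "(E s a b * E s c d') $$ (p, q) + (if a = d' then E s c b $$ (p, q) else 0)
      = (E s c d' * E s a b) $$ (p, q) + (if b = c then E s a d' $$ (p, q) else 0)" if "p < d s" "q < d s" for p q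
  proof -
    have "(E s a b * E s c d' - E s c d' * E s a b) $$ (p, q)
      = ((if b = c then E s a d' else 0\<^sub>m (d s) (d s)) - (if a = d' then E s c b else 0\<^sub>m (d s) (d s))) $$ (p, q)"
      by (simp only: rel)
    moreover have "(E s a b * E s c d' - E s c d' * E s a b) $$ (p, q) = (E s a b * E s c d') $$ (p, q) - (E s c d' * E s a b) $$ (p, q)"
      by (rule index_minus_mat) (use that car[OF i(1,2)] car[OF i(3,4)] in auto)
    moreover have "((if b = c then E s a d' else 0\<^sub>m (d s) (d s)) - (if a = d' then E s c b else 0\<^sub>m (d s) (d s))) $$ (p, q)
      = (if b = c then E s a d' $$ (p, q) else 0) - (if a = d' then E s c b $$ (p, q) else 0)"
      using that car[OF i(3,2)] car[OF i(1,4)] by (subst index_minus_mat) auto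
    ultimately show ?thesis by (simp add: algebra_simps)
  qed
  show "(\<Sum>\<delta>\<in>tI S d. tker S d s (E s a b) \<beta> \<delta> * tker S d s (E s c d') \<delta> \<gamma>) + (if a = d' then tker S d s (E s c b) \<beta> \<gamma> else 0) =
    (\<Sum>\<delta>\<in>tI S d. tker S d s (E s c d') \<beta> \<delta> * tker S d s (E s a b) \<delta> \<gamma>) + (if b = c then tker S d s (E s a d') \<beta> \<gamma> else 0)"
    unfolding tker_mult[OF fin s car[OF i(1,2)] car[OF i(3,4)] \<gamma>] tker_mult[OF fin s car[OF i(3,4)] car[OF i(1,2)] \<gamma>]
    using ent tI_less[OF _ s] \<gamma> by (auto simp: tker_def)
next
  fix s s' a b c d' \<beta> \<gamma>
  assume "s \<in> S" "s' \<in> S" "s \<noteq> s'" "\<gamma> \<in> tI S d"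
  then show "(\<Sum>\<delta>\<in>tI S d. tker S d s (E s a b) \<beta> \<delta> * tker S d s' (E s' c d') \<delta> \<gamma>) =
    (\<Sum>\<delta>\<in>tI S d. tker S d s' (E s' c d') \<beta> \<delta> * tker S d s (E s a b) \<delta> \<gamma>)"
    by (rule tker_commute[OF fin])
qed

text \<open>The generators in the vector representation. They are numbered from 1, matrix positions
  from 0.\<close>

definition vmat :: "nat \<Rightarrow> nat \<Rightarrow> nat \<Rightarrow> complex mat" where
  "vmat N a b = mat N N (\<lambda>(p, q). if Suc p = a \<and> Suc q = b then 1 else 0)"

lemma vmat_carrier [simp]: "vmat N a b \<in> carrier_mat N N"
  by (simp add: vmat_def)

lemma vmat_index [simp]: "p < N \<Longrightarrow> q < N \<Longrightarrow> vmat N a b $$ (p, q) = (if Suc p = a \<and> Suc q = b then 1 else 0)"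
  by (simp add: vmat_def)

lemma vmat_mult:
  assumes "b \<in> {1..N}" "c \<in> {1..N}"
  shows "vmat N a b * vmat N c d = (if b = c then vmat N a d else 0\<^sub>m N N)"
proof (rule eq_matI)
  fix p q assume "p < dim_row (if b = c then vmat N a d else 0\<^sub>m N N)" "q < dim_col (if b = c then vmat N a d else 0\<^sub>m N N)"
  then have pq: "p < N" "q < N" by (auto simp: vmat_def split: if_splits)
  have "(vmat N a b * vmat N c d) $$ (p, q) = (\<Sum>r<N. vmat N a b $$ (p, r) * vmat N c d $$ (r, q))"
    using pq by (simp add: vmat_def scalar_prod_def atLeast0LessThan)
  also have "\<dots> = (\<Sum>r<N. if r = b - 1 then (if Suc p = a \<and> b = c \<and> Suc q = d then 1 else 0) else 0)"
    by (intro sum.cong refl) (use pq assms in auto)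
  also have "\<dots> = (if b = c then vmat N a d else 0\<^sub>m N N) $$ (p, q)"
    using assms pq by (auto simp: sum.delta)
  finally show "(vmat N a b * vmat N c d) $$ (p, q) = (if b = c then vmat N a d else 0\<^sub>m N N) $$ (p, q)" .
qed (auto simp: vmat_def)

lemma vmat_gl_module: "gl_module N N (vmat N)"
  unfolding gl_module_def
proof (intro conjI ballI)
  fix a b a' b' assume i: "a \<in> {1..N}" "b \<in> {1..N}" "a' \<in> {1..N}" "b' \<in> {1..N}"
  show "vmat N a b * vmat N a' b' - vmat N a' b' * vmat N a b =
    (if b = a' then vmat N a b' else 0\<^sub>m N N) - (if a = b' then vmat N a' b else 0\<^sub>m N N)"
    unfolding vmat_mult[OF i(2,3)] vmat_mult[OF i(4,1)] by auto
qed simp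

text \<open>
  An equivariant embedding \<open>\<phi>\<close> of the \<open>i\<close>-th factor into \<open>(\<complex>\<^bsup>N\<^esup>)\<^bsup>\<otimes>Q\<^esup>\<close> with equivariant left inverse \<open>\<pi>\<close>.
  The system \<open>small\<close> is the given one, \<open>big\<close> has the vector sites \<open>Q\<close> instead of the site \<open>i\<close>.
\<close>

locale splitting =
  fixes N :: nat and S :: "nat set" and i :: nat and d :: "nat \<Rightarrow> nat" and E :: "nat \<Rightarrow> nat \<Rightarrow> nat \<Rightarrow> complex mat"
    and Q :: "nat set" and \<phi> :: "(nat \<Rightarrow> nat) \<Rightarrow> nat \<Rightarrow> complex" and \<pi> :: "nat \<Rightarrow> (nat \<Rightarrow> nat) \<Rightarrow> complex"
  assumes finS: "finite S" and iS: "i \<in> S" and finQ: "finite Q" and disj: "Q \<inter> S = {}"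
    and gl: "\<And>s. s \<in> S \<Longrightarrow> gl_module N (d s) (E s)"
    and phi: "\<And>a b w c'. a \<in> {1..N} \<Longrightarrow> b \<in> {1..N} \<Longrightarrow> w \<in> tI Q (\<lambda>_. N) \<Longrightarrow> c' < d i \<Longrightarrow>
      (\<Sum>c<d i. \<phi> w c * E i a b $$ (c, c')) = (\<Sum>s\<in>Q. \<Sum>q<N. vmat N a b $$ (w s, q) * \<phi> (w(s := q)) c')"
    and pi: "\<And>a b c w'. a \<in> {1..N} \<Longrightarrow> b \<in> {1..N} \<Longrightarrow> c < d i \<Longrightarrow> w' \<in> tI Q (\<lambda>_. N) \<Longrightarrow>
      (\<Sum>w\<in>tI Q (\<lambda>_. N). \<pi> c w * (\<Sum>s\<in>Q. tker Q (\<lambda>_. N) s (vmat N a b) w w')) = (\<Sum>c'<d i. E i a b $$ (c, c') * \<pi> c' w')"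
    and pi_phi: "\<And>c c'. c < d i \<Longrightarrow> c' < d i \<Longrightarrow> (\<Sum>w\<in>tI Q (\<lambda>_. N). \<pi> c w * \<phi> w c') = (if c = c' then 1 else 0)"
begin

definition S' :: "nat set" where "S' = (S - {i}) \<union> Q"
definition d' :: "nat \<Rightarrow> nat" where "d' s = (if s \<in> Q then N else d s)"
definition E' :: "nat \<Rightarrow> nat \<Rightarrow> nat \<Rightarrow> complex mat" where "E' s = (if s \<in> Q then vmat N else E s)"

abbreviation "W \<equiv> tI Q (\<lambda>_. N)"

lemma finS': "finite S'" using finS finQ by (simp add: S'_def)

sublocale small: gaudin N "tI S d" S "\<lambda>s a b. tker S d s (E s a b)"
  by (rule tensor_gaudin[OF finS gl])

sublocale big: gaudin N "tI S' d'" S' "\<lambda>s a b. tker S' d' s (E' s a b)"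
proof (rule tensor_gaudin[OF finS'])
  show "gl_module N (d' s) (E' s)" if "s \<in> S'" for s
    using that disj gl vmat_gl_module by (auto simp: S'_def d'_def E'_def)
qed

text \<open>In passing between the two systems, \<open>ext\<close> trades the entries at the sites
  \<open>Q\<close> for one entry at the site \<open>i\<close>, and \<open>mrg\<close> does the
  opposite.\<close>

definition ext :: "(nat \<Rightarrow> nat) \<Rightarrow> nat \<Rightarrow> nat \<Rightarrow> nat" where
  "ext \<beta> c = (restrict \<beta> (S - {i}))(i := c)"

definition mrg :: "(nat \<Rightarrow> nat) \<Rightarrow> (nat \<Rightarrow> nat) \<Rightarrow> nat \<Rightarrow> nat" where
  "mrg \<beta> w = (\<lambda>s. if s \<in> Q then w s else restrict \<beta> (S - {i}) s)"

lemma ext_in: "\<beta> \<in> tI S' d' \<Longrightarrow> c < d i \<Longrightarrow> ext \<beta> c \<in> tI S d"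
proof -
  assume \<beta>: "\<beta> \<in> tI S' d'" and c: "c < d i"
  have "\<beta> s < d s" if "s \<in> S" "s \<noteq> i" for s
  proof -
    have "s \<in> S'" "s \<notin> Q" using that disj by (auto simp: S'_def)
    then show ?thesis using tI_less[OF \<beta>, of s] by (simp add: d'_def)
  qed
  then show ?thesis using c iS unfolding tI_def ext_def by (auto simp: PiE_iff extensional_def)
qed

lemma restrict_in: "\<beta> \<in> tI S' d' \<Longrightarrow> restrict \<beta> Q \<in> W"
proof -
  assume \<beta>: "\<beta> \<in> tI S' d'"
  have "\<beta> s < N" if "s \<in> Q" for s
    using tI_less[OF \<beta>, of s] that by (simp add: S'_def d'_def)
  then show ?thesis unfolding tI_def by (auto simp: PiE_iff extensional_def)
qed

lemma mrg_in: "\<beta> \<in> tI S d \<Longrightarrow> w \<in> W \<Longrightarrow> mrg \<beta> w \<in> tI S' d'"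
  using disj unfolding tI_def mrg_def S'_def d'_def by (auto simp: PiE_iff extensional_def disjoint_iff)

text \<open>\<phi> tensored with the identity of the other sites; \<open>Pik\<close> is the same for
  \<pi>.\<close>

definition Phik :: "(nat \<Rightarrow> nat) \<Rightarrow> (nat \<Rightarrow> nat) \<Rightarrow> complex" where
  "Phik \<beta> \<gamma> = (if \<beta> \<in> tI S' d' \<and> \<gamma> \<in> tI S d \<and> (\<forall>s\<in>S - {i}. \<beta> s = \<gamma> s) then \<phi> (restrict \<beta> Q) (\<gamma> i) else 0)"

definition Pik :: "(nat \<Rightarrow> nat) \<Rightarrow> (nat \<Rightarrow> nat) \<Rightarrow> complex" where
  "Pik \<gamma> \<beta> = (if \<beta> \<in> tI S' d' \<and> \<gamma> \<in> tI S d \<and> (\<forall>s\<in>S - {i}. \<beta> s = \<gamma> s) then \<pi> (\<gamma> i) (restrict \<beta> Q) else 0)"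

lemma Phik_zero: "\<not> (\<forall>s\<in>S - {i}. \<beta> s = \<gamma> s) \<Longrightarrow> Phik \<beta> \<gamma> = 0"
  by (simp only: Phik_def simp_thms if_False)

lemma Pik_zero: "\<not> (\<forall>s\<in>S - {i}. \<beta> s = \<gamma> s) \<Longrightarrow> Pik \<gamma> \<beta> = 0"
  by (simp only: Pik_def simp_thms if_False)

lemma app_Phi:
  fixes h :: "complex \<Rightarrow> 'r :: comm_ring_1"
  assumes "h 0 = 0"
  shows "app (mk h (tI S d) Phik) x \<beta> = (if \<beta> \<in> tI S' d' then \<Sum>c<d i. h (\<phi> (restrict \<beta> Q) c) * x (ext \<beta> c) else 0)"
proof (cases "\<beta> \<in> tI S' d'")
  case True
  have img: "ext \<beta> ` {..<d i} \<subseteq> tI S d" using ext_in[OF True] by auto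
  have "(\<Sum>\<gamma>\<in>tI S d. h (Phik \<beta> \<gamma>) * x \<gamma>) = (\<Sum>\<gamma>\<in>ext \<beta> ` {..<d i}. h (Phik \<beta> \<gamma>) * x \<gamma>)"
  proof (rule sum.mono_neutral_right[OF finite_tI[OF finS] img], rule ballI)
    fix \<gamma> assume \<gamma>: "\<gamma> \<in> tI S d - ext \<beta> ` {..<d i}"
    have "\<not> (\<forall>s\<in>S - {i}. \<beta> s = \<gamma> s)"
    proof
      assume eq: "\<forall>s\<in>S - {i}. \<beta> s = \<gamma> s"
      have i: "\<gamma> i < d i" using \<gamma> iS tI_less by blast
      have "\<gamma> = ext \<beta> (\<gamma> i)"
        by (rule tI_eqI[OF _ ext_in[OF True i] refl]) (use \<gamma> eq in \<open>auto simp: ext_def\<close>)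
      then show False using \<gamma> i by blast
    qed
    then have "Phik \<beta> \<gamma> = 0" by (rule Phik_zero)
    then show "h (Phik \<beta> \<gamma>) * x \<gamma> = 0" using assms by simp
  qed
  also have "\<dots> = (\<Sum>c<d i. h (Phik \<beta> (ext \<beta> c)) * x (ext \<beta> c))"
    by (rule sum.reindex_cong[of "ext \<beta>"]) (auto intro!: inj_on_inverseI[where g = "\<lambda>\<gamma>. \<gamma> i"] simp: ext_def)
  also have "\<dots> = (\<Sum>c<d i. h (\<phi> (restrict \<beta> Q) c) * x (ext \<beta> c))"
  proof (intro sum.cong refl)
    fix c assume "c \<in> {..<d i}"
    then have "ext \<beta> c \<in> tI S d" using ext_in[OF True] by simp
    moreover have "\<forall>s\<in>S - {i}. \<beta> s = ext \<beta> c s" "ext \<beta> c i = c" by (auto simp: ext_def)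
    ultimately have "Phik \<beta> (ext \<beta> c) = \<phi> (restrict \<beta> Q) c"
      using True unfolding Phik_def by (subst if_P) auto
    then show "h (Phik \<beta> (ext \<beta> c)) * x (ext \<beta> c) = h (\<phi> (restrict \<beta> Q) c) * x (ext \<beta> c)" by (simp only:)
  qed
  finally show ?thesis using True by (simp add: app_mk)
qed (simp add: app_mk Phik_def assms)

lemma app_Pi:
  fixes h :: "complex \<Rightarrow> 'r :: comm_ring_1"
  assumes "h 0 = 0"
  shows "app (mk h (tI S' d') Pik) x \<gamma> = (if \<gamma> \<in> tI S d then \<Sum>w\<in>W. h (\<pi> (\<gamma> i) w) * x (mrg \<gamma> w) else 0)"
proof (cases "\<gamma> \<in> tI S d")
  case True
  have rm: "restrict (mrg \<gamma> w) Q = w" if "w \<in> W" for w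
    using that unfolding tI_def mrg_def by (auto simp: fun_eq_iff PiE_iff extensional_def)
  have img: "mrg \<gamma> ` W \<subseteq> tI S' d'" using mrg_in[OF True] by auto
  have "(\<Sum>\<beta>\<in>tI S' d'. h (Pik \<gamma> \<beta>) * x \<beta>) = (\<Sum>\<beta>\<in>mrg \<gamma> ` W. h (Pik \<gamma> \<beta>) * x \<beta>)"
  proof (rule sum.mono_neutral_right[OF finite_tI[OF finS'] img], rule ballI)
    fix \<beta> assume \<beta>: "\<beta> \<in> tI S' d' - mrg \<gamma> ` W"
    have "\<not> (\<forall>s\<in>S - {i}. \<beta> s = \<gamma> s)"
    proof
      assume eq: "\<forall>s\<in>S - {i}. \<beta> s = \<gamma> s"
      have r: "restrict \<beta> Q \<in> W" using \<beta> restrict_in by blast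
      have "\<beta> = mrg \<gamma> (restrict \<beta> Q)"
        by (rule tI_eqI[OF _ mrg_in[OF True r] refl]) (use \<beta> eq in \<open>auto simp: mrg_def S'_def\<close>)
      then show False using \<beta> r by blast
    qed
    then have "Pik \<gamma> \<beta> = 0" by (rule Pik_zero)
    then show "h (Pik \<gamma> \<beta>) * x \<beta> = 0" using assms by simp
  qed
  also have "\<dots> = (\<Sum>w\<in>W. h (Pik \<gamma> (mrg \<gamma> w)) * x (mrg \<gamma> w))"
    by (rule sum.reindex_cong[of "mrg \<gamma>"]) (use rm in \<open>auto intro!: inj_on_inverseI[where g = "\<lambda>\<beta>. restrict \<beta> Q"]\<close>)
  also have "\<dots> = (\<Sum>w\<in>W. h (\<pi> (\<gamma> i) w) * x (mrg \<gamma> w))"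
  proof (intro sum.cong refl)
    fix w assume "w \<in> W"
    moreover have "\<forall>s\<in>S - {i}. mrg \<gamma> w s = \<gamma> s" using disj by (auto simp: mrg_def)
    ultimately show "h (Pik \<gamma> (mrg \<gamma> w)) * x (mrg \<gamma> w) = h (\<pi> (\<gamma> i) w) * x (mrg \<gamma> w)"
      using True mrg_in[OF True] rm by (simp add: Pik_def)
  qed
  finally show ?thesis using True by (simp add: app_mk)
qed (simp add: app_mk Pik_def assms)

lemma app_small:
  fixes h :: "complex \<Rightarrow> 'r :: comm_ring_1"
  assumes "h 0 = 0" "s \<in> S"
  shows "app (small.ef h s a b) x \<gamma> = (if \<gamma> \<in> tI S d then \<Sum>c<d s. h (E s a b $$ (\<gamma> s, c)) * x (\<gamma>(s := c)) else 0)"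
  unfolding small.ef_def by (rule app_tker[where h = h, OF finS assms(2,1)])

lemma app_big:
  fixes h :: "complex \<Rightarrow> 'r :: comm_ring_1"
  assumes "h 0 = 0" "s \<in> S'"
  shows "app (big.ef h s a b) x \<beta> = (if \<beta> \<in> tI S' d' then \<Sum>c<d' s. h (E' s a b $$ (\<beta> s, c)) * x (\<beta>(s := c)) else 0)"
  unfolding big.ef_def by (rule app_tker[where h = h, OF finS' assms(2,1)])

lemma Phi_other:
  assumes h: "chom h" and s: "s \<in> S - {i}"
  shows "mk h (tI S d) Phik * small.ef h s a b = big.ef h s a b * mk h (tI S d) Phik"
proof (rule addop_eqI, rule ext)
  fix x \<beta>
  have h0: "h 0 = 0" by (rule chomD(1)[OF h])
  have s': "s \<in> S" "s \<in> S'" "s \<notin> Q" "s \<noteq> i" "E' s = E s" "d' s = d s"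
    using s disj by (auto simp: S'_def E'_def d'_def)
  show "app (mk h (tI S d) Phik * small.ef h s a b) x \<beta> = app (big.ef h s a b * mk h (tI S d) Phik) x \<beta>"
  proof (cases "\<beta> \<in> tI S' d'")
    case True
    have ext: "ext \<beta> c s = \<beta> s" "(ext \<beta> c)(s := c') = ext (\<beta>(s := c')) c" "restrict (\<beta>(s := c')) Q = restrict \<beta> Q" for c c'
      using s' s by (auto simp: ext_def fun_eq_iff)
    have "app (mk h (tI S d) Phik * small.ef h s a b) x \<beta>
      = (\<Sum>c<d i. \<Sum>c'<d s. h (\<phi> (restrict \<beta> Q) c) * (h (E s a b $$ (\<beta> s, c')) * x (ext (\<beta>(s := c')) c)))"
      using True ext_in[OF True] by (simp add: app_Phi[where h = h, OF h0] app_small[where h = h, OF h0 s'(1)] ext sum_distrib_left del: fun_upd_apply)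
    also have "\<dots> = (\<Sum>c'<d s. \<Sum>c<d i. h (E s a b $$ (\<beta> s, c')) * (h (\<phi> (restrict \<beta> Q) c) * x (ext (\<beta>(s := c')) c)))"
      by (subst sum.swap) (simp add: mult.left_commute)
    also have "\<dots> = app (big.ef h s a b * mk h (tI S d) Phik) x \<beta>"
      using True s' tI_upd[OF True s'(2)]
      by (simp add: app_Phi[where h = h, OF h0] app_big[where h = h, OF h0 s'(2)] ext sum_distrib_left del: fun_upd_apply)
    finally show ?thesis .
  qed (simp add: app_Phi[where h = h, OF h0] app_big[where h = h, OF h0 s'(2)])
qed

text \<open>Equivariance of \<phi>: the generator at \<open>i\<close> becomes the sum of the
  generators at the vector sites.\<close>

lemma Phi_i:
  assumes h: "chom h" and ab: "a \<in> {1..N}" "b \<in> {1..N}"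
  shows "mk h (tI S d) Phik * small.ef h i a b = (\<Sum>s\<in>Q. big.ef h s a b) * mk h (tI S d) Phik"
proof (rule addop_eqI, rule ext)
  fix x \<beta>
  have h0: "h 0 = 0" by (rule chomD(1)[OF h])
  have q: "s \<in> S'" "E' s = vmat N" "d' s = N" if "s \<in> Q" for s
    using that by (auto simp: S'_def E'_def d'_def)
  show "app (mk h (tI S d) Phik * small.ef h i a b) x \<beta> = app ((\<Sum>s\<in>Q. big.ef h s a b) * mk h (tI S d) Phik) x \<beta>"
  proof (cases "\<beta> \<in> tI S' d'")
    case True
    have ext: "ext \<beta> c i = c" "(ext \<beta> c)(i := c') = ext \<beta> c'" for c c'
      by (auto simp: ext_def)
    have ext2: "ext (\<beta>(s := q)) c = ext \<beta> c" "restrict (\<beta>(s := q)) Q = (restrict \<beta> Q)(s := q)" if "s \<in> Q" for s q c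
      using that disj by (auto simp: ext_def fun_eq_iff)
    have "app (mk h (tI S d) Phik * small.ef h i a b) x \<beta>
      = (\<Sum>c<d i. \<Sum>c'<d i. h (\<phi> (restrict \<beta> Q) c) * (h (E i a b $$ (c, c')) * x (ext \<beta> c')))"
      using True ext_in[OF True] by (simp add: app_Phi[where h = h, OF h0] app_small[where h = h, OF h0 iS] ext sum_distrib_left)
    also have "\<dots> = (\<Sum>c'<d i. h (\<Sum>c<d i. \<phi> (restrict \<beta> Q) c * E i a b $$ (c, c')) * x (ext \<beta> c'))"
      by (subst sum.swap) (simp add: chomD[OF h] sum_distrib_right mult.assoc)
    also have "\<dots> = (\<Sum>c'<d i. h (\<Sum>s\<in>Q. \<Sum>q<N. vmat N a b $$ (\<beta> s, q) * \<phi> ((restrict \<beta> Q)(s := q)) c') * x (ext \<beta> c'))"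
      by (intro sum.cong refl) (simp add: phi[OF ab restrict_in[OF True]])
    also have "\<dots> = (\<Sum>c'<d i. \<Sum>s\<in>Q. \<Sum>q<N. h (vmat N a b $$ (\<beta> s, q)) * (h (\<phi> ((restrict \<beta> Q)(s := q)) c') * x (ext \<beta> c')))"
      by (simp add: chomD[OF h] sum_distrib_right mult.assoc)
    also have "\<dots> = (\<Sum>s\<in>Q. \<Sum>q<N. \<Sum>c'<d i. h (vmat N a b $$ (\<beta> s, q)) * (h (\<phi> ((restrict \<beta> Q)(s := q)) c') * x (ext \<beta> c')))"
      by (subst sum.swap) (rule sum.cong[OF refl sum.swap])
    also have "\<dots> = (\<Sum>s\<in>Q. app (big.ef h s a b) (app (mk h (tI S d) Phik) x) \<beta>)"
    proof (intro sum.cong refl)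
      fix s assume s: "s \<in> Q"
      show "(\<Sum>q<N. \<Sum>c'<d i. h (vmat N a b $$ (\<beta> s, q)) * (h (\<phi> ((restrict \<beta> Q)(s := q)) c') * x (ext \<beta> c')))
        = app (big.ef h s a b) (app (mk h (tI S d) Phik) x) \<beta>"
        using True q[OF s] tI_upd[OF True q(1)[OF s]]
        by (simp add: app_Phi[where h = h, OF h0] app_big[where h = h, OF h0 q(1)[OF s]] ext2[OF s] sum_distrib_left del: fun_upd_apply)
    qed
    finally show ?thesis by (simp add: app_sum_left sum_fun_apply)
  next
    case False
    then show ?thesis
      by (simp add: app_Phi[where h = h, OF h0] app_sum_left sum_fun_apply app_big[where h = h, OF h0 q(1)])
  qed
qed

lemma Pi_other:
  assumes h: "chom h" and s: "s \<in> S - {i}"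
  shows "mk h (tI S' d') Pik * big.ef h s a b = small.ef h s a b * mk h (tI S' d') Pik"
proof (rule addop_eqI, rule ext)
  fix x \<gamma>
  have h0: "h 0 = 0" by (rule chomD(1)[OF h])
  have s': "s \<in> S" "s \<in> S'" "s \<notin> Q" "s \<noteq> i" "E' s = E s" "d' s = d s"
    using s disj by (auto simp: S'_def E'_def d'_def)
  show "app (mk h (tI S' d') Pik * big.ef h s a b) x \<gamma> = app (small.ef h s a b * mk h (tI S' d') Pik) x \<gamma>"
  proof (cases "\<gamma> \<in> tI S d")
    case True
    have m: "mrg \<gamma> w s = \<gamma> s" "(mrg \<gamma> w)(s := c') = mrg (\<gamma>(s := c')) w" "(\<gamma>(s := c')) i = \<gamma> i" for w c'
      using s' s by (auto simp: mrg_def fun_eq_iff)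
    have "app (mk h (tI S' d') Pik * big.ef h s a b) x \<gamma>
      = (\<Sum>w\<in>W. \<Sum>c'<d s. h (\<pi> (\<gamma> i) w) * (h (E s a b $$ (\<gamma> s, c')) * x (mrg (\<gamma>(s := c')) w)))"
      using True mrg_in[OF True] s' by (simp add: app_Pi[where h = h, OF h0] app_big[where h = h, OF h0 s'(2)] m sum_distrib_left del: fun_upd_apply)
    also have "\<dots> = (\<Sum>c'<d s. \<Sum>w\<in>W. h (E s a b $$ (\<gamma> s, c')) * (h (\<pi> (\<gamma> i) w) * x (mrg (\<gamma>(s := c')) w)))"
      by (subst sum.swap) (simp add: mult.left_commute)
    also have "\<dots> = app (small.ef h s a b * mk h (tI S' d') Pik) x \<gamma>"
      using True s' tI_upd[OF True s'(1)]
      by (simp add: app_Pi[where h = h, OF h0] app_small[where h = h, OF h0 s'(1)] m(3) sum_distrib_left del: fun_upd_apply)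
    finally show ?thesis .
  qed (simp add: app_Pi[where h = h, OF h0] app_small[where h = h, OF h0 s'(1)])
qed

lemma Pi_i:
  assumes h: "chom h" and ab: "a \<in> {1..N}" "b \<in> {1..N}"
  shows "mk h (tI S' d') Pik * (\<Sum>s\<in>Q. big.ef h s a b) = small.ef h i a b * mk h (tI S' d') Pik"
proof (rule addop_eqI, rule ext)
  fix x \<gamma>
  have h0: "h 0 = 0" by (rule chomD(1)[OF h])
  have q: "s \<in> S'" "E' s = vmat N" "d' s = N" if "s \<in> Q" for s
    using that by (auto simp: S'_def E'_def d'_def)
  show "app (mk h (tI S' d') Pik * (\<Sum>s\<in>Q. big.ef h s a b)) x \<gamma> = app (small.ef h i a b * mk h (tI S' d') Pik) x \<gamma>"
  proof (cases "\<gamma> \<in> tI S d")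
    case True
    have \<gamma>i: "\<gamma> i < d i" using tI_less[OF True iS] .
    have m: "mrg \<gamma> w s = w s" "(mrg \<gamma> w)(s := c') = mrg \<gamma> (w(s := c'))" if "s \<in> Q" for w s c'
      using that by (auto simp: mrg_def fun_eq_iff)
    have m2: "mrg (\<gamma>(i := c)) w = mrg \<gamma> w" for c w by (auto simp: mrg_def fun_eq_iff)
    have "app (mk h (tI S' d') Pik * (\<Sum>s\<in>Q. big.ef h s a b)) x \<gamma>
      = (\<Sum>w\<in>W. h (\<pi> (\<gamma> i) w) * (\<Sum>s\<in>Q. app (big.ef h s a b) x (mrg \<gamma> w)))"
      using True by (simp add: app_Pi[where h = h, OF h0] app_sum_left sum_fun_apply)
    also have "\<dots> = (\<Sum>w\<in>W. h (\<pi> (\<gamma> i) w) * (\<Sum>s\<in>Q. \<Sum>w'\<in>W. h (tker Q (\<lambda>_. N) s (vmat N a b) w w') * x (mrg \<gamma> w')))"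
    proof (intro sum.cong refl arg_cong2[of _ _ _ _ "(*)"])
      fix w s assume w: "w \<in> W" and s: "s \<in> Q"
      have "app (big.ef h s a b) x (mrg \<gamma> w) = (\<Sum>c<N. h (vmat N a b $$ (w s, c)) * x (mrg \<gamma> (w(s := c))))"
        using mrg_in[OF True w] q[OF s] by (simp add: app_big[where h = h, OF h0 q(1)[OF s]] m[OF s] del: fun_upd_apply)
      also have "\<dots> = (\<Sum>w'\<in>W. h (tker Q (\<lambda>_. N) s (vmat N a b) w w') * x (mrg \<gamma> w'))"
        by (rule sum_tker[where h = h, OF finQ s w h0, symmetric])
      finally show "app (big.ef h s a b) x (mrg \<gamma> w) = (\<Sum>w'\<in>W. h (tker Q (\<lambda>_. N) s (vmat N a b) w w') * x (mrg \<gamma> w'))" .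
    qed
    also have "\<dots> = (\<Sum>w\<in>W. \<Sum>w'\<in>W. h (\<pi> (\<gamma> i) w * (\<Sum>s\<in>Q. tker Q (\<lambda>_. N) s (vmat N a b) w w')) * x (mrg \<gamma> w'))"
      by (intro sum.cong refl, subst sum.swap) (simp add: chomD[OF h] sum_distrib_left sum_distrib_right mult.assoc)
    also have "\<dots> = (\<Sum>w'\<in>W. h (\<Sum>w\<in>W. \<pi> (\<gamma> i) w * (\<Sum>s\<in>Q. tker Q (\<lambda>_. N) s (vmat N a b) w w')) * x (mrg \<gamma> w'))"
      by (subst sum.swap) (simp add: chomD[OF h] sum_distrib_right)
    also have "\<dots> = (\<Sum>w'\<in>W. h (\<Sum>c'<d i. E i a b $$ (\<gamma> i, c') * \<pi> c' w') * x (mrg \<gamma> w'))"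
      by (intro sum.cong refl) (simp add: pi[OF ab \<gamma>i])
    also have "\<dots> = (\<Sum>c'<d i. h (E i a b $$ (\<gamma> i, c')) * (\<Sum>w'\<in>W. h (\<pi> c' w') * x (mrg \<gamma> w')))"
      by (simp add: chomD[OF h] sum_distrib_left sum_distrib_right mult.assoc, subst sum.swap) (rule refl)
    also have "\<dots> = app (small.ef h i a b * mk h (tI S' d') Pik) x \<gamma>"
      using True tI_upd[OF True iS] by (simp add: app_Pi[where h = h, OF h0] app_small[where h = h, OF h0 iS] m2)
    finally show ?thesis .
  qed (simp add: app_Pi[where h = h, OF h0] app_small[where h = h, OF h0 iS])
qed

lemma Pi_Phi:
  assumes h: "chom h" and x: "\<And>\<gamma>. \<gamma> \<notin> tI S d \<Longrightarrow> x \<gamma> = 0"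
  shows "app (mk h (tI S' d') Pik) (app (mk h (tI S d) Phik) x) = x"
proof (rule ext)
  fix \<gamma>
  have h0: "h 0 = 0" by (rule chomD(1)[OF h])
  show "app (mk h (tI S' d') Pik) (app (mk h (tI S d) Phik) x) \<gamma> = x \<gamma>"
  proof (cases "\<gamma> \<in> tI S d")
    case True
    have \<gamma>i: "\<gamma> i < d i" using tI_less[OF True iS] .
    have rm: "restrict (mrg \<gamma> w) Q = w" if "w \<in> W" for w
      using that unfolding tI_def mrg_def by (auto simp: fun_eq_iff PiE_iff extensional_def)
    have em: "ext (mrg \<gamma> w) c = \<gamma>(i := c)" for w c
    proof (rule ext)
      fix s show "ext (mrg \<gamma> w) c s = (\<gamma>(i := c)) s"
        using True disj by (auto simp: ext_def mrg_def tI_def PiE_iff extensional_def)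
    qed
    have "app (mk h (tI S' d') Pik) (app (mk h (tI S d) Phik) x) \<gamma>
      = (\<Sum>w\<in>W. h (\<pi> (\<gamma> i) w) * (\<Sum>c<d i. h (\<phi> w c) * x (\<gamma>(i := c))))"
      using True mrg_in[OF True] by (simp add: app_Pi[where h = h, OF h0] app_Phi[where h = h, OF h0] rm em)
    also have "\<dots> = (\<Sum>c<d i. h (\<Sum>w\<in>W. \<pi> (\<gamma> i) w * \<phi> w c) * x (\<gamma>(i := c)))"
      by (simp add: chomD[OF h] sum_distrib_left sum_distrib_right mult.assoc, subst sum.swap) (rule refl)
    also have "\<dots> = (\<Sum>c<d i. if c = \<gamma> i then x (\<gamma>(i := c)) else 0)"
      by (intro sum.cong refl) (simp add: pi_phi[OF \<gamma>i] chomD[OF h])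
    also have "\<dots> = x \<gamma>" using \<gamma>i by simp
    finally show ?thesis .
  qed (simp add: app_Pi[where h = h, OF h0] x)
qed
text \<open>All vector sites sit at \<open>z i\<close>, so they share the pole of the site that they
  replace.\<close>

definition zz :: "(nat \<Rightarrow> complex) \<Rightarrow> nat \<Rightarrow> complex" where
  "zz z s = (if s \<in> Q then z i else z s)"

lemma pole_zz: "pole (zz z) z0 s = (if s \<in> Q then pole z z0 i else pole z z0 s)"
  by (simp add: pole_def zz_def)

lemma sum_split_sites:
  fixes g g' :: "nat \<Rightarrow> 'c :: comm_monoid_add"
  assumes "i \<in> T" "T \<subseteq> S"
  shows "(\<Sum>s\<in>T. g s) = g i + (\<Sum>s\<in>T - {i}. g s)"
    and "(\<Sum>s\<in>(T - {i}) \<union> Q. g' s) = (\<Sum>s\<in>Q. g' s) + (\<Sum>s\<in>T - {i}. g' s)"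
proof -
  have fin: "finite T" using assms(2) finS by (rule finite_subset)
  show "(\<Sum>s\<in>T. g s) = g i + (\<Sum>s\<in>T - {i}. g s)" by (rule sum.remove[OF fin assms(1)])
  show "(\<Sum>s\<in>(T - {i}) \<union> Q. g' s) = (\<Sum>s\<in>Q. g' s) + (\<Sum>s\<in>T - {i}. g' s)"
    by (subst Un_commute, rule sum.union_disjoint) (use fin finQ disj assms in auto)
qed

text \<open>The common pole factors out of the sum over \<open>Q\<close>, so equivariance of \<phi>
  for the summed generators is enough.\<close>

lemma XX_Phi:
  assumes T: "i \<in> T" "T \<subseteq> S" and ab: "a \<in> {1..N}" "b \<in> {1..N}"
  shows "mk fls_const (tI S d) Phik * small.XX K T z z0 a b = big.XX K ((T - {i}) \<union> Q) (zz z) z0 a b * mk fls_const (tI S d) Phik"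
proof -
  define F where "F = mk fls_const (tI S d) Phik"
  define G where "G = (if a = b then dd - sc (fls_const (K a)) else (0 :: (nat \<Rightarrow> nat, complex fls) addop))"
  have G: "F * G = G * F"
    by (simp add: G_def F_def dd_mk sc_mk algebra_simps)
  have c: "F * (sc p * X) = sc p * (F * X)" for p X
    by (simp only: mult.assoc[symmetric] F_def sc_mk)
  have 1: "F * (sc (pole z z0 i) * small.efl i b a) = (\<Sum>s\<in>Q. sc (pole (zz z) z0 s) * big.efl s b a) * F"
  proof -
    have "F * (sc (pole z z0 i) * small.efl i b a) = sc (pole z z0 i) * ((\<Sum>s\<in>Q. big.efl s b a) * F)"
      unfolding c unfolding F_def by (simp only: Phi_i[OF chom_fls_const ab(2,1)])
    also have "\<dots> = (\<Sum>s\<in>Q. sc (pole (zz z) z0 s) * big.efl s b a) * F"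
      by (simp add: pole_zz sum_distrib_left sum_distrib_right mult.assoc)
    finally show ?thesis .
  qed
  have 2: "F * (\<Sum>s\<in>T - {i}. sc (pole z z0 s) * small.efl s b a) = (\<Sum>s\<in>T - {i}. sc (pole (zz z) z0 s) * big.efl s b a) * F"
    unfolding sum_distrib_left sum_distrib_right
  proof (intro sum.cong refl)
    fix s assume s: "s \<in> T - {i}"
    then have s': "s \<in> S - {i}" "s \<notin> Q" using T disj by auto
    show "F * (sc (pole z z0 s) * small.efl s b a) = sc (pole (zz z) z0 s) * big.efl s b a * F"
      unfolding c unfolding F_def by (simp add: Phi_other[OF chom_fls_const s'(1)] pole_zz s'(2) mult.assoc)
  qed
  show ?thesis
    unfolding small.XX_def big.XX_def sum_split_sites[OF T] F_def[symmetric] G_def[symmetric]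
    by (simp only: right_diff_distrib left_diff_distrib distrib_left distrib_right G 1 2)
qed

lemma XX_Pi:
  assumes T: "i \<in> T" "T \<subseteq> S" and ab: "a \<in> {1..N}" "b \<in> {1..N}"
  shows "mk fls_const (tI S' d') Pik * big.XX K ((T - {i}) \<union> Q) (zz z) z0 a b = small.XX K T z z0 a b * mk fls_const (tI S' d') Pik"
proof -
  define F where "F = mk fls_const (tI S' d') Pik"
  define G where "G = (if a = b then dd - sc (fls_const (K a)) else (0 :: (nat \<Rightarrow> nat, complex fls) addop))"
  have G: "F * G = G * F"
    by (simp add: G_def F_def dd_mk sc_mk algebra_simps)
  have c: "F * (sc p * X) = sc p * (F * X)" for p X
    by (simp only: mult.assoc[symmetric] F_def sc_mk)
  have 1: "F * (\<Sum>s\<in>Q. sc (pole (zz z) z0 s) * big.efl s b a) = (sc (pole z z0 i) * small.efl i b a) * F"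
  proof -
    have "F * (\<Sum>s\<in>Q. sc (pole (zz z) z0 s) * big.efl s b a) = sc (pole z z0 i) * (F * (\<Sum>s\<in>Q. big.efl s b a))"
      by (simp add: pole_zz sum_distrib_left c)
    also have "\<dots> = (sc (pole z z0 i) * small.efl i b a) * F"
      unfolding F_def by (simp only: Pi_i[OF chom_fls_const ab(2,1)] mult.assoc)
    finally show ?thesis .
  qed
  have 2: "F * (\<Sum>s\<in>T - {i}. sc (pole (zz z) z0 s) * big.efl s b a) = (\<Sum>s\<in>T - {i}. sc (pole z z0 s) * small.efl s b a) * F"
    unfolding sum_distrib_left sum_distrib_right
  proof (intro sum.cong refl)
    fix s assume s: "s \<in> T - {i}"
    then have s': "s \<in> S - {i}" "s \<notin> Q" using T disj by auto
    show "F * (sc (pole (zz z) z0 s) * big.efl s b a) = sc (pole z z0 s) * small.efl s b a * F"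
      unfolding c unfolding F_def by (simp add: Pi_other[OF chom_fls_const s'(1)] pole_zz s'(2) mult.assoc)
  qed
  show ?thesis
    unfolding small.XX_def big.XX_def sum_split_sites[OF T] F_def[symmetric] G_def[symmetric]
    by (simp only: right_diff_distrib left_diff_distrib distrib_left distrib_right G 1 2)
qed

text \<open>\<open>P0\<close> is a leading coefficient of a row determinant, so it inherits the
  intertwining property from the entries.\<close>

lemma P0_Phi:
  "app (mk (\<lambda>c. c) (tI S d) Phik) (app (small.P0 {i} (of_int l)) v) = app (big.P0 Q (of_int l)) (app (mk (\<lambda>c. c) (tI S d) Phik) v)"
proof -
  have Q: "Q \<subseteq> S'" "{i} \<subseteq> S" "zz (\<lambda>_. 0) = (\<lambda>_. 0)" using iS by (auto simp: S'_def zz_def fun_eq_iff)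
  have tw: "mk fls_const (tI S d) Phik * rdet N (small.XX (\<lambda>a. 0) {i} (\<lambda>_. 0) 0)
    = rdet N (big.XX (\<lambda>a. 0) Q (\<lambda>_. 0) 0) * mk fls_const (tI S d) Phik"
    by (rule rdet_intertwine) (use XX_Phi[of "{i}" _ _ "\<lambda>a. 0" "\<lambda>_. 0" 0] Q iS in simp)
  show ?thesis
    unfolding small.P0_mono'[OF Q(2)] big.P0_mono'[OF Q(1)]
    unfolding cf_mk[symmetric] app_mk_fmono[symmetric]
    by (simp only: app_eqD[OF tw])
qed

lemma Phi_wspace: "v \<in> small.wspace m \<Longrightarrow> app (mk (\<lambda>c. c) (tI S d) Phik) v \<in> big.wspace m"
  unfolding big.wspace_def
proof (intro CollectI conjI ballI allI impI)
  assume v: "v \<in> small.wspace m"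
  show "app (mk (\<lambda>c. c) (tI S d) Phik) v \<beta> = 0" if "\<beta> \<notin> tI S' d'" for \<beta>
    using that by (subst app_Phi[where h = "\<lambda>c. c"]) auto
  fix a assume a: "a \<in> {1..N}"
  have "(\<Sum>s\<in>S'. big.efc s a a) * mk (\<lambda>c. c) (tI S d) Phik = mk (\<lambda>c. c) (tI S d) Phik * (\<Sum>s\<in>S. small.efc s a a)"
    unfolding sum_split_sites(2)[OF iS subset_refl, folded S'_def] sum_split_sites(1)[OF iS subset_refl] distrib_left distrib_right
      Phi_i[OF chom_id a a]
    by (simp only: sum_distrib_left sum_distrib_right) (simp add: Phi_other[OF chom_id])
  then have "app (\<Sum>s\<in>S'. big.efc s a a) (app (mk (\<lambda>c. c) (tI S d) Phik) v) = app (mk (\<lambda>c. c) (tI S d) Phik) (app (\<Sum>s\<in>S. small.efc s a a) v)"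
    by (rule app_eqD)
  also have "app (\<Sum>s\<in>S. small.efc s a a) v = app (sc (m a)) v"
    using v a unfolding small.wspace_def by blast
  also have "app (mk (\<lambda>c. c) (tI S d) Phik) (app (sc (m a)) v) = app (sc (m a)) (app (mk (\<lambda>c. c) (tI S d) Phik) v)"
    by (rule app_eqD[OF sc_mk[symmetric]])
  finally show "app (\<Sum>s\<in>S'. big.efc s a a) (app (mk (\<lambda>c. c) (tI S d) Phik) v) = app (sc (m a)) (app (mk (\<lambda>c. c) (tI S d) Phik) v)" .
qed

lemma Pi_wspace: "v \<in> big.wspace m \<Longrightarrow> app (mk (\<lambda>c. c) (tI S' d') Pik) v \<in> small.wspace m"
  unfolding small.wspace_def
proof (intro CollectI conjI ballI allI impI)
  assume v: "v \<in> big.wspace m"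
  show "app (mk (\<lambda>c. c) (tI S' d') Pik) v \<beta> = 0" if "\<beta> \<notin> tI S d" for \<beta>
    using that by (subst app_Pi[where h = "\<lambda>c. c"]) auto
  fix a assume a: "a \<in> {1..N}"
  have "(\<Sum>s\<in>S. small.efc s a a) * mk (\<lambda>c. c) (tI S' d') Pik = mk (\<lambda>c. c) (tI S' d') Pik * (\<Sum>s\<in>S'. big.efc s a a)"
    unfolding sum_split_sites(2)[OF iS subset_refl, folded S'_def] sum_split_sites(1)[OF iS subset_refl] distrib_left distrib_right
      Pi_i[OF chom_id a a]
    by (simp only: sum_distrib_left sum_distrib_right) (simp add: Pi_other[OF chom_id])
  then have "app (\<Sum>s\<in>S. small.efc s a a) (app (mk (\<lambda>c. c) (tI S' d') Pik) v) = app (mk (\<lambda>c. c) (tI S' d') Pik) (app (\<Sum>s\<in>S'. big.efc s a a) v)"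
    by (rule app_eqD)
  also have "app (\<Sum>s\<in>S'. big.efc s a a) v = app (sc (m a)) v"
    using v a unfolding big.wspace_def by blast
  also have "app (mk (\<lambda>c. c) (tI S' d') Pik) (app (sc (m a)) v) = app (sc (m a)) (app (mk (\<lambda>c. c) (tI S' d') Pik) v)"
    by (rule app_eqD[OF sc_mk[symmetric]])
  finally show "app (\<Sum>s\<in>S. small.efc s a a) (app (mk (\<lambda>c. c) (tI S' d') Pik) v) = app (sc (m a)) (app (mk (\<lambda>c. c) (tI S' d') Pik) v)" .
qed

text \<open>Supplies the hypotheses \<open>vec\<close> and \<open>unit\<close> of
  \<open>frobenius_limit\<close> for the big system.\<close>

lemma vector_sites:
  assumes p: "p \<in> Q"
  shows "a \<in> {1..N} \<Longrightarrow> b \<in> {1..N} \<Longrightarrow> c \<in> {1..N} \<Longrightarrow> c' \<in> {1..N} \<Longrightarrow> \<gamma> \<in> tI S' d' \<Longrightarrow>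
      (\<Sum>\<delta>\<in>tI S' d'. tker S' d' p (E' p a b) \<beta> \<delta> * tker S' d' p (E' p c c') \<delta> \<gamma>)
      = (if b = c then tker S' d' p (E' p a c') \<beta> \<gamma> else 0)" (is "_ \<Longrightarrow> _ \<Longrightarrow> _ \<Longrightarrow> _ \<Longrightarrow> _ \<Longrightarrow> ?A")
    and "\<beta> \<in> tI S' d' \<Longrightarrow> \<gamma> \<in> tI S' d' \<Longrightarrow> (\<Sum>c=1..N. tker S' d' p (E' p c c) \<beta> \<gamma>) = (if \<beta> = \<gamma> then 1 else 0)"
proof -
  have q: "p \<in> S'" "E' p = vmat N" "d' p = N" using p by (auto simp: S'_def E'_def d'_def)
  have E: "E' p a b \<in> carrier_mat (d' p) (d' p)" for a b using q by simp
  { assume i: "a \<in> {1..N}" "b \<in> {1..N}" "c \<in> {1..N}" "c' \<in> {1..N}" "\<gamma> \<in> tI S' d'"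
    show ?A
      unfolding tker_mult[OF finS' q(1) E E i(5)] unfolding q(2) vmat_mult[OF i(2,3)]
      using tI_less[of _ S' d', OF _ q(1)] i(5) q(3) by (auto simp: tker_def) }
  { assume \<beta>: "\<beta> \<in> tI S' d'" and \<gamma>: "\<gamma> \<in> tI S' d'"
    have lt: "\<beta> p < N" "\<gamma> p < N" using tI_less[OF \<beta> q(1)] tI_less[OF \<gamma> q(1)] q(3) by auto
    have s: "(\<Sum>c=1..N. vmat N c c $$ (\<beta> p, \<gamma> p)) = (if \<gamma> p = \<beta> p then 1 else 0)"
    proof -
      have "(\<Sum>c=1..N. vmat N c c $$ (\<beta> p, \<gamma> p)) = (\<Sum>c=1..N. if c = Suc (\<beta> p) then (if \<gamma> p = \<beta> p then 1 else 0) else 0)"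
        by (intro sum.cong refl) (use lt in auto)
      also have "\<dots> = (if \<gamma> p = \<beta> p then 1 else 0)" using lt by (subst sum.delta) auto
      finally show ?thesis .
    qed
    have eq: "\<beta> = \<gamma> \<longleftrightarrow> (\<forall>s'\<in>S'. s' \<noteq> p \<longrightarrow> \<gamma> s' = \<beta> s') \<and> \<gamma> p = \<beta> p"
      using tI_eqI[OF \<beta> \<gamma> refl] by metis
    show "(\<Sum>c=1..N. tker S' d' p (E' p c c) \<beta> \<gamma>) = (if \<beta> = \<gamma> then 1 else 0)"
    proof (cases "\<forall>s'\<in>S'. s' \<noteq> p \<longrightarrow> \<gamma> s' = \<beta> s'")
      case True
      then have "\<beta> = \<gamma> \<longleftrightarrow> \<gamma> p = \<beta> p" unfolding eq by blast
      then show ?thesis unfolding tker_eq[OF \<beta> \<gamma>] q(2) by (simp only: if_P[OF True] s)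
    next
      case False
      then show ?thesis unfolding eq tker_zero[OF False] by (simp only: if_False simp_thms sum.neutral_const)
    qed }
qed

text \<open>The embedding carries \<open>v\<close> into the big system and its left inverse carries
  the polynomial back. Both intertwine the operators and preserve weights, and their composition is
  the identity, so the coefficient at \<open>l0\<close> is \<open>v\<close> again.\<close>

lemma split_limit:
  assumes z: "\<And>s. s \<in> S - {i} \<Longrightarrow> z s \<noteq> z i"
    and v: "v \<in> small.wspace m" "app (small.P0 {i} (of_nat l0)) v = 0" and l0: "l0 < N + card Q"
  shows "\<exists>f. (\<forall>l. f l \<in> small.wspace m) \<and> f l0 = v \<and> (\<forall>l<l0. f l = 0) \<and>
    ordge (int (card Q)) (app (rdet N (small.XX K S z (z i))) (\<Sum>l<N + card Q. fmono (int l) (f l)))"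
proof -
  define P where "P = mk (\<lambda>c :: complex. c) (tI S' d') Pik"
  define F where "F = mk (\<lambda>c :: complex. c) (tI S d) Phik"
  have "app (big.P0 Q (of_nat l0)) (app F v) = 0"
    using P0_Phi[of "int l0" v] v(2) unfolding F_def by (simp only: of_int_of_nat_eq app_0)
  then have "\<exists>g. (\<forall>l. g l \<in> big.wspace m) \<and> g l0 = app F v \<and> (\<forall>l<l0. g l = 0) \<and>
    ordge (int (card Q)) (app (rdet N (big.XX K S' (zz z) (z i))) (\<Sum>l<N + card Q. fmono (int l) (g l)))"
  proof (intro big.frobenius_limit)
    show "zz z s \<noteq> z i" if "s \<in> S' - Q" for s using that z by (auto simp: zz_def S'_def)
    show "app F v \<in> big.wspace m" using Phi_wspace[OF v(1)] by (simp add: F_def)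
  qed (use vector_sites l0 in \<open>auto simp: zz_def S'_def\<close>)
  then obtain g where g: "\<forall>l. g l \<in> big.wspace m" "g l0 = app F v" "\<forall>l<l0. g l = 0"
    "ordge (int (card Q)) (app (rdet N (big.XX K S' (zz z) (z i))) (\<Sum>l<N + card Q. fmono (int l) (g l)))" by blast
  have tw: "mk fls_const (tI S' d') Pik * rdet N (big.XX K S' (zz z) (z i))
    = rdet N (small.XX K S z (z i)) * mk fls_const (tI S' d') Pik"
    by (rule rdet_intertwine) (simp only: S'_def[symmetric] XX_Pi[OF iS subset_refl, folded S'_def])
  show ?thesis
  proof (intro exI[of _ "\<lambda>l. app P (g l)"] conjI allI impI)
    show "app P (g l) \<in> small.wspace m" for l using Pi_wspace g(1) by (simp add: P_def)
    show "app P (g l0) = v" unfolding g(2) P_def F_def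
      by (rule Pi_Phi) (use v(1) in \<open>auto simp: small.wspace_def\<close>)
    show "app P (g l) = 0" if "l < l0" for l using g(3) that by (simp only: app_0)
    have "(\<Sum>l<N + card Q. fmono (int l) (app P (g l))) = app (mk fls_const (tI S' d') Pik) (\<Sum>l<N + card Q. fmono (int l) (g l))"
      unfolding P_def app_sum by (simp only: app_mk_fmono)
    then show "ordge (int (card Q)) (app (rdet N (small.XX K S z (z i))) (\<Sum>l<N + card Q. fmono (int l) (app P (g l))))"
      using ordge_mk[OF g(4), of "tI S' d'" Pik] by (simp only: app_eqD[OF tw])
  qed
qed

end

section \<open>Embedding a module into a tensor power\<close>

definition hip :: "'w set \<Rightarrow> ('w \<Rightarrow> complex) \<Rightarrow> ('w \<Rightarrow> complex) \<Rightarrow> complex" where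
  "hip I x y = (\<Sum>\<beta>\<in>I. cnj (x \<beta>) * y \<beta>)"

lemma hip_simps:
  "hip I (x + x') y = hip I x y + hip I x' y" "hip I x (y + y') = hip I x y + hip I x y'"
  "hip I (app (sc c) x) y = cnj c * hip I x y" "hip I x (app (sc c) y) = c * hip I x y"
  "hip I 0 y = 0" "hip I x 0 = 0"
  by (simp_all add: hip_def app_sc algebra_simps sum.distrib sum_distrib_left)

lemma hip_eq_0:
  assumes "finite I" "hip I x x = 0" "\<beta> \<in> I"
  shows "x \<beta> = 0"
proof -
  have "hip I x x = of_real (\<Sum>\<beta>\<in>I. (cmod (x \<beta>))\<^sup>2)"
    unfolding hip_def of_real_sum by (intro sum.cong refl) (simp only: complex_norm_square mult.commute)
  then have "(\<Sum>\<beta>\<in>I. (cmod (x \<beta>))\<^sup>2) = 0" using assms(2) by (metis of_real_eq_0_iff)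
  then have "(cmod (x \<beta>))\<^sup>2 = 0" using assms(1,3) by (simp add: sum_nonneg_eq_0_iff)
  then show ?thesis by simp
qed

lemma commutator_swap:
  assumes "X * Y - Y * X = (if P then Z else 0) - (if P' then Z' else (0 :: ('i, 'r :: ring_1) addop))"
  shows "app X (app Y x) = app Y (app X x) + ((if P then app Z x else 0) - (if P' then app Z' x else 0))"
proof -
  have "X * Y = Y * X + ((if P then Z else 0) - (if P' then Z' else 0))"
    using assms by (simp only: algebra_simps)
  then have "app (X * Y) x = app (Y * X + ((if P then Z else 0) - (if P' then Z' else 0))) x"
    by (rule arg_cong)
  then show ?thesis by (simp only: app_ring_simps if_distrib[of "\<lambda>T. app T x"])
qed

text \<open>
  Two modules with highest weight vectors \<open>w\<close> and \<open>b\<close> of the same weight, the second one unitary. The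
  submodule \<open>G\<close> of the direct sum generated by \<open>(w, b)\<close> is the graph of a map: if \<open>(0, y)\<close> is in \<open>G\<close>, then
  \<open>y\<close> is orthogonal to \<open>b\<close>, as \<open>w\<close> is not in the span \<open>L\<close> of lower weight vectors, and by adjointness to
  the second component of every element of \<open>G\<close>.
\<close>

locale hw_pair =
  fixes N :: nat and A :: "nat \<Rightarrow> nat \<Rightarrow> ('c, complex) addop" and B :: "nat \<Rightarrow> nat \<Rightarrow> ('w, complex) addop"
    and I :: "'w set" and \<Lambda> :: "nat \<Rightarrow> complex" and w :: "'c \<Rightarrow> complex" and b :: "'w \<Rightarrow> complex"
  assumes finI: "finite I"
    and A_rel: "\<And>p q r s. p \<in> {1..N} \<Longrightarrow> q \<in> {1..N} \<Longrightarrow> r \<in> {1..N} \<Longrightarrow> s \<in> {1..N} \<Longrightarrow>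
      A p q * A r s - A r s * A p q = (if q = r then A p s else 0) - (if p = s then A r q else 0)"
    and B_rel: "\<And>p q r s. p \<in> {1..N} \<Longrightarrow> q \<in> {1..N} \<Longrightarrow> r \<in> {1..N} \<Longrightarrow> s \<in> {1..N} \<Longrightarrow>
      B p q * B r s - B r s * B p q = (if q = r then B p s else 0) - (if p = s then B r q else 0)"
    and A_sc: "\<And>p q c. sc c * A p q = A p q * sc c" and B_sc: "\<And>p q c. sc c * B p q = B p q * sc c"
    and B_supp: "\<And>p q y \<beta>. \<beta> \<notin> I \<Longrightarrow> app (B p q) y \<beta> = 0"
    and B_adj: "\<And>p q x y. p \<in> {1..N} \<Longrightarrow> q \<in> {1..N} \<Longrightarrow> hip I (app (B p q) x) y = hip I x (app (B q p) y)"
    and w: "w \<noteq> 0" "\<And>p q. p \<in> {1..N} \<Longrightarrow> q \<in> {1..N} \<Longrightarrow> p < q \<Longrightarrow> app (A p q) w = 0"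
      "\<And>p. p \<in> {1..N} \<Longrightarrow> app (A p p) w = app (sc (\<Lambda> p)) w"
    and b: "b \<noteq> 0" "\<And>p q. p \<in> {1..N} \<Longrightarrow> q \<in> {1..N} \<Longrightarrow> p < q \<Longrightarrow> app (B p q) b = 0"
      "\<And>p. p \<in> {1..N} \<Longrightarrow> app (B p p) b = app (sc (\<Lambda> p)) b" "\<And>\<beta>. \<beta> \<notin> I \<Longrightarrow> b \<beta> = 0"
begin

text \<open>Only lowering operators generate, which leaves them as the one nontrivial case in
  \<open>G_decompose\<close>. Stability under all generators follows in \<open>G_act\<close> by
  commuting them past the lowering operators down to the highest weight vectors.\<close>

inductive G :: "('c \<Rightarrow> complex) \<Rightarrow> ('w \<Rightarrow> complex) \<Rightarrow> bool" where
  base: "G w b"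
| add: "G x y \<Longrightarrow> G x' y' \<Longrightarrow> G (x + x') (y + y')"
| scale: "G x y \<Longrightarrow> G (app (sc c) x) (app (sc c) y)"
| low: "G x y \<Longrightarrow> p \<in> {1..N} \<Longrightarrow> q \<in> {1..N} \<Longrightarrow> q < p \<Longrightarrow> G (app (A p q) x) (app (B p q) y)"

lemma G_0: "G 0 0"
  using scale[OF base, of 0] by (simp only: sc_simps app_ring_simps)

lemma G_uminus: "G x y \<Longrightarrow> G (- x) (- y)"
  using scale[of x y "- 1"] by (simp only: sc_simps app_ring_simps)

lemma G_diff: "G x y \<Longrightarrow> G x' y' \<Longrightarrow> G (x - x') (y - y')"
  using add[OF _ G_uminus, of x y x' y'] by (simp only: diff_conv_add_uminus)

lemma G_sum: "(\<And>j. j \<in> J \<Longrightarrow> G (x j) (y j)) \<Longrightarrow> G (\<Sum>j\<in>J. x j) (\<Sum>j\<in>J. y j)"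
  by (induction J rule: infinite_finite_induct) (simp_all only: sum.infinite sum.empty sum.insert G_0 add insert_iff simp_thms)

lemmas swap_A = commutator_swap[OF A_rel] and swap_B = commutator_swap[OF B_rel]

lemma G_act: "G x y \<Longrightarrow> p \<in> {1..N} \<Longrightarrow> q \<in> {1..N} \<Longrightarrow> G (app (A p q) x) (app (B p q) y)"
proof (induction arbitrary: p q rule: G.induct)
  case base
  consider "p < q" | "p = q" | "q < p" by linarith
  then show ?case
  proof cases
    case 1
    show ?thesis unfolding w(2)[OF base 1] b(2)[OF base 1] by (rule G_0)
  next
    case 2
    show ?thesis unfolding 2 w(3)[OF base(2)] b(3)[OF base(2)] by (intro G.scale G.base)
  next
    case 3
    then show ?thesis by (intro low G.base base)
  qed
next
  case (add x y x' y')
  show ?case unfolding app_add by (intro G.add add.IH add.prems)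
next
  case (scale x y c)
  show ?case unfolding app_eqD[OF A_sc[symmetric]] app_eqD[OF B_sc[symmetric]] by (intro G.scale scale.IH scale.prems)
next
  case (low x y r s)
  have 1: "G (if q = r then app (A p s) x else 0) (if q = r then app (B p s) y else 0)"
    by (cases "q = r") (simp_all only: if_True if_False simp_thms G_0 low.IH[OF low.prems(1) low.hyps(3)])
  have 2: "G (if p = s then app (A r q) x else 0) (if p = s then app (B r q) y else 0)"
    by (cases "p = s") (simp_all only: if_True if_False simp_thms G_0 low.IH[OF low.hyps(2) low.prems(2)])
  show ?case
    unfolding swap_A[OF low.prems low.hyps(2,3)] swap_B[OF low.prems low.hyps(2,3)]
    by (rule G.add[OF G.low[OF low.IH[OF low.prems] low.hyps(2-4)] G_diff[OF 1 2]])
qed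

lemma G_supp: "G x y \<Longrightarrow> \<beta> \<notin> I \<Longrightarrow> y \<beta> = 0"
  by (induction rule: G.induct) (simp_all add: b(4) app_sc B_supp)

text \<open>A grading element: \<open>A p q\<close> shifts its eigenvalues by q - p, so lowering
  operators decrease them by positive integers.\<close>

definition H :: "('c, complex) addop" where "H = (\<Sum>c=1..N. sc (of_nat (N - c)) * A c c)"
definition h0 :: complex where "h0 = (\<Sum>c=1..N. of_nat (N - c) * \<Lambda> c)"

lemma H_sc: "sc c * H = H * sc c"
  unfolding H_def sum_distrib_left sum_distrib_right
  by (intro sum.cong refl)
    (subst mult.assoc[symmetric], subst sc_commute, subst mult.assoc, subst A_sc, subst mult.assoc[symmetric], rule refl)

lemma H_w: "app H w = app (sc h0) w"
proof -
  have "app H w = (\<Sum>c=1..N. app (sc (of_nat (N - c))) (app (A c c) w))"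
    unfolding H_def app_sum_left by (simp only: app_ring_simps)
  also have "\<dots> = (\<Sum>c=1..N. app (sc (of_nat (N - c) * \<Lambda> c)) w)"
    by (intro sum.cong refl) (simp only: w(3) sc_simps app_ring_simps)
  also have "\<dots> = app (sc h0) w"
    unfolding h0_def by (rule ext) (simp add: app_sc sum_fun_apply sum_distrib_right)
  finally show ?thesis .
qed

lemma H_A:
  assumes i: "p \<in> {1..N}" "q \<in> {1..N}"
  shows "H * A p q = A p q * H + sc (of_nat q - of_nat p) * A p q"
proof -
  have "H * A p q - A p q * H = (\<Sum>c=1..N. sc (of_nat (N - c)) * (A c c * A p q - A p q * A c c))"
    unfolding H_def sum_distrib_left sum_distrib_right sum_subtractf[symmetric]
  proof (intro sum.cong refl)
    fix c
    have "A p q * (sc (of_nat (N - c)) * A c c) = sc (of_nat (N - c)) * (A p q * A c c)"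
      by (subst mult.assoc[symmetric], subst A_sc[symmetric]) (rule mult.assoc)
    then show "sc (of_nat (N - c)) * A c c * A p q - A p q * (sc (of_nat (N - c)) * A c c) = sc (of_nat (N - c)) * (A c c * A p q - A p q * A c c)"
      by (simp only: right_diff_distrib mult.assoc)
  qed
  also have "\<dots> = (\<Sum>c=1..N. (if c = p then sc (of_nat (N - c)) * A p q else 0) - (if c = q then sc (of_nat (N - c)) * A p q else 0))"
    by (intro sum.cong refl, subst A_rel) (use i in \<open>auto simp: right_diff_distrib\<close>)
  also have "\<dots> = sc (of_nat (N - p)) * A p q - sc (of_nat (N - q)) * A p q"
    unfolding sum_subtractf using i by (simp add: sum.delta)
  also have "\<dots> = sc (of_nat q - of_nat p) * A p q"
    using i by (simp add: of_nat_diff left_diff_distrib[symmetric] sc_simps(2)[symmetric])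
  finally show ?thesis by (simp only: diff_eq_eq add.commute)
qed

inductive L :: "('c \<Rightarrow> complex) \<Rightarrow> bool" where
  eig: "app H x = app (sc (h0 - of_nat k)) x \<Longrightarrow> 1 \<le> k \<Longrightarrow> L x"
| add: "L x \<Longrightarrow> L y \<Longrightarrow> L (x + y)"

lemma L_scale: "L x \<Longrightarrow> L (app (sc c) x)"
proof (induction rule: L.induct)
  case (eig x k)
  show ?case
    by (rule L.eig[OF _ eig(2)]) (simp only: app_eqD[OF H_sc[symmetric]] eig(1) app_eqD[OF sc_commute[of c]])
next
  case (add x y)
  then show ?case unfolding app_add by (intro L.add)
qed

lemma A_eig:
  assumes "p \<in> {1..N}" "q \<in> {1..N}" "q < p" "app H x = app (sc (h0 - of_nat k)) x"
  shows "app H (app (A p q) x) = app (sc (h0 - of_nat (k + (p - q)))) (app (A p q) x)"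
proof -
  have "app H (app (A p q) x) = app (A p q * H + sc (of_nat q - of_nat p) * A p q) x"
    unfolding H_A[OF assms(1,2), symmetric] by (simp only: app_ring_simps)
  also have "\<dots> = app (sc (h0 - of_nat k)) (app (A p q) x) + app (sc (of_nat q - of_nat p)) (app (A p q) x)"
    by (simp only: app_ring_simps assms(4) app_eqD[OF A_sc])
  also have "\<dots> = app (sc ((h0 - of_nat k) + (of_nat q - of_nat p))) (app (A p q) x)"
    by (simp only: sc_simps(1) app_ring_simps)
  also have "(h0 - of_nat k) + (of_nat q - of_nat p) = h0 - of_nat (k + (p - q))"
    using assms(3) by (simp add: of_nat_diff)
  finally show ?thesis .
qed

lemma L_low: "L x \<Longrightarrow> p \<in> {1..N} \<Longrightarrow> q \<in> {1..N} \<Longrightarrow> q < p \<Longrightarrow> L (app (A p q) x)"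
proof (induction rule: L.induct)
  case (eig x k)
  show ?case by (rule L.eig[OF A_eig[OF eig(3-5,1)]]) (use eig in simp)
next
  case (add x y)
  then show ?case unfolding app_add by (intro L.add)
qed

text \<open>Annihilates the sum \<open>L\<close> of the eigenspaces of \<open>H\<close> for \<open>h0 - 1, h0 - 2, \<dots>\<close>, but not \<open>w\<close>.\<close>

primrec hp :: "nat \<Rightarrow> ('c, complex) addop" where
  "hp 0 = 1"
| "hp (Suc m) = (H - sc (h0 - of_nat (Suc m))) * hp m"

lemma hp_eig: "app H x = app (sc \<mu>) x \<Longrightarrow> app (hp m) x = app (sc (\<Prod>q=1..m. \<mu> - h0 + of_nat q)) x"
proof (induction m)
  case 0
  show ?case by (simp add: sc_simps)
next
  case (Suc m)
  let ?c = "\<Prod>q=1..m. \<mu> - h0 + of_nat q"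
  have "app (hp (Suc m)) x = app H (app (sc ?c) x) - app (sc (h0 - of_nat (Suc m))) (app (sc ?c) x)"
    by (simp only: hp.simps app_ring_simps Suc.IH[OF Suc.prems])
  also have "app H (app (sc ?c) x) = app (sc \<mu>) (app (sc ?c) x)"
    by (simp only: app_eqD[OF H_sc[symmetric]] Suc.prems app_eqD[OF sc_commute[of ?c]])
  also have "app (sc \<mu>) (app (sc ?c) x) - app (sc (h0 - of_nat (Suc m))) (app (sc ?c) x) = app (sc ((\<mu> - (h0 - of_nat (Suc m))) * ?c)) x"
    by (simp only: sc_simps app_ring_simps)
  also have "(\<mu> - (h0 - of_nat (Suc m))) * ?c = (\<Prod>q=1..Suc m. \<mu> - h0 + of_nat q)"
    by (simp add: mult.commute)
  finally show ?case .
qed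

lemma L_hp: "L x \<Longrightarrow> \<exists>n. \<forall>m\<ge>n. app (hp m) x = 0"
proof (induction rule: L.induct)
  case (eig x k)
  have "app (hp m) x = 0" if "k \<le> m" for m
  proof -
    have "(\<Prod>q=1..m. h0 - of_nat k - h0 + of_nat q) = (0 :: complex)"
      by (rule prod_zero) (use eig(2) that in \<open>auto intro!: bexI[of _ k]\<close>)
    then show ?thesis unfolding hp_eig[OF eig(1)] by (simp only: sc_simps app_ring_simps)
  qed
  then show ?case by blast
next
  case (add x y)
  then obtain n n' where "\<forall>m\<ge>n. app (hp m) x = 0" "\<forall>m\<ge>n'. app (hp m) y = 0" by blast
  then show ?case by (intro exI[of _ "max n n'"] allI impI) (simp only: app_add max.bounded_iff add_0)
qed

lemma L_w: "L (app (sc c) w) \<Longrightarrow> c = 0"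
proof -
  assume "L (app (sc c) w)"
  then obtain m where "app (hp m) (app (sc c) w) = 0" using L_hp by blast
  moreover have "app H (app (sc c) w) = app (sc h0) (app (sc c) w)"
    by (simp only: app_eqD[OF H_sc[symmetric]] H_w app_eqD[OF sc_commute[of c]])
  ultimately have "app (sc (\<Prod>q=1..m. h0 - h0 + of_nat q)) (app (sc c) w) = 0"
    by (simp only: hp_eig)
  then have z: "(\<Prod>q=1..m. of_nat q :: complex) * (c * w \<beta>) = 0" for \<beta>
    by (metis (no_types, lifting) app_sc cancel_comm_monoid_add_class.diff_cancel add_0 prod.cong zero_fun_apply)
  have "(\<Prod>q=1..m. of_nat q :: complex) \<noteq> 0" by simp
  moreover obtain \<beta> where "w \<beta> \<noteq> 0" using w(1) by (auto simp: fun_eq_iff)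
  ultimately show "c = 0" using z[of \<beta>] by simp
qed

text \<open>One scalar records both top components. Lowering moves the first component into
  \<open>L\<close> and makes the second orthogonal to \<open>b\<close>, because the adjoint raising
  operator kills \<open>b\<close>.\<close>

lemma G_decompose: "G x y \<Longrightarrow> \<exists>c x'. x = app (sc c) w + x' \<and> L x' \<and> hip I b y = c * hip I b b"
proof (induction rule: G.induct)
  case base
  have "L 0" by (rule L.eig[of 0 1]) (simp_all only: app_0 le_refl)
  then show ?case by (intro exI[of _ 1] exI[of _ 0]) (simp only: sc_simps app_ring_simps simp_thms add_0_right mult_1)
next
  case (add x y x' y')
  then obtain c u c' u' where *: "x = app (sc c) w + u" "L u" "hip I b y = c * hip I b b"
    "x' = app (sc c') w + u'" "L u'" "hip I b y' = c' * hip I b b" by blast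
  show ?case
  proof (intro exI conjI)
    show "x + x' = app (sc (c + c')) w + (u + u')"
      unfolding *(1,4) by (simp only: sc_simps app_ring_simps add_ac)
    show "L (u + u')" using * by (intro L.add)
    show "hip I b (y + y') = (c + c') * hip I b b" using * by (simp only: hip_simps distrib_right)
  qed
next
  case (scale x y k)
  then obtain c u where *: "x = app (sc c) w + u" "L u" "hip I b y = c * hip I b b" by blast
  show ?case
  proof (intro exI conjI)
    show "app (sc k) x = app (sc (k * c)) w + app (sc k) u"
      unfolding *(1) by (simp only: sc_simps app_ring_simps app_add)
    show "L (app (sc k) u)" by (rule L_scale[OF *(2)])
    show "hip I b (app (sc k) y) = (k * c) * hip I b b" using * by (simp only: hip_simps mult.assoc)
  qed
next
  case (low x y p q)
  then obtain c u where *: "x = app (sc c) w + u" "L u" by blast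
  show ?case
  proof (intro exI conjI)
    show "app (A p q) x = app (sc 0) w + app (A p q) x" by (simp only: sc_simps app_ring_simps add_0)
    have "app H (app (sc c) w) = app (sc (h0 - of_nat 0)) (app (sc c) w)"
      by (simp only: app_eqD[OF H_sc[symmetric]] H_w app_eqD[OF sc_commute[of c]] of_nat_0 diff_zero)
    from A_eig[OF low.hyps(2-4) this] have "L (app (A p q) (app (sc c) w))"
      by (rule L.eig) (use low.hyps in simp)
    then show "L (app (A p q) x)" unfolding *(1) app_add by (rule L.add[OF _ L_low[OF *(2) low.hyps(2-4)]])
    show "hip I b (app (B p q) y) = 0 * hip I b b"
      unfolding B_adj[OF low.hyps(3,2), symmetric] b(2)[OF low.hyps(3,2,4)] by (simp only: hip_simps mult_zero_left)
  qed
qed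

lemma L_uminus: "L x \<Longrightarrow> L (- x)"
  using L_scale[of x "- 1"] by (simp only: sc_simps app_ring_simps)

lemma G_0_right: "G 0 y \<Longrightarrow> y = 0"
proof -
  have orth: "G x' y' \<Longrightarrow> G 0 y \<Longrightarrow> hip I y' y = 0" for x' y' y
  proof (induction arbitrary: y rule: G.induct)
    case base
    then obtain c u where *: "0 = app (sc c) w + u" "L u" "hip I b y = c * hip I b b" using G_decompose by blast
    have "app (sc c) w = - u" using *(1) by (metis eq_neg_iff_add_eq_0)
    then have "c = 0" using L_uminus[OF *(2)] L_w by metis
    then show ?case using *(3) by simp
  next
    case (low x y' p q)
    have "G (app (A q p) 0) (app (B q p) y)" by (rule G_act[OF low.prems low.hyps(3,2)])
    then show ?case unfolding B_adj[OF low.hyps(2,3)] app_0 by (rule low.IH)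
  qed (simp_all only: hip_simps mult_zero_right add_0)
  \<comment> \<open>By \<open>orth\<close>, \<open>y\<close> is orthogonal to the second component
    of every element of the graph, hence to itself.\<close>
  assume y: "G 0 y"
  show "y = 0"
  proof (rule ext)
    fix \<beta> show "y \<beta> = 0 \<beta>" using hip_eq_0[OF finI orth[OF y y]] G_supp[OF y] by (cases "\<beta> \<in> I") simp_all
  qed
qed

end

lemma hip_sum: "hip I x (\<Sum>j\<in>J. y j) = (\<Sum>j\<in>J. hip I x (y j))" "hip I (\<Sum>j\<in>J. y j) x = (\<Sum>j\<in>J. hip I (y j) x)"
  by (induction J rule: infinite_finite_induct) (simp_all only: sum.infinite sum.empty sum.insert hip_simps not_False_eq_True)

lemma hip_adjoint:
  assumes "\<And>\<beta> \<gamma>. \<beta> \<in> I \<Longrightarrow> \<gamma> \<in> I \<Longrightarrow> M \<beta> \<gamma> = cnj (M' \<gamma> \<beta>)"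
  shows "hip I (app (mk (\<lambda>c. c) I M) x) y = hip I x (app (mk (\<lambda>c. c) I M') y)"
proof -
  have "hip I (app (mk (\<lambda>c. c) I M) x) y = (\<Sum>\<beta>\<in>I. \<Sum>\<gamma>\<in>I. cnj (x \<gamma>) * (M' \<gamma> \<beta> * y \<beta>))"
    unfolding hip_def app_mk cnj_sum sum_distrib_right by (intro sum.cong refl) (simp add: assms)
  also have "\<dots> = hip I x (app (mk (\<lambda>c. c) I M') y)"
    unfolding hip_def app_mk sum_distrib_left by (rule sum.swap)
  finally show ?thesis .
qed

text \<open>The first module is now irreducible on coordinates below \<open>d\<close>.
  Irreducibility is phrased for predicates: one that is closed under the module operations and holds
  for some nonzero vector holds for all vectors.\<close>

locale hw_embed = hw_pair N "\<lambda>p q. mk (\<lambda>c. c) {..<d} (E p q)" "\<lambda>p q. mk (\<lambda>c. c) I (t p q)" I \<Lambda> w b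
  for N d :: nat and E :: "nat \<Rightarrow> nat \<Rightarrow> nat \<Rightarrow> nat \<Rightarrow> complex" and I :: "'w set" and t :: "nat \<Rightarrow> nat \<Rightarrow> 'w \<Rightarrow> 'w \<Rightarrow> complex"
    and \<Lambda> w b +
  assumes E_supp: "\<And>p q c c'. \<not> c < d \<Longrightarrow> E p q c c' = 0" and w_supp: "\<And>c. \<not> c < d \<Longrightarrow> w c = 0"
    and herm: "\<And>p q \<beta> \<gamma>. p \<in> {1..N} \<Longrightarrow> q \<in> {1..N} \<Longrightarrow> \<beta> \<in> I \<Longrightarrow> \<gamma> \<in> I \<Longrightarrow> t p q \<beta> \<gamma> = cnj (t q p \<gamma> \<beta>)"
    and irr: "\<And>P x0 x. (\<And>x. P x \<Longrightarrow> \<forall>c. \<not> c < d \<longrightarrow> x c = 0) \<Longrightarrow> (\<And>x y. P x \<Longrightarrow> P y \<Longrightarrow> P (x + y)) \<Longrightarrow>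
      (\<And>c x. P x \<Longrightarrow> P (app (sc c) x)) \<Longrightarrow>
      (\<And>p q x. p \<in> {1..N} \<Longrightarrow> q \<in> {1..N} \<Longrightarrow> P x \<Longrightarrow> P (app (mk (\<lambda>c. c) {..<d} (E p q)) x)) \<Longrightarrow>
      P x0 \<Longrightarrow> x0 \<noteq> 0 \<Longrightarrow> \<forall>c. \<not> c < d \<longrightarrow> x c = 0 \<Longrightarrow> P x"
begin

lemma G_supp_left: "G x y \<Longrightarrow> \<not> c < d \<Longrightarrow> x c = 0"
  by (induction rule: G.induct) (simp_all add: w_supp app_sc app_mk E_supp)

lemma G_total: "\<forall>c. \<not> c < d \<longrightarrow> x c = 0 \<Longrightarrow> \<exists>y. G x y"
proof (rule irr[where P = "\<lambda>x. \<exists>y. G x y" and x = x])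
  show "w \<noteq> 0" by (rule w(1))
  show "\<exists>y. G w y" using G.base by blast
  show "\<exists>z. G (x + y) z" if "\<exists>z. G x z" "\<exists>z. G y z" for x y using that G.add by blast
  show "\<exists>z. G (app (sc c) x) z" if "\<exists>z. G x z" for c x using that G.scale by blast
  show "\<exists>z. G (app (mk (\<lambda>c. c) {..<d} (E p q)) x) z" if "p \<in> {1..N}" "q \<in> {1..N}" "\<exists>z. G x z" for p q x
    using that G_act by blast
qed (use G_supp_left in blast)+

text \<open>The x with (x, 0) in the graph form a submodule. Were it nonzero, it would contain
  \<open>w\<close>; subtracting from (w, b) leaves (0, b), which \<open>G_0_right\<close>
  excludes.\<close>

lemma G_0_left: "G x 0 \<Longrightarrow> x = 0"
proof (rule ccontr)
  assume x: "G x 0" "x \<noteq> 0"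
  have "G w 0"
  proof (rule irr[where P = "\<lambda>x. G x 0" and x = w, OF _ _ _ _ x])
    show "G (x + y) 0" if "G x 0" "G y 0" for x y using G.add[OF that] by (simp only: add_0)
    show "G (app (sc c) x) 0" if "G x 0" for c x using G.scale[OF that] by (simp only: app_0)
    show "G (app (mk (\<lambda>c. c) {..<d} (E p q)) x) 0" if "p \<in> {1..N}" "q \<in> {1..N}" "G x 0" for p q x
      using G_act[OF that(3,1,2)] by (simp only: app_0)
  qed (use G_supp_left w_supp in blast)+
  from G_diff[OF G.base this] have "G 0 b" by (simp only: diff_self diff_zero)
  then show False using G_0_right b(1) by blast
qed

definition ee :: "nat \<Rightarrow> nat \<Rightarrow> complex" where "ee c = (\<lambda>c'. if c' = c then 1 else 0)"
text \<open>The images of the basis vectors under the embedding; \<open>G_0_right\<close> makes the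
  choice unique.\<close>

definition yy :: "nat \<Rightarrow> 'w \<Rightarrow> complex" where "yy c = (SOME y. G (ee c) y)"

lemma G_yy: "c < d \<Longrightarrow> G (ee c) (yy c)"
  using someI_ex[OF G_total[of "ee c"]] by (simp add: yy_def ee_def)

lemma B_yy:
  assumes "p \<in> {1..N}" "q \<in> {1..N}" "c' < d"
  shows "app (mk (\<lambda>c. c) I (t p q)) (yy c') = (\<Sum>c<d. app (sc (E p q c c')) (yy c))"
proof -
  have eq: "app (mk (\<lambda>c. c) {..<d} (E p q)) (ee c') = (\<Sum>c<d. app (sc (E p q c c')) (ee c))"
    using assms(3) by (intro ext) (auto simp: app_mk app_sc ee_def sum_fun_apply E_supp if_distrib[of "(*) _"] cong: if_cong)
  have 1: "G (\<Sum>c<d. app (sc (E p q c c')) (ee c)) (\<Sum>c<d. app (sc (E p q c c')) (yy c))"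
    by (intro G_sum G.scale G_yy) simp
  have 2: "G (\<Sum>c<d. app (sc (E p q c c')) (ee c)) (app (mk (\<lambda>c. c) I (t p q)) (yy c'))"
    using G_act[OF G_yy[OF assms(3)] assms(1,2)] unfolding eq .
  from G_diff[OF 2 1] show ?thesis unfolding diff_self using G_0_right eq_iff_diff_eq_0 by blast
qed

text \<open>The left inverse of the embedding is \<open>(\<phi>\<^sup>* \<phi>)\<^bsup>-1\<^esup> \<phi>\<^sup>*\<close>.\<close>

definition gram :: "complex mat" where "gram = mat d d (\<lambda>(c, c'). hip I (yy c) (yy c'))"

lemma gram_carrier: "gram \<in> carrier_mat d d" by (simp add: gram_def)

text \<open>A vector in the kernel gives a combination of the images of norm zero, hence zero, and
  the embedding is injective by \<open>G_0_left\<close>.\<close>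

lemma det_gram: "det gram \<noteq> 0"
proof
  assume "det gram = 0"
  then obtain v where v: "v \<in> carrier_vec d" "v \<noteq> 0\<^sub>v d" "gram *\<^sub>v v = 0\<^sub>v d"
    using det_0_iff_vec_prod_zero_field[OF gram_carrier] by blast
  define u where "u = (\<Sum>c<d. app (sc (vec_index v c)) (yy c))"
  have G: "G (\<Sum>c<d. app (sc (vec_index v c)) (ee c)) u" unfolding u_def by (intro G_sum G.scale G_yy) simp
  have row: "(\<Sum>c'<d. (vec_index v c') * hip I (yy c) (yy c')) = 0" if "c < d" for c
  proof -
    have "vec_index (gram *\<^sub>v v) c = (\<Sum>c'<d. (vec_index v c') * hip I (yy c) (yy c'))"
      using that v(1) by (auto simp: gram_def scalar_prod_def atLeast0LessThan mult.commute intro!: sum.cong)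
    then show ?thesis using v(3) that by simp
  qed
  have "hip I u u = (\<Sum>c<d. cnj (vec_index v c) * (\<Sum>c'<d. (vec_index v c') * hip I (yy c) (yy c')))"
    unfolding u_def by (simp only: hip_sum(2) hip_simps(3)) (simp only: hip_sum(1) hip_simps(4))
  also have "\<dots> = 0" by (intro sum.neutral ballI) (simp add: row)
  finally have "u \<beta> = 0" for \<beta> using hip_eq_0[OF finI] G_supp[OF G] by (cases "\<beta> \<in> I") auto
  then have "u = 0" by (simp add: fun_eq_iff)
  then have "(\<Sum>c<d. app (sc (vec_index v c)) (ee c)) = 0" using G_0_left G by blast
  then have z: "(\<Sum>c<d. app (sc (vec_index v c)) (ee c)) c = 0" for c by (metis zero_fun_apply)
  have "vec_index v c = 0" if "c < d" for c
    using z[of c] that by (simp add: sum_fun_apply app_sc ee_def if_distrib[of "(*) _"] cong: if_cong)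
  then show False using v(1,2) by auto
qed

lemma embedding:
  "\<exists>\<phi> \<pi>. (\<forall>p\<in>{1..N}. \<forall>q\<in>{1..N}. \<forall>\<beta> c'. c' < d \<longrightarrow> (\<Sum>c<d. \<phi> \<beta> c * E p q c c') = (\<Sum>\<gamma>\<in>I. t p q \<beta> \<gamma> * \<phi> \<gamma> c'))
    \<and> (\<forall>p\<in>{1..N}. \<forall>q\<in>{1..N}. \<forall>\<gamma>\<in>I. \<forall>c<d. (\<Sum>\<beta>\<in>I. \<pi> c \<beta> * t p q \<beta> \<gamma>) = (\<Sum>c'<d. E p q c c' * \<pi> c' \<gamma>))
    \<and> (\<forall>c<d. \<forall>c'<d. (\<Sum>\<beta>\<in>I. \<pi> c \<beta> * \<phi> \<beta> c') = (if c = c' then 1 else (0 :: complex)))"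
proof -
  define h where "h = (1 / det gram) \<cdot>\<^sub>m adj_mat gram"
  have hc: "h \<in> carrier_mat d d" using adj_mat(1)[OF gram_carrier] by (simp add: h_def)
  have hg: "h * gram = 1\<^sub>m d" "gram * h = 1\<^sub>m d"
    using det_gram adj_mat[OF gram_carrier] gram_carrier unfolding h_def
    by (auto simp: mult_smult_assoc_mat[of _ d d _ d] mult_smult_distrib[of _ d d _ d])
  define \<pi> where "\<pi> c \<beta> = (\<Sum>c'<d. h $$ (c, c') * cnj (yy c' \<beta>))" for c \<beta>
  have ent: "(A * B) $$ (c, c') = (\<Sum>k<d. A $$ (c, k) * B $$ (k, c'))" if "A \<in> carrier_mat d d" "B \<in> carrier_mat d d" "c < d" "c' < d" for A B :: "complex mat" and c c'
    using that by (auto simp: scalar_prod_def atLeast0LessThan)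
  have gram_ent: "gram $$ (c, c') = hip I (yy c) (yy c')" if "c < d" "c' < d" for c c' using that by (simp add: gram_def)
  show ?thesis
  proof (intro exI[of _ "\<lambda>\<beta> c. yy c \<beta>"] exI[of _ \<pi>] conjI ballI allI impI)
    fix p q \<beta> c' assume "p \<in> {1..N}" "q \<in> {1..N}" "c' < d"
    from fun_cong[OF B_yy[OF this], of \<beta>]
    show "(\<Sum>c<d. yy c \<beta> * E p q c c') = (\<Sum>\<gamma>\<in>I. t p q \<beta> \<gamma> * yy c' \<gamma>)"
      by (simp add: app_mk app_sc sum_fun_apply mult.commute)
  next
    fix c c' assume c: "c < d" "c' < d"
    have "(\<Sum>\<beta>\<in>I. \<pi> c \<beta> * yy c' \<beta>) = (\<Sum>k<d. h $$ (c, k) * gram $$ (k, c'))"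
      unfolding \<pi>_def sum_distrib_right by (subst sum.swap) (use c in \<open>simp add: gram_ent hip_def sum_distrib_left mult.assoc\<close>)
    also have "\<dots> = (if c = c' then 1 else 0)"
      unfolding ent[OF hc gram_carrier c, symmetric] hg(1) using c by simp
    finally show "(\<Sum>\<beta>\<in>I. \<pi> c \<beta> * yy c' \<beta>) = (if c = c' then 1 else 0)" .
  next
    fix p q \<gamma> c assume pq: "p \<in> {1..N}" "q \<in> {1..N}" and \<gamma>: "\<gamma> \<in> I" and c: "c < d"
    define F where "F = mat d d (\<lambda>(k, e). cnj (E q p e k))"
    define M where "M = mat d d (\<lambda>(k, e). E p q k e)"
    have car: "F \<in> carrier_mat d d" "M \<in> carrier_mat d d" by (auto simp: F_def M_def)
    \<comment> \<open>Adjointness in coordinates: the conjugate transpose of the opposite generator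
      passes through the Gram matrix. Conjugation by its inverse \<open>h\<close> then makes the
      left inverse equivariant.\<close>
    have "F * gram = gram * M"
    proof (rule eq_matI)
      fix k e assume "k < dim_row (gram * M)" "e < dim_col (gram * M)"
      then have ke: "k < d" "e < d" by (auto simp: gram_def M_def)
      have "(F * gram) $$ (k, e) = (\<Sum>c<d. cnj (E q p c k) * hip I (yy c) (yy e))"
        unfolding ent[OF car(1) gram_carrier ke] by (intro sum.cong refl) (use ke in \<open>simp add: F_def gram_ent\<close>)
      also have "\<dots> = hip I (app (mk (\<lambda>c. c) I (t q p)) (yy k)) (yy e)"
        unfolding B_yy[OF pq(2,1) ke(1)] by (simp only: hip_sum hip_simps)
      also have "\<dots> = hip I (yy k) (app (mk (\<lambda>c. c) I (t p q)) (yy e))" by (rule B_adj[OF pq(2,1)])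
      also have "\<dots> = (\<Sum>c<d. hip I (yy k) (yy c) * E p q c e)"
        unfolding B_yy[OF pq ke(2)] by (simp only: hip_sum hip_simps mult.commute)
      also have "\<dots> = (gram * M) $$ (k, e)"
        unfolding ent[OF gram_carrier car(2) ke] by (intro sum.cong refl) (use ke in \<open>simp add: M_def gram_ent\<close>)
      finally show "(F * gram) $$ (k, e) = (gram * M) $$ (k, e)" .
    qed (auto simp: F_def M_def gram_def)
    then have "h * (F * gram) * h = h * (gram * M) * h" by simp
    moreover have "h * (F * gram) * h = h * F"
    proof -
      have "h * (F * gram) * h = h * F * (gram * h)"
        using hc car gram_carrier by (simp add: assoc_mult_mat[of _ d d _ d _ d])
      then show ?thesis using hc car hg(2) by simp
    qed
    moreover have "h * (gram * M) * h = M * h"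
    proof -
      have "h * (gram * M) * h = (h * gram) * (M * h)"
        using hc car gram_carrier by (simp add: assoc_mult_mat[of _ d d _ d _ d])
      then show ?thesis using hc car hg(1) by simp
    qed
    ultimately have hF: "h * F = M * h" by simp
    have yt: "(\<Sum>\<beta>\<in>I. cnj (yy k \<beta>) * t p q \<beta> \<gamma>) = (\<Sum>e<d. F $$ (k, e) * cnj (yy e \<gamma>))" if k: "k < d" for k
    proof -
      have "(\<Sum>\<beta>\<in>I. cnj (yy k \<beta>) * t p q \<beta> \<gamma>) = cnj (\<Sum>\<beta>\<in>I. t q p \<gamma> \<beta> * yy k \<beta>)"
        unfolding cnj_sum by (intro sum.cong refl) (simp add: herm[OF pq _ \<gamma>])
      also have "\<dots> = cnj (\<Sum>e<d. E q p e k * yy e \<gamma>)"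
        using fun_cong[OF B_yy[OF pq(2,1) k], of \<gamma>] by (simp add: app_mk app_sc sum_fun_apply)
      also have "\<dots> = (\<Sum>e<d. F $$ (k, e) * cnj (yy e \<gamma>))"
        unfolding cnj_sum by (intro sum.cong refl) (use k in \<open>simp add: F_def\<close>)
      finally show ?thesis .
    qed
    have "(\<Sum>\<beta>\<in>I. \<pi> c \<beta> * t p q \<beta> \<gamma>) = (\<Sum>k<d. h $$ (c, k) * (\<Sum>\<beta>\<in>I. cnj (yy k \<beta>) * t p q \<beta> \<gamma>))"
      unfolding \<pi>_def sum_distrib_right sum_distrib_left by (subst sum.swap) (simp only: mult.assoc)
    also have "\<dots> = (\<Sum>k<d. \<Sum>e<d. h $$ (c, k) * F $$ (k, e) * cnj (yy e \<gamma>))"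
      by (simp add: yt sum_distrib_left mult.assoc)
    also have "\<dots> = (\<Sum>e<d. (\<Sum>k<d. h $$ (c, k) * F $$ (k, e)) * cnj (yy e \<gamma>))"
      unfolding sum_distrib_right by (rule sum.swap)
    also have "\<dots> = (\<Sum>e<d. (\<Sum>k<d. M $$ (c, k) * h $$ (k, e)) * cnj (yy e \<gamma>))"
      by (intro sum.cong refl) (simp add: ent[OF hc car(1) c, symmetric] ent[OF car(2) hc c, symmetric] hF)
    also have "\<dots> = (\<Sum>k<d. E p q c k * \<pi> k \<gamma>)"
      unfolding \<pi>_def sum_distrib_right sum_distrib_left by (subst sum.swap) (use c in \<open>simp add: M_def mult.assoc\<close>)
    finally show "(\<Sum>\<beta>\<in>I. \<pi> c \<beta> * t p q \<beta> \<gamma>) = (\<Sum>c'<d. E p q c c' * \<pi> c' \<gamma>)" .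
  qed
qed

end

section \<open>Modules given by matrices\<close>

definition ekern :: "nat \<Rightarrow> (nat \<Rightarrow> nat \<Rightarrow> complex mat) \<Rightarrow> nat \<Rightarrow> nat \<Rightarrow> nat \<Rightarrow> nat \<Rightarrow> complex" where
  "ekern d E p q c c' = (if c < d then E p q $$ (c, c') else 0)"

text \<open>A single module is regarded as a system with one site, so that the operator relations
  and \<open>P0\<close> are available for it.\<close>

lemma single_gaudin:
  assumes "gl_module N d E"
  shows "gaudin N {..<d} {()} (\<lambda>_. ekern d E)"
proof
  fix a b c e \<beta> \<gamma>
  assume i: "a \<in> {1..N}" "b \<in> {1..N}" "c \<in> {1..N}" "e \<in> {1..N}" and \<gamma>: "\<gamma> \<in> {..<d}"
  have car: "E a b \<in> carrier_mat d d" if "a \<in> {1..N}" "b \<in> {1..N}" for a b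
    using assms that by (auto simp: gl_module_def)
  have rel: "E a b * E c e - E c e * E a b = (if b = c then E a e else 0\<^sub>m d d) - (if a = e then E c b else 0\<^sub>m d d)"
    using assms i by (auto simp: gl_module_def)
  have ent: "(A * B) $$ (k, l) = (\<Sum>j<d. A $$ (k, j) * B $$ (j, l))" if "A \<in> carrier_mat d d" "B \<in> carrier_mat d d" "k < d" "l < d" for A B :: "complex mat" and k l
    using that by (auto simp: scalar_prod_def atLeast0LessThan)
  show "(\<Sum>\<delta><d. ekern d E a b \<beta> \<delta> * ekern d E c e \<delta> \<gamma>) + (if a = e then ekern d E c b \<beta> \<gamma> else 0)
    = (\<Sum>\<delta><d. ekern d E c e \<beta> \<delta> * ekern d E a b \<delta> \<gamma>) + (if b = c then ekern d E a e \<beta> \<gamma> else 0)"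
  proof (cases "\<beta> < d")
    case True
    have "(E a b * E c e - E c e * E a b) $$ (\<beta>, \<gamma>) = (E a b * E c e) $$ (\<beta>, \<gamma>) - (E c e * E a b) $$ (\<beta>, \<gamma>)"
      by (rule index_minus_mat) (use True \<gamma> car[OF i(1,2)] car[OF i(3,4)] in auto)
    moreover have "((if b = c then E a e else 0\<^sub>m d d) - (if a = e then E c b else 0\<^sub>m d d)) $$ (\<beta>, \<gamma>)
      = (if b = c then E a e $$ (\<beta>, \<gamma>) else 0) - (if a = e then E c b $$ (\<beta>, \<gamma>) else 0)"
      using True \<gamma> car[OF i(3,2)] car[OF i(1,4)] by (subst index_minus_mat) auto
    ultimately have "(E a b * E c e) $$ (\<beta>, \<gamma>) + (if a = e then E c b $$ (\<beta>, \<gamma>) else 0)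
      = (E c e * E a b) $$ (\<beta>, \<gamma>) + (if b = c then E a e $$ (\<beta>, \<gamma>) else 0)"
      unfolding rel by (simp add: algebra_simps)
    moreover have "(\<Sum>\<delta><d. ekern d E a b \<beta> \<delta> * ekern d E c e \<delta> \<gamma>) = (E a b * E c e) $$ (\<beta>, \<gamma>)"
      using True \<gamma> by (subst ent[OF car[OF i(1,2)] car[OF i(3,4)]]) (simp_all add: ekern_def)
    moreover have "(\<Sum>\<delta><d. ekern d E c e \<beta> \<delta> * ekern d E a b \<delta> \<gamma>) = (E c e * E a b) $$ (\<beta>, \<gamma>)"
      using True \<gamma> by (subst ent[OF car[OF i(3,4)] car[OF i(1,2)]]) (simp_all add: ekern_def)
    ultimately show ?thesis using True by (simp only: ekern_def if_True)
  qed (simp add: ekern_def)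
qed (auto simp: ekern_def)

lemma (in gaudin) sum_ef_commutator:
  assumes h: "chom h" and i: "a \<in> {1..N}" "b \<in> {1..N}" "c \<in> {1..N}" "d \<in> {1..N}"
  shows "(\<Sum>s\<in>S. ef h s a b) * (\<Sum>s\<in>S. ef h s c d) - (\<Sum>s\<in>S. ef h s c d) * (\<Sum>s\<in>S. ef h s a b)
    = (if b = c then (\<Sum>s\<in>S. ef h s a d) else 0) - (if a = d then (\<Sum>s\<in>S. ef h s c b) else 0)"
proof -
  have "(\<Sum>s\<in>S. ef h s a b) * (\<Sum>s\<in>S. ef h s c d) - (\<Sum>s\<in>S. ef h s c d) * (\<Sum>s\<in>S. ef h s a b)
    = (\<Sum>s\<in>S. (\<Sum>s'\<in>S. ef h s a b * ef h s' c d - ef h s' c d * ef h s a b))"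
    unfolding sum_subtractf sum_distrib_left[symmetric] sum_distrib_right[symmetric] by (rule refl)
  also have "\<dots> = (\<Sum>s\<in>S. (if b = c then ef h s a d else 0) - (if a = d then ef h s c b else 0))"
  proof (intro sum.cong refl)
    fix s assume "s \<in> S"
    from sum_ef_rel[OF h subset_refl this i, of "\<lambda>_. 1"]
    show "(\<Sum>s'\<in>S. ef h s a b * ef h s' c d - ef h s' c d * ef h s a b) = (if b = c then ef h s a d else 0) - (if a = d then ef h s c b else 0)"
      by (simp only: sc_simps mult_1)
  qed
  finally show ?thesis by (simp only: sum_subtractf) (simp only: if_distrib[of "sum _"] split: if_splits, simp)
qed

definition fvec :: "nat \<Rightarrow> complex vec \<Rightarrow> nat \<Rightarrow> complex" where
  "fvec d v c = (if c < d then vec_index v c else 0)"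

lemma app_fvec:
  assumes "E p q \<in> carrier_mat d d" "v \<in> carrier_vec d"
  shows "app (mk (\<lambda>c. c) {..<d} (ekern d E p q)) (fvec d v) = fvec d (E p q *\<^sub>v v)"
  using assms by (intro ext) (auto simp: app_mk fvec_def ekern_def scalar_prod_def atLeast0LessThan)

text \<open>Translates irreducibility, stated with subspaces of coordinate vectors, to closed
  predicates on functions; the predicate cuts out an invariant subspace.\<close>

lemma irreducible_closed:
  assumes gl: "gl_module N d E" and irr: "gl_irreducible N d E"
    and P: "\<And>x. P x \<Longrightarrow> \<forall>c. \<not> c < d \<longrightarrow> x c = 0" "\<And>x y. P x \<Longrightarrow> P y \<Longrightarrow> P (x + y)" "\<And>c x. P x \<Longrightarrow> P (app (sc c) x)"
      "\<And>p q x. p \<in> {1..N} \<Longrightarrow> q \<in> {1..N} \<Longrightarrow> P x \<Longrightarrow> P (app (mk (\<lambda>c. c) {..<d} (ekern d E p q)) x)"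
    and x0: "P x0" "x0 \<noteq> 0" and x: "\<forall>c. \<not> c < d \<longrightarrow> x c = 0"
  shows "P x"
proof -
  define W where "W = {v \<in> carrier_vec d. P (fvec d v)}"
  have fv: "fvec d (vec d x) = x" if "\<forall>c. \<not> c < d \<longrightarrow> x c = 0" for x
    using that by (auto simp: fvec_def fun_eq_iff)
  have P0: "P 0" using P(3)[OF x0(1), of 0] by (simp only: sc_simps app_ring_simps)
  have "VectorSpace.subspace class_ring W (module_vec TYPE(complex) d)"
    unfolding VectorSpace.subspace_def
  proof (intro conjI vec_vs)
    show "submodule class_ring W (module_vec TYPE(complex) d)"
      unfolding submodule_def module_vec_simps class_ring_simps
    proof (intro conjI allI impI vec_module)
      show "W \<subseteq> carrier_vec d" by (auto simp: W_def)
      show "v + u \<in> W" if "v \<in> W" "u \<in> W" for v u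
      proof -
        have "fvec d (v + u) = fvec d v + fvec d u" using that by (auto simp: W_def fvec_def fun_eq_iff)
        then show ?thesis using that P(2) by (simp add: W_def)
      qed
      have "fvec d (0\<^sub>v d) = 0" by (auto simp: fvec_def fun_eq_iff)
      then show "0\<^sub>v d \<in> W" using P0 by (simp add: W_def)
      show "c \<cdot>\<^sub>v v \<in> W" if "v \<in> W" for c v
      proof -
        have "fvec d (c \<cdot>\<^sub>v v) = app (sc c) (fvec d v)" using that by (auto simp: W_def fvec_def fun_eq_iff app_sc)
        then show ?thesis using that P(3) by (simp add: W_def)
      qed
    qed
  qed
  moreover have "\<forall>a\<in>{1..N}. \<forall>b\<in>{1..N}. \<forall>w\<in>W. E a b *\<^sub>v w \<in> W"
  proof (intro ballI)
    fix a b w assume i: "a \<in> {1..N}" "b \<in> {1..N}" and w: "w \<in> W"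
    have car: "E a b \<in> carrier_mat d d" using gl i by (auto simp: gl_module_def)
    show "E a b *\<^sub>v w \<in> W"
      using P(4)[OF i, of "fvec d w"] app_fvec[of E a b d w, OF car] w car by (auto simp: W_def)
  qed
  ultimately have "W = {0\<^sub>v d} \<or> W = carrier_vec d" using irr unfolding gl_irreducible_def by blast
  moreover have "vec d x0 \<in> W" "vec d x0 \<noteq> 0\<^sub>v d"
  proof -
    have s: "\<forall>c. \<not> c < d \<longrightarrow> x0 c = 0" by (rule P(1)[OF x0(1)])
    show "vec d x0 \<in> W" unfolding W_def mem_Collect_eq fv[OF s] by (intro conjI x0 vec_carrier)
    show "vec d x0 \<noteq> 0\<^sub>v d"
    proof
      assume "vec d x0 = 0\<^sub>v d"
      then have "x0 = fvec d (0\<^sub>v d)" using fv[OF s] by simp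
      moreover have "fvec d (0\<^sub>v d) = 0" by (auto simp: fvec_def fun_eq_iff)
      ultimately show False using x0(2) by simp
    qed
  qed
  ultimately have "W = carrier_vec d" by blast
  then have "vec d x \<in> W" by simp
  then show ?thesis unfolding W_def mem_Collect_eq fv[OF x] by blast
qed

section \<open>Highest weight vectors in tensor powers of the vector representation\<close>

definition vop :: "nat \<Rightarrow> nat set \<Rightarrow> nat \<Rightarrow> nat \<Rightarrow> ((nat \<Rightarrow> nat) \<Rightarrow> complex) \<Rightarrow> (nat \<Rightarrow> nat) \<Rightarrow> complex" where
  "vop N Q p q x \<beta> = (if \<beta> \<in> tI Q (\<lambda>_. N) then \<Sum>s\<in>Q. if Suc (\<beta> s) = p then x (\<beta>(s := q - 1)) else 0 else 0)"

definition hwv :: "nat \<Rightarrow> nat set \<Rightarrow> (nat \<Rightarrow> nat) \<Rightarrow> ((nat \<Rightarrow> nat) \<Rightarrow> complex) \<Rightarrow> bool" where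
  "hwv N Q \<Lambda> b \<longleftrightarrow> (\<forall>\<beta>. \<beta> \<notin> tI Q (\<lambda>_. N) \<longrightarrow> b \<beta> = 0) \<and> (\<exists>\<beta>. b \<beta> \<noteq> 0) \<and>
    (\<forall>p\<in>{1..N}. \<forall>q\<in>{1..N}. p < q \<longrightarrow> (\<forall>\<beta>. vop N Q p q b \<beta> = 0)) \<and>
    (\<forall>p\<in>{1..N}. \<forall>\<beta>. vop N Q p p b \<beta> = of_nat (\<Lambda> p) * b \<beta>)"

lemma hwv_empty:
  assumes "\<And>a. a \<in> {1..N} \<Longrightarrow> \<Lambda> a = 0"
  shows "\<exists>b. hwv N {} \<Lambda> b"
  by (intro exI[of _ "\<lambda>\<beta>. if \<beta> \<in> tI {} (\<lambda>_. N) then 1 else 0"])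
     (use assms in \<open>auto simp: hwv_def vop_def tI_def\<close>)

text \<open>A generator acts on a tensor product by the Leibniz rule, so the product of two highest
  weight vectors is one again and the weights add.\<close>

lemma hwv_union:
  assumes b1: "hwv N Q1 \<Lambda>1 b1" and b2: "hwv N Q2 \<Lambda>2 b2" and Q: "finite Q1" "finite Q2" "Q1 \<inter> Q2 = {}"
    and \<Lambda>: "\<And>a. a \<in> {1..N} \<Longrightarrow> \<Lambda> a = \<Lambda>1 a + \<Lambda>2 a"
  shows "\<exists>b. hwv N (Q1 \<union> Q2) \<Lambda> b"
proof -
  let ?T = "tI (Q1 \<union> Q2) (\<lambda>_. N)"
  define b where "b \<beta> = (if \<beta> \<in> ?T then b1 (restrict \<beta> Q1) * b2 (restrict \<beta> Q2) else 0)" for \<beta>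
  have res: "restrict \<beta> Q1 \<in> tI Q1 (\<lambda>_. N)" "restrict \<beta> Q2 \<in> tI Q2 (\<lambda>_. N)" if "\<beta> \<in> ?T" for \<beta>
    using that by (auto simp: tI_def PiE_iff)
  have key: "vop N (Q1 \<union> Q2) p q b \<beta> = vop N Q1 p q b1 (restrict \<beta> Q1) * b2 (restrict \<beta> Q2)
      + b1 (restrict \<beta> Q1) * vop N Q2 p q b2 (restrict \<beta> Q2)"
    if \<beta>: "\<beta> \<in> ?T" and q: "q \<in> {1..N}" for p q \<beta>
  proof -
    have up: "\<beta>(s := q - 1) \<in> ?T" if "s \<in> Q1 \<union> Q2" for s
      by (rule tI_upd[OF \<beta> that]) (use q in auto)
    have 1: "restrict (\<beta>(s := q - 1)) Q1 = (restrict \<beta> Q1)(s := q - 1)" "restrict (\<beta>(s := q - 1)) Q2 = restrict \<beta> Q2" if "s \<in> Q1" for s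
      using that Q(3) by (auto simp: fun_eq_iff)
    have 2: "restrict (\<beta>(s := q - 1)) Q2 = (restrict \<beta> Q2)(s := q - 1)" "restrict (\<beta>(s := q - 1)) Q1 = restrict \<beta> Q1" if "s \<in> Q2" for s
      using that Q(3) by (auto simp: fun_eq_iff)
    have "vop N (Q1 \<union> Q2) p q b \<beta> = (\<Sum>s\<in>Q1 \<union> Q2. if Suc (\<beta> s) = p then b (\<beta>(s := q - 1)) else 0)"
      using \<beta> by (simp add: vop_def)
    also have "\<dots> = (\<Sum>s\<in>Q1. if Suc (\<beta> s) = p then b (\<beta>(s := q - 1)) else 0) + (\<Sum>s\<in>Q2. if Suc (\<beta> s) = p then b (\<beta>(s := q - 1)) else 0)"
      by (rule sum.union_disjoint[OF Q])
    also have "(\<Sum>s\<in>Q1. if Suc (\<beta> s) = p then b (\<beta>(s := q - 1)) else 0) = vop N Q1 p q b1 (restrict \<beta> Q1) * b2 (restrict \<beta> Q2)"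
      using res(1)[OF \<beta>] up by (auto simp: vop_def sum_distrib_right b_def 1 intro!: sum.cong simp del: fun_upd_apply One_nat_def)
    also have "(\<Sum>s\<in>Q2. if Suc (\<beta> s) = p then b (\<beta>(s := q - 1)) else 0) = b1 (restrict \<beta> Q1) * vop N Q2 p q b2 (restrict \<beta> Q2)"
      using res(2)[OF \<beta>] up by (auto simp: vop_def sum_distrib_left b_def 2 intro!: sum.cong simp del: fun_upd_apply One_nat_def)
    finally show ?thesis .
  qed
  obtain \<beta>1 \<beta>2 where nz: "b1 \<beta>1 \<noteq> 0" "b2 \<beta>2 \<noteq> 0" using b1 b2 by (auto simp: hwv_def)
  then have t: "\<beta>1 \<in> tI Q1 (\<lambda>_. N)" "\<beta>2 \<in> tI Q2 (\<lambda>_. N)" using b1 b2 by (auto simp: hwv_def)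
  define \<beta> where "\<beta> s = (if s \<in> Q1 then \<beta>1 s else \<beta>2 s)" for s
  have "restrict \<beta> Q1 = \<beta>1" "restrict \<beta> Q2 = \<beta>2" "\<beta> \<in> ?T"
    using t Q(3) by (auto simp: \<beta>_def tI_def PiE_iff extensional_def fun_eq_iff)
  then have "b \<beta> \<noteq> 0" using nz by (simp add: b_def)
  then have "hwv N (Q1 \<union> Q2) \<Lambda> b"
    unfolding hwv_def
  proof (intro conjI ballI allI impI exI[of _ \<beta>])
    fix p q \<gamma> assume pq: "p \<in> {1..N}" "q \<in> {1..N}" "p < q"
    show "vop N (Q1 \<union> Q2) p q b \<gamma> = 0"
    proof (cases "\<gamma> \<in> ?T")
      case True
      show ?thesis unfolding key[OF True pq(2)] using b1 b2 pq by (simp add: hwv_def)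
    qed (simp add: vop_def)
  next
    fix p \<gamma> assume p: "p \<in> {1..N}"
    show "vop N (Q1 \<union> Q2) p p b \<gamma> = of_nat (\<Lambda> p) * b \<gamma>"
    proof (cases "\<gamma> \<in> ?T")
      case True
      have "vop N Q1 p p b1 (restrict \<gamma> Q1) = of_nat (\<Lambda>1 p) * b1 (restrict \<gamma> Q1)"
        "vop N Q2 p p b2 (restrict \<gamma> Q2) = of_nat (\<Lambda>2 p) * b2 (restrict \<gamma> Q2)"
        using b1 b2 p by (auto simp: hwv_def)
      then show ?thesis unfolding key[OF True p] using True by (simp add: b_def \<Lambda>[OF p] algebra_simps)
    qed (simp add: vop_def b_def)
  qed (auto simp: b_def)
  then show ?thesis by blast
qed

text \<open>
  The alternating tensor on \<open>h\<close> sites: Laplace expansion along the replaced column turns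
  the action of a generator into an entry of \<open>M * adj_mat M\<close>.
\<close>

lemma hwv_column:
  assumes Q: "finite Q" "card Q \<le> N"
  shows "\<exists>b. hwv N Q (\<lambda>a. if a \<le> card Q then 1 else 0) b"
proof -
  define h where "h = card Q"
  obtain g where g: "bij_betw g {0..<h} Q" using ex_bij_betw_nat_finite[OF Q(1)] h_def by blast
  \<comment> \<open>Column j is the unit vector of the state at the j-th site, or zero if that state
    is not below \<open>h\<close>; the determinant is thus the alternating tensor in the first
    \<open>h\<close> basis vectors.\<close>
  define M :: "(nat \<Rightarrow> nat) \<Rightarrow> complex mat" where "M \<beta> = mat h h (\<lambda>(i, j). if \<beta> (g j) = i then 1 else 0)" for \<beta>
  have M: "M \<beta> \<in> carrier_mat h h" for \<beta> by (simp add: M_def)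
  let ?T = "tI Q (\<lambda>_. N)"
  define b where "b \<beta> = (if \<beta> \<in> ?T then det (M \<beta>) else 0)" for \<beta>
  have gQ: "g j \<in> Q" if "j < h" for j using g that by (auto simp: bij_betw_def)
  have ginj: "g j = g j' \<longleftrightarrow> j = j'" if "j < h" "j' < h" for j j'
    using g that by (auto simp: bij_betw_def inj_on_def)
  have col: "det (M (\<beta>(g j := c))) = (if c < h then cofactor (M \<beta>) c j else 0)" if j: "j < h" for \<beta> j c
  proof -
    have "det (M (\<beta>(g j := c))) = (\<Sum>i<h. M (\<beta>(g j := c)) $$ (i, j) * cofactor (M (\<beta>(g j := c))) i j)"
      by (rule laplace_expansion_column[OF M j])
    also have "\<dots> = (\<Sum>i<h. if i = c then cofactor (M (\<beta>(g j := c))) c j else 0)"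
      by (intro sum.cong refl) (use j in \<open>auto simp: M_def\<close>)
    also have "\<dots> = (if c < h then cofactor (M (\<beta>(g j := c))) c j else 0)" by simp
    also have "cofactor (M (\<beta>(g j := c))) c j = cofactor (M \<beta>) c j"
    proof -
      have "mat_delete (M (\<beta>(g j := c))) c j = mat_delete (M \<beta>) c j"
        unfolding mat_delete_def M_def using j by (intro eq_matI) (auto simp: ginj)
      then show ?thesis by (simp add: cofactor_def)
    qed
    finally show ?thesis .
  qed
  \<comment> \<open>In the range p \<le> q, q \<le> h forces p \<le> h, so that row p - 1 exists in
    the h by h matrix.\<close>
  have act: "vop N Q p q b \<beta> = (if p = q \<and> q \<le> h then b \<beta> else 0)" if pq: "p \<in> {1..N}" "q \<in> {1..N}" "p \<le> q" for p q \<beta>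
  proof (cases "\<beta> \<in> ?T")
    case True
    have up: "\<beta>(g j := q - 1) \<in> ?T" if "j < h" for j
      by (rule tI_upd[OF True gQ[OF that]]) (use pq in auto)
    have "vop N Q p q b \<beta> = (\<Sum>s\<in>Q. if Suc (\<beta> s) = p then b (\<beta>(s := q - 1)) else 0)"
      using True by (simp add: vop_def)
    also have "\<dots> = (\<Sum>j<h. if Suc (\<beta> (g j)) = p then b (\<beta>(g j := q - 1)) else 0)"
      using sum.reindex_bij_betw[OF g, of "\<lambda>s. if Suc (\<beta> s) = p then b (\<beta>(s := q - 1)) else 0"] by (simp only: atLeast0LessThan)
    also have "\<dots> = (\<Sum>j<h. if Suc (\<beta> (g j)) = p \<and> q - 1 < h then cofactor (M \<beta>) (q - 1) j else 0)"
    proof (intro sum.cong refl)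
      fix j assume "j \<in> {..<h}"
      then have j: "j < h" by simp
      show "(if Suc (\<beta> (g j)) = p then b (\<beta>(g j := q - 1)) else 0) = (if Suc (\<beta> (g j)) = p \<and> q - 1 < h then cofactor (M \<beta>) (q - 1) j else 0)"
        using col[OF j, of \<beta> "q - 1"] up[OF j] by (simp add: b_def)
    qed
    also have "\<dots> = (if p = q \<and> q \<le> h then b \<beta> else 0)"
    proof (cases "q \<le> h")
      case False
      then have "\<not> q - 1 < h" using pq by auto
      then show ?thesis using False by simp
    next
      case qh: True
      have lt: "p - 1 < h" "q - 1 < h" using pq qh by auto
      have "(\<Sum>j<h. if Suc (\<beta> (g j)) = p \<and> q - 1 < h then cofactor (M \<beta>) (q - 1) j else 0)
        = (\<Sum>j<h. M \<beta> $$ (p - 1, j) * adj_mat (M \<beta>) $$ (j, q - 1))"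
        by (intro sum.cong refl) (use lt pq in \<open>auto simp: M_def adj_mat_def\<close>)
      also have "\<dots> = (M \<beta> * adj_mat (M \<beta>)) $$ (p - 1, q - 1)"
        using M[of \<beta>] adj_mat(1)[OF M, of \<beta>] lt by (auto simp: scalar_prod_def atLeast0LessThan)
      also have "\<dots> = (if p = q then det (M \<beta>) else 0)"
        unfolding adj_mat(2)[OF M] using lt pq by auto
      finally show ?thesis using qh True by (simp add: b_def)
    qed
    finally show ?thesis .
  qed (simp add: vop_def b_def)
  \<comment> \<open>The multi-index with pairwise different states in increasing order; its matrix
    is the identity, so the tensor is nonzero.\<close>
  define \<beta> where "\<beta> s = (if s \<in> Q then inv_into {0..<h} g s else undefined)" for s
  have inv: "\<beta> (g j) = j" if "j < h" for j
    using g that gQ[OF that] by (auto simp: \<beta>_def bij_betw_def inv_into_f_f)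
  have "\<beta> s < N" if "s \<in> Q" for s
  proof -
    have "s \<in> g ` {0..<h}" using g that by (simp add: bij_betw_def)
    then obtain j where "j < h" "s = g j" by auto
    then show ?thesis using inv Q(2) by (simp add: h_def)
  qed
  then have "\<beta> \<in> ?T" by (auto simp: tI_def PiE_iff extensional_def \<beta>_def)
  moreover have "M \<beta> = 1\<^sub>m h" by (rule eq_matI) (auto simp: M_def inv)
  ultimately have "b \<beta> \<noteq> 0" by (simp add: b_def)
  then have "hwv N Q (\<lambda>a. if a \<le> card Q then 1 else 0) b"
    unfolding hwv_def by (intro conjI ballI allI impI exI[of _ \<beta>]) (auto simp: b_def act h_def)
  then show ?thesis by blast
qed

text \<open>Induction that removes the first column of the Young diagram of \<Lambda>: an
  alternating tensor takes its place, and the rest is again a partition, since the shortened rows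
  were positive and the rows below them are empty.\<close>

lemma hwv_exists:
  assumes "finite Q" "\<And>a. a \<in> {1..<N} \<Longrightarrow> \<Lambda> (Suc a) \<le> \<Lambda> a" "(\<Sum>a=1..N. \<Lambda> a) = card Q"
  shows "\<exists>b. hwv N Q \<Lambda> b"
  using assms
proof (induction "card Q" arbitrary: Q \<Lambda> rule: less_induct)
  case less
  have anti: "\<Lambda> a' \<le> \<Lambda> a" if "1 \<le> a" "a \<le> a'" "a' \<le> N" for a a'
    using that(2,3)
  proof (induction rule: dec_induct)
    case (step k)
    then show ?case using less.prems(2)[of k] that(1) by simp
  qed simp
  show ?case
  proof (cases "card Q = 0")
    case True
    then have "Q = {}" using less.prems(1) by simp
    then show ?thesis using hwv_empty[of N \<Lambda>] less.prems(3) True by simp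
  next
    case False
    \<comment> \<open>The largest index of a nonempty row is the height of the first column.\<close>
    define A where "A = {a \<in> {1..N}. 0 < \<Lambda> a}"
    have "A \<noteq> {}"
    proof
      assume "A = {}"
      then have "(\<Sum>a=1..N. \<Lambda> a) = 0" by (intro sum.neutral) (auto simp: A_def)
      then show False using False less.prems(3) by simp
    qed
    moreover have "finite A" by (simp add: A_def)
    ultimately have "Max A \<in> A" by (rule Max_in[rotated])
    define h where "h = Max A"
    have h: "1 \<le> h" "h \<le> N" "0 < \<Lambda> h" using \<open>Max A \<in> A\<close> by (auto simp: A_def h_def)
    have zero: "\<Lambda> a = 0" if "h < a" "a \<le> N" for a
    proof (rule ccontr)
      assume "\<Lambda> a \<noteq> 0"
      then have "a \<in> A" using that h by (simp add: A_def)
      then have "a \<le> h" unfolding h_def by (rule Max_ge[OF \<open>finite A\<close>])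
      then show False using that by simp
    qed
    have pos: "0 < \<Lambda> a" if "1 \<le> a" "a \<le> h" for a using anti[OF that h(2)] h(3) by simp
    define \<Lambda>' where "\<Lambda>' a = \<Lambda> a - (if a \<le> h then 1 else 0)" for a
    have \<Lambda>: "\<Lambda> a = (if a \<le> h then 1 else 0) + \<Lambda>' a" if "a \<in> {1..N}" for a
      using that pos by (auto simp: \<Lambda>'_def)
    have "(\<Sum>a=1..N. \<Lambda> a) = (\<Sum>a=1..N. (if a \<le> h then 1 else 0)) + (\<Sum>a=1..N. \<Lambda>' a)"
      unfolding sum.distrib[symmetric] by (intro sum.cong refl \<Lambda>)
    also have "(\<Sum>a=1..N. (if a \<le> h then 1 else 0)) = card {1..h}"
    proof -
      have "{1..N} \<inter> {a. a \<le> h} = {1..h}" using h by auto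
      then show ?thesis by (simp add: sum.If_cases)
    qed
    finally have sum': "h + (\<Sum>a=1..N. \<Lambda>' a) = card Q" using less.prems(3) by simp
    then obtain Q1 where Q1: "Q1 \<subseteq> Q" "card Q1 = h" using obtain_subset_with_card_n[of h Q] by auto
    have fin: "finite Q1" "finite (Q - Q1)" using Q1(1) less.prems(1) finite_subset by auto
    have c: "card (Q - Q1) = card Q - h" using Q1 fin(1) by (simp add: card_Diff_subset)
    have "\<exists>b. hwv N (Q - Q1) \<Lambda>' b"
    proof (rule less.hyps)
      show "card (Q - Q1) < card Q" using c h False by simp
      show "(\<Sum>a=1..N. \<Lambda>' a) = card (Q - Q1)" using c sum' by simp
      show "\<Lambda>' (Suc a) \<le> \<Lambda>' a" if "a \<in> {1..<N}" for a
        using less.prems(2)[OF that] zero[of "Suc a"] that by (auto simp: \<Lambda>'_def not_le)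
    qed (rule fin)
    then obtain b2 where b2: "hwv N (Q - Q1) \<Lambda>' b2" by blast
    obtain b1 where b1: "hwv N Q1 (\<lambda>a. if a \<le> h then 1 else 0) b1"
      using hwv_column[OF fin(1), of N] Q1(2) h(2) by auto
    have "\<exists>b. hwv N (Q1 \<union> (Q - Q1)) \<Lambda> b"
      by (rule hwv_union[OF b1 b2 fin _ \<Lambda>]) auto
    moreover have "Q1 \<union> (Q - Q1) = Q" using Q1 by auto
    ultimately show ?thesis by simp
  qed
qed

lemma app_vector_sites:
  assumes "finite Q" "p \<in> {1..N}" "q \<in> {1..N}"
  shows "app (mk (\<lambda>c. c) (tI Q (\<lambda>_. N)) (\<lambda>\<beta> \<gamma>. \<Sum>s\<in>Q. tker Q (\<lambda>_. N) s (vmat N p q) \<beta> \<gamma>)) x = vop N Q p q x"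
proof (rule ext)
  fix \<beta>
  show "app (mk (\<lambda>c. c) (tI Q (\<lambda>_. N)) (\<lambda>\<beta> \<gamma>. \<Sum>s\<in>Q. tker Q (\<lambda>_. N) s (vmat N p q) \<beta> \<gamma>)) x \<beta> = vop N Q p q x \<beta>"
  proof (cases "\<beta> \<in> tI Q (\<lambda>_. N)")
    case True
    have "app (mk (\<lambda>c. c) (tI Q (\<lambda>_. N)) (\<lambda>\<beta> \<gamma>. \<Sum>s\<in>Q. tker Q (\<lambda>_. N) s (vmat N p q) \<beta> \<gamma>)) x \<beta>
      = (\<Sum>s\<in>Q. \<Sum>\<gamma>\<in>tI Q (\<lambda>_. N). tker Q (\<lambda>_. N) s (vmat N p q) \<beta> \<gamma> * x \<gamma>)"
      unfolding app_mk sum_distrib_right by (rule sum.swap)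
    also have "\<dots> = (\<Sum>s\<in>Q. if Suc (\<beta> s) = p then x (\<beta>(s := q - 1)) else 0)"
    proof (intro sum.cong refl)
      fix s assume s: "s \<in> Q"
      have lt: "\<beta> s < N" by (rule tI_less[OF True s])
      have "(\<Sum>\<gamma>\<in>tI Q (\<lambda>_. N). tker Q (\<lambda>_. N) s (vmat N p q) \<beta> \<gamma> * x \<gamma>) = (\<Sum>c<N. vmat N p q $$ (\<beta> s, c) * x (\<beta>(s := c)))"
        by (rule sum_tker[where h = "\<lambda>c. c", OF assms(1) s True refl])
      also have "\<dots> = (\<Sum>c<N. if c = q - 1 then (if Suc (\<beta> s) = p then x (\<beta>(s := q - 1)) else 0) else 0)"
        by (intro sum.cong refl) (use lt assms(3) in auto)
      also have "\<dots> = (if Suc (\<beta> s) = p then x (\<beta>(s := q - 1)) else 0)"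
        using assms(3) by (subst sum.delta) auto
      finally show "(\<Sum>\<gamma>\<in>tI Q (\<lambda>_. N). tker Q (\<lambda>_. N) s (vmat N p q) \<beta> \<gamma> * x \<gamma>) = (if Suc (\<beta> s) = p then x (\<beta>(s := q - 1)) else 0)" .
    qed
    finally show ?thesis using True by (simp add: vop_def)
  qed (simp add: app_mk vop_def tker_def)
qed

lemma dominant_nonneg:
  assumes "integral_dominant N \<Lambda>" "\<Lambda> N = 0" "a \<in> {1..N}"
  shows "0 \<le> \<Lambda> a"
proof -
  have "a \<le> N" using assms(3) by simp
  then have "1 \<le> a \<longrightarrow> 0 \<le> \<Lambda> a"
  proof (induction rule: inc_induct)
    case (step k)
    then show ?case using assms(1) by (force simp: integral_dominant_def)
  qed (use assms(2) in simp)
  then show ?thesis using assms(3) by simp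
qed

text \<open>Dominance with last entry 0 makes the weight a partition with as many boxes as
  \<open>Q\<close> has sites, so the tensor power contains a highest weight vector of this weight.
  The tensor power is unitary for the standard inner product, and \<open>hw_embed\<close>
  applies.\<close>

lemma module_embedding:
  assumes M: "irreducible_highest_weight_module N d E \<Lambda>" and dom: "integral_dominant N \<Lambda>" "\<Lambda> N = 0"
    and Q: "finite Q" "int (card Q) = (\<Sum>a=1..N. \<Lambda> a)"
  shows "\<exists>\<phi> \<pi>.
    (\<forall>a\<in>{1..N}. \<forall>b\<in>{1..N}. \<forall>w\<in>tI Q (\<lambda>_. N). \<forall>c'<d.
      (\<Sum>c<d. \<phi> w c * E a b $$ (c, c')) = (\<Sum>s\<in>Q. \<Sum>q<N. vmat N a b $$ (w s, q) * \<phi> (w(s := q)) c'))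
    \<and> (\<forall>a\<in>{1..N}. \<forall>b\<in>{1..N}. \<forall>w'\<in>tI Q (\<lambda>_. N). \<forall>c<d.
      (\<Sum>w\<in>tI Q (\<lambda>_. N). \<pi> c w * (\<Sum>s\<in>Q. tker Q (\<lambda>_. N) s (vmat N a b) w w')) = (\<Sum>c'<d. E a b $$ (c, c') * \<pi> c' w'))
    \<and> (\<forall>c<d. \<forall>c'<d. (\<Sum>w\<in>tI Q (\<lambda>_. N). \<pi> c w * \<phi> w c') = (if c = c' then 1 else (0 :: complex)))"
proof -
  let ?I = "tI Q (\<lambda>_. N)"
  let ?t = "\<lambda>p q \<beta> \<gamma>. \<Sum>s\<in>Q. tker Q (\<lambda>_. N) s (vmat N p q) \<beta> \<gamma>"
  from M have gl: "gl_module N d E" and irr: "gl_irreducible N d E" by (auto simp: irreducible_highest_weight_module_def)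
  from M obtain v where v: "highest_weight_vector N d E \<Lambda> v" by (auto simp: irreducible_highest_weight_module_def)
  have car: "E p q \<in> carrier_mat d d" if "p \<in> {1..N}" "q \<in> {1..N}" for p q using gl that by (auto simp: gl_module_def)
  have mono: "\<Lambda> (Suc a) \<le> \<Lambda> a" if "a \<in> {1..<N}" for a using dom(1) that by (auto simp: integral_dominant_def)
  have nonneg: "0 \<le> \<Lambda> a" if "a \<in> {1..N}" for a by (rule dominant_nonneg[OF dom that])
  have "int (\<Sum>a=1..N. nat (\<Lambda> a)) = int (card Q)"
    unfolding Q(2) of_nat_sum by (intro sum.cong refl) (use nonneg in simp)
  then have "(\<Sum>a=1..N. nat (\<Lambda> a)) = card Q" by (simp only: of_nat_eq_iff)
  then have "\<exists>b. hwv N Q (\<lambda>a. nat (\<Lambda> a)) b"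
    by (intro hwv_exists[OF Q(1)]) (auto intro!: nat_mono mono)
  then obtain b where b: "hwv N Q (\<lambda>a. nat (\<Lambda> a)) b" by blast
  interpret m: gaudin N "{..<d}" "{()}" "\<lambda>_. ekern d E" by (rule single_gaudin[OF gl])
  interpret f: gaudin N ?I Q "\<lambda>s p q. tker Q (\<lambda>_. N) s (vmat N p q)"
    by (rule tensor_gaudin[OF Q(1) vmat_gl_module])
  have vop: "app (mk (\<lambda>c. c) ?I (?t p q)) x = vop N Q p q x" if "p \<in> {1..N}" "q \<in> {1..N}" for p q x
    by (rule app_vector_sites[OF Q(1) that])
  have fsum: "mk (\<lambda>c. c) ?I (?t p q) = (\<Sum>s\<in>Q. f.efc s p q)" for p q
    unfolding f.ef_def by (rule mk_sum[OF chom_id, symmetric])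
  have herm: "?t p q \<beta> \<gamma> = cnj (?t q p \<gamma> \<beta>)" if "\<beta> \<in> ?I" "\<gamma> \<in> ?I" for p q \<beta> \<gamma>
    unfolding cnj_sum
  proof (intro sum.cong refl)
    fix s assume s: "s \<in> Q"
    have lt: "\<beta> s < N" "\<gamma> s < N" using tI_less[OF that(1) s] tI_less[OF that(2) s] by auto
    have "(\<forall>s'\<in>Q. s' \<noteq> s \<longrightarrow> \<gamma> s' = \<beta> s') \<longleftrightarrow> (\<forall>s'\<in>Q. s' \<noteq> s \<longrightarrow> \<beta> s' = \<gamma> s')" by auto
    then show "tker Q (\<lambda>_. N) s (vmat N p q) \<beta> \<gamma> = cnj (tker Q (\<lambda>_. N) s (vmat N q p) \<gamma> \<beta>)"
      using that lt unfolding tker_eq[OF that] tker_eq[OF that(2,1)] by (auto simp: conj_commute)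
  qed
  have v': "v \<in> carrier_vec d" "v \<noteq> 0\<^sub>v d" using v by (auto simp: highest_weight_vector_def)
  interpret hw_embed N d "ekern d E" ?I ?t "\<lambda>a. of_int (\<Lambda> a)" "fvec d v" b
  proof
    show "finite ?I" by (rule finite_tI[OF Q(1)])
    fix p q r s assume i: "p \<in> {1..N}" "q \<in> {1..N}" "r \<in> {1..N}" "s \<in> {1..N}"
    show "mk (\<lambda>c. c) {..<d} (ekern d E p q) * mk (\<lambda>c. c) {..<d} (ekern d E r s) -
       mk (\<lambda>c. c) {..<d} (ekern d E r s) * mk (\<lambda>c. c) {..<d} (ekern d E p q) =
       (if q = r then mk (\<lambda>c. c) {..<d} (ekern d E p s) else 0) - (if p = s then mk (\<lambda>c. c) {..<d} (ekern d E r q) else (0 :: (nat, complex) addop))"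
      using m.ef_rel[OF chom_id _ i, of "()"] unfolding m.ef_def by simp
    show "mk (\<lambda>c. c) ?I (?t p q) * mk (\<lambda>c. c) ?I (?t r s) - mk (\<lambda>c. c) ?I (?t r s) * mk (\<lambda>c. c) ?I (?t p q) =
       (if q = r then mk (\<lambda>c. c) ?I (?t p s) else 0) - (if p = s then mk (\<lambda>c. c) ?I (?t r q) else (0 :: (nat \<Rightarrow> nat, complex) addop))"
      unfolding fsum by (rule f.sum_ef_commutator[OF chom_id i])
  next
    show "sc c * mk (\<lambda>c. c) {..<d} (ekern d E p q) = mk (\<lambda>c. c) {..<d} (ekern d E p q) * sc c" for p q c by (rule sc_mk)
    show "sc c * mk (\<lambda>c. c) ?I (?t p q) = mk (\<lambda>c. c) ?I (?t p q) * sc c" for p q c by (rule sc_mk)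
    show "app (mk (\<lambda>c. c) ?I (?t p q)) y \<beta> = 0" if "\<beta> \<notin> ?I" for p q y \<beta>
      using that by (simp add: app_mk tker_def)
    show "hip ?I (app (mk (\<lambda>c. c) ?I (?t p q)) x) y = hip ?I x (app (mk (\<lambda>c. c) ?I (?t q p)) y)" for p q x y
      by (rule hip_adjoint) (rule herm)
    show "fvec d v \<noteq> 0"
    proof
      assume z: "fvec d v = 0"
      have "vec_index v c = 0" if "c < d" for c using fun_cong[OF z, of c] that by (simp add: fvec_def)
      then show False using v' by auto
    qed
    show "app (mk (\<lambda>c. c) {..<d} (ekern d E p q)) (fvec d v) = 0" if "p \<in> {1..N}" "q \<in> {1..N}" "p < q" for p q
    proof -
      have "E p q *\<^sub>v v = 0\<^sub>v d" using v that by (simp add: highest_weight_vector_def)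
      then show ?thesis unfolding app_fvec[of E p q d v, OF car[OF that(1,2)] v'(1)] by (auto simp: fvec_def fun_eq_iff)
    qed
    show "app (mk (\<lambda>c. c) {..<d} (ekern d E p p)) (fvec d v) = app (sc (of_int (\<Lambda> p))) (fvec d v)" if "p \<in> {1..N}" for p
    proof -
      have "E p p *\<^sub>v v = of_int (\<Lambda> p) \<cdot>\<^sub>v v" using v that by (simp add: highest_weight_vector_def)
      then show ?thesis unfolding app_fvec[of E p p d v, OF car[OF that that] v'(1)] using v'(1) by (auto simp: fvec_def fun_eq_iff app_sc)
    qed
    show "b \<noteq> 0" using b by (auto simp: hwv_def fun_eq_iff)
    show "app (mk (\<lambda>c. c) ?I (?t p q)) b = 0" if "p \<in> {1..N}" "q \<in> {1..N}" "p < q" for p q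
      unfolding vop[OF that(1,2)] using b that by (simp add: hwv_def fun_eq_iff)
    show "app (mk (\<lambda>c. c) ?I (?t p p)) b = app (sc (of_int (\<Lambda> p))) b" if "p \<in> {1..N}" for p
      unfolding vop[OF that that] app_sc using b that nonneg[OF that] by (simp add: hwv_def fun_eq_iff)
    show "b \<beta> = 0" if "\<beta> \<notin> ?I" for \<beta> using b that by (simp add: hwv_def)
    show "ekern d E p q c c' = 0" if "\<not> c < d" for p q c c' using that by (simp add: ekern_def)
    show "fvec d v c = 0" if "\<not> c < d" for c using that by (simp add: fvec_def)
    show "?t p q \<beta> \<gamma> = cnj (?t q p \<gamma> \<beta>)" if "\<beta> \<in> ?I" "\<gamma> \<in> ?I" for p q \<beta> \<gamma> by (rule herm[OF that])
    show "P x" if "\<And>x. P x \<Longrightarrow> \<forall>c. \<not> c < d \<longrightarrow> x c = 0" "\<And>x y. P x \<Longrightarrow> P y \<Longrightarrow> P (x + y)" "\<And>c x. P x \<Longrightarrow> P (app (sc c) x)"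
      "\<And>p q x. p \<in> {1..N} \<Longrightarrow> q \<in> {1..N} \<Longrightarrow> P x \<Longrightarrow> P (app (mk (\<lambda>c. c) {..<d} (ekern d E p q)) x)"
      "P x0" "x0 \<noteq> 0" "\<forall>c. \<not> c < d \<longrightarrow> x c = 0" for P x0 x
      by (rule irreducible_closed[of N d E P x0 x, OF gl irr that])
  qed
  from embedding obtain \<phi> \<pi> where *:
    "\<forall>p\<in>{1..N}. \<forall>q\<in>{1..N}. \<forall>\<beta> c'. c' < d \<longrightarrow> (\<Sum>c<d. \<phi> \<beta> c * ekern d E p q c c') = (\<Sum>\<gamma>\<in>?I. ?t p q \<beta> \<gamma> * \<phi> \<gamma> c')"
    "\<forall>p\<in>{1..N}. \<forall>q\<in>{1..N}. \<forall>\<gamma>\<in>?I. \<forall>c<d. (\<Sum>\<beta>\<in>?I. \<pi> c \<beta> * ?t p q \<beta> \<gamma>) = (\<Sum>c'<d. ekern d E p q c c' * \<pi> c' \<gamma>)"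
    "\<forall>c<d. \<forall>c'<d. (\<Sum>\<beta>\<in>?I. \<pi> c \<beta> * \<phi> \<beta> c') = (if c = c' then 1 else (0 :: complex))" by blast
  show ?thesis
  proof (intro exI[of _ \<phi>] exI[of _ \<pi>] conjI ballI allI impI)
    fix a b w c' assume i: "a \<in> {1..N}" "b \<in> {1..N}" "w \<in> ?I" "c' < d"
    have "(\<Sum>c<d. \<phi> w c * E a b $$ (c, c')) = (\<Sum>c<d. \<phi> w c * ekern d E a b c c')"
      by (intro sum.cong refl) (simp add: ekern_def)
    also have "\<dots> = (\<Sum>\<gamma>\<in>?I. ?t a b w \<gamma> * \<phi> \<gamma> c')" using *(1) i by blast
    also have "\<dots> = (\<Sum>s\<in>Q. \<Sum>\<gamma>\<in>?I. tker Q (\<lambda>_. N) s (vmat N a b) w \<gamma> * \<phi> \<gamma> c')"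
      unfolding sum_distrib_right by (rule sum.swap)
    also have "\<dots> = (\<Sum>s\<in>Q. \<Sum>q<N. vmat N a b $$ (w s, q) * \<phi> (w(s := q)) c')"
      by (intro sum.cong refl) (rule sum_tker[where h = "\<lambda>c. c" and x = "\<lambda>\<gamma>. \<phi> \<gamma> c'", OF Q(1) _ i(3) refl])
    finally show "(\<Sum>c<d. \<phi> w c * E a b $$ (c, c')) = (\<Sum>s\<in>Q. \<Sum>q<N. vmat N a b $$ (w s, q) * \<phi> (w(s := q)) c')" .
  next
    fix a b w' c assume i: "a \<in> {1..N}" "b \<in> {1..N}" "w' \<in> ?I" "c < d"
    have "(\<Sum>\<beta>\<in>?I. \<pi> c \<beta> * ?t a b \<beta> w') = (\<Sum>c'<d. ekern d E a b c c' * \<pi> c' w')" using *(2) i by blast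
    then show "(\<Sum>w\<in>?I. \<pi> c w * ?t a b w w') = (\<Sum>c'<d. E a b $$ (c, c') * \<pi> c' w')"
      using i(4) by (simp add: ekern_def)
  qed (use *(3) in blast)
qed

section \<open>The indicial polynomial on an irreducible module\<close>

context gaudin
begin

lemma rdet_supp:
  assumes T: "T \<subseteq> S" and x: "\<And>\<beta>. \<beta> \<notin> I \<Longrightarrow> x \<beta> = 0"
  shows "\<beta> \<notin> I \<Longrightarrow> app (rdet N (XX K T z z0)) x \<beta> = 0"
proof -
  have "\<forall>\<beta>. \<beta> \<notin> I \<longrightarrow> app (rdet N (XX K T z z0)) x \<beta> = 0"
  proof (rule rdet_invariant[where Q = "\<lambda>x. \<forall>\<beta>. \<beta> \<notin> I \<longrightarrow> x \<beta> = 0"])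
    fix a b and x :: "'i \<Rightarrow> complex fls"
    assume ab: "a \<in> {1..N}" "b \<in> {1..N}" and x: "\<forall>\<beta>. \<beta> \<notin> I \<longrightarrow> x \<beta> = 0"
    show "\<forall>\<beta>. \<beta> \<notin> I \<longrightarrow> app (XX K T z z0 a b) x \<beta> = 0"
    proof (intro allI impI)
      fix \<beta> assume \<beta>: "\<beta> \<notin> I"
      have "app (efl s b a) x \<beta> = 0" if "s \<in> T" for s
        unfolding ef_def app_mk using supp[of s b a \<beta>] that T ab \<beta> by (auto simp: subset_iff)
      then show "app (XX K T z z0 a b) x \<beta> = 0"
        using x \<beta> by (simp add: XX_def app_sum_left sum_fun_apply app_sc app_dd)
    qed
  qed (use x in auto)
  then show "\<beta> \<notin> I \<Longrightarrow> app (rdet N (XX K T z z0)) x \<beta> = 0" by blast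
qed

lemma P0_supp:
  assumes T: "T \<subseteq> S" and x: "\<And>\<beta>. \<beta> \<notin> I \<Longrightarrow> v \<beta> = 0" and \<beta>: "\<beta> \<notin> I"
  shows "app (P0 T (of_int l)) v \<beta> = 0"
proof -
  have "app (rdet N (XX (\<lambda>a. 0) T (\<lambda>s. 0) 0)) (fmono l v) \<beta> = 0"
    by (rule rdet_supp[OF T _ \<beta>]) (simp add: fmono_def x)
  then show ?thesis unfolding P0_mono'[OF T] cf_def by simp
qed

text \<open>For one site the total action of gl_N is the action at that site, and it commutes with
  the determinant for K = 0.\<close>

lemma P0_commute:
  assumes T: "s \<in> S" and i: "c \<in> {1..N}" "d \<in> {1..N}"
  shows "app (efc s c d) (app (P0 {s} (of_int l)) v) = app (P0 {s} (of_int l)) (app (efc s c d) v)"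
proof -
  have sub: "{s} \<subseteq> S" using T by simp
  have f: "fmono l (app (efc s c d) v) = app (efl s c d) (fmono l v)"
    unfolding ef_def by (rule app_mk_fmono[symmetric])
  have "efl s c d * rdet N (XX (\<lambda>a. 0) {s} (\<lambda>s. 0) 0) = rdet N (XX (\<lambda>a. 0) {s} (\<lambda>s. 0) 0) * efl s c d"
    using rdet_sum_ef_commute[OF sub i] by (simp only: sum.insert[OF finite.emptyI empty_iff[THEN iffD1, THEN notI]] sum.empty add_0_right)
  from app_eqD[OF this] show ?thesis
    unfolding P0_mono'[OF sub] f cf_ef[symmetric] by (simp only:)
qed

text \<open>Rows act from the last one upwards. While all later rows are fixed by \<sigma>,
  injectivity gives \<sigma> a \<le> a: equality contributes a scalar, and \<sigma> a < a
  contributes a raising operator, which kills the vector.\<close>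

lemma foldr_X0_hw:
  assumes \<sigma>: "\<sigma> permutes {1..N}"
    and w: "\<And>p q. p \<in> {1..N} \<Longrightarrow> q \<in> {1..N} \<Longrightarrow> p < q \<Longrightarrow> app (efc s p q) w = 0"
      "\<And>p. p \<in> {1..N} \<Longrightarrow> app (efc s p p) w = app (sc (\<Lambda> p)) w"
  shows "k \<le> N \<Longrightarrow> foldr (\<lambda>a. app (X0 {s} (r a) a (\<sigma> a))) [Suc (N - k)..<N+1] w
    = app (sc (if \<forall>a\<in>{Suc (N - k)..N}. \<sigma> a = a then \<Prod>a=Suc (N - k)..N. r a - \<Lambda> a else 0)) w"
proof (induction k)
  case 0
  show ?case by (simp add: sc_simps)
next
  case (Suc k)
  define a where "a = N - k"
  have a: "a \<in> {1..N}" "Suc (N - Suc k) = a" "Suc (N - k) = Suc a" using Suc.prems by (auto simp: a_def)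
  let ?P = "\<forall>b\<in>{Suc a..N}. \<sigma> b = b"
  let ?c = "\<Prod>b=Suc a..N. r b - \<Lambda> b"
  have split: "[a..<N+1] = a # [Suc a..<N+1]" by (rule upt_conv_Cons) (use a in simp)
  have "foldr (\<lambda>a. app (X0 {s} (r a) a (\<sigma> a))) [a..<N+1] w = app (X0 {s} (r a) a (\<sigma> a)) (app (sc (if ?P then ?c else 0)) w)"
    unfolding split foldr.simps comp_apply using Suc.IH Suc.prems unfolding a(3) by simp
  also have "\<dots> = app (sc (if ?P then ?c else 0)) (app (X0 {s} (r a) a (\<sigma> a)) w)"
  proof (rule app_eqD[symmetric])
    show "sc c * X0 {s} (r a) a (\<sigma> a) = X0 {s} (r a) a (\<sigma> a) * sc c" for c
      unfolding X0_def by (simp add: right_diff_distrib left_diff_distrib sc_commute[of c] sc_ef)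
  qed
  also have "\<dots> = app (sc (if \<forall>b\<in>{a..N}. \<sigma> b = b then \<Prod>b=a..N. r b - \<Lambda> b else 0)) w"
  proof (cases ?P)
    case True
    have sa: "\<sigma> a \<in> {1..N}" using permutes_in_image[OF \<sigma>] a by blast
    have "\<sigma> a \<le> a"
    proof (rule ccontr)
      assume "\<not> \<sigma> a \<le> a"
      then have "\<sigma> a \<in> {Suc a..N}" using sa by simp
      then have "\<sigma> (\<sigma> a) = \<sigma> a" using True by blast
      then have "\<sigma> a = a" using permutes_inj[OF \<sigma>] by (simp add: inj_eq)
      then show False using \<open>\<not> \<sigma> a \<le> a\<close> by simp
    qed
    then consider "\<sigma> a = a" | "\<sigma> a < a" by linarith
    then show ?thesis
    proof cases
      case 1
      have iv: "{a..N} = insert a {Suc a..N}" using a by auto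
      have X: "app (X0 {s} (r a) a a) w = app (sc (r a - \<Lambda> a)) w"
        by (simp add: X0_def w(2)[OF a(1)] sc_simps)
      have all: "\<forall>b\<in>{a..N}. \<sigma> b = b" using True 1 by (auto simp: iv)
      have pr: "(\<Prod>b=a..N. r b - \<Lambda> b) = ?c * (r a - \<Lambda> a)" unfolding iv by (subst prod.insert) (auto simp: mult.commute)
      show ?thesis unfolding if_P[OF True] if_P[OF all] pr 1 X by (simp only: sc_simps app_ring_simps)
    next
      case 2
      have X: "app (X0 {s} (r a) a (\<sigma> a)) w = 0"
        using 2 by (simp add: X0_def w(1)[OF sa a(1)])
      have nall: "\<not> (\<forall>b\<in>{a..N}. \<sigma> b = b)" using 2 a by (auto intro!: bexI[of _ a])
      show ?thesis unfolding if_not_P[OF nall] X app_0 by (simp only: sc_simps app_ring_simps)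
    qed
  next
    case False
    then have nall: "\<not> (\<forall>b\<in>{a..N}. \<sigma> b = b)" by auto
    show ?thesis unfolding if_not_P[OF False] if_not_P[OF nall] by (simp only: sc_simps app_ring_simps)
  qed
  finally show ?case unfolding a(2) .
qed

lemma P0_hw:
  assumes w: "\<And>p q. p \<in> {1..N} \<Longrightarrow> q \<in> {1..N} \<Longrightarrow> p < q \<Longrightarrow> app (efc s p q) w = 0"
      "\<And>p. p \<in> {1..N} \<Longrightarrow> app (efc s p p) w = app (sc (\<Lambda> p)) w"
  shows "app (P0 {s} r) w = app (sc (\<Prod>a=1..N. r - (of_nat N - of_nat a) - \<Lambda> a)) w"
proof -
  let ?c = "\<Prod>a=1..N. r - (of_nat N - of_nat a) - \<Lambda> a"
  have "app (P0 {s} r) w = (\<Sum>\<sigma> | \<sigma> permutes {1..N}. app (of_int (sign \<sigma>)) (foldr (\<lambda>a. app (X0 {s} (r - (of_nat N - of_nat a)) a (\<sigma> a))) [1..<N+1] w))"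
    unfolding P0_def app_sum_left by (simp only: app_ring_simps app_prod_list)
  also have "\<dots> = (\<Sum>\<sigma> | \<sigma> permutes {1..N}. if \<sigma> = id then app (sc ?c) w else 0)"
  proof (intro sum.cong refl)
    fix \<sigma> :: "nat \<Rightarrow> nat" assume "\<sigma> \<in> {\<sigma>. \<sigma> permutes {1..N}}"
    then have \<sigma>: "\<sigma> permutes {1..N}" by simp
    have eq: "(\<forall>a\<in>{1..N}. \<sigma> a = a) \<longleftrightarrow> \<sigma> = id"
      using \<sigma> by (auto simp: fun_eq_iff permutes_def)
    have "foldr (\<lambda>a. app (X0 {s} (r - (of_nat N - of_nat a)) a (\<sigma> a))) [1..<N+1] w = app (sc (if \<sigma> = id then ?c else 0)) w"
      using foldr_X0_hw[of \<sigma> s w \<Lambda> N "\<lambda>a. r - (of_nat N - of_nat a)", OF \<sigma> w] unfolding eq[symmetric] by simp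
    then show "app (of_int (sign \<sigma>)) (foldr (\<lambda>a. app (X0 {s} (r - (of_nat N - of_nat a)) a (\<sigma> a))) [1..<N+1] w) = (if \<sigma> = id then app (sc ?c) w else 0)"
      by (cases "\<sigma> = id") (simp_all only: sign_id of_int_1 app_ring_simps sc_simps app_0 if_True if_False simp_thms)
  qed
  also have "\<dots> = app (sc ?c) w"
    by (subst sum.delta) (auto simp: finite_permutations permutes_id)
  finally show ?thesis .
qed

end

text \<open>The vectors on which \<open>P0\<close> acts by this scalar form a submodule because it
  commutes with the generators, and the highest weight vector is among them; irreducibility does the
  rest.\<close>

lemma module_P0:
  assumes M: "irreducible_highest_weight_module N d E \<Lambda>" and x: "\<forall>c. \<not> c < d \<longrightarrow> x c = 0"
  shows "app (gaudin.P0 N {..<d} (\<lambda>_. ekern d E) {()} (of_int l)) x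
    = app (sc (\<Prod>a=1..N. of_int l - (of_nat N - of_nat a) - of_int (\<Lambda> a))) x"
proof -
  from M have gl: "gl_module N d E" and irr: "gl_irreducible N d E" by (auto simp: irreducible_highest_weight_module_def)
  from M obtain v where v: "highest_weight_vector N d E \<Lambda> v" by (auto simp: irreducible_highest_weight_module_def)
  have car: "E p q \<in> carrier_mat d d" if "p \<in> {1..N}" "q \<in> {1..N}" for p q using gl that by (auto simp: gl_module_def)
  have v': "v \<in> carrier_vec d" "v \<noteq> 0\<^sub>v d" using v by (auto simp: highest_weight_vector_def)
  interpret m: gaudin N "{..<d}" "{()}" "\<lambda>_. ekern d E" by (rule single_gaudin[OF gl])
  let ?c = "\<Prod>a=1..N. of_int l - (of_nat N - of_nat a) - (of_int (\<Lambda> a) :: complex)"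
  have "(\<forall>c. \<not> c < d \<longrightarrow> x c = 0) \<and> app (m.P0 {()} (of_int l)) x = app (sc ?c) x"
  proof (rule irreducible_closed[OF gl irr, where P = "\<lambda>x. (\<forall>c. \<not> c < d \<longrightarrow> x c = 0) \<and> app (m.P0 {()} (of_int l)) x = app (sc ?c) x" and ?x0.0 = "fvec d v"])
    fix k x assume "(\<forall>c. \<not> c < d \<longrightarrow> x c = 0) \<and> app (m.P0 {()} (of_int l)) x = app (sc ?c) x"
    then have x: "\<forall>c. \<not> c < d \<longrightarrow> x c = 0" "app (m.P0 {()} (of_int l)) x = app (sc ?c) x" by blast+
    have "app (m.P0 {()} (of_int l)) (app (sc k) x) = app (sc k) (app (m.P0 {()} (of_int l)) x)"
      by (rule app_eqD[OF m.P0_sc])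
    then show "(\<forall>c. \<not> c < d \<longrightarrow> app (sc k) x c = 0) \<and> app (m.P0 {()} (of_int l)) (app (sc k) x) = app (sc ?c) (app (sc k) x)"
      unfolding x(2) using x(1) by (simp add: app_sc mult.left_commute)
  next
    fix p q x assume pq: "p \<in> {1..N}" "q \<in> {1..N}" and "(\<forall>c. \<not> c < d \<longrightarrow> x c = 0) \<and> app (m.P0 {()} (of_int l)) x = app (sc ?c) x"
    then have x: "app (m.P0 {()} (of_int l)) x = app (sc ?c) x" by blast
    have "app (m.P0 {()} (of_int l)) (app (mk (\<lambda>c. c) {..<d} (ekern d E p q)) x) = app (sc ?c) (app (mk (\<lambda>c. c) {..<d} (ekern d E p q)) x)"
      using m.P0_commute[of "()" p q l x, OF _ pq, symmetric] unfolding x m.ef_def by (simp only: singletonI simp_thms app_eqD[OF sc_mk])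
    then show "(\<forall>c. \<not> c < d \<longrightarrow> app (mk (\<lambda>c. c) {..<d} (ekern d E p q)) x c = 0) \<and>
      app (m.P0 {()} (of_int l)) (app (mk (\<lambda>c. c) {..<d} (ekern d E p q)) x) = app (sc ?c) (app (mk (\<lambda>c. c) {..<d} (ekern d E p q)) x)"
      by (simp add: app_mk ekern_def)
  next
    have "app (m.P0 {()} (of_int l)) (fvec d v) = app (sc ?c) (fvec d v)"
    proof (rule m.P0_hw)
      show "app (m.efc () p q) (fvec d v) = 0" if "p \<in> {1..N}" "q \<in> {1..N}" "p < q" for p q
      proof -
        have "E p q *\<^sub>v v = 0\<^sub>v d" using v that by (simp add: highest_weight_vector_def)
        then show ?thesis unfolding m.ef_def app_fvec[of E p q d v, OF car[OF that(1,2)] v'(1)] by (auto simp: fvec_def fun_eq_iff)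
      qed
      show "app (m.efc () p p) (fvec d v) = app (sc (of_int (\<Lambda> p))) (fvec d v)" if "p \<in> {1..N}" for p
      proof -
        have "E p p *\<^sub>v v = of_int (\<Lambda> p) \<cdot>\<^sub>v v" using v that by (simp add: highest_weight_vector_def)
        then show ?thesis unfolding m.ef_def app_fvec[of E p p d v, OF car[OF that that] v'(1)] using v'(1) by (auto simp: fvec_def fun_eq_iff app_sc)
      qed
    qed
    then show "(\<forall>c. \<not> c < d \<longrightarrow> fvec d v c = 0) \<and> app (m.P0 {()} (of_int l)) (fvec d v) = app (sc ?c) (fvec d v)"
      by (simp add: fvec_def)
    show "fvec d v \<noteq> 0"
    proof
      assume z: "fvec d v = 0"
      have "vec_index v c = 0" if "c < d" for c using fun_cong[OF z, of c] that by (simp add: fvec_def)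
      then show False using v' by auto
    qed
  qed (use x in \<open>auto simp: app_add app_sc algebra_simps\<close>)
  then show ?thesis by blast
qed

text \<open>Freezing all coordinates of \<beta> except the one at \<open>i\<close> gives a slice
  that lives in the single module, and the operators at the site \<open>i\<close> act slice by
  slice.\<close>

lemma tensor_P0:
  assumes S: "finite S" "\<And>s. s \<in> S \<Longrightarrow> gl_module N (d s) (E s)" and i: "i \<in> S"
    and M: "irreducible_highest_weight_module N (d i) (E i) \<Lambda>" and \<beta>: "\<beta> \<in> tI S d"
  shows "app (gaudin.P0 N (tI S d) (\<lambda>s a b. tker S d s (E s a b)) {i} (of_int l)) x \<beta>
    = (\<Prod>a=1..N. of_int l - (of_nat N - of_nat a) - of_int (\<Lambda> a)) * x \<beta>"
proof -
  interpret t: gaudin N "tI S d" S "\<lambda>s a b. tker S d s (E s a b)" by (rule tensor_gaudin[OF S])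
  interpret m: gaudin N "{..<d i}" "{()}" "\<lambda>_. ekern (d i) (E i)" by (rule single_gaudin[OF S(2)[OF i]])
  define sl where "sl x c = (if c < d i then x (\<beta>(i := c)) else 0)" for x :: "(nat \<Rightarrow> nat) \<Rightarrow> complex" and c
  have up: "\<beta>(i := c) \<in> tI S d" if "c < d i" for c by (rule tI_upd[OF \<beta> i that])
  have sl_e: "sl (app (t.efc i a b) x) = app (m.efc () a b) (sl x)" for a b x
  proof (rule ext)
    fix c show "sl (app (t.efc i a b) x) c = app (m.efc () a b) (sl x) c"
      unfolding sl_def t.ef_def m.ef_def by (subst app_tker[OF S(1) i]) (auto simp: up app_mk ekern_def)
  qed
  have sl_X: "sl (app (t.X0 {i} r a b) x) = app (m.X0 {()} r a b) (sl x)" for r a b x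
  proof -
    have "sl (app (t.X0 {i} r a b) x) = (\<lambda>c. (if a = b then r * sl x c else 0) - sl (app (t.efc i b a) x) c)"
      by (auto simp: t.X0_def sl_def app_sc fun_eq_iff)
    then show ?thesis unfolding sl_e by (auto simp: m.X0_def app_sc fun_eq_iff)
  qed
  have sl_f: "sl (foldr (\<lambda>a. app (t.X0 {i} (r a) a (\<sigma> a))) as x) = foldr (\<lambda>a. app (m.X0 {()} (r a) a (\<sigma> a))) as (sl x)" for r \<sigma> as
    by (induction as) (simp_all add: sl_X)
  have "sl (app (t.P0 {i} (of_int l)) x) = app (m.P0 {()} (of_int l)) (sl x)"
  proof (rule ext)
    fix c
    have "app (t.P0 {i} (of_int l)) x \<gamma> = (\<Sum>\<sigma> | \<sigma> permutes {1..N}. of_int (sign \<sigma>) * foldr (\<lambda>a. app (t.X0 {i} (of_int l - (of_nat N - of_nat a)) a (\<sigma> a))) [1..<N+1] x \<gamma>)" for \<gamma>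
      unfolding t.P0_def app_sum_left by (simp only: app_ring_simps app_prod_list sum_fun_apply app_of_int)
    then have "sl (app (t.P0 {i} (of_int l)) x) c = (\<Sum>\<sigma> | \<sigma> permutes {1..N}. of_int (sign \<sigma>) * sl (foldr (\<lambda>a. app (t.X0 {i} (of_int l - (of_nat N - of_nat a)) a (\<sigma> a))) [1..<N+1] x) c)"
      by (simp add: sl_def del: upt_Suc)
    also have "\<dots> = app (m.P0 {()} (of_int l)) (sl x) c"
      unfolding m.P0_def app_sum_left sl_f by (simp only: app_ring_simps app_prod_list sum_fun_apply app_of_int)
    finally show "sl (app (t.P0 {i} (of_int l)) x) c = app (m.P0 {()} (of_int l)) (sl x) c" .
  qed
  also have "\<dots> = app (sc (\<Prod>a=1..N. of_int l - (of_nat N - of_nat a) - of_int (\<Lambda> a))) (sl x)"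
    by (rule module_P0[OF M]) (simp add: sl_def)
  finally have "sl (app (t.P0 {i} (of_int l)) x) (\<beta> i) = app (sc (\<Prod>a=1..N. of_int l - (of_nat N - of_nat a) - of_int (\<Lambda> a))) (sl x) (\<beta> i)"
    by (rule fun_cong)
  then show ?thesis using tI_less[OF \<beta> i] by (simp add: sl_def app_sc)
qed

section \<open>Convergence\<close>

lemma fls_mult_nth_shift:
  fixes f g :: "complex fls"
  assumes f: "\<forall>n < - a. fls_nth f n = 0" and g: "\<forall>n < - b. fls_nth g n = 0"
  shows "fls_nth (f * g) (int n - a - b) = (\<Sum>i\<le>n. fls_nth f (int (n - i) - a) * fls_nth g (int i - b))"
proof -
  define F G where "F = Abs_fps (\<lambda>i. fls_nth f (int i - a))" and "G = Abs_fps (\<lambda>i. fls_nth g (int i - b))"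
  have f': "f = fls_shift a (fps_to_fls F)"
  proof (rule fls_eqI)
    fix n show "fls_nth f n = fls_nth (fls_shift a (fps_to_fls F)) n"
      using f by (cases "n + a < 0") (auto simp: F_def)
  qed
  have g': "g = fls_shift b (fps_to_fls G)"
  proof (rule fls_eqI)
    fix n show "fls_nth g n = fls_nth (fls_shift b (fps_to_fls G)) n"
      using g by (cases "n + b < 0") (auto simp: G_def)
  qed
  have "f * g = fls_shift (a + b) (fps_to_fls (F * G))"
    unfolding f' g' fls_times_both_shifted_simp fls_times_fps_to_fls by (rule refl)
  then have "fls_nth (f * g) (int n - a - b) = fps_nth (F * G) n" by simp
  also have "\<dots> = fps_nth (G * F) n" by (simp only: mult.commute)
  also have "\<dots> = (\<Sum>i\<le>n. fls_nth g (int i - b) * fls_nth f (int (n - i) - a))"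
    unfolding fps_mult_nth atLeast0AtMost by (simp add: F_def G_def)
  finally show ?thesis by (simp only: mult.commute)
qed

text \<open>Counting from order -1 covers both kinds of site: the pole itself has the single
  coefficient 1, and for a site at distance r the coefficient of order j - 1 has absolute value
  r^(-j) for j > 0.\<close>

lemma pole_bound:
  assumes \<rho>: "1 \<le> \<rho>" "z s \<noteq> z0 \<Longrightarrow> 1 / cmod (z0 - z s) \<le> \<rho>"
  shows "cmod (fls_nth (pole z z0 s) (int j - 1)) \<le> \<rho> ^ j" and "\<forall>n < - 1. fls_nth (pole z z0 s) n = 0"
proof -
  have "cmod (fls_nth (pole z z0 s) (int j - 1)) \<le> \<rho> ^ j \<and> (\<forall>n < - 1. fls_nth (pole z z0 s) n = 0)"
  proof (cases "z s = z0")
    case True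
    show ?thesis using \<rho>(1) unfolding pole_self[of z s z0, OF True] by (cases "j = 0") (auto simp: fls_X_inv_nth)
  next
    case False
    let ?g = "pole z z0 s" and ?c = "z0 - z s"
    have c: "?c \<noteq> 0" using False by simp
    have nz: "fls_X + fls_const ?c \<noteq> 0"
    proof
      assume "fls_X + fls_const ?c = 0"
      then have "fls_nth (fls_X + fls_const ?c) 0 = 0" by simp
      then show False using c by simp
    qed
    have "(fls_X + fls_const ?c) * ?g = 1" unfolding pole_def by (rule right_inverse[OF nz])
    \<comment> \<open>Comparing coefficients in the product of the linear series with its
      inverse.\<close>
    then have rec: "fls_nth ?g (n - 1) + ?c * fls_nth ?g n = (if n = 0 then 1 else 0)" for n
      by (metis (no_types, lifting) distrib_right fls_X_times_conv_shift(1) fls_mult_const_nth(1) fls_one_nth fls_plus_nth fls_shift_nth diff_conv_add_uminus)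
    have neg: "\<forall>n<0. fls_nth ?g n = 0" by (rule pole_regular[of z s z0, OF False])
    have val: "cmod (fls_nth ?g (int j)) = (1 / cmod ?c) ^ Suc j" for j
    proof (induction j)
      case 0
      have "?c * fls_nth ?g 0 = 1" using rec[of 0] neg by simp
      then have "cmod ?c * cmod (fls_nth ?g 0) = 1" by (metis norm_mult norm_one)
      then show ?case using c by (simp add: field_simps)
    next
      case (Suc j)
      have "?c * fls_nth ?g (int (Suc j)) = - fls_nth ?g (int j)" using rec[of "int (Suc j)"] by (simp add: add_eq_0_iff)
      then have "cmod ?c * cmod (fls_nth ?g (int (Suc j))) = cmod (fls_nth ?g (int j))" by (metis norm_mult norm_minus_cancel)
      then show ?case using c Suc by (simp add: field_simps)
    qed
    show ?thesis
    proof (intro conjI)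
      show "cmod (fls_nth ?g (int j - 1)) \<le> \<rho> ^ j"
      proof (cases j)
        case 0
        then show ?thesis using neg by simp
      next
        case (Suc k)
        have "cmod (fls_nth ?g (int j - 1)) = (1 / cmod ?c) ^ j" using val[of k] Suc by simp
        also have "\<dots> \<le> \<rho> ^ j" by (rule power_mono[OF \<rho>(2)[OF False]]) simp
        finally show ?thesis .
      qed
    qed (use neg in auto)
  qed
  then show "cmod (fls_nth (pole z z0 s) (int j - 1)) \<le> \<rho> ^ j" "\<forall>n < - 1. fls_nth (pole z z0 s) n = 0" by blast+
qed

text \<open>After division by the powers of \<rho> the hypothesis bounds a term by C times the sum
  of all earlier ones, so from \<open>L\<close> on the partial sums grow by at most the factor 1 + C
  per step.\<close>

lemma geometric_growth:
  fixes \<alpha> :: "nat \<Rightarrow> real"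
  assumes nn: "\<And>l. 0 \<le> \<alpha> l" "0 \<le> C" "0 < \<rho>" and rec: "\<And>l. L \<le> l \<Longrightarrow> \<alpha> l \<le> C * (\<Sum>k<l. \<rho> ^ (l - k) * \<alpha> k)"
  shows "\<exists>A R. 0 < R \<and> (\<forall>l. \<alpha> l \<le> A * R ^ l)"
proof -
  define a where "a l = \<alpha> l / \<rho> ^ l" for l
  define s where "s l = (\<Sum>k<l. a k)" for l
  have a0: "0 \<le> a l" for l using nn by (simp add: a_def)
  have rec': "a l \<le> C * s l" if "L \<le> l" for l
  proof -
    have "a l \<le> C * (\<Sum>k<l. \<rho> ^ (l - k) * \<alpha> k) / \<rho> ^ l"
      unfolding a_def using rec[OF that] nn(3) by (intro divide_right_mono) auto
    also have "\<dots> = C * s l"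
      unfolding s_def a_def sum_divide_distrib[symmetric] times_divide_eq_right[symmetric]
      by (simp add: sum_divide_distrib) (intro disjI2 sum.cong refl, use nn(3) in \<open>simp add: power_diff field_simps\<close>)
    finally show ?thesis .
  qed
  have s_mono: "s l \<le> s l'" if "l \<le> l'" for l l'
    unfolding s_def by (rule sum_mono2) (use that a0 in auto)
  have s0: "0 \<le> s l" for l unfolding s_def using a0 by (intro sum_nonneg) auto
  have s: "s (L + j) \<le> s L * (1 + C) ^ j" for j
  proof (induction j)
    case (Suc j)
    have "s (L + Suc j) = s (L + j) + a (L + j)" by (simp add: s_def)
    also have "\<dots> \<le> (1 + C) * s (L + j)" using rec'[of "L + j"] by (simp add: algebra_simps)
    also have "\<dots> \<le> (1 + C) * (s L * (1 + C) ^ j)" using Suc nn(2) by (intro mult_left_mono) auto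
    finally show ?case by (simp add: mult_ac)
  qed simp
  have "\<alpha> l \<le> s L * (1 + C) * (\<rho> * (1 + C)) ^ l" for l
  proof -
    have "a l \<le> s (Suc l)" unfolding s_def using a0 by (simp add: sum_nonneg)
    also have "\<dots> \<le> s (L + Suc l)" by (rule s_mono) simp
    also have "\<dots> \<le> s L * (1 + C) ^ Suc l" by (rule s)
    finally have "\<alpha> l \<le> s L * (1 + C) ^ Suc l * \<rho> ^ l" using nn(3) by (simp add: a_def field_simps)
    then show ?thesis by (simp add: power_mult_distrib mult_ac)
  qed
  then show ?thesis using nn(2,3) by (intro exI[of _ "s L * (1 + C)"] exI[of _ "\<rho> * (1 + C)"]) auto
qed

section \<open>Norm estimates for the operators\<close>

definition nrm :: "'i set \<Rightarrow> ('i \<Rightarrow> complex) \<Rightarrow> real" where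
  "nrm I v = (\<Sum>\<beta>\<in>I. cmod (v \<beta>))"

lemma nrm_nonneg: "0 \<le> nrm I v"
  unfolding nrm_def by (intro sum_nonneg) simp

lemma nrm_add: "nrm I (v + w) \<le> nrm I v + nrm I w" and nrm_diff: "nrm I (v - w) \<le> nrm I v + nrm I w"
  unfolding nrm_def sum.distrib[symmetric] by (intro sum_mono, simp add: norm_triangle_ineq norm_triangle_ineq4)+

lemma nrm_sc: "nrm I (app (sc c) v) = cmod c * nrm I v"
  by (simp add: nrm_def app_sc norm_mult sum_distrib_left)

lemma nrm_0: "nrm I 0 = 0"
  by (simp add: nrm_def)

lemma nrm_sum: "nrm I (\<Sum>j\<in>J. v j) \<le> (\<Sum>j\<in>J. nrm I (v j))"
proof (induction J rule: infinite_finite_induct)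
  case (insert j J)
  then show ?case unfolding sum.insert[OF insert(1,2)] using nrm_add[of I "v j" "\<Sum>j\<in>J. v j"] by linarith
qed (simp_all add: nrm_def)

lemma nrm_mk:
  assumes "finite I"
  shows "nrm I (app (mk (\<lambda>c. c) I M) v) \<le> (\<Sum>\<beta>\<in>I. \<Sum>\<gamma>\<in>I. cmod (M \<beta> \<gamma>)) * nrm I v"
proof -
  have "nrm I (app (mk (\<lambda>c. c) I M) v) = (\<Sum>\<beta>\<in>I. cmod (\<Sum>\<gamma>\<in>I. M \<beta> \<gamma> * v \<gamma>))"
    by (simp add: nrm_def app_mk)
  also have "\<dots> \<le> (\<Sum>\<beta>\<in>I. \<Sum>\<gamma>\<in>I. cmod (M \<beta> \<gamma>) * nrm I v)"
  proof (intro sum_mono order_trans[OF norm_sum])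
    fix \<beta> \<gamma> assume "\<gamma> \<in> I"
    then have "cmod (v \<gamma>) \<le> nrm I v" unfolding nrm_def by (intro member_le_sum assms) auto
    then show "cmod (M \<beta> \<gamma> * v \<gamma>) \<le> cmod (M \<beta> \<gamma>) * nrm I v" by (simp add: norm_mult mult_left_mono)
  qed
  finally show ?thesis by (simp add: sum_distrib_right)
qed

context gaudin
begin

text \<open>The derivative costs a factor linear in n; the constant K and the poles cost a
  convolution with a geometric sequence, where \<rho> bounds the inverse distances to the other
  sites.\<close>

lemma XX_bound:
  assumes \<rho>: "1 \<le> \<rho>" "\<forall>s\<in>S. z s \<noteq> z0 \<longrightarrow> 1 / cmod (z0 - z s) \<le> \<rho>"
  shows "\<exists>A\<ge>0. \<forall>y q n. ordge (- int q) y \<longrightarrow> nrm I (cf (int n - int q - 1) (app (XX K S z z0 a b) y))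
    \<le> A * ((real n + real q + 1) * nrm I (cf (int n - int q) y) + (\<Sum>i\<le>n. \<rho> ^ (n - i) * nrm I (cf (int i - int q) y)))"
proof -
  define B where "B s = (\<Sum>\<beta>\<in>I. \<Sum>\<gamma>\<in>I. cmod (e s b a \<beta> \<gamma>))" for s
  define A where "A = 1 + cmod (K a) + (\<Sum>s\<in>S. B s)"
  have B0: "0 \<le> B s" for s unfolding B_def by (intro sum_nonneg) simp
  have A0: "0 \<le> A" unfolding A_def using B0 by (intro add_nonneg_nonneg sum_nonneg) auto
  show ?thesis
  proof (intro exI[of _ A] conjI A0 allI impI)
    fix y :: "'i \<Rightarrow> complex fls" and q n :: nat
    assume y: "ordge (- int q) y"
    define g where "g i = nrm I (cf (int i - int q) y)" for i
    define T where "T = (\<Sum>i\<le>n. \<rho> ^ (n - i) * g i)"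
    have g0: "0 \<le> g i" for i by (simp add: g_def nrm_nonneg)
    have T0: "0 \<le> T" unfolding T_def using g0 \<rho>(1) by (intro sum_nonneg) auto
    have dd: "nrm I (cf (int n - int q - 1) (app dd y)) \<le> (real n + real q + 1) * g n"
    proof -
      have "cf (int n - int q - 1) (app dd y) = app (sc (of_int (int n - int q))) (cf (int n - int q) y)" unfolding cf_dd by simp
      then have "nrm I (cf (int n - int q - 1) (app dd y)) = \<bar>real n - real q\<bar> * g n"
        unfolding g_def by (simp only: nrm_sc norm_of_int) simp
      also have "\<dots> \<le> (real n + real q + 1) * g n" by (intro mult_right_mono g0) auto
      finally show ?thesis .
    qed
    have KK: "nrm I (cf (int n - int q - 1) (app (sc (fls_const (K a))) y)) \<le> cmod (K a) * T"
    proof (cases n)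
      case 0
      have "cf (int n - int q - 1) y = 0" using y 0 unfolding ordge_cf by simp
      then show ?thesis unfolding cf_sc_const nrm_sc using T0 by (simp only: nrm_0) simp
    next
      case (Suc k)
      have "nrm I (cf (int n - int q - 1) y) = g k" using Suc by (simp add: g_def algebra_simps)
      also have "\<dots> \<le> \<rho> ^ (n - k) * g k" using g0[of k] \<rho>(1) by (simp add: mult_le_cancel_right1 one_le_power)
      also have "\<dots> \<le> T" unfolding T_def by (rule member_le_sum) (use Suc g0 \<rho>(1) in auto)
      finally show ?thesis unfolding cf_sc_const nrm_sc by (simp add: mult_left_mono)
    qed
    have PP: "nrm I (cf (int n - int q - 1) (app (sc (pole z z0 s)) (app (efl s b a) y))) \<le> B s * T" if s: "s \<in> S" for s
    proof -
      have pb: "cmod (fls_nth (pole z z0 s) (int j - 1)) \<le> \<rho> ^ j" "\<forall>n < - 1. fls_nth (pole z z0 s) n = 0" for j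
        using pole_bound[of \<rho> z s z0, OF \<rho>(1)] \<rho>(2) s by blast+
      have oe: "ordge (- int q) (app (efl s b a) y)" by (rule ordge_ef[OF y])
      have "cf (int n - int q - 1) (app (sc (pole z z0 s)) (app (efl s b a) y))
        = (\<Sum>i\<le>n. app (sc (fls_nth (pole z z0 s) (int (n - i) - 1))) (cf (int i - int q) (app (efl s b a) y)))"
      proof (rule ext)
        fix \<beta>
        have *: "int n - int q - 1 = int n - 1 - int q" by simp
        have oe': "\<forall>k < - int q. fls_nth (app (efl s b a) y \<beta>) k = 0" using oe unfolding ordge_def by blast
        show "cf (int n - int q - 1) (app (sc (pole z z0 s)) (app (efl s b a) y)) \<beta>
          = (\<Sum>i\<le>n. app (sc (fls_nth (pole z z0 s) (int (n - i) - 1))) (cf (int i - int q) (app (efl s b a) y))) \<beta>"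
          using fls_mult_nth_shift[of 1 "pole z z0 s" "int q" "app (efl s b a) y \<beta>" n, OF pb(2) oe']
          unfolding * by (simp only: cf_def app_sc sum_fun_apply)
      qed
      then have "nrm I (cf (int n - int q - 1) (app (sc (pole z z0 s)) (app (efl s b a) y)))
        \<le> (\<Sum>i\<le>n. nrm I (app (sc (fls_nth (pole z z0 s) (int (n - i) - 1))) (cf (int i - int q) (app (efl s b a) y))))"
        by (simp only: nrm_sum)
      also have "\<dots> \<le> (\<Sum>i\<le>n. \<rho> ^ (n - i) * (B s * g i))"
        unfolding nrm_sc cf_ef
        by (intro sum_mono mult_mono pb(1)) (use \<rho>(1) in \<open>auto simp: ef_def B_def g_def nrm_nonneg intro!: nrm_mk finI\<close>)
      also have "\<dots> = B s * T" by (simp add: T_def sum_distrib_left mult_ac)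
      finally show ?thesis .
    qed
    have ab: "nrm I (cf (int n - int q - 1) (app (if a = b then dd - sc (fls_const (K a)) else 0) y)) \<le> (real n + real q + 1) * g n + cmod (K a) * T"
    proof (cases "a = b")
      case True
      show ?thesis
        unfolding if_P[OF True] app_ring_simps cf_simps using nrm_diff dd KK by (meson add_mono order_trans)
    next
      case False
      show ?thesis unfolding if_not_P[OF False] app_ring_simps cf_simps nrm_0 using g0 T0 by simp
    qed
    have ss: "nrm I (cf (int n - int q - 1) (app (\<Sum>s\<in>S. sc (pole z z0 s) * efl s b a) y)) \<le> (\<Sum>s\<in>S. B s) * T"
      unfolding app_sum_left cf_sum sum_distrib_right
      by (rule order_trans[OF nrm_sum], rule sum_mono) (simp only: app_ring_simps PP)
    have "nrm I (cf (int n - int q - 1) (app (XX K S z z0 a b) y)) \<le> ((real n + real q + 1) * g n + cmod (K a) * T) + (\<Sum>s\<in>S. B s) * T"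
      unfolding XX_def app_ring_simps(4) cf_simps(2) using nrm_diff ab ss by (meson add_mono order_trans)
    also have "\<dots> \<le> A * ((real n + real q + 1) * g n + T)"
    proof -
      have "1 * ((real n + real q + 1) * g n) \<le> A * ((real n + real q + 1) * g n)"
        using B0 g0 by (intro mult_right_mono) (auto simp: A_def intro!: add_nonneg_nonneg sum_nonneg)
      moreover have "(cmod (K a) + (\<Sum>s\<in>S. B s)) * T \<le> A * T"
        using T0 by (intro mult_right_mono) (auto simp: A_def)
      ultimately show ?thesis by (simp add: algebra_simps)
    qed
    finally show "nrm I (cf (int n - int q - 1) (app (XX K S z z0 a b) y))
      \<le> A * ((real n + real q + 1) * nrm I (cf (int n - int q) y) + (\<Sum>i\<le>n. \<rho> ^ (n - i) * nrm I (cf (int i - int q) y)))"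
      by (simp only: g_def T_def)
  qed
qed

text \<open>Each factor contributes one power of n + 1. For all N rows this is the growth of the
  indicial polynomial, which will divide it out in the recursion.\<close>

lemma XX_foldr_bound:
  assumes \<rho>: "1 \<le> \<rho>" "\<forall>s\<in>S. z s \<noteq> z0 \<longrightarrow> 1 / cmod (z0 - z s) \<le> \<rho>"
  shows "\<exists>C\<ge>0. \<forall>x. ordge 0 x \<longrightarrow> ordge (- int (length as)) (foldr (\<lambda>a. app (XX K S z z0 a (\<sigma> a))) as x) \<and>
    (\<forall>n. nrm I (cf (int n - int (length as)) (foldr (\<lambda>a. app (XX K S z z0 a (\<sigma> a))) as x))
      \<le> C * real (n + 1) ^ length as * (\<Sum>i\<le>n. \<rho> ^ (n - i) * nrm I (cf (int i) x)))"
proof (induction as)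
  case Nil
  show ?case
  proof (intro exI[of _ 1] conjI allI impI)
    fix x :: "'i \<Rightarrow> complex fls" and n :: nat
    assume "ordge 0 x"
    then show "ordge (- int (length ([] :: nat list))) (foldr (\<lambda>a. app (XX K S z z0 a (\<sigma> a))) [] x)" by simp
    have "\<rho> ^ (n - n) * nrm I (cf (int n) x) \<le> (\<Sum>i\<le>n. \<rho> ^ (n - i) * nrm I (cf (int i) x))"
      by (rule member_le_sum[of n "{..n}" "\<lambda>i. \<rho> ^ (n - i) * nrm I (cf (int i) x)"]) (use \<rho>(1) nrm_nonneg in \<open>auto intro!: mult_nonneg_nonneg\<close>)
    then show "nrm I (cf (int n - int (length ([] :: nat list))) (foldr (\<lambda>a. app (XX K S z z0 a (\<sigma> a))) [] x))
      \<le> 1 * real (n + 1) ^ length ([] :: nat list) * (\<Sum>i\<le>n. \<rho> ^ (n - i) * nrm I (cf (int i) x))" by simp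
  qed simp
next
  case (Cons a as)
  define q where "q = length as"
  define Y where "Y = foldr (\<lambda>a. app (XX K S z z0 a (\<sigma> a))) as"
  define s where "s x n = (\<Sum>i\<le>n. \<rho> ^ (n - i) * nrm I (cf (int i) x))" for x :: "'i \<Rightarrow> complex fls" and n
  obtain C where C: "0 \<le> C" "\<And>x. ordge 0 x \<Longrightarrow> ordge (- int q) (Y x)"
    "\<And>x n. ordge 0 x \<Longrightarrow> nrm I (cf (int n - int q) (Y x)) \<le> C * real (n + 1) ^ q * s x n"
    using Cons.IH unfolding q_def Y_def s_def by blast
  from XX_bound[where K = K and a = a and b = "\<sigma> a" and z = z and ?z0.0 = z0 and \<rho> = \<rho>, OF \<rho>]
  obtain A where A: "0 \<le> A" and A': "\<forall>y q n. ordge (- int q) y \<longrightarrow> nrm I (cf (int n - int q - 1) (app (XX K S z z0 a (\<sigma> a)) y))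
    \<le> A * ((real n + real q + 1) * nrm I (cf (int n - int q) y) + (\<Sum>i\<le>n. \<rho> ^ (n - i) * nrm I (cf (int i - int q) y)))"
    by (elim exE conjE)
  have s0: "0 \<le> s x n" for x n unfolding s_def using \<rho>(1) by (intro sum_nonneg mult_nonneg_nonneg nrm_nonneg) auto
  \<comment> \<open>Repeated convolution with the same geometric weights stays below one such sum
    per term, so iterating costs only the number n + 1 of terms.\<close>
  have s_le: "\<rho> ^ (n - i) * s x i \<le> s x n" if "i \<le> n" for x i n
  proof -
    have "\<rho> ^ (n - i) * s x i = (\<Sum>k\<le>i. \<rho> ^ (n - k) * nrm I (cf (int k) x))"
      unfolding s_def sum_distrib_left by (intro sum.cong refl) (use that in \<open>simp add: power_add[symmetric] mult.assoc[symmetric]\<close>)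
    also have "\<dots> \<le> s x n" unfolding s_def by (rule sum_mono2) (use that \<rho>(1) nrm_nonneg in \<open>auto intro!: mult_nonneg_nonneg\<close>)
    finally show ?thesis .
  qed
  \<comment> \<open>In the constant, q + 1 accounts for the derivative, as n + q + 1 \<le> (q + 1)(n
    + 1), and 1 for the convolution.\<close>
  show ?case
  proof (intro exI[of _ "A * C * (real q + 2)"] conjI allI impI)
    show "0 \<le> A * C * (real q + 2)" using A C(1) by simp
    fix x :: "'i \<Rightarrow> complex fls" and n :: nat
    assume x: "ordge 0 x"
    have "ordge (- int q - 1) (app (XX K S z z0 a (\<sigma> a)) (Y x))" by (rule XX_lead(1)[OF subset_refl C(2)[OF x]])
    moreover have "- int q - 1 = - int (length (a # as))" by (simp add: q_def)
    ultimately show "ordge (- int (length (a # as))) (foldr (\<lambda>a. app (XX K S z z0 a (\<sigma> a))) (a # as) x)"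
      unfolding Y_def by (simp only: foldr.simps comp_apply)
    have "(real n + real q + 1) * nrm I (cf (int n - int q) (Y x)) \<le> ((real q + 1) * real (n + 1)) * (C * real (n + 1) ^ q * s x n)"
    proof (intro mult_mono C(3)[OF x])
      show "real n + real q + 1 \<le> (real q + 1) * real (n + 1)" by (simp add: algebra_simps)
    qed (simp_all add: nrm_nonneg)
    moreover have "(\<Sum>i\<le>n. \<rho> ^ (n - i) * nrm I (cf (int i - int q) (Y x))) \<le> (\<Sum>i\<le>n. C * real (n + 1) ^ q * s x n)"
    proof (rule sum_mono)
      fix i assume "i \<in> {..n}"
      then have i: "i \<le> n" by simp
      have "\<rho> ^ (n - i) * nrm I (cf (int i - int q) (Y x)) \<le> \<rho> ^ (n - i) * (C * real (i + 1) ^ q * s x i)"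
        using \<rho>(1) by (intro mult_left_mono C(3)[OF x]) auto
      also have "\<dots> = C * real (i + 1) ^ q * (\<rho> ^ (n - i) * s x i)" by simp
      also have "\<dots> \<le> C * real (n + 1) ^ q * s x n"
        using i C(1) s0 \<rho>(1) by (intro mult_mono power_mono s_le mult_nonneg_nonneg) auto
      finally show "\<rho> ^ (n - i) * nrm I (cf (int i - int q) (Y x)) \<le> C * real (n + 1) ^ q * s x n" .
    qed
    ultimately have "(real n + real q + 1) * nrm I (cf (int n - int q) (Y x)) + (\<Sum>i\<le>n. \<rho> ^ (n - i) * nrm I (cf (int i - int q) (Y x)))
      \<le> ((real q + 1) * real (n + 1)) * (C * real (n + 1) ^ q * s x n) + real (n + 1) * (C * real (n + 1) ^ q * s x n)"
      by simp
    then have "A * ((real n + real q + 1) * nrm I (cf (int n - int q) (Y x)) + (\<Sum>i\<le>n. \<rho> ^ (n - i) * nrm I (cf (int i - int q) (Y x))))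
      \<le> A * (((real q + 1) * real (n + 1)) * (C * real (n + 1) ^ q * s x n) + real (n + 1) * (C * real (n + 1) ^ q * s x n))"
      by (rule mult_left_mono[OF _ A])
    also have "\<dots> = A * C * (real q + 2) * real (n + 1) ^ Suc q * s x n" by (simp add: algebra_simps)
    finally have "nrm I (cf (int n - int q - 1) (app (XX K S z z0 a (\<sigma> a)) (Y x))) \<le> A * C * (real q + 2) * real (n + 1) ^ Suc q * s x n"
      using A'[rule_format, OF C(2)[OF x], of n] by linarith
    then show "nrm I (cf (int n - int (length (a # as))) (foldr (\<lambda>a. app (XX K S z z0 a (\<sigma> a))) (a # as) x))
      \<le> A * C * (real q + 2) * real (n + 1) ^ length (a # as) * (\<Sum>i\<le>n. \<rho> ^ (n - i) * nrm I (cf (int i) x))"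
      by (simp add: q_def Y_def s_def algebra_simps)
  qed
qed

lemma rdet_bound:
  assumes \<rho>: "1 \<le> \<rho>" "\<forall>s\<in>S. z s \<noteq> z0 \<longrightarrow> 1 / cmod (z0 - z s) \<le> \<rho>"
  shows "\<exists>C\<ge>0. \<forall>x n. ordge 0 x \<longrightarrow> nrm I (cf (int n - int N) (app (rdet N (XX K S z z0)) x))
      \<le> C * real (n + 1) ^ N * (\<Sum>i\<le>n. \<rho> ^ (n - i) * nrm I (cf (int i) x))"
proof -
  let ?Y = "\<lambda>\<sigma>. foldr (\<lambda>a. app (XX K S z z0 a (\<sigma> a))) [1..<N+1]"
  have len: "length [1..<N+1] = N" by simp
  have "\<forall>\<sigma> :: nat \<Rightarrow> nat. \<exists>C. 0 \<le> C \<and> (\<forall>x n. ordge 0 x \<longrightarrow> nrm I (cf (int n - int N) (?Y \<sigma> x)) \<le> C * real (n + 1) ^ N * (\<Sum>i\<le>n. \<rho> ^ (n - i) * nrm I (cf (int i) x)))"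
  proof
    fix \<sigma> :: "nat \<Rightarrow> nat"
    from XX_foldr_bound[where K = K and as = "[1..<N+1]" and z = z and ?z0.0 = z0 and \<rho> = \<rho> and \<sigma> = \<sigma>, OF \<rho>]
    show "\<exists>C. 0 \<le> C \<and> (\<forall>x n. ordge 0 x \<longrightarrow> nrm I (cf (int n - int N) (?Y \<sigma> x)) \<le> C * real (n + 1) ^ N * (\<Sum>i\<le>n. \<rho> ^ (n - i) * nrm I (cf (int i) x)))"
      unfolding len by (elim exE conjE) (rule exI, rule conjI, assumption, blast)
  qed
  then obtain C where C': "\<forall>\<sigma> :: nat \<Rightarrow> nat. 0 \<le> C \<sigma> \<and> (\<forall>x n. ordge 0 x \<longrightarrow> nrm I (cf (int n - int N) (?Y \<sigma> x)) \<le> C \<sigma> * real (n + 1) ^ N * (\<Sum>i\<le>n. \<rho> ^ (n - i) * nrm I (cf (int i) x)))"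
    by (rule exE[OF choice])
  have C: "0 \<le> C \<sigma>" "ordge 0 x \<Longrightarrow> nrm I (cf (int n - int N) (?Y \<sigma> x)) \<le> C \<sigma> * real (n + 1) ^ N * (\<Sum>i\<le>n. \<rho> ^ (n - i) * nrm I (cf (int i) x))"
    for \<sigma> :: "nat \<Rightarrow> nat" and x n using C' by blast+
  show ?thesis
  proof (intro exI[of _ "\<Sum>\<sigma> | \<sigma> permutes {1..N}. C \<sigma>"] conjI allI impI)
    show "0 \<le> (\<Sum>\<sigma> | \<sigma> permutes {1..N}. C \<sigma>)" using C(1) by (intro sum_nonneg)
    fix x :: "'i \<Rightarrow> complex fls" and n :: nat
    assume x: "ordge 0 x"
    have "cf (int n - int N) (app (rdet N (XX K S z z0)) x) = (\<Sum>\<sigma> | \<sigma> permutes {1..N}. app (sc (of_int (sign \<sigma>))) (cf (int n - int N) (?Y \<sigma> x)))"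
      unfolding rdet_def app_sum_left cf_sum
      by (intro sum.cong refl) (simp only: app_ring_simps app_prod_list cf_of_int of_int_eq_sc)
    then have "nrm I (cf (int n - int N) (app (rdet N (XX K S z z0)) x)) \<le> (\<Sum>\<sigma> | \<sigma> permutes {1..N}. nrm I (app (sc (of_int (sign \<sigma>))) (cf (int n - int N) (?Y \<sigma> x))))"
      by (simp only: nrm_sum)
    also have "\<dots> \<le> (\<Sum>\<sigma> | \<sigma> permutes {1..N}. C \<sigma> * real (n + 1) ^ N * (\<Sum>i\<le>n. \<rho> ^ (n - i) * nrm I (cf (int i) x)))"
    proof (rule sum_mono)
      fix \<sigma> :: "nat \<Rightarrow> nat"
      have "cmod (of_int (sign \<sigma>)) = 1" by (simp add: sign_def)
      then show "nrm I (app (sc (of_int (sign \<sigma>))) (cf (int n - int N) (?Y \<sigma> x))) \<le> C \<sigma> * real (n + 1) ^ N * (\<Sum>i\<le>n. \<rho> ^ (n - i) * nrm I (cf (int i) x))"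
        unfolding nrm_sc using C(2)[OF x, of n \<sigma>] by (simp only: mult_1)
    qed
    finally show "nrm I (cf (int n - int N) (app (rdet N (XX K S z z0)) x)) \<le> (\<Sum>\<sigma> | \<sigma> permutes {1..N}. C \<sigma>) * real (n + 1) ^ N * (\<Sum>i\<le>n. \<rho> ^ (n - i) * nrm I (cf (int i) x))"
      by (simp only: sum_distrib_right)
  qed
qed

end

context gaudin
begin

section \<open>Formal power series solutions and their convergence\<close>

definition ser :: "(nat \<Rightarrow> 'i \<Rightarrow> complex) \<Rightarrow> 'i \<Rightarrow> complex fls" where
  "ser F = (\<lambda>\<beta>. fps_to_fls (Abs_fps (\<lambda>l. F l \<beta>)))"

lemma cf_ser: "cf n (ser F) = (if n < 0 then 0 else F (nat n))"
  by (auto simp: cf_def ser_def fun_eq_iff)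

lemma cf_partial: "cf n (\<Sum>l<M. fmono (int l) (F l)) = (if 0 \<le> n \<and> n < int M then F (nat n) else 0)"
proof -
  have "cf n (\<Sum>l<M. fmono (int l) (F l)) = (\<Sum>l<M. if l = nat n then (if 0 \<le> n then F (nat n) else 0) else 0)"
    unfolding cf_sum by (intro sum.cong refl) (auto simp only: cf_fmono nat_int of_nat_0_le_iff simp_thms if_True if_False int_nat_eq split: if_splits)
  also have "\<dots> = (if nat n < M then (if 0 \<le> n then F (nat n) else 0) else 0)"
    by (simp only: sum.delta finite_lessThan lessThan_iff)
  also have "\<dots> = (if 0 \<le> n \<and> n < int M then F (nat n) else 0)"
    by (cases "0 \<le> n") (simp_all only: nat_less_iff simp_thms if_True if_False if_cancel)
  finally show ?thesis .
qed

text \<open>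
  The coefficient of order \<open>l - N\<close> determines \<open>F l\<close> from the lower ones as long as \<open>p l\<close> does not
  vanish, and the growth of \<open>p\<close> makes the resulting series converge.
\<close>

lemma formal_solution:
  assumes P0: "\<And>l x. L \<le> l \<Longrightarrow> x \<in> wspace m \<Longrightarrow> app (P0 {s \<in> S. z s = z0} (of_nat l)) x = app (sc (p l)) x"
    and p: "0 < c" "\<And>l. L \<le> l \<Longrightarrow> c * real (l + 1) ^ N \<le> cmod (p l)"
    and f: "\<And>l. f l \<in> wspace m" "ordge (int L - int N) (app (rdet N (XX K S z z0)) (\<Sum>l<L. fmono (int l) (f l)))"
  shows "\<exists>F A R. (\<forall>l. F l \<in> wspace m) \<and> (\<forall>l<L. F l = f l) \<and> 0 < R \<and> (\<forall>l. nrm I (F l) \<le> A * R ^ l) \<and>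
    app (rdet N (XX K S z z0)) (ser F) = 0"
proof -
  define D where "D = app (rdet N (XX K S z z0))"
  have p0: "p l \<noteq> 0" if "L \<le> l" for l
  proof -
    have "0 < c * real (l + 1) ^ N" using p(1) by simp
    then show ?thesis using p(2)[OF that] by auto
  qed
  \<comment> \<open>The coefficient at L + j that cancels the term of order L + j - N left by the
    partial sum \<open>x\<close>.\<close>
  define g where "g j x = app (sc (- 1 / p (L + j))) (cf (int (L + j) - int N) (D x))" for j x
  define xs where "xs = rec_nat (\<Sum>l<L. fmono (int l) (f l)) (\<lambda>j x. x + fmono (int (L + j)) (g j x))"
  have xs_0: "xs 0 = (\<Sum>l<L. fmono (int l) (f l))" and xs_Suc: "xs (Suc j) = xs j + fmono (int (L + j)) (g j (xs j))" for j
    by (simp_all only: xs_def nat.rec)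
  define F where "F l = (if l < L then f l else g (l - L) (xs (l - L)))" for l
  have xs: "xs j = (\<Sum>l<L + j. fmono (int l) (F l))" for j
  proof (induction j)
    case 0
    show ?case unfolding xs_0 add_0_right by (intro sum.cong refl) (simp add: F_def)
  next
    case (Suc j)
    have "F (L + j) = g j (xs j)" by (simp add: F_def)
    then show ?case unfolding xs_Suc add_Suc_right sum.lessThan_Suc Suc[symmetric] by (simp only:)
  qed
  have D_diff: "D (x - y) = D x - D y" for x y unfolding D_def by (rule app_diff)
  have D_ord: "ordge (l - int N) (D x)" if "ordge l x" for l x
    unfolding D_def by (rule rdet_lead(1)[OF subset_refl that])
  have Fw: "F l \<in> wspace m" for l
  proof (induction l rule: less_induct)
    case (less l)
    show ?case
    proof (cases "l < L")
      case False
      have "cf n (xs (l - L)) \<in> wspace m" for n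
        unfolding xs cf_partial using less.IH False wspace_0 by (cases "0 \<le> n \<and> n < int (L + (l - L))") (auto simp: nat_less_iff)
      then have "cf n (D (xs (l - L))) \<in> wspace m" for n unfolding D_def by (rule rdet_wspace)
      from wspace_scale[OF this] show ?thesis using False unfolding F_def g_def app_sc by (simp only: if_False)
    qed (simp add: F_def f)
  qed
  have inv: "ordge (int (L + j) - int N) (D (xs j))" for j
  proof (induction j)
    case 0
    show ?case using f(2) unfolding D_def xs_0 by simp
  next
    case (Suc j)
    let ?n = "int (L + j) - int N"
    have D_add: "D (xs (Suc j)) = D (xs j) + D (fmono (int (L + j)) (F (L + j)))"
      unfolding xs_Suc D_def app_add by (simp add: F_def)
    have o1: "ordge ?n (D (fmono (int (L + j)) (F (L + j))))" by (rule D_ord[OF ordge_fmono])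
    have "cf ?n (D (fmono (int (L + j)) (F (L + j)))) = app (P0 {s \<in> S. z s = z0} (of_nat (L + j))) (F (L + j))"
      using rdet_lead(2)[where K = K and z = z and ?z0.0 = z0, OF subset_refl ordge_fmono[of "int (L + j)" "F (L + j)"]] unfolding D_def cf_fmono by simp
    also have "\<dots> = app (sc (p (L + j))) (F (L + j))" by (rule P0[OF _ Fw]) simp
    also have "app (sc (p (L + j))) (F (L + j)) = app (sc (p (L + j) * (- 1 / p (L + j)))) (cf ?n (D (xs j)))"
      unfolding sc_simps(4) app_ring_simps by (simp add: F_def g_def)
    also have "\<dots> = - cf ?n (D (xs j))" using p0[of "L + j"] by (simp add: sc_simps)
    finally have z: "cf ?n (D (xs (Suc j))) = 0" unfolding D_add cf_simps by simp
    have o: "ordge ?n (D (xs (Suc j)))" unfolding D_add by (rule ordge_simps(2)[OF Suc o1])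
    show ?case unfolding ordge_cf
    proof (intro allI impI)
      fix n assume "n < int (L + Suc j) - int N"
      then consider "n < ?n" | "n = ?n" by linarith
      then show "cf n (D (xs (Suc j))) = 0"
        using o z unfolding ordge_cf by cases blast+
    qed
  qed
  have sol: "D (ser F) = 0"
  proof -
    \<comment> \<open>A coefficient of the image depends only on finitely many coefficients of the
      series, so a long enough partial sum decides it.\<close>
    have cf0: "cf n (D (ser F)) = 0" for n
    proof -
      define j where "j = nat (n + int N + 1)"
      have n: "n < int (L + j) - int N" by (simp add: j_def)
      have "ordge (int (L + j)) (ser F - xs j)"
        unfolding ordge_cf cf_simps xs cf_partial cf_ser by auto
      then have "cf n (D (ser F) - D (xs j)) = 0" using D_ord n unfolding ordge_cf D_diff[symmetric] by blast
      moreover have "cf n (D (xs j)) = 0" using inv n unfolding ordge_cf by blast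
      ultimately show ?thesis unfolding cf_simps by simp
    qed
    show ?thesis
    proof (intro ext fls_eqI)
      fix \<beta> n show "fls_nth (D (ser F) \<beta>) n = fls_nth (0 \<beta>) n" using fun_cong[OF cf0[of n], of \<beta>] by (simp add: cf_def)
    qed
  qed
  \<comment> \<open>A crude common bound of the inverse distances; sites at \<open>z0\<close>
    contribute 1/0 = 0.\<close>
  define \<rho> where "\<rho> = 1 + (\<Sum>s\<in>S. 1 / cmod (z0 - z s))"
  have sn: "0 \<le> (\<Sum>s\<in>S. 1 / cmod (z0 - z s))" by (intro sum_nonneg) simp
  have \<rho>: "1 \<le> \<rho>" "\<forall>s\<in>S. z s \<noteq> z0 \<longrightarrow> 1 / cmod (z0 - z s) \<le> \<rho>"
  proof -
    show "1 \<le> \<rho>" using sn by (simp add: \<rho>_def)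
    show "\<forall>s\<in>S. z s \<noteq> z0 \<longrightarrow> 1 / cmod (z0 - z s) \<le> \<rho>"
    proof (intro ballI impI)
      fix s assume "s \<in> S"
      then have "1 / cmod (z0 - z s) \<le> (\<Sum>s\<in>S. 1 / cmod (z0 - z s))"
        by (intro member_le_sum[of s S "\<lambda>s. 1 / cmod (z0 - z s)"]) (auto simp: finS)
      then show "1 / cmod (z0 - z s) \<le> \<rho>" by (simp add: \<rho>_def)
    qed
  qed
  obtain C where C: "0 \<le> C" "\<forall>x n. ordge 0 x \<longrightarrow> nrm I (cf (int n - int N) (D x))
      \<le> C * real (n + 1) ^ N * (\<Sum>i\<le>n. \<rho> ^ (n - i) * nrm I (cf (int i) x))"
    using rdet_bound[where K = K and z = z and ?z0.0 = z0 and \<rho> = \<rho>, OF \<rho>] unfolding D_def by blast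
  have "nrm I (F l) \<le> (C / c) * (\<Sum>k<l. \<rho> ^ (l - k) * nrm I (F k))" if l: "L \<le> l" for l
  proof -
    define j where "j = l - L"
    have lj: "l = L + j" using l by (simp add: j_def)
    let ?s = "\<Sum>k<l. \<rho> ^ (l - k) * nrm I (F k)"
    have s0: "0 \<le> ?s" using \<rho>(1) nrm_nonneg by (intro sum_nonneg mult_nonneg_nonneg) auto
    have "ordge 0 (xs j)" unfolding ordge_cf xs cf_partial by auto
    then have "nrm I (cf (int l - int N) (D (xs j))) \<le> C * real (l + 1) ^ N * (\<Sum>i\<le>l. \<rho> ^ (l - i) * nrm I (cf (int i) (xs j)))"
      using C(2) by blast
    also have "(\<Sum>i\<le>l. \<rho> ^ (l - i) * nrm I (cf (int i) (xs j))) = ?s"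
    proof -
      have "cf (int l) (xs j) = 0" unfolding xs cf_partial lj by simp
      then have "(\<Sum>i\<le>l. \<rho> ^ (l - i) * nrm I (cf (int i) (xs j))) = (\<Sum>i<l. \<rho> ^ (l - i) * nrm I (cf (int i) (xs j)))"
        unfolding lessThan_Suc_atMost[symmetric] sum.lessThan_Suc by (simp only: nrm_0 mult_zero_right add_0_right)
      also have "\<dots> = ?s" by (intro sum.cong refl) (simp add: xs cf_partial lj)
      finally show ?thesis .
    qed
    finally have b: "nrm I (cf (int l - int N) (D (xs j))) \<le> C * real (l + 1) ^ N * ?s" .
    have "F l = app (sc (- 1 / p l)) (cf (int l - int N) (D (xs j)))" by (simp add: F_def g_def lj)
    then have "nrm I (F l) = nrm I (cf (int l - int N) (D (xs j))) / cmod (p l)"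
      by (simp add: nrm_sc norm_divide)
    \<comment> \<open>The powers of l + 1 from the operator bound and from the lower bound of the
      indicial polynomial cancel, leaving a recursion with constant factor.\<close>
    also have "\<dots> \<le> (C * real (l + 1) ^ N * ?s) / (c * real (l + 1) ^ N)"
      using b p(1) p(2)[OF l] C(1) s0 by (intro frac_le) (auto intro!: mult_nonneg_nonneg)
    also have "\<dots> = (C / c) * ?s" using p(1) by simp
    finally show ?thesis .
  qed
  then have "\<exists>A R. 0 < R \<and> (\<forall>l. nrm I (F l) \<le> A * R ^ l)"
    by (intro geometric_growth[where \<alpha> = "\<lambda>l. nrm I (F l)" and C = "C / c" and \<rho> = \<rho> and L = L])
       (use C(1) p(1) \<rho>(1) in \<open>auto simp: nrm_nonneg\<close>)
  then obtain A R where "0 < R" "\<forall>l. nrm I (F l) \<le> A * R ^ l" by blast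
  then show ?thesis using Fw sol unfolding D_def by (intro exI[of _ F] exI[of _ A] exI[of _ R]) (auto simp: F_def)
qed

lemma Dan_supp:
  assumes f: "\<And>\<beta> u. \<beta> \<notin> I \<Longrightarrow> f u \<beta> = 0"
  shows "\<beta> \<notin> I \<Longrightarrow> Dan K z f u \<beta> = 0"
proof -
  have X: "\<forall>\<beta> u. \<beta> \<notin> I \<longrightarrow> Xan K z a b f u \<beta> = 0" if "a \<in> {1..N}" "b \<in> {1..N}" "\<forall>\<beta> u. \<beta> \<notin> I \<longrightarrow> f u \<beta> = 0" for a b f
    using that by (auto simp: Xan_def supp)
  have "\<forall>\<beta> u. \<beta> \<notin> I \<longrightarrow> foldr (\<lambda>a. Xan K z a (\<sigma> a)) as f u \<beta> = 0" if "set as \<subseteq> {1..N}" "\<sigma> permutes {1..N}" for as \<sigma>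
    using that(1)
  proof (induction as)
    case (Cons a as)
    then show ?case using X[of a "\<sigma> a"] permutes_in_image[OF that(2), of a] by simp
  qed (use f in simp)
  then have "foldr (\<lambda>a. Xan K z a (\<sigma> a)) [1..<N+1] f u \<beta> = 0" if "\<sigma> permutes {1..N}" "\<beta> \<notin> I" for \<sigma> \<beta>
    using that by (metis order_refl set_upt1)
  then show "\<beta> \<notin> I \<Longrightarrow> Dan K z f u \<beta> = 0"
    unfolding Dan_def by (intro sum.neutral ballI) (simp del: upt_Suc)
qed

text \<open>The expansion at \<open>z0\<close> of the operator applied to the sum is the formal
  image, hence zero, and a function with zero expansion vanishes near the point. So no termwise
  differentiation is needed.\<close>

lemma convergent_solution:
  assumes F: "\<And>l. F l \<in> wspace m" and R: "0 < R" "\<And>l. nrm I (F l) \<le> A * R ^ l"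
    and sol: "app (rdet N (XX K S z z0)) (ser F) = 0" and l0: "\<And>l. l < l0 \<Longrightarrow> F l = 0"
  shows "\<exists>r>0. \<exists>f. (\<forall>\<beta>. (\<lambda>u. f u \<beta>) holomorphic_on ball z0 r) \<and> (\<forall>u\<in>ball z0 r. f u \<in> wspace m) \<and>
    (\<forall>u\<in>ball z0 r - {z0}. \<forall>\<beta>. Dan K z f u \<beta> = 0) \<and>
    (\<forall>\<beta>. (\<lambda>u. f u \<beta> - F l0 \<beta> * (u - z0) ^ l0) \<in> O[at z0](\<lambda>u. (u - z0) ^ (l0 + 1)))"
proof -
  define G where "G \<beta> = Abs_fps (\<lambda>l. F l \<beta>)" for \<beta>
  have F0: "F l \<beta> = 0" if "\<beta> \<notin> I" for l \<beta> using F[of l] that by (auto simp: wspace_def)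
  have bnd: "cmod (F l \<beta>) \<le> A * R ^ l" for l \<beta>
  proof (cases "\<beta> \<in> I")
    case True
    then have "cmod (F l \<beta>) \<le> nrm I (F l)" unfolding nrm_def by (intro member_le_sum finI) auto
    then show ?thesis using R(2)[of l] by linarith
  next
    case False
    have "0 \<le> nrm I (F l)" by (rule nrm_nonneg)
    then show ?thesis using R(2)[of l] F0[OF False] by simp
  qed
  have A0: "0 \<le> A" using bnd[of 0] norm_ge_zero[of "F 0 undefined"] by (metis mult.right_neutral order_trans power_0)
  define r0 where "r0 = 1 / R"
  have r0: "0 < r0" using R(1) by (simp add: r0_def)
  \<comment> \<open>The shifted series are included because the one for k = l0 + 1 is the remainder
    in the O-estimate.\<close>
  have summ: "summable (\<lambda>l. norm (fps_nth (fps_shift k (G \<beta>)) l * t ^ l))" if "cmod t < r0" for t k \<beta>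
  proof (rule summable_comparison_test')
    have "R * cmod t < 1" using that R(1) by (simp add: r0_def field_simps)
    then show "summable (\<lambda>l. A * R ^ k * (R * cmod t) ^ l)"
      using R(1) by (intro summable_mult summable_geometric) auto
    show "norm (norm (fps_nth (fps_shift k (G \<beta>)) l * t ^ l)) \<le> A * R ^ k * (R * cmod t) ^ l" if "0 \<le> l" for l
    proof -
      have "cmod (F (l + k) \<beta>) * cmod t ^ l \<le> A * R ^ (l + k) * cmod t ^ l" by (intro mult_right_mono bnd) simp
      then show ?thesis by (simp add: G_def norm_mult norm_power power_add power_mult_distrib mult_ac)
    qed
  qed
  have rad: "ereal r0 \<le> fps_conv_radius (fps_shift k (G \<beta>))" for k \<beta>
    unfolding fps_conv_radius_def
  proof (rule conv_radius_geI_ex')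
    fix r assume r: "0 < r" "ereal r < ereal r0"
    then have "cmod (of_real r) < r0" by simp
    from summable_norm_cancel[OF summ[OF this, of k \<beta>]] show "summable (\<lambda>n. fps_nth (fps_shift k (G \<beta>)) n * of_real r ^ n)" .
  qed
  have rad0: "ereal r0 \<le> fps_conv_radius (G \<beta>)" for \<beta> using rad[of 0 \<beta>] by simp
  have pos: "0 < fps_conv_radius (fps_shift k (G \<beta>))" for k \<beta>
    by (rule less_le_trans[OF _ rad]) (use r0 in simp)
  define f where "f u \<beta> = eval_fps (G \<beta>) (u - z0)" for u \<beta>
  have fsums: "(\<lambda>l. F l \<beta> * (u - z0) ^ l) sums f u \<beta>" if "u \<in> ball z0 r0" for u \<beta>
    using summable_sums[OF summable_norm_cancel[OF summ[of "u - z0" 0 \<beta>]]] that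
    by (simp add: f_def eval_fps_def G_def dist_norm norm_minus_commute)
  have f0: "f u \<beta> = 0" if "\<beta> \<notin> I" for u \<beta>
  proof -
    have "G \<beta> = 0" unfolding G_def by (intro fps_ext) (simp add: F0[OF that])
    then show ?thesis by (simp add: f_def)
  qed
  have hol: "(\<lambda>u. f u \<beta>) holomorphic_on ball z0 r0" for \<beta>
    unfolding f_def
  proof (rule holomorphic_on_compose_gen[where g = "eval_fps (G \<beta>)" and t = "ball 0 r0", unfolded o_def])
    show "eval_fps (G \<beta>) holomorphic_on ball 0 r0"
      by (rule holomorphic_on_eval_fps) (use less_le_trans[OF _ rad0[of \<beta>]] in \<open>auto simp: in_eball_iff\<close>)
  qed (auto intro!: holomorphic_intros simp: dist_norm norm_minus_commute)
  have lx: "lexp z0 f (ser F)"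
    unfolding lexp_def
  proof
    fix \<beta>
    have "eval_fps (G \<beta>) has_fps_expansion G \<beta>" using pos[of 0 \<beta>] by (intro eval_fps_has_fps_expansion) simp
    then have "eval_fps (G \<beta>) has_laurent_expansion fps_to_fls (G \<beta>)" by (rule has_laurent_expansion_fps)
    then show "(\<lambda>t. f (z0 + t) \<beta>) has_laurent_expansion ser F \<beta>" by (simp add: f_def ser_def G_def)
  qed
  have "\<forall>\<^sub>F t in at 0. Dan K z f (z0 + t) \<beta> = 0" for \<beta>
  proof -
    have "(\<lambda>t. Dan K z f (z0 + t) \<beta>) has_laurent_expansion 0"
      using lexp_Dan[OF lx, of K z] unfolding sol lexp_def by simp
    then show ?thesis using has_laurent_expansion_eventually_zero_iff[of "\<lambda>u. Dan K z f (z0 + u) \<beta>" 0 0] by simp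
  qed
  \<comment> \<open>Only the finitely many coordinates in \<open>I\<close> matter, so one
    neighbourhood serves all of them.\<close>
  then have "\<forall>\<^sub>F t in at 0. \<forall>\<beta>\<in>I. Dan K z f (z0 + t) \<beta> = 0"
    by (subst eventually_ball_finite_distrib[OF finI]) blast
  then obtain \<delta> where \<delta>: "0 < \<delta>" "\<And>t. t \<noteq> 0 \<Longrightarrow> dist t 0 < \<delta> \<Longrightarrow> \<forall>\<beta>\<in>I. Dan K z f (z0 + t) \<beta> = 0"
    unfolding eventually_at by auto
  define r where "r = min r0 \<delta>"
  have sub: "ball z0 r \<subseteq> ball z0 r0" by (auto simp: r_def)
  show ?thesis
  proof (intro exI[of _ r] exI[of _ f] conjI allI ballI)
    show "0 < r" using r0 \<delta>(1) by (simp add: r_def)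
    show "(\<lambda>u. f u \<beta>) holomorphic_on ball z0 r" for \<beta> by (rule holomorphic_on_subset[OF hol sub])
    show "f u \<in> wspace m" if "u \<in> ball z0 r" for u
      unfolding wspace_def
    proof (intro CollectI conjI allI impI ballI)
      show "f u \<beta> = 0" if "\<beta> \<notin> I" for \<beta> by (rule f0[OF that])
      fix a assume a: "a \<in> {1..N}"
      have u: "u \<in> ball z0 r0" using that sub by blast
      show "app (\<Sum>s\<in>S. efc s a a) (f u) = app (sc (m a)) (f u)"
      proof (rule ext)
        fix \<beta>
        have "(\<lambda>l. \<Sum>s\<in>S. \<Sum>\<gamma>\<in>I. e s a a \<beta> \<gamma> * (F l \<gamma> * (u - z0) ^ l)) sums (\<Sum>s\<in>S. \<Sum>\<gamma>\<in>I. e s a a \<beta> \<gamma> * f u \<gamma>)"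
          by (intro sums_sum sums_mult fsums u)
        moreover have "(\<Sum>s\<in>S. \<Sum>\<gamma>\<in>I. e s a a \<beta> \<gamma> * (F l \<gamma> * (u - z0) ^ l)) = m a * (F l \<beta> * (u - z0) ^ l)" for l
        proof -
          have "app (\<Sum>s\<in>S. efc s a a) (F l) \<beta> = app (sc (m a)) (F l) \<beta>" using F[of l] a unfolding wspace_def by simp
          then have "(\<Sum>s\<in>S. \<Sum>\<gamma>\<in>I. e s a a \<beta> \<gamma> * F l \<gamma>) = m a * F l \<beta>"
            by (simp add: app_sum_left sum_fun_apply ef_def app_mk app_sc)
          then show ?thesis by (simp add: mult.assoc[symmetric] sum_distrib_right[symmetric])
        qed
        ultimately have "(\<lambda>l. m a * (F l \<beta> * (u - z0) ^ l)) sums (\<Sum>s\<in>S. \<Sum>\<gamma>\<in>I. e s a a \<beta> \<gamma> * f u \<gamma>)" by simp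
        moreover have "(\<lambda>l. m a * (F l \<beta> * (u - z0) ^ l)) sums (m a * f u \<beta>)" by (intro sums_mult fsums u)
        ultimately have "(\<Sum>s\<in>S. \<Sum>\<gamma>\<in>I. e s a a \<beta> \<gamma> * f u \<gamma>) = m a * f u \<beta>" by (rule sums_unique2)
        then show "app (\<Sum>s\<in>S. efc s a a) (f u) \<beta> = app (sc (m a)) (f u) \<beta>"
          by (simp add: app_sum_left sum_fun_apply ef_def app_mk app_sc)
      qed
    qed
    show "Dan K z f u \<beta> = 0" if "u \<in> ball z0 r - {z0}" for u \<beta>
    proof (cases "\<beta> \<in> I")
      case True
      have "u - z0 \<noteq> 0" "dist (u - z0) 0 < \<delta>" using that by (auto simp: r_def dist_norm norm_minus_commute)
      from \<delta>(2)[OF this] True show ?thesis by simp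
    qed (rule Dan_supp[OF f0])
    show "(\<lambda>u. f u \<beta> - F l0 \<beta> * (u - z0) ^ l0) \<in> O[at z0](\<lambda>u. (u - z0) ^ (l0 + 1))" for \<beta>
    proof (rule bigoI_tendsto)
      let ?h = "\<lambda>u. eval_fps (fps_shift (l0 + 1) (G \<beta>)) (u - z0)"
      show "\<forall>\<^sub>F u in at z0. (u - z0) ^ (l0 + 1) \<noteq> 0"
        by (simp add: eventually_at_filter)
      have "isCont (eval_fps (fps_shift (l0 + 1) (G \<beta>))) (z0 - z0)"
        using continuous_eval_fps[of "z0 - z0" "fps_shift (l0 + 1) (G \<beta>)" UNIV] pos[of "l0 + 1" \<beta>] by (simp add: zero_ereal_def)
      moreover have "isCont (\<lambda>u. u - z0) z0" by (intro continuous_intros)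
      ultimately have "isCont ?h z0" by (rule isCont_o2[rotated])
      then have lim: "(?h \<longlongrightarrow> ?h z0) (at z0)" by (simp only: isCont_def)
      have "f u \<beta> - F l0 \<beta> * (u - z0) ^ l0 = (u - z0) ^ (l0 + 1) * ?h u" if "u \<in> ball z0 r0" for u
      proof -
        have u: "cmod (u - z0) < r0" using that by (simp add: dist_norm norm_minus_commute)
        have 1: "(\<lambda>l. F (l + (l0 + 1)) \<beta> * (u - z0) ^ (l + (l0 + 1))) sums (f u \<beta> - (\<Sum>l<l0 + 1. F l \<beta> * (u - z0) ^ l))"
          using sums_split_initial_segment[OF fsums[OF that, of \<beta>], of "l0 + 1"] .
        have 2: "(\<Sum>l<l0 + 1. F l \<beta> * (u - z0) ^ l) = F l0 \<beta> * (u - z0) ^ l0" using l0 by simp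
        have 3: "(\<lambda>l. (u - z0) ^ (l0 + 1) * (F (l + (l0 + 1)) \<beta> * (u - z0) ^ l)) sums ((u - z0) ^ (l0 + 1) * ?h u)"
          using summable_sums[OF summable_norm_cancel[OF summ[OF u, of "l0 + 1" \<beta>]]]
          by (intro sums_mult) (simp add: eval_fps_def G_def)
        have 4: "(\<lambda>l. (u - z0) ^ (l0 + 1) * (F (l + (l0 + 1)) \<beta> * (u - z0) ^ l)) = (\<lambda>l. F (l + (l0 + 1)) \<beta> * (u - z0) ^ (l + (l0 + 1)))"
          by (simp add: fun_eq_iff power_add mult_ac)
        show ?thesis by (rule sums_unique2[OF 1[unfolded 2] 3[unfolded 4]])
      qed
      then have ev: "\<forall>\<^sub>F u in at z0. (f u \<beta> - F l0 \<beta> * (u - z0) ^ l0) / (u - z0) ^ (l0 + 1) = ?h u"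
        unfolding eventually_at using r0 by (intro exI[of _ r0]) (auto simp: dist_commute)
      show "((\<lambda>u. (f u \<beta> - F l0 \<beta> * (u - z0) ^ l0) / (u - z0) ^ (l0 + 1)) \<longlongrightarrow> ?h z0) (at z0)"
        by (rule Lim_transform_eventually[OF lim]) (use ev in \<open>simp add: eq_commute\<close>)
    qed
  qed
qed

end

section \<open>Solutions with prescribed leading term\<close>

lemma factor_op_tker:
  assumes "s \<in> {1..n}"
  shows "factor_op n d s A x \<beta> = (\<Sum>\<gamma>\<in>tI {1..n} d. tker {1..n} d s A \<beta> \<gamma> * x \<gamma>)"
  using app_tker[where h = "\<lambda>c. c" and S = "{1..n}" and s = s and d = d and A = A and x = x and \<beta> = \<beta>] assms
  by (simp add: app_mk factor_op_def multi_indices_def tI_def)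

text \<open>The constant is the one that is sharp at l = r + 1, where both sides equal 1.\<close>

lemma indicial_bound:
  fixes r :: real
  assumes "0 \<le> r" "r + 1 \<le> l"
  shows "(l + 1) / (r + 2) \<le> \<bar>l - r\<bar>"
proof -
  have "l + 1 \<le> (l - r) * (r + 2)"
  proof -
    have "0 \<le> (l - r - 1) * (r + 1)" using assms by (intro mult_nonneg_nonneg) auto
    then show ?thesis by (simp add: algebra_simps)
  qed
  then show ?thesis using assms by (simp add: divide_le_eq)
qed

text \<open>At a site the division in \<open>X_op\<close> returns a default value, so the equation
  is asserted off the sites. The exponent is a nonnegative integer, which makes the solution
  holomorphic on the full disc.\<close>

theorem theorem12p2:
  fixes N n :: nat
    and K :: "nat \<Rightarrow> complex"
    and \<Lambda> :: "nat \<Rightarrow> nat \<Rightarrow> int"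
    and d :: "nat \<Rightarrow> nat"
    and E :: "nat \<Rightarrow> nat \<Rightarrow> nat \<Rightarrow> complex mat"
    and z :: "nat \<Rightarrow> complex"
    and m :: "nat \<Rightarrow> complex"
    and v :: "(nat \<Rightarrow> nat) \<Rightarrow> complex"
    and i j :: nat
  assumes "\<And>s. s \<in> {1..n} \<Longrightarrow> integral_dominant N (\<Lambda> s)"
    and "\<And>s. s \<in> {1..n} \<Longrightarrow> \<Lambda> s N = 0"
    and "\<And>s. s \<in> {1..n} \<Longrightarrow> irreducible_highest_weight_module N (d s) (E s) (\<Lambda> s)"
    and "inj_on z {1..n}"
    and "i \<in> {1..n}" and "j \<in> {1..N}"
    and "v \<in> weight_subspace N n d E m" and "v \<noteq> (\<lambda>\<beta>. 0)"
  shows "\<exists>r>0. \<exists>f :: complex \<Rightarrow> (nat \<Rightarrow> nat) \<Rightarrow> complex.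
           (\<forall>\<beta>. (\<lambda>u. f u \<beta>) holomorphic_on ball (z i) r) \<and>
           (\<forall>u\<in>ball (z i) r. f u \<in> weight_subspace N n d E m) \<and>
           (\<forall>u\<in>ball (z i) r - z ` {1..n}. \<forall>\<beta>.
              universal_diff_op N n d E (\<lambda>a b. if a = b then K a else 0) z f u \<beta> = 0) \<and>
           (\<forall>\<beta>. (\<lambda>u. f u \<beta> - v \<beta> * (u - z i) powi (\<Lambda> i j + int N - int j))
              \<in> O[at (z i)](\<lambda>u. (u - z i) powi (\<Lambda> i j + int N - int j + 1)))"
proof -
  define S where "S = {1..n}"
  let ?I = "tI S d"
  note asm = assms[folded S_def]
  have gl: "gl_module N (d s) (E s)" if "s \<in> S" for s
    using asm(3)[OF that] by (simp add: irreducible_highest_weight_module_def)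
  have nonneg: "0 \<le> \<Lambda> i a" if "a \<in> {1..N}" for a
    by (rule dominant_nonneg[OF asm(1)[OF asm(5)] asm(2)[OF asm(5)] that])
  define k where "k = nat (\<Sum>a=1..N. \<Lambda> i a)"
  have k: "int k = (\<Sum>a=1..N. \<Lambda> i a)" using sum_nonneg[of "{1..N}" "\<Lambda> i"] nonneg by (simp add: k_def)
  have le_k: "\<Lambda> i a \<le> int k" if "a \<in> {1..N}" for a
    unfolding k by (rule member_le_sum) (use that nonneg in auto)
  \<comment> \<open>Fresh labels for the vector sites, one for each box of the partition.\<close>
  define Q where "Q = {n + 1..n + k}"
  have Q: "finite Q" "card Q = k" "Q \<inter> S = {}" by (auto simp: Q_def S_def)
  have finS: "finite S" by (simp add: S_def)
  have mi: "multi_indices n d = ?I" by (simp add: multi_indices_def tI_def S_def)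
  obtain \<phi> \<pi> where emb:
    "\<forall>a\<in>{1..N}. \<forall>b\<in>{1..N}. \<forall>w\<in>tI Q (\<lambda>_. N). \<forall>c'<d i.
      (\<Sum>c<d i. \<phi> w c * E i a b $$ (c, c')) = (\<Sum>s\<in>Q. \<Sum>q<N. vmat N a b $$ (w s, q) * \<phi> (w(s := q)) c')"
    "\<forall>a\<in>{1..N}. \<forall>b\<in>{1..N}. \<forall>w'\<in>tI Q (\<lambda>_. N). \<forall>c<d i.
      (\<Sum>w\<in>tI Q (\<lambda>_. N). \<pi> c w * (\<Sum>s\<in>Q. tker Q (\<lambda>_. N) s (vmat N a b) w w')) = (\<Sum>c'<d i. E i a b $$ (c, c') * \<pi> c' w')"
    "\<forall>c<d i. \<forall>c'<d i. (\<Sum>w\<in>tI Q (\<lambda>_. N). \<pi> c w * \<phi> w c') = (if c = c' then 1 else (0 :: complex))"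
    using module_embedding[OF asm(3)[OF asm(5)] asm(1)[OF asm(5)] asm(2)[OF asm(5)] Q(1)] Q(2) k by blast
  interpret sp: splitting N S i d E Q \<phi> \<pi>
    by unfold_locales (use asm(5) Q finS gl emb in blast)+
  have factor: "factor_op n d s (E s a b) x \<beta> = (\<Sum>\<gamma>\<in>?I. tker S d s (E s a b) \<beta> \<gamma> * x \<gamma>)" if "s \<in> S" for s a b x \<beta>
    unfolding S_def by (rule factor_op_tker[OF that[unfolded S_def]])
  have ws: "weight_subspace N n d E m = sp.small.wspace m"
    unfolding weight_subspace_def sp.small.wspace_def tensor_space_def
    unfolding mi S_def[symmetric] by (auto simp: app_sum_left sum_fun_apply sp.small.ef_def app_mk app_sc factor fun_eq_iff)
  have X: "X_op n d E (\<lambda>a b. if a = b then K a else 0) z a b f = sp.small.Xan K z a b f" for a b f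
    unfolding X_op_def S_def[symmetric] by (auto simp: sp.small.Xan_def factor fun_eq_iff)
  have UD: "universal_diff_op N n d E (\<lambda>a b. if a = b then K a else 0) z f = sp.small.Dan K z f" for f
    unfolding universal_diff_op_def sp.small.Dan_def X ..
  define p :: "nat \<Rightarrow> complex" where "p l = (\<Prod>a=1..N. of_int (int l) - (of_nat N - of_nat a) - of_int (\<Lambda> i a))" for l
  have P0: "app (sp.small.P0 {i} (of_nat l)) x = app (sc (p l)) x" if "x \<in> sp.small.wspace m" for l x
  proof (rule ext)
    fix \<beta>
    have supp: "\<And>\<beta>. \<beta> \<notin> ?I \<Longrightarrow> x \<beta> = 0" using that by (auto simp: sp.small.wspace_def)
    show "app (sp.small.P0 {i} (of_nat l)) x \<beta> = app (sc (p l)) x \<beta>"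
    proof (cases "\<beta> \<in> ?I")
      case True
      show ?thesis
        using tensor_P0[of S N d E i "\<Lambda> i" \<beta> "int l" x, OF finS gl asm(5) asm(3)[OF asm(5)] True]
        by (simp add: p_def app_sc)
    next
      case False
      have "app (sp.small.P0 {i} (of_int (int l))) x \<beta> = 0"
        by (rule sp.small.P0_supp[OF _ supp False]) (use asm(5) in simp)
      then show ?thesis by (simp add: app_sc supp[OF False])
    qed
  qed
  define l0 where "l0 = nat (\<Lambda> i j + int N - int j)"
  have l0: "int l0 = \<Lambda> i j + int N - int j" using nonneg[OF asm(6)] asm(6) by (simp add: l0_def)
  have l0_less: "l0 < N + card Q"
  proof -
    have "int l0 < int N + int k" unfolding l0 using le_k[OF asm(6)] asm(6) by simp
    then show ?thesis unfolding Q(2) by linarith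
  qed
  have v: "v \<in> sp.small.wspace m" using asm(7) by (simp only: ws)
  have "p l0 = 0"
    unfolding p_def by (rule prod_zero[OF finite_atLeastAtMost]) (use asm(6) l0 in \<open>auto intro!: bexI[of _ j]\<close>)
  then have Pv: "app (sp.small.P0 {i} (of_nat l0)) v = 0"
    unfolding P0[OF v] by (simp only: sc_simps app_ring_simps)
  have zi: "\<And>s. s \<in> S - {i} \<Longrightarrow> z s \<noteq> z i" using asm(4,5) by (auto simp: inj_on_def)
  obtain f0 where f0: "\<And>l. f0 l \<in> sp.small.wspace m" "f0 l0 = v" "\<And>l. l < l0 \<Longrightarrow> f0 l = 0"
    "ordge (int (card Q)) (app (rdet N (sp.small.XX K S z (z i))) (\<Sum>l<N + card Q. fmono (int l) (f0 l)))"
  proof -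
    have "\<exists>f. (\<forall>l. f l \<in> sp.small.wspace m) \<and> f l0 = v \<and> (\<forall>l<l0. f l = 0) \<and>
      ordge (int (card Q)) (app (rdet N (sp.small.XX K S z (z i))) (\<Sum>l<N + card Q. fmono (int l) (f l)))"
      by (rule sp.split_limit[OF _ v Pv l0_less]) (rule zi)
    then show thesis using that by blast
  qed
  have site: "{s \<in> S. z s = z i} = {i}" using zi asm(5) by auto
  \<comment> \<open>The exponents at \<open>z i\<close>, that is, the zeros of the indicial
    polynomial; all are at most N + k - 1.\<close>
  define ra where "ra a = real_of_int (int N - int a + \<Lambda> i a)" for a
  have ra: "0 \<le> ra a" "ra a + 1 \<le> real N + real k" if "a \<in> {1..N}" for a
  proof -
    have "0 \<le> int N - int a + \<Lambda> i a" "int N - int a + \<Lambda> i a + 1 \<le> int N + int k"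
      using nonneg[OF that] le_k[OF that] that by auto
    then show "0 \<le> ra a" "ra a + 1 \<le> real N + real k" unfolding ra_def by linarith+
  qed
  \<comment> \<open>The product of the constants of \<open>indicial_bound\<close>, one for each
    linear factor of \<open>p\<close>.\<close>
  define c where "c = (\<Prod>a=1..N. 1 / (ra a + 2))"
  have c: "0 < c" unfolding c_def by (rule prod_pos) (use ra in \<open>auto simp: add_nonneg_pos\<close>)
  have pl: "c * real (l + 1) ^ N \<le> cmod (p l)" if "N + card Q \<le> l" for l
  proof -
    have "c * real (l + 1) ^ N = (\<Prod>a=1..N. (real l + 1) / (ra a + 2))"
      unfolding c_def by (simp add: prod_dividef add.commute)
    also have "\<dots> \<le> (\<Prod>a=1..N. \<bar>real l - ra a\<bar>)"
    proof (rule prod_mono, intro conjI)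
      fix a assume a: "a \<in> {1..N}"
      show "0 \<le> (real l + 1) / (ra a + 2)" using ra(1)[OF a] by simp
      show "(real l + 1) / (ra a + 2) \<le> \<bar>real l - ra a\<bar>"
        by (rule indicial_bound[OF ra(1)[OF a]]) (use ra(2)[OF a] that Q(2) in linarith)
    qed
    also have "\<dots> = cmod (p l)"
      unfolding p_def prod_norm[symmetric]
    proof (intro prod.cong refl)
      fix a
      have "complex_of_int (int l) - (of_nat N - of_nat a) - of_int (\<Lambda> i a) = of_real (real l - ra a)" by (simp add: ra_def)
      then show "\<bar>real l - ra a\<bar> = cmod (complex_of_int (int l) - (of_nat N - of_nat a) - of_int (\<Lambda> i a))"
        by (simp only: norm_of_real)
    qed
    finally show ?thesis .
  qed
  have "ordge (int (N + card Q) - int N) (app (rdet N (sp.small.XX K S z (z i))) (\<Sum>l<N + card Q. fmono (int l) (f0 l)))"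
    using f0(4) by simp
  note start = this
  have "\<exists>F A R. (\<forall>l. F l \<in> sp.small.wspace m) \<and> (\<forall>l<N + card Q. F l = f0 l) \<and> 0 < R \<and> (\<forall>l. nrm ?I (F l) \<le> A * R ^ l) \<and>
    app (rdet N (sp.small.XX K S z (z i))) (sp.small.ser F) = 0"
    by (rule sp.small.formal_solution[where L = "N + card Q" and m = m and z = z and ?z0.0 = "z i" and p = p and c = c and f = f0 and K = K,
      unfolded site, OF P0 c pl f0(1) start])
  then obtain F A R where F: "\<forall>l. F l \<in> sp.small.wspace m" "\<forall>l<N + card Q. F l = f0 l" "0 < R" "\<forall>l. nrm ?I (F l) \<le> A * R ^ l"
    "app (rdet N (sp.small.XX K S z (z i))) (sp.small.ser F) = 0" by blast
  have Fl0: "F l0 = v" "\<And>l. l < l0 \<Longrightarrow> F l = 0" using F(2) f0(2,3) l0_less by auto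
  have "\<exists>r>0. \<exists>f. (\<forall>\<beta>. (\<lambda>u. f u \<beta>) holomorphic_on ball (z i) r) \<and> (\<forall>u\<in>ball (z i) r. f u \<in> sp.small.wspace m) \<and>
    (\<forall>u\<in>ball (z i) r - {z i}. \<forall>\<beta>. sp.small.Dan K z f u \<beta> = 0) \<and>
    (\<forall>\<beta>. (\<lambda>u. f u \<beta> - F l0 \<beta> * (u - z i) ^ l0) \<in> O[at (z i)](\<lambda>u. (u - z i) ^ (l0 + 1)))"
    by (rule sp.small.convergent_solution[where m = m, OF F(1)[rule_format] F(3) F(4)[rule_format] F(5) Fl0(2)])
  then obtain r f where r: "0 < r" and f: "\<forall>\<beta>. (\<lambda>u. f u \<beta>) holomorphic_on ball (z i) r" "\<forall>u\<in>ball (z i) r. f u \<in> sp.small.wspace m"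
    "\<forall>u\<in>ball (z i) r - {z i}. \<forall>\<beta>. sp.small.Dan K z f u \<beta> = 0"
    "\<forall>\<beta>. (\<lambda>u. f u \<beta> - F l0 \<beta> * (u - z i) ^ l0) \<in> O[at (z i)](\<lambda>u. (u - z i) ^ (l0 + 1))" by blast
  have pw: "x powi (\<Lambda> i j + int N - int j) = x ^ l0" "x powi (\<Lambda> i j + int N - int j + 1) = x ^ (l0 + 1)" for x :: complex
  proof -
    show "x powi (\<Lambda> i j + int N - int j) = x ^ l0" unfolding l0[symmetric] by (rule power_int_of_nat)
    have "int l0 + 1 = int (l0 + 1)" by simp
    then show "x powi (\<Lambda> i j + int N - int j + 1) = x ^ (l0 + 1)" unfolding l0[symmetric] by (simp only: power_int_of_nat)
  qed
  have "z i \<in> z ` S" using asm(5) by blast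
  then show ?thesis
    unfolding ws UD pw S_def[symmetric] using r f[unfolded Fl0(1)] by (intro exI[of _ r] exI[of _ f]) blast
qed

end
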